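(* Let $(k_1,k_2)\neq(0,0)$ and let $f\colon M^m\to \mathbb{Q}_{k_1}^{n_1}\times \mathbb{Q}_{k_2}^{n_2}$ be a totally geodesic isometric immersion of an $m$-dimensional Riemannian manifold. Then one of the following possibilities holds: (i) $f$ is a totally geodesic isometric immersion into a slice of $\mathbb{Q}_{k_1}^{n_1}\times \mathbb{Q}_{k_2}^{n_2}$; (ii) there exist a local isometry $\phi\colon M^m\to\mathbb{Q}_{k_1}^{m_1}\times\mathbb{Q}_{k_2}^{m_2}$ and a totally geodesic inclusion $j=j_1\times j_2\colon\mathbb{Q}_{k_1}^{m_1}\times\mathbb{Q}_{k_2}^{m_2}\to\mathbb{Q}_{k_1}^{n_1}\times\mathbb{Q}_{k_2}^{n_2}$ such that $f=j\circ\phi$; (iii) $k_1k_2>0$ and there exist a local isometry $\phi\colon M^m\to\mathbb{Q}_k^m$, $k=k_1k_2/(k_1+k_2)$, and a totally geodesic inclusion $j=j_1\times j_2\colon\mathbb{Q}_{k_1}^m\times\mathbb{Q}_{k_2}^m\to\mathbb{Q}_{k_1}^{n_1}\times\mathbb{Q}_{k_2}^{n_2}$ such that $f=j\circ g\circ\phi$, where $g\colon\mathbb{Q}_k^m\to\mathbb{Q}_{k_1}^m\times\mathbb{Q}_{k_2}^m$ is the totally geodesic isometric embedding $g(x)=(ax,bx)$ with $a^2=k_2/(k_1+k_2)$, $b^2=k_1/(k_1+k_2)$, $a,b>0$; (iv) $k_1k_2=0$, say, $k_2=0$, and there exist a local isometry $\phi\colon M^m\to\mathbb{R}^m=\mathbb{R}\times\mathbb{R}^{m-1}$,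 a unit-speed geodesic $\gamma\colon\mathbb{R}\to\mathbb{Q}_{k_1}^1\times\mathbb{R}$ and a totally geodesic inclusion $j\colon\mathbb{Q}_{k_1}^1\times\mathbb{R}^m\to\mathbb{Q}_{k_1}^{n_1}\times\mathbb{R}^{n_2}$ such that $f=j\circ(\gamma\times \mathrm{id})\circ\phi$, where $\mathrm{id}\colon\mathbb{R}^{m-1}\to\mathbb{R}^{m-1}$ is the identity.
   Context: Manifolds are assumed connected. $\mathbb{R}^N_s$ denotes flat $\mathbb{R}^N$ with a metric of index $s$; $\sigma(k)=1$ if $k<0$ and $\sigma(k)=0$ otherwise. For $k\neq 0$, $\mathbb{Q}_k^n=\{X\in\mathbb{R}^{n+1}_{\sigma(k)}:\langle X,X\rangle=1/k\}$ (a connected component of this set if $k<0$), with the induced Riemannian metric (so $\mathbb{Q}_k^1$ is a circle if $k>0$ and is isometric to a line if $k<0$); $\mathbb{Q}_0^n=\mathbb{R}^n$. $f\colon M^m\to \mathbb{Q}_{k_1}^{n_1}\times \mathbb{Q}_{k_2}^{n_2}$ is an isometric immersion into a slice if there exist an isometric immersion $\tilde f\colon M^m\to\mathbb{Q}_{k_1}^{n_1}$ (resp. $\tilde f\colon M^m\to\mathbb{Q}_{k_2}^{n_2}$) and a totally geodesic inclusion $j\colon \mathbb{Q}_{k_1}^{n_1}\to\mathbb{Q}_{k_1}^{n_1}\times\{x_2\}$ (resp. $j\colon \mathbb{Q}_{k_2}^{n_2}\to\{x_1\}\times\mathbb{Q}_{k_2}^{n_2}$) such that $f=j\circ\tilde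 f$. A totally geodesic inclusion is an isometric embedding onto a totally geodesic submanifold. In (iv), $\gamma\times\mathrm{id}$ takes values in $(\mathbb{Q}_{k_1}^1\times\mathbb{R})\times\mathbb{R}^{m-1}=\mathbb{Q}_{k_1}^1\times\mathbb{R}^m$, and "say, $k_2=0$" means up to interchanging the two factors.
   Formalization: The case m=1 with k_1k_2≠0 is excluded, since the claim fails there: a geodesic of S^2×H^2 with both components non-constant is a totally geodesic isometric immersion satisfying none of (i)–(iv). *)

theory Defs
  imports "HOL-Analysis.Analysis"
begin

text \<open>
  The dimensions of the manifolds are natural numbers that are quantified over, so coordinate
  spaces are spaces of functions \<open>'i \<Rightarrow> real\<close>; as in \<^const>\<open>Euclidean_space\<close>, a point of
  \<open>\<real>\<^sup>n\<close> is a function \<open>nat \<Rightarrow> real\<close> that vanishes at all \<open>i \<ge> n\<close>.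
\<close>

subsection \<open>Calculus in coordinates\<close>

definition pderiv_at :: "nat \<Rightarrow> ((nat \<Rightarrow> real) \<Rightarrow> real) \<Rightarrow> (nat \<Rightarrow> real) \<Rightarrow> real" where
  "pderiv_at a F u = deriv (\<lambda>t. F (u(a := t))) (u a)"

definition vpderiv :: "nat \<Rightarrow> ((nat \<Rightarrow> real) \<Rightarrow> 'i \<Rightarrow> real) \<Rightarrow> (nat \<Rightarrow> real) \<Rightarrow> 'i \<Rightarrow> real" where
  "vpderiv a F u = (\<lambda>i. pderiv_at a (\<lambda>x. F x i) u)"

text \<open>\<open>C_k_on m k U F\<close>: \<open>F\<close> is of class \<open>C\<^sup>k\<close> on the open subset \<open>U\<close> of \<open>\<real>\<^sup>m\<close>.\<close>

primrec C_k_on :: "nat \<Rightarrow> nat \<Rightarrow> (nat \<Rightarrow> real) set \<Rightarrow> ((nat \<Rightarrow> real) \<Rightarrow> real) \<Rightarrow> bool" where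
  "C_k_on m 0 U F \<longleftrightarrow> continuous_on U F"
| "C_k_on m (Suc k) U F \<longleftrightarrow> continuous_on U F \<and>
     (\<forall>a<m. (\<forall>u\<in>U. (\<lambda>t. F (u(a := t))) differentiable (at (u a))) \<and> C_k_on m k U (pderiv_at a F))"

definition smooth_real :: "nat \<Rightarrow> (nat \<Rightarrow> real) set \<Rightarrow> ((nat \<Rightarrow> real) \<Rightarrow> real) \<Rightarrow> bool" where
  "smooth_real m U F \<longleftrightarrow> (\<forall>k. C_k_on m k U F)"

definition smooth_vec :: "nat \<Rightarrow> (nat \<Rightarrow> real) set \<Rightarrow> ((nat \<Rightarrow> real) \<Rightarrow> 'i \<Rightarrow> real) \<Rightarrow> bool" where
  "smooth_vec m U F \<longleftrightarrow> (\<forall>i. smooth_real m U (\<lambda>u. F u i))"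

subsection \<open>Riemannian manifolds\<close>

text \<open>
  A chart is given by its inverse, i.e. by a pair \<open>(U, \<psi>)\<close> where \<open>U\<close> is open in \<open>\<real>\<^sup>m\<close> and \<open>\<psi>\<close>
  is a homeomorphism of \<open>U\<close> onto an open subset of the manifold. The metric is given by its
  coefficients: \<open>gram c u a b = \<langle>\<partial>\<^sub>a, \<partial>\<^sub>b\<rangle>\<close> at the point with coordinates \<open>u\<close> in the chart \<open>c\<close>.
\<close>

type_synonym 'a param = "(nat \<Rightarrow> real) set \<times> ((nat \<Rightarrow> real) \<Rightarrow> 'a)"

record 'a riem =
  rdim :: nat
  rtop :: "'a topology"
  atlas :: "'a param set"
  gram :: "'a param \<Rightarrow> (nat \<Rightarrow> real) \<Rightarrow> nat \<Rightarrow> nat \<Rightarrow> real"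

definition is_param :: "nat \<Rightarrow> 'a topology \<Rightarrow> 'a param \<Rightarrow> bool" where
  "is_param m X c \<longleftrightarrow>
     openin (Euclidean_space m) (fst c) \<and> openin X (snd c ` fst c) \<and>
     embedding_map (subtopology (Euclidean_space m) (fst c)) X (snd c)"

definition overlap :: "'a param \<Rightarrow> 'a param \<Rightarrow> (nat \<Rightarrow> real) set" where
  "overlap c d = {u \<in> fst c. snd c u \<in> snd d ` fst d}"

definition transition :: "'a param \<Rightarrow> 'a param \<Rightarrow> (nat \<Rightarrow> real) \<Rightarrow> nat \<Rightarrow> real" where
  "transition c d u = inv_into (fst d) (snd d) (snd c u)"

definition smooth_atlas :: "'a riem \<Rightarrow> bool" where
  "smooth_atlas M \<longleftrightarrow>
     (\<forall>c\<in>atlas M. is_param (rdim M) (rtop M) c) \<and>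
     (\<Union>c\<in>atlas M. snd c ` fst c) = topspace (rtop M) \<and>
     (\<forall>c\<in>atlas M. \<forall>d\<in>atlas M. smooth_vec (rdim M) (overlap c d) (transition c d))"

definition riemannian_metric :: "'a riem \<Rightarrow> bool" where
  "riemannian_metric M \<longleftrightarrow>
     (\<forall>c\<in>atlas M. \<forall>a<rdim M. \<forall>b<rdim M. smooth_real (rdim M) (fst c) (\<lambda>u. gram M c u a b)) \<and>
     (\<forall>c\<in>atlas M. \<forall>u\<in>fst c. \<forall>a<rdim M. \<forall>b<rdim M. gram M c u a b = gram M c u b a) \<and>
     (\<forall>c\<in>atlas M. \<forall>u\<in>fst c. \<forall>w. (\<exists>a<rdim M. w a \<noteq> 0) \<longrightarrow>
        (\<Sum>a<rdim M. \<Sum>b<rdim M. gram M c u a b * w a * w b) > 0) \<and>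
     (\<forall>c\<in>atlas M. \<forall>d\<in>atlas M. \<forall>u\<in>overlap c d. \<forall>a<rdim M. \<forall>b<rdim M.
        gram M c u a b =
          (\<Sum>p<rdim M. \<Sum>q<rdim M. vpderiv a (transition c d) u p * vpderiv b (transition c d) u q *
             gram M d (transition c d u) p q))"

definition riemannian_manifold :: "'a riem \<Rightarrow> bool" where
  "riemannian_manifold M \<longleftrightarrow>
     topspace (rtop M) \<noteq> {} \<and> connected_space (rtop M) \<and>
     Hausdorff_space (rtop M) \<and> second_countable (rtop M) \<and>
     smooth_atlas M \<and> riemannian_metric M"

subsection \<open>Submanifolds of pseudo-Euclidean spaces\<close>

text \<open>
  The diagonal form \<open>\<eta>\<close> encodes a flat pseudo-Euclidean space: its coordinates are the indices
  where \<open>\<eta>\<close> is nonzero, and \<open>\<eta>\<close> takes the value \<open>-1\<close> on the timelike coordinates and \<open>1\<close> on the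
  spacelike ones.
\<close>

definition ip :: "('i \<Rightarrow> real) \<Rightarrow> ('i \<Rightarrow> real) \<Rightarrow> ('i \<Rightarrow> real) \<Rightarrow> real" where
  "ip \<eta> x y = (\<Sum>i | \<eta> i \<noteq> 0. \<eta> i * x i * y i)"

record 'i submfd =
  pts :: "('i \<Rightarrow> real) set"
  form :: "'i \<Rightarrow> real"
  sdim :: nat

definition tangent_space :: "'i submfd \<Rightarrow> ('i \<Rightarrow> real) \<Rightarrow> ('i \<Rightarrow> real) set" where
  "tangent_space S p = {v. \<exists>c e. e > 0 \<and> c 0 = p \<and> (\<forall>t::real. \<bar>t\<bar> < e \<longrightarrow> c t \<in> pts S) \<and>
     (\<forall>i. ((\<lambda>t. c t i) has_real_derivative v i) (at 0))}"

definition subtop :: "'i submfd \<Rightarrow> ('i \<Rightarrow> real) topology" where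
  "subtop S = subtopology (powertop_real UNIV) (pts S)"

text \<open>
  The manifold structure and the metric that \<open>S\<close> inherits from the ambient space; its atlas
  consists of all smooth regular parametrizations of open subsets of \<open>S\<close>.
\<close>

definition induced :: "'i submfd \<Rightarrow> ('i \<Rightarrow> real) riem" where
  "induced S =
     \<lparr>rdim = sdim S,
      rtop = subtop S,
      atlas = {c. is_param (sdim S) (subtop S) c \<and> smooth_vec (sdim S) (fst c) (snd c) \<and>
        (\<forall>u\<in>fst c. \<forall>w. (\<forall>i. (\<Sum>a<sdim S. w a * vpderiv a (snd c) u i) = 0) \<longrightarrow>
           (\<forall>a<sdim S. w a = 0))},
      gram = (\<lambda>c u a b. ip (form S) (vpderiv a (snd c) u) (vpderiv b (snd c) u))\<rparr>"

text \<open>\<open>orth_proj \<eta> V x\<close> is only used for subspaces \<open>V\<close> on which \<open>\<eta>\<close> is positive definite.\<close>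

definition orth_proj :: "('i \<Rightarrow> real) \<Rightarrow> ('i \<Rightarrow> real) set \<Rightarrow> ('i \<Rightarrow> real) \<Rightarrow> 'i \<Rightarrow> real" where
  "orth_proj \<eta> V x = (THE y. y \<in> V \<and> (\<forall>v\<in>V. ip \<eta> (\<lambda>i. x i - y i) v = 0))"

subsection \<open>Maps from a Riemannian manifold into a submanifold\<close>

definition isometric_immersion :: "'a riem \<Rightarrow> 'i submfd \<Rightarrow> ('a \<Rightarrow> 'i \<Rightarrow> real) \<Rightarrow> bool" where
  "isometric_immersion M S f \<longleftrightarrow>
     f ` topspace (rtop M) \<subseteq> pts S \<and>
     (\<forall>c\<in>atlas M. smooth_vec (rdim M) (fst c) (f \<circ> snd c) \<and>
        (\<forall>u\<in>fst c. \<forall>a<rdim M. \<forall>b<rdim M.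
           ip (form S) (vpderiv a (f \<circ> snd c) u) (vpderiv b (f \<circ> snd c) u) = gram M c u a b))"

text \<open>The image of the differential of \<open>f\<close> at the point with coordinates \<open>u\<close> in the chart \<open>c\<close>.\<close>

definition diff_image :: "'a riem \<Rightarrow> ('a \<Rightarrow> 'i \<Rightarrow> real) \<Rightarrow> 'a param \<Rightarrow> (nat \<Rightarrow> real) \<Rightarrow> ('i \<Rightarrow> real) set" where
  "diff_image M f c u = {\<lambda>i. \<Sum>a<rdim M. w a * vpderiv a (f \<circ> snd c) u i | w. True}"

definition normal_space ::
  "'a riem \<Rightarrow> 'i submfd \<Rightarrow> ('a \<Rightarrow> 'i \<Rightarrow> real) \<Rightarrow> 'a param \<Rightarrow> (nat \<Rightarrow> real) \<Rightarrow> ('i \<Rightarrow> real) set" where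
  "normal_space M S f c u =
     {\<xi> \<in> tangent_space S (f (snd c u)). \<forall>v\<in>diff_image M f c u. ip (form S) \<xi> v = 0}"

text \<open>
  The Levi-Civita connection of \<open>S\<close> is the tangential component of the flat derivative, so this is
  the covariant derivative in \<open>S\<close>, along \<open>f\<close>, of the image of \<open>\<partial>\<^sub>b\<close> in the direction \<open>\<partial>\<^sub>a\<close>.
\<close>

definition cov_deriv ::
  "'i submfd \<Rightarrow> ('a \<Rightarrow> 'i \<Rightarrow> real) \<Rightarrow> 'a param \<Rightarrow> (nat \<Rightarrow> real) \<Rightarrow> nat \<Rightarrow> nat \<Rightarrow> 'i \<Rightarrow> real" where
  "cov_deriv S f c u a b =
     orth_proj (form S) (tangent_space S (f (snd c u))) (vpderiv a (vpderiv b (f \<circ> snd c)) u)"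

definition second_fundamental_form ::
  "'a riem \<Rightarrow> 'i submfd \<Rightarrow> ('a \<Rightarrow> 'i \<Rightarrow> real) \<Rightarrow> 'a param \<Rightarrow> (nat \<Rightarrow> real) \<Rightarrow> nat \<Rightarrow> nat \<Rightarrow> 'i \<Rightarrow> real" where
  "second_fundamental_form M S f c u a b =
     orth_proj (form S) (normal_space M S f c u) (cov_deriv S f c u a b)"

definition totally_geodesic :: "'a riem \<Rightarrow> 'i submfd \<Rightarrow> ('a \<Rightarrow> 'i \<Rightarrow> real) \<Rightarrow> bool" where
  "totally_geodesic M S f \<longleftrightarrow>
     (\<forall>c\<in>atlas M. \<forall>u\<in>fst c. \<forall>a<rdim M. \<forall>b<rdim M. second_fundamental_form M S f c u a b = (\<lambda>i. 0))"

text \<open>Each differential is a linear isometry of tangent spaces; the second conjunct is surjectivity.\<close>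

definition local_isometry :: "'a riem \<Rightarrow> 'i submfd \<Rightarrow> ('a \<Rightarrow> 'i \<Rightarrow> real) \<Rightarrow> bool" where
  "local_isometry M S \<phi> \<longleftrightarrow> isometric_immersion M S \<phi> \<and>
     (\<forall>c\<in>atlas M. \<forall>u\<in>fst c. diff_image M \<phi> c u = tangent_space S (\<phi> (snd c u)))"

definition tg_inclusion :: "'j submfd \<Rightarrow> 'i submfd \<Rightarrow> (('j \<Rightarrow> real) \<Rightarrow> 'i \<Rightarrow> real) \<Rightarrow> bool" where
  "tg_inclusion S S' j \<longleftrightarrow>
     isometric_immersion (induced S) S' j \<and> embedding_map (subtop S) (subtop S') j \<and>
     totally_geodesic (induced S) S' j"

definition velocity :: "(real \<Rightarrow> 'i \<Rightarrow> real) \<Rightarrow> real \<Rightarrow> 'i \<Rightarrow> real" where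
  "velocity \<gamma> t = (\<lambda>i. deriv (\<lambda>s. \<gamma> s i) t)"

definition unit_speed_geodesic :: "'i submfd \<Rightarrow> (real \<Rightarrow> 'i \<Rightarrow> real) \<Rightarrow> bool" where
  "unit_speed_geodesic S \<gamma> \<longleftrightarrow>
     (\<forall>t. \<gamma> t \<in> pts S) \<and>
     (\<forall>i k t. (deriv ^^ k) (\<lambda>s. \<gamma> s i) differentiable (at t)) \<and>
     (\<forall>t. ip (form S) (velocity \<gamma> t) (velocity \<gamma> t) = 1) \<and>
     (\<forall>t. orth_proj (form S) (tangent_space S (\<gamma> t)) (velocity (velocity \<gamma>) t) = (\<lambda>i. 0))"

subsection \<open>Space forms and their products\<close>

definition space_form_form :: "real \<Rightarrow> nat \<Rightarrow> nat \<Rightarrow> real" where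
  "space_form_form k n i =
     (if i < (if k = 0 then n else n + 1) then if k < 0 \<and> i = 0 then -1 else 1 else 0)"

definition space_form :: "real \<Rightarrow> nat \<Rightarrow> nat submfd" where
  "space_form k n =
     \<lparr>pts = (if k = 0 then {x. \<forall>i\<ge>n. x i = 0}
             else {x. (\<forall>i\<ge>n + 1. x i = 0) \<and> ip (space_form_form k n) x x = 1 / k \<and> (k < 0 \<longrightarrow> x 0 > 0)}),
      form = space_form_form k n,
      sdim = n\<rparr>"

text \<open>Pairs of vectors are vectors over the disjoint sum of the index types.\<close>

definition vpair :: "('i \<Rightarrow> real) \<Rightarrow> ('j \<Rightarrow> real) \<Rightarrow> 'i + 'j \<Rightarrow> real" where
  "vpair x y = case_sum x y"

definition vfst :: "('i + 'j \<Rightarrow> real) \<Rightarrow> 'i \<Rightarrow> real" where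
  "vfst z = (\<lambda>i. z (Inl i))"

definition vsnd :: "('i + 'j \<Rightarrow> real) \<Rightarrow> 'j \<Rightarrow> real" where
  "vsnd z = (\<lambda>j. z (Inr j))"

definition vswap :: "('i + 'j \<Rightarrow> real) \<Rightarrow> 'j + 'i \<Rightarrow> real" where
  "vswap z = vpair (vsnd z) (vfst z)"

definition prod_map :: "(('i \<Rightarrow> real) \<Rightarrow> 'k \<Rightarrow> real) \<Rightarrow> (('j \<Rightarrow> real) \<Rightarrow> 'l \<Rightarrow> real) \<Rightarrow>
    ('i + 'j \<Rightarrow> real) \<Rightarrow> 'k + 'l \<Rightarrow> real" where
  "prod_map f g z = vpair (f (vfst z)) (g (vsnd z))"

definition prod_submfd :: "'i submfd \<Rightarrow> 'j submfd \<Rightarrow> ('i + 'j) submfd" where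
  "prod_submfd S T =
     \<lparr>pts = {vpair x y | x y. x \<in> pts S \<and> y \<in> pts T},
      form = vpair (form S) (form T),
      sdim = sdim S + sdim T\<rparr>"

text \<open>
  The map \<open>\<gamma> \<times> id\<close> on \<open>\<real>\<^sup>m = \<real> \<times> \<real>\<^bsup>m-1\<^esup>\<close> (for \<open>m \<ge> 1\<close>), for a curve \<open>\<gamma>\<close> in a product \<open>S \<times> \<real>\<close>: the
  first coordinate \<open>y 0\<close> is the parameter of \<open>\<gamma>\<close>, and \<open>(S \<times> \<real>) \<times> \<real>\<^bsup>m-1\<^esup>\<close> is identified with
  \<open>S \<times> \<real>\<^sup>m\<close> by letting the factor \<open>\<real>\<close> be the first coordinate of \<open>\<real>\<^sup>m\<close>.
\<close>

definition curve_times_id :: "(real \<Rightarrow> 'i + nat \<Rightarrow> real) \<Rightarrow> (nat \<Rightarrow> real) \<Rightarrow> 'i + nat \<Rightarrow> real" where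
  "curve_times_id \<gamma> y = vpair (vfst (\<gamma> (y 0))) (y(0 := vsnd (\<gamma> (y 0)) 0))"

subsection \<open>The possible forms of a totally geodesic immersion into a product\<close>

text \<open>For \<open>f\<close> into \<open>S \<times> T\<close>: an isometric immersion into a slice \<open>S \<times> {q}\<close>.\<close>

definition into_slice :: "'a riem \<Rightarrow> 'i submfd \<Rightarrow> 'j submfd \<Rightarrow> ('a \<Rightarrow> 'i + 'j \<Rightarrow> real) \<Rightarrow> bool" where
  "into_slice M S T f \<longleftrightarrow>
     (\<exists>f' j q. isometric_immersion M S f' \<and> q \<in> pts T \<and>
        tg_inclusion S (prod_submfd S T) j \<and> (\<forall>x\<in>pts S. vsnd (j x) = q) \<and>
        (\<forall>x\<in>topspace (rtop M). f x = j (f' x)))"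

text \<open>For \<open>f\<close> into the product of a space form of curvature \<open>k\<close> with the flat space \<open>\<real>\<^sup>l\<close>.\<close>

definition geodesic_times_flat ::
  "'a riem \<Rightarrow> real \<Rightarrow> nat \<Rightarrow> nat \<Rightarrow> ('a \<Rightarrow> nat + nat \<Rightarrow> real) \<Rightarrow> bool" where
  "geodesic_times_flat M k n l f \<longleftrightarrow>
     rdim M \<ge> 1 \<and>
     (\<exists>\<phi> \<gamma> j. local_isometry M (space_form 0 (rdim M)) \<phi> \<and>
        unit_speed_geodesic (prod_submfd (space_form k 1) (space_form 0 1)) \<gamma> \<and>
        tg_inclusion (prod_submfd (space_form k 1) (space_form 0 (rdim M)))
          (prod_submfd (space_form k n) (space_form 0 l)) j \<and>
        (\<forall>x\<in>topspace (rtop M). f x = j (curve_times_id \<gamma> (\<phi> x))))"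

end

theory Submission
  imports Defs "HOL-Library.Landau_Symbols"
begin

text \<open>The components \<open>f\<^sub>i\<close> of \<open>f\<close>, as maps into flat space, satisfy
  \<open>\<partial>\<^sub>a\<partial>\<^sub>bf\<^sub>i = \<Gamma>\<^sub>a\<^sub>b\<^sup>c \<partial>\<^sub>cf\<^sub>i - k\<^sub>i \<langle>\<partial>\<^sub>af\<^sub>i, \<partial>\<^sub>bf\<^sub>i\<rangle> f\<^sub>i\<close> with common coefficients \<open>\<Gamma>\<close>. Equality of the third
  derivatives makes the tangent space at a point invariant under the curvature tensor of the product, and
  linear algebra leaves three cases: it is the sum of its intersections with the two factors, or
  \<open>k\<^sub>1\<langle>X\<^sub>1,Y\<^sub>1\<rangle> = k\<^sub>2\<langle>X\<^sub>2,Y\<^sub>2\<rangle>\<close> on it, or it is such a sum plus a line. In each case the totally geodesic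
  submanifold through the point with this tangent space is explicit, and unique continuation for the
  differential equation above shows that \<open>f\<close> takes its values in it.\<close>

text \<open>The symbols \<Gamma> are not computed from the metric. Total geodesicity makes the
  tangential part of a second derivative of f a combination of the coordinate vectors of f; its
  coefficients are chosen pointwise and prove regular because they solve the Gram system. As
  coefficients for f itself they serve both components. The obstacle in the last step is that the
  equation is nonlinear: it is quadratic in the first derivatives, while uniqueness needs linearity.
  What is propagated is the difference between f and its expected form, and all that is asked of it
  is that its second derivatives are bounded by its first jet. For this, all factors but one of each
  nonlinear term count as known continuous coefficients. The expected form is found by coordinates:
  each component is expressed in a frame at the base point, where its initial value and derivative
  are explicit. Agreement of two reduced components, or of one with a model curve, is then a matter
  of comparing initial data. Constants such as \<open>a\<close>, \<open>b\<close>, \<open>k\<close>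
  and the slope of the geodesic come from this comparison.\<close>

section \<open>Linear systems and dimension counts\<close>

text \<open>Elimination: an equation with a nonzero coefficient at \<open>l\<close> expresses the
  unknown \<open>l\<close> by the others, which removes one equation and one unknown. The dimension
  counts below come down to this.\<close>

lemma homogeneous_system_nontrivial:
  fixes A :: "'k \<Rightarrow> 'l \<Rightarrow> real"
  assumes "finite I" "finite J" "card I < card J"
  shows "\<exists>x. (\<exists>j\<in>J. x j \<noteq> 0) \<and> (\<forall>i\<in>I. (\<Sum>j\<in>J. A i j * x j) = 0)"
  using assms
proof (induction I arbitrary: J A rule: finite_induct)
  case empty
  then obtain j where "j \<in> J" by (metis card.empty card_gt_0_iff equals0I)
  then show ?case by (intro exI[of _ "\<lambda>_. 1"]) auto
next
  case (insert i0 I)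
  show ?case
  proof (cases "\<forall>j\<in>J. A i0 j = 0")
    case True
    have "card I < card J" using insert by simp
    then obtain x where x: "\<exists>j\<in>J. x j \<noteq> 0" "\<forall>i\<in>I. (\<Sum>j\<in>J. A i j * x j) = 0"
      using insert.IH[OF insert.prems(1)] by blast
    have "(\<Sum>j\<in>J. A i0 j * x j) = 0" using True by simp
    with x show ?thesis by blast
  next
    case False
    then obtain l where l: "l \<in> J" "A i0 l \<noteq> 0" by blast
    have "card I < card (J - {l})" using insert l by simp
    then obtain x where x: "\<exists>j\<in>J - {l}. x j \<noteq> 0"
      "\<forall>i\<in>I. (\<Sum>j\<in>J - {l}. (A i j - A i l * A i0 j / A i0 l) * x j) = 0"
      using insert.IH[of "J - {l}" "\<lambda>i j. A i j - A i l * A i0 j / A i0 l"] insert.prems by blast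
    \<comment> \<open>Back substitution: \<open>s\<close> is what equation \<open>i0\<close> gives
      without the unknown \<open>l\<close>, and \<open>y l\<close> is chosen to cancel it.\<close>
    define s where "s = (\<Sum>j\<in>J - {l}. A i0 j * x j)"
    define y where "y = x(l := - s / A i0 l)"
    have sp: "(\<Sum>j\<in>J. A i j * y j) = (\<Sum>j\<in>J - {l}. A i j * x j) - A i l * s / A i0 l" for i
    proof -
      have "(\<Sum>j\<in>J. A i j * y j) = A i l * y l + (\<Sum>j\<in>J - {l}. A i j * y j)"
        by (rule sum.remove) (use l insert.prems in auto)
      also have "(\<Sum>j\<in>J - {l}. A i j * y j) = (\<Sum>j\<in>J - {l}. A i j * x j)"
        by (rule sum.cong) (auto simp: y_def)
      finally show ?thesis by (simp add: y_def)
    qed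
    have "(\<Sum>j\<in>J. A i j * y j) = 0" if "i \<in> I" for i
    proof -
      have "(\<Sum>j\<in>J - {l}. (A i j - A i l * A i0 j / A i0 l) * x j)
          = (\<Sum>j\<in>J - {l}. A i j * x j) - A i l / A i0 l * s"
        unfolding s_def sum_distrib_left sum_subtractf[symmetric]
        by (rule sum.cong) (auto simp: algebra_simps)
      with x(2) that show ?thesis by (simp add: sp)
    qed
    moreover have "(\<Sum>j\<in>J. A i0 j * y j) = 0"
      using l by (simp add: sp s_def[symmetric])
    moreover have "\<exists>j\<in>J. y j \<noteq> 0" using x(1) by (auto simp: y_def)
    ultimately show ?thesis by (intro exI[of _ y]) auto
  qed
qed

text \<open>The right-hand side becomes a further unknown with coefficient \<open>- r i\<close>. A
  nontrivial solution of the enlarged system cannot vanish in this last entry, by injectivity, so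
  one may divide by it.\<close>

lemma square_system_solvable:
  fixes A :: "nat \<Rightarrow> nat \<Rightarrow> real"
  assumes inj: "\<And>x. \<forall>i<n. (\<Sum>j<n. A i j * x j) = 0 \<Longrightarrow> \<forall>j<n. x j = 0"
  shows "\<exists>x. \<forall>i<n. (\<Sum>j<n. A i j * x j) = r i"
proof -
  define B where "B i j = (if j < n then A i j else - r i)" for i j :: nat
  have "\<exists>x. (\<exists>j\<in>{..n}. x j \<noteq> 0) \<and> (\<forall>i\<in>{..<n}. (\<Sum>j\<in>{..n}. B i j * x j) = 0)"
    by (rule homogeneous_system_nontrivial) auto
  then obtain x where x: "\<exists>j\<in>{..n}. x j \<noteq> 0" "\<forall>i<n. (\<Sum>j\<le>n. B i j * x j) = 0"
    by (meson lessThan_iff)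
  have e: "(\<Sum>j<n. A i j * x j) = r i * x n" if "i < n" for i
  proof -
    have "(\<Sum>j\<le>n. B i j * x j) = (\<Sum>j<n. B i j * x j) + B i n * x n"
      by (simp add: lessThan_Suc_atMost[symmetric])
    moreover have "(\<Sum>j<n. B i j * x j) = (\<Sum>j<n. A i j * x j)"
      by (rule sum.cong) (auto simp: B_def)
    ultimately show ?thesis using x(2) that by (simp add: B_def)
  qed
  have "x n \<noteq> 0"
  proof
    assume "x n = 0"
    have "\<forall>j<n. x j = 0" by (rule inj) (simp add: e \<open>x n = 0\<close>)
    with \<open>x n = 0\<close> x(1) show False by (auto simp: le_less)
  qed
  then have "\<forall>i<n. (\<Sum>j<n. A i j * (x j / x n)) = r i"
    by (simp add: e sum_divide_distrib[symmetric])
  then show ?thesis by (intro exI[of _ "\<lambda>j. x j / x n"]) simp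
qed

text \<open>Tangent spaces of all dimensions are sets of functions over one index type, so linear
  algebra is done with sets and not with types.\<close>

definition subsp :: "('i \<Rightarrow> real) set \<Rightarrow> bool" where
  "subsp V \<longleftrightarrow> (\<lambda>i. 0) \<in> V \<and> (\<forall>x\<in>V. \<forall>y\<in>V. (\<lambda>i. x i + y i) \<in> V) \<and> (\<forall>x\<in>V. \<forall>c. (\<lambda>i. c * x i) \<in> V)"

lemma subspD:
  assumes "subsp V"
  shows subsp_0: "(\<lambda>i. 0) \<in> V"
    and subsp_add: "x \<in> V \<Longrightarrow> y \<in> V \<Longrightarrow> (\<lambda>i. x i + y i) \<in> V"
    and subsp_scale: "x \<in> V \<Longrightarrow> (\<lambda>i. c * x i) \<in> V"
  using assms by (auto simp: subsp_def)

lemma subsp_diff: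
  assumes "subsp V" "x \<in> V" "y \<in> V" shows "(\<lambda>i. x i - y i) \<in> V"
  using subsp_add[OF assms(1,2) subsp_scale[OF assms(1,3), of "-1"]] by simp

lemma subsp_sum:
  assumes "subsp V" "\<And>a. a \<in> A \<Longrightarrow> x a \<in> V" shows "(\<lambda>i. \<Sum>a\<in>A. w a * x a i) \<in> V"
  using assms(2)
proof (induction A rule: infinite_finite_induct)
  case (insert b A)
  then show ?case
    using subsp_add[OF assms(1) subsp_scale[OF assms(1), of "x b" "w b"], of "\<lambda>i. \<Sum>a\<in>A. w a * x a i"]
    by simp
qed (auto simp: subsp_0[OF assms(1)])

text \<open>\<open>V\<close> embeds linearly into \<open>\<real>\<^sup>I\<close>, which bounds its dimension by \<open>card I\<close>.\<close>

definition determined_by :: "('i \<Rightarrow> real) set \<Rightarrow> 'i set \<Rightarrow> bool" where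
  "determined_by V I \<longleftrightarrow> finite I \<and> (\<forall>v\<in>V. (\<forall>i\<in>I. v i = 0) \<longrightarrow> v = (\<lambda>i. 0))"

lemma determined_by_dependent:
  fixes n :: nat and w :: "nat \<Rightarrow> 'i \<Rightarrow> real"
  assumes "subsp V" "determined_by V I" "\<And>a. a < n \<Longrightarrow> w a \<in> V" "card I < n"
  shows "\<exists>x. (\<exists>a<n. x a \<noteq> 0) \<and> (\<forall>i. (\<Sum>a<n. x a * w a i) = 0)"
proof -
  have "\<exists>x. (\<exists>j\<in>{..<n}. x j \<noteq> 0) \<and> (\<forall>i\<in>I. (\<Sum>j\<in>{..<n}. w j i * x j) = 0)"
    by (rule homogeneous_system_nontrivial) (use assms in \<open>auto simp: determined_by_def\<close>)
  then obtain x where x: "\<exists>j<n. x j \<noteq> 0" "\<forall>i\<in>I. (\<Sum>j<n. x j * w j i) = 0"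
    by (auto simp: mult.commute)
  have "(\<lambda>i. \<Sum>j<n. x j * w j i) \<in> V" by (rule subsp_sum) (use assms in auto)
  with x assms(2) have "(\<lambda>i. \<Sum>j<n. x j * w j i) = (\<lambda>i. 0)" by (auto simp: determined_by_def)
  with x show ?thesis by metis
qed

text \<open>There is a relation among \<open>v\<close> and the \<open>n\<close> given vectors, since
  the dimension is at most \<open>n\<close>. Independence makes its coefficient at \<open>v\<close>
  nonzero.\<close>

lemma independent_spans:
  fixes n :: nat and w :: "nat \<Rightarrow> 'i \<Rightarrow> real"
  assumes "subsp V" "determined_by V I" "\<And>a. a < n \<Longrightarrow> w a \<in> V" "card I \<le> n"
    and ind: "\<And>x. \<forall>i. (\<Sum>a<n. x a * w a i) = 0 \<Longrightarrow> \<forall>a<n. x a = 0"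
    and "v \<in> V"
  shows "\<exists>x. v = (\<lambda>i. \<Sum>a<n. x a * w a i)"
proof -
  have "\<exists>x. (\<exists>a<Suc n. x a \<noteq> 0) \<and> (\<forall>i. (\<Sum>a<Suc n. x a * (if a < n then w a else v) i) = 0)"
    by (rule determined_by_dependent[OF assms(1,2)]) (use assms(3,4,6) in auto)
  then obtain x where x: "\<exists>a<Suc n. x a \<noteq> 0" "\<forall>i. (\<Sum>a<Suc n. x a * (if a < n then w a else v) i) = 0"
    by blast
  have x2: "(\<Sum>a<n. x a * w a i) + x n * v i = 0" for i using x(2)[rule_format, of i] by simp
  have "x n \<noteq> 0"
  proof
    assume "x n = 0"
    have "\<forall>a<n. x a = 0" by (rule ind) (use x2 \<open>x n = 0\<close> in simp)
    with \<open>x n = 0\<close> x(1) show False by (auto simp: less_Suc_eq)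
  qed
  have "v i = (\<Sum>a<n. (- x a / x n) * w a i)" for i
  proof -
    have "(\<Sum>a<n. (- x a / x n) * w a i) = - (\<Sum>a<n. x a * w a i) / x n"
      by (simp add: sum_divide_distrib sum_negf)
    also have "\<dots> = v i" using x2[of i] \<open>x n \<noteq> 0\<close> by (simp add: field_simps)
    finally show ?thesis by simp
  qed
  then show ?thesis by (intro exI[of _ "\<lambda>a. - x a / x n"]) auto
qed

text \<open>The Steinitz inequality: with more vectors than generators, the matrix of coefficients
  has a nontrivial kernel, and a kernel vector is a linear relation.\<close>

lemma independent_card_le_span:
  fixes n r :: nat and e w :: "nat \<Rightarrow> 'i \<Rightarrow> real"
  assumes span: "\<And>b. b < r \<Longrightarrow> \<exists>x. e b = (\<lambda>i. \<Sum>a<n. x a * w a i)"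
    and ind: "\<And>x. \<forall>i. (\<Sum>b<r. x b * e b i) = 0 \<Longrightarrow> \<forall>b<r. x b = 0"
  shows "r \<le> n"
proof (rule ccontr)
  assume "\<not> r \<le> n"
  obtain A where A: "\<And>b. b < r \<Longrightarrow> e b = (\<lambda>i. \<Sum>a<n. A b a * w a i)" using span by metis
  have "\<exists>x. (\<exists>b\<in>{..<r}. x b \<noteq> 0) \<and> (\<forall>a\<in>{..<n}. (\<Sum>b\<in>{..<r}. A b a * x b) = 0)"
    by (rule homogeneous_system_nontrivial[of _ _ "\<lambda>a b. A b a"]) (use \<open>\<not> r \<le> n\<close> in auto)
  then obtain x where x: "\<exists>b<r. x b \<noteq> 0" "\<forall>a<n. (\<Sum>b<r. A b a * x b) = 0" by auto
  have "(\<Sum>b<r. x b * e b i) = 0" for i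
  proof -
    have "(\<Sum>b<r. x b * e b i) = (\<Sum>b<r. \<Sum>a<n. A b a * x b * w a i)"
      by (rule sum.cong) (auto simp: A sum_distrib_left algebra_simps)
    also have "\<dots> = (\<Sum>a<n. (\<Sum>b<r. A b a * x b) * w a i)"
      by (subst sum.swap) (simp add: sum_distrib_right)
    finally show ?thesis using x(2) by simp
  qed
  with ind x(1) show False by blast
qed

subsection \<open>Bilinear forms\<close>

lemma ip_comm: "ip \<eta> x y = ip \<eta> y x"
  by (simp add: ip_def algebra_simps)

lemma ip_cong: "(\<And>i. \<eta> i \<noteq> 0 \<Longrightarrow> x i = x' i) \<Longrightarrow> (\<And>i. \<eta> i \<noteq> 0 \<Longrightarrow> y i = y' i) \<Longrightarrow> ip \<eta> x y = ip \<eta> x' y'"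
  by (auto simp: ip_def intro!: sum.cong)

lemma ip_add_left: "ip \<eta> (\<lambda>i. x i + y i) z = ip \<eta> x z + ip \<eta> y z"
  by (simp add: ip_def sum.distrib[symmetric] algebra_simps)

lemma ip_add_right: "ip \<eta> z (\<lambda>i. x i + y i) = ip \<eta> z x + ip \<eta> z y"
  by (simp add: ip_comm[of _ z] ip_add_left)

lemma ip_diff_left: "ip \<eta> (\<lambda>i. x i - y i) z = ip \<eta> x z - ip \<eta> y z"
  by (simp add: ip_def sum_subtractf[symmetric] algebra_simps)

lemma ip_diff_right: "ip \<eta> z (\<lambda>i. x i - y i) = ip \<eta> z x - ip \<eta> z y"
  by (simp add: ip_comm[of _ z] ip_diff_left)

lemma ip_scale_left: "ip \<eta> (\<lambda>i. c * x i) z = c * ip \<eta> x z"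
  by (simp add: ip_def sum_distrib_left algebra_simps)

lemma ip_scale_right: "ip \<eta> z (\<lambda>i. c * x i) = c * ip \<eta> z x"
  by (simp add: ip_comm[of _ z] ip_scale_left)

lemma ip_zero_left: "ip \<eta> (\<lambda>i. 0) z = 0" and ip_zero_right: "ip \<eta> z (\<lambda>i. 0) = 0"
  by (simp_all add: ip_def)

lemma ip_sum_left: "ip \<eta> (\<lambda>i. \<Sum>a\<in>A. w a * x a i) z = (\<Sum>a\<in>A. w a * ip \<eta> (x a) z)"
proof -
  have "ip \<eta> (\<lambda>i. \<Sum>a\<in>A. w a * x a i) z = (\<Sum>i | \<eta> i \<noteq> 0. \<Sum>a\<in>A. w a * (\<eta> i * x a i * z i))"
    unfolding ip_def by (rule sum.cong) (auto simp: sum_distrib_left sum_distrib_right algebra_simps)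
  also have "\<dots> = (\<Sum>a\<in>A. \<Sum>i | \<eta> i \<noteq> 0. w a * (\<eta> i * x a i * z i))" by (rule sum.swap)
  finally show ?thesis by (simp add: ip_def sum_distrib_left)
qed

lemma ip_sum_right: "ip \<eta> z (\<lambda>i. \<Sum>a\<in>A. w a * x a i) = (\<Sum>a\<in>A. w a * ip \<eta> z (x a))"
  by (simp add: ip_comm[of _ z] ip_sum_left)

lemmas ip_linear = ip_add_left ip_add_right ip_diff_left ip_diff_right ip_scale_left ip_scale_right
  ip_zero_left ip_zero_right

text \<open>For negative curvature the ambient form is Lorentzian, so positivity is available only
  on tangent spaces and their subspaces.\<close>

definition posdef_on :: "('i \<Rightarrow> real) \<Rightarrow> ('i \<Rightarrow> real) set \<Rightarrow> bool" where
  "posdef_on \<eta> V \<longleftrightarrow> (\<forall>v\<in>V. v \<noteq> (\<lambda>i. 0) \<longrightarrow> ip \<eta> v v > 0)"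

lemma posdef_onD: "posdef_on \<eta> V \<Longrightarrow> v \<in> V \<Longrightarrow> ip \<eta> v v = 0 \<Longrightarrow> v = (\<lambda>i. 0)"
  unfolding posdef_on_def by (metis less_irrefl)

lemma posdef_on_nonneg: "posdef_on \<eta> V \<Longrightarrow> v \<in> V \<Longrightarrow> ip \<eta> v v \<ge> 0"
  unfolding posdef_on_def by (metis less_imp_le order_refl ip_zero_left)

text \<open>Two candidates for the projection differ by a vector of \<open>V\<close> that is
  orthogonal to itself; positivity makes the definite description unique.\<close>

lemma orth_proj_eqI:
  assumes "subsp V" "posdef_on \<eta> V" "y \<in> V" "\<And>v. v \<in> V \<Longrightarrow> ip \<eta> (\<lambda>i. x i - y i) v = 0"
  shows "orth_proj \<eta> V x = y"
  unfolding orth_proj_def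
proof (rule the_equality)
  fix z assume z: "z \<in> V \<and> (\<forall>v\<in>V. ip \<eta> (\<lambda>i. x i - z i) v = 0)"
  have d: "(\<lambda>i. z i - y i) \<in> V" using assms z by (auto intro: subsp_diff)
  have "ip \<eta> (\<lambda>i. z i - y i) (\<lambda>i. z i - y i) = 0"
    using assms(4)[OF d] z[THEN conjunct2, rule_format, OF d] by (simp add: ip_linear)
  then have "(\<lambda>i. z i - y i) = (\<lambda>i. 0)" using posdef_onD[OF assms(2) d] by blast
  then show "z = y" by (auto simp: fun_eq_iff)
qed (use assms in auto)

definition orthonormal :: "('i \<Rightarrow> real) \<Rightarrow> nat \<Rightarrow> (nat \<Rightarrow> 'i \<Rightarrow> real) \<Rightarrow> bool" where
  "orthonormal \<eta> r e \<longleftrightarrow> (\<forall>i<r. \<forall>j<r. ip \<eta> (e i) (e j) = (if i = j then 1 else 0))"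

lemma orthonormal_coeff:
  assumes "orthonormal \<eta> r e" "b < r"
  shows "ip \<eta> (\<lambda>i. \<Sum>a<r. x a * e a i) (e b) = x b"
proof -
  have "ip \<eta> (\<lambda>i. \<Sum>a<r. x a * e a i) (e b) = (\<Sum>a<r. x a * (if a = b then 1 else 0))"
    unfolding ip_sum_left by (rule sum.cong) (use assms in \<open>auto simp: orthonormal_def\<close>)
  then show ?thesis using assms(2) by (simp add: if_distrib[of "\<lambda>c. _ * c"] cong: if_cong)
qed

lemma orthonormal_independent:
  assumes "orthonormal \<eta> r e" "\<forall>i. (\<Sum>a<r. x a * e a i) = 0"
  shows "\<forall>a<r. x a = 0"
proof (intro allI impI)
  fix b assume "b < r"
  from orthonormal_coeff[OF assms(1) this, of x] assms(2) show "x b = 0" by (simp add: ip_zero_left)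
qed

text \<open>An orthonormal family of maximal length spans: a vector outside its span leaves a
  nonzero orthogonal remainder, and the normalised remainder would lengthen the family. The maximum
  exists because \<open>card I\<close> bounds all lengths.\<close>

lemma orthonormal_basis_exists:
  assumes "subsp V" "posdef_on \<eta> V" "determined_by V I"
  shows "\<exists>r e. orthonormal \<eta> r e \<and> (\<forall>a<r. e a \<in> V) \<and> (\<forall>v\<in>V. v = (\<lambda>i. \<Sum>a<r. ip \<eta> v (e a) * e a i))"
proof -
  define P where "P r \<longleftrightarrow> (\<exists>e. orthonormal \<eta> r e \<and> (\<forall>a<r. e a \<in> V))" for r
  have P0: "P 0" by (auto simp: P_def orthonormal_def)
  have bound: "r \<le> card I" if "P r" for r
  proof (rule ccontr)
    assume "\<not> r \<le> card I"
    from that obtain e where e: "orthonormal \<eta> r e" "\<forall>a<r. e a \<in> V" by (auto simp: P_def)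
    obtain x where "\<exists>a<r. x a \<noteq> 0" "\<forall>i. (\<Sum>a<r. x a * e a i) = 0"
      using determined_by_dependent[OF assms(1,3), of r e] e \<open>\<not> r \<le> card I\<close> by auto
    with orthonormal_independent[OF e(1)] show False by blast
  qed
  obtain r where r: "P r" "\<And>s. P s \<Longrightarrow> s \<le> r"
    using bound P0 by (metis Greatest_le_nat GreatestI_nat)
  from r(1) obtain e where e: "orthonormal \<eta> r e" "\<forall>a<r. e a \<in> V" by (auto simp: P_def)
  have "v = (\<lambda>i. \<Sum>a<r. ip \<eta> v (e a) * e a i)" if v: "v \<in> V" for v
  proof (rule ccontr)
    assume ne: "v \<noteq> (\<lambda>i. \<Sum>a<r. ip \<eta> v (e a) * e a i)"
    define z where "z = (\<lambda>i. v i - (\<Sum>a<r. ip \<eta> v (e a) * e a i))"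
    have zV: "z \<in> V" unfolding z_def using v e by (auto intro!: subsp_diff subsp_sum assms(1))
    have ze: "ip \<eta> z (e b) = 0" if "b < r" for b
      unfolding z_def ip_diff_left orthonormal_coeff[OF e(1) that] by simp
    have "z \<noteq> (\<lambda>i. 0)" using ne by (auto simp: z_def fun_eq_iff)
    then have pos: "ip \<eta> z z > 0" using assms(2) zV by (auto simp: posdef_on_def)
    define n where "n = (\<lambda>i. (1 / sqrt (ip \<eta> z z)) * z i)"
    have nV: "n \<in> V" unfolding n_def by (rule subsp_scale[OF assms(1) zV])
    have nn: "ip \<eta> n n = 1" using pos unfolding n_def ip_scale_left ip_scale_right by simp
    have ne: "ip \<eta> n (e b) = 0" if "b < r" for b using ze[OF that] unfolding n_def ip_scale_left by simp
    have "orthonormal \<eta> (Suc r) (e(r := n))"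
      using e(1) nn ne by (auto simp: orthonormal_def less_Suc_eq ip_comm[of _ "e _" n])
    moreover have "\<forall>a<Suc r. (e(r := n)) a \<in> V" using e(2) nV by (auto simp: less_Suc_eq)
    ultimately have "P (Suc r)" unfolding P_def by blast
    from r(2)[OF this] show False by simp
  qed
  with e show ?thesis by blast
qed

text \<open>Gaussian elimination: a class of functions closed under field operations contains the solutions
  of a positive definite system with coefficients in the class.\<close>

lemma solution_in_class:
  fixes U :: "'u set" and A :: "('u \<Rightarrow> real) set" and n :: nat
  assumes diff: "\<And>F G. F \<in> A \<Longrightarrow> G \<in> A \<Longrightarrow> (\<lambda>u. F u - G u) \<in> A"
    and mult: "\<And>F G. F \<in> A \<Longrightarrow> G \<in> A \<Longrightarrow> (\<lambda>u. F u * G u) \<in> A"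
    and div: "\<And>F G. F \<in> A \<Longrightarrow> G \<in> A \<Longrightarrow> \<forall>u\<in>U. G u \<noteq> 0 \<Longrightarrow> (\<lambda>u. F u / G u) \<in> A"
    and cong: "\<And>F G. F \<in> A \<Longrightarrow> \<forall>u\<in>U. F u = G u \<Longrightarrow> G \<in> A"
  assumes "\<And>i j. i < n \<Longrightarrow> j < n \<Longrightarrow> G i j \<in> A" "\<And>i. i < n \<Longrightarrow> r i \<in> A"
    and "\<And>i j u. i < n \<Longrightarrow> j < n \<Longrightarrow> u \<in> U \<Longrightarrow> G i j u = G j i u"
    and "\<And>u w. u \<in> U \<Longrightarrow> \<exists>i<n. w i \<noteq> 0 \<Longrightarrow> (\<Sum>i<n. \<Sum>j<n. G i j u * w i * w j) > 0"
    and "\<And>u i. u \<in> U \<Longrightarrow> i < n \<Longrightarrow> (\<Sum>j<n. G i j u * x j u) = r i u"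
    and "j < n"
  shows "x j \<in> A"
  using assms(5-)
proof (induction n arbitrary: G r j)
  case 0
  then show ?case by simp
next
  case (Suc n)
  note GA = Suc.prems(1) and rA = Suc.prems(2) and sym = Suc.prems(3)
    and pos = Suc.prems(4) and sol = Suc.prems(5)
  have nn: "G n n u > 0" if "u \<in> U" for u
  proof -
    have "0 < (\<Sum>i<Suc n. \<Sum>j<Suc n. G i j u * (if i = n then 1 else 0) * (if j = n then 1 else 0))"
      by (rule pos[OF that]) auto
    also have "\<dots> = G n n u" by simp
    finally show ?thesis .
  qed
  \<comment> \<open>Schur complement: the unknown \<open>x n\<close> is eliminated with the pivot
    \<open>G n n\<close>, which is positive and hence nowhere zero on \<open>U\<close>.\<close>
  define G' where "G' i j = (\<lambda>u. G i j u - G i n u * G n j u / G n n u)" for i j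
  define r' where "r' i = (\<lambda>u. r i u - G i n u * r n u / G n n u)" for i
  have nz: "\<forall>u\<in>U. G n n u \<noteq> 0" using nn by force
  have soln: "(\<Sum>j<n. G i j u * x j u) + G i n u * x n u = r i u" if "u \<in> U" "i < Suc n" for u i
    using sol[OF that] by simp
  have xA: "x j \<in> A" if "j < n" for j
  proof (rule Suc.IH[of G' r'])
    show "G' i j \<in> A" if "i < n" "j < n" for i j
      unfolding G'_def using that nz by (intro diff mult div GA) auto
    show "r' i \<in> A" if "i < n" for i
      unfolding r'_def using that nz by (intro diff mult div GA rA) auto
    show "G' i j u = G' j i u" if "i < n" "j < n" "u \<in> U" for i j u
      using that sym[of i j u] sym[of i n u] sym[of j n u] by (simp add: G'_def)
    show "0 < (\<Sum>i<n. \<Sum>j<n. G' i j u * w i * w j)" if u: "u \<in> U" and w: "\<exists>i<n. w i \<noteq> 0" for u w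
    proof -
      \<comment> \<open>The last entry of \<open>v\<close> minimises the old quadratic form when the
        other entries are those of \<open>w\<close>. The minimum is the form of the Schur complement
        at \<open>w\<close>, which is therefore positive.\<close>
      define s where "s = (\<Sum>j<n. G n j u * w j)"
      define v where "v = w(n := - s / G n n u)"
      have "0 < (\<Sum>i<Suc n. \<Sum>j<Suc n. G i j u * v i * v j)"
        by (rule pos[OF u]) (use w in \<open>auto simp: v_def less_Suc_eq\<close>)
      also have "\<dots> = (\<Sum>i<n. \<Sum>j<n. G i j u * w i * w j) + (\<Sum>i<n. G i n u * w i * v n)
          + (\<Sum>j<n. G n j u * v n * w j) + G n n u * v n * v n"
      proof -
        have vw: "v i = w i" if "i \<in> {..<n}" for i using that by (simp add: v_def)
        show ?thesis
          by (simp only: sum.lessThan_Suc sum.distrib add.assoc vw cong: sum.cong)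
      qed
      also have "(\<Sum>i<n. G i n u * w i * v n) = s * v n"
        unfolding s_def sum_distrib_right by (rule sum.cong) (use u sym in auto)
      also have "(\<Sum>j<n. G n j u * v n * w j) = s * v n"
        unfolding s_def sum_distrib_right by (rule sum.cong) auto
      also have "(\<Sum>i<n. \<Sum>j<n. G i j u * w i * w j) + s * v n + s * v n + G n n u * v n * v n
          = (\<Sum>i<n. \<Sum>j<n. G i j u * w i * w j) - s * s / G n n u"
        using nn[OF u] by (simp add: v_def field_simps)
      also have "s * s / G n n u = (\<Sum>i<n. \<Sum>j<n. G i n u * G n j u / G n n u * w i * w j)"
      proof -
        have "s = (\<Sum>i<n. G i n u * w i)" unfolding s_def by (rule sum.cong) (use u sym in auto)
        then have "s * s = (\<Sum>i<n. G i n u * w i) * (\<Sum>j<n. G n j u * w j)" by (simp add: s_def)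
        then have "s * s / G n n u = (\<Sum>i<n. \<Sum>j<n. G i n u * w i * (G n j u * w j) / G n n u)"
          by (simp only: sum_product sum_divide_distrib)
        also have "\<dots> = (\<Sum>i<n. \<Sum>j<n. G i n u * G n j u / G n n u * w i * w j)"
          by (intro sum.cong refl) simp
        finally show ?thesis .
      qed
      finally show ?thesis
        by (simp only: G'_def left_diff_distrib sum_subtractf)
    qed
    show "(\<Sum>j<n. G' i j u * x j u) = r' i u" if u: "u \<in> U" and i: "i < n" for u i
    proof -
      have "(\<Sum>j<n. G' i j u * x j u) = (\<Sum>j<n. G i j u * x j u) - G i n u / G n n u * (\<Sum>j<n. G n j u * x j u)"
        unfolding G'_def sum_distrib_left left_diff_distrib sum_subtractf
        by (intro arg_cong2[of _ _ _ _ "(-)"] sum.cong refl) simp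
      also have "\<dots> = (r i u - G i n u * x n u) - G i n u / G n n u * (r n u - G n n u * x n u)"
      proof -
        have "(\<Sum>j<n. G i j u * x j u) = r i u - G i n u * x n u" using soln[OF u, of i] i by linarith
        moreover have "(\<Sum>j<n. G n j u * x j u) = r n u - G n n u * x n u" using soln[OF u, of n] by linarith
        ultimately show ?thesis by (simp only:)
      qed
      also have "\<dots> = r' i u" using nn[OF u] by (simp add: r'_def field_simps)
      finally show ?thesis .
    qed
  qed (use that in auto)
  have sumA: "(\<lambda>u. r n u - (\<Sum>j<k. G n j u * x j u)) \<in> A" if "k \<le> n" for k
    using that
  proof (induction k)
    case 0
    then show ?case using rA[of n] by simp
  next
    case (Suc k)
    have "(\<lambda>u. (r n u - (\<Sum>j<k. G n j u * x j u)) - G n k u * x k u) \<in> A"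
      by (rule diff[OF _ mult[OF GA xA]]) (use Suc in auto)
    then show ?case by (simp add: diff_diff_eq)
  qed
  have "(\<lambda>u. (r n u - (\<Sum>j<n. G n j u * x j u)) / G n n u) \<in> A"
    by (rule div[OF sumA GA nz]) auto
  then have "x n \<in> A"
  proof (rule cong, intro ballI)
    fix u assume u: "u \<in> U"
    have "r n u - (\<Sum>j<n. G n j u * x j u) = G n n u * x n u" using soln[OF u, of n] by linarith
    then show "(r n u - (\<Sum>j<n. G n j u * x j u)) / G n n u = x n u" using nn[OF u] by simp
  qed
  with xA Suc.prems(6) show ?case by (auto simp: less_Suc_eq)
qed

subsection \<open>Neighbourhoods in coordinate space\<close>

definition cube :: "nat \<Rightarrow> (nat \<Rightarrow> real) \<Rightarrow> real \<Rightarrow> (nat \<Rightarrow> real) set" where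
  "cube m u e = {v. (\<forall>i<m. \<bar>v i - u i\<bar> < e) \<and> (\<forall>i\<ge>m. v i = u i)}"

text \<open>The filter is not punctured, so an estimate along it also holds at \<open>u\<close>. It
  is restricted to \<open>U\<close> because \<open>U\<close> is open only relative to the coordinate
  subspace.\<close>

definition nhds_in :: "(nat \<Rightarrow> real) set \<Rightarrow> (nat \<Rightarrow> real) \<Rightarrow> (nat \<Rightarrow> real) filter" where
  "nhds_in U u = inf (nhds u) (principal U)"

lemma eventually_nhds_in:
  "eventually P (nhds_in U u) \<longleftrightarrow> (\<exists>S. open S \<and> u \<in> S \<and> (\<forall>v\<in>S \<inter> U. P v))"
  by (auto simp: nhds_in_def eventually_inf_principal eventually_nhds)

lemma openin_Euclidean_spaceD:
  assumes "openin (Euclidean_space m) U"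
  shows "U \<subseteq> {x. \<forall>i\<ge>m. x i = 0}" and "\<exists>T. open T \<and> U = T \<inter> {x. \<forall>i\<ge>m. x i = 0}"
  using assms by (auto simp: Euclidean_space_def openin_subtopology euclidean_product_topology)

text \<open>A basic open set of the product topology constrains every coordinate separately. The
  finitely many coordinates below \<open>m\<close> admit a common radius, and a cube keeps all
  others fixed.\<close>

lemma open_contains_cube:
  fixes S :: "(nat \<Rightarrow> real) set"
  assumes "open S" "u \<in> S"
  shows "\<exists>e>0. cube m u e \<subseteq> S"
proof -
  have "openin (product_topology (\<lambda>i::nat. euclidean :: real topology) UNIV) S"
    using assms by (simp add: euclidean_product_topology)
  from product_topology_open_contains_basis[OF this assms(2)]
  obtain X :: "nat \<Rightarrow> real set" where X: "u \<in> Pi\<^sub>E UNIV X" "\<And>i. open (X i)" "Pi\<^sub>E UNIV X \<subseteq> S"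
    by auto
  have "eventually (\<lambda>e. \<forall>x. \<bar>x - u i\<bar> < e \<longrightarrow> x \<in> X i) (at_right 0)" for i
  proof -
    have "u i \<in> X i" using X(1) by auto
    then obtain d where "d > 0" "\<forall>x. \<bar>x - u i\<bar> < d \<longrightarrow> x \<in> X i"
      using X(2)[of i] by (auto simp: open_dist dist_real_def)
    then show ?thesis by (auto simp: eventually_at_right intro!: exI[of _ d])
  qed
  then have "eventually (\<lambda>e. \<forall>i\<in>{..<m}. \<forall>x. \<bar>x - u i\<bar> < e \<longrightarrow> x \<in> X i) (at_right 0)"
    by (intro eventually_ball_finite) auto
  then have "eventually (\<lambda>e. e > 0 \<and> (\<forall>i\<in>{..<m}. \<forall>x. \<bar>x - u i\<bar> < e \<longrightarrow> x \<in> X i)) (at_right 0)"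
    by (auto elim: eventually_elim2[OF _ eventually_at_right_less])
  from eventually_happens'[OF trivial_limit_at_right_real this]
  obtain e where e: "e > 0" "\<forall>i<m. \<forall>x. \<bar>x - u i\<bar> < e \<longrightarrow> x \<in> X i" by auto
  have "cube m u e \<subseteq> Pi\<^sub>E UNIV X"
  proof
    fix v assume v: "v \<in> cube m u e"
    have "v i \<in> X i" for i
      using v e X(1) by (cases "i < m") (auto simp: cube_def PiE_iff)
    then show "v \<in> Pi\<^sub>E UNIV X" by auto
  qed
  with X(3) e(1) show ?thesis by blast
qed

lemma eventually_nhds_in_cube:
  assumes U: "openin (Euclidean_space m) U" "u \<in> U" and "eventually P (nhds_in U u)"
  shows "\<exists>e>0. cube m u e \<subseteq> U \<and> (\<forall>v\<in>cube m u e. P v)"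
proof -
  obtain S where S: "open S" "u \<in> S" "\<forall>v\<in>S \<inter> U. P v" using assms(3) by (auto simp: eventually_nhds_in)
  obtain T where T: "open T" "U = T \<inter> {x. \<forall>i\<ge>m. x i = 0}" using openin_Euclidean_spaceD(2)[OF U(1)] by blast
  have "open (S \<inter> T)" "u \<in> S \<inter> T" using S T U by auto
  from open_contains_cube[OF this, of m] obtain e where e: "e > 0" "cube m u e \<subseteq> S \<inter> T" by blast
  have "cube m u e \<subseteq> {x. \<forall>i\<ge>m. x i = 0}" using T U(2) by (auto simp: cube_def)
  with e T have "cube m u e \<subseteq> U" by blast
  moreover have "\<forall>v\<in>cube m u e. P v" using e S \<open>cube m u e \<subseteq> U\<close> by blast
  ultimately show ?thesis using e(1) by blast
qed

lemma eventually_nhds_inI_cube: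
  assumes U: "openin (Euclidean_space m) U" "u \<in> U" and "e > 0" "\<And>v. v \<in> cube m u e \<Longrightarrow> P v"
  shows "eventually P (nhds_in U u)"
proof -
  define S where "S = (\<Inter>i<m. (\<lambda>v::nat \<Rightarrow> real. v i) -` {x. \<bar>x - u i\<bar> < e})"
  have "open {x. \<bar>x - c\<bar> < e}" for c :: real
    by (intro open_Collect_less continuous_intros)
  then have "open S" unfolding S_def
    by (intro open_INT ballI open_vimage) auto
  moreover have "u \<in> S" using \<open>e > 0\<close> by (auto simp: S_def)
  moreover have "v \<in> cube m u e" if "v \<in> S \<inter> U" for v
  proof -
    have "\<forall>i\<ge>m. v i = 0" "\<forall>i\<ge>m. u i = 0" using openin_Euclidean_spaceD(1)[OF U(1)] U(2) that by blast+
    with that show ?thesis by (auto simp: S_def cube_def)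
  qed
  ultimately show ?thesis unfolding eventually_nhds_in using assms(4) by blast
qed

lemma line_in_open:
  assumes "openin (Euclidean_space m) U" "u \<in> U" "a < m"
  shows "eventually (\<lambda>t. u(a := t) \<in> U) (nhds (u a))"
proof -
  obtain e where e: "e > 0" "cube m u e \<subseteq> U"
    using eventually_nhds_in_cube[OF assms(1,2), of "\<lambda>_. True"] by auto
  have "u(a := t) \<in> U" if "dist t (u a) < e" for t
    using that e assms(3) by (intro subsetD[OF e(2)]) (auto simp: cube_def dist_real_def)
  with e(1) show ?thesis by (auto simp: eventually_nhds_metric)
qed

lemma continuous_on_eventually_nhds_in:
  fixes F :: "(nat \<Rightarrow> real) \<Rightarrow> real"
  assumes "continuous_on U F" "u \<in> U" "open S" "F u \<in> S"
  shows "eventually (\<lambda>v. F v \<in> S) (nhds_in U u)"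
proof -
  from assms obtain A where "open A" "A \<inter> U = F -` S \<inter> U" by (metis continuous_on_open_invariant)
  with assms show ?thesis unfolding eventually_nhds_in by (intro exI[of _ A]) auto
qed

lemma continuous_on_bigo_1:
  fixes F :: "(nat \<Rightarrow> real) \<Rightarrow> real"
  assumes "continuous_on U F" "u \<in> U"
  shows "F \<in> O[nhds_in U u](\<lambda>_. 1)"
proof -
  have "eventually (\<lambda>v. F v \<in> {x. \<bar>x\<bar> < \<bar>F u\<bar> + 1}) (nhds_in U u)"
    by (rule continuous_on_eventually_nhds_in[OF assms]) (auto intro!: open_Collect_less continuous_intros)
  then show ?thesis
    by (intro bigoI[of _ "\<bar>F u\<bar> + 1"]) (auto elim!: eventually_mono)
qed

subsection \<open>Partial derivatives\<close>

definition has_pderiv :: "nat \<Rightarrow> ((nat \<Rightarrow> real) \<Rightarrow> real) \<Rightarrow> (nat \<Rightarrow> real) \<Rightarrow> real \<Rightarrow> bool" where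
  "has_pderiv a F u D \<longleftrightarrow> ((\<lambda>t. F (u(a := t))) has_real_derivative D) (at (u a))"

lemma has_pderiv_imp: "has_pderiv a F u D \<Longrightarrow> pderiv_at a F u = D"
  by (simp add: has_pderiv_def pderiv_at_def DERIV_imp_deriv)

lemma differentiable_has_pderiv:
  "(\<lambda>t. F (u(a := t))) differentiable at (u a) \<Longrightarrow> has_pderiv a F u (pderiv_at a F u)"
  unfolding has_pderiv_def pderiv_at_def by (metis DERIV_imp_deriv real_differentiable_def)

lemma has_pderiv_unique: "has_pderiv a F u D \<Longrightarrow> has_pderiv a F u E \<Longrightarrow> D = E"
  using has_pderiv_imp by blast

lemma has_pderiv_const: "has_pderiv a (\<lambda>_. c) u 0"
  by (simp add: has_pderiv_def)

lemma has_pderiv_add: "has_pderiv a F u D \<Longrightarrow> has_pderiv a G u E \<Longrightarrow> has_pderiv a (\<lambda>v. F v + G v) u (D + E)"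
  unfolding has_pderiv_def by (rule DERIV_add)

lemma has_pderiv_diff: "has_pderiv a F u D \<Longrightarrow> has_pderiv a G u E \<Longrightarrow> has_pderiv a (\<lambda>v. F v - G v) u (D - E)"
  unfolding has_pderiv_def by (rule DERIV_diff)

lemma has_pderiv_mult:
  "has_pderiv a F u D \<Longrightarrow> has_pderiv a G u E \<Longrightarrow> has_pderiv a (\<lambda>v. F v * G v) u (D * G u + F u * E)"
  unfolding has_pderiv_def
  by (drule (1) DERIV_mult) (simp add: mult.commute)

lemma has_pderiv_cmult: "has_pderiv a F u D \<Longrightarrow> has_pderiv a (\<lambda>v. c * F v) u (c * D)"
  unfolding has_pderiv_def by (rule DERIV_cmult)

lemma has_pderiv_sum:
  "(\<And>i. i \<in> I \<Longrightarrow> has_pderiv a (F i) u (D i)) \<Longrightarrow> has_pderiv a (\<lambda>v. \<Sum>i\<in>I. F i v) u (\<Sum>i\<in>I. D i)"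
  unfolding has_pderiv_def by (rule DERIV_sum)

lemma has_pderiv_chain:
  "(g has_real_derivative g') (at (F u)) \<Longrightarrow> has_pderiv a F u D \<Longrightarrow> has_pderiv a (\<lambda>v. g (F v)) u (g' * D)"
  unfolding has_pderiv_def using DERIV_chain2[of g g' "\<lambda>t. F (u(a := t))" "u a" D UNIV] by simp

text \<open>Functions are total and may differ off \<open>U\<close>; openness keeps the coordinate
  line inside \<open>U\<close> near \<open>u\<close>, which is all that a derivative sees.\<close>

lemma has_pderiv_cong:
  assumes "openin (Euclidean_space m) U" "u \<in> U" "a < m" "\<And>v. v \<in> U \<Longrightarrow> F v = G v" "has_pderiv a F u D"
  shows "has_pderiv a G u D"
proof -
  have "eventually (\<lambda>t. F (u(a := t)) = G (u(a := t))) (nhds (u a))"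
    using line_in_open[OF assms(1-3)] by eventually_elim (use assms(4) in auto)
  with assms(5) show ?thesis unfolding has_pderiv_def by (subst (asm) DERIV_cong_ev[OF refl _ refl])
qed

lemma pderiv_at_cong:
  assumes "openin (Euclidean_space m) U" "u \<in> U" "a < m" "\<And>v. v \<in> U \<Longrightarrow> F v = G v"
  shows "pderiv_at a F u = pderiv_at a G u"
proof -
  have "eventually (\<lambda>t. F (u(a := t)) = G (u(a := t))) (nhds (u a))"
    using line_in_open[OF assms(1-3)] by eventually_elim (use assms(4) in auto)
  then show ?thesis unfolding pderiv_at_def by (rule deriv_cong_ev) simp
qed

lemma smooth_real_continuous: "smooth_real m U F \<Longrightarrow> continuous_on U F"
  unfolding smooth_real_def by (metis C_k_on.simps(1))

lemma smooth_real_has_pderiv: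
  assumes "smooth_real m U F" "u \<in> U" "a < m"
  shows "has_pderiv a F u (pderiv_at a F u)"
proof -
  have "C_k_on m (Suc 0) U F" using assms(1) by (simp add: smooth_real_def del: C_k_on.simps)
  then have "(\<lambda>t. F (u(a := t))) differentiable at (u a)" using assms(2,3) by simp
  then show ?thesis by (rule differentiable_has_pderiv)
qed

lemma smooth_real_pderiv:
  assumes "smooth_real m U F" "a < m" shows "smooth_real m U (pderiv_at a F)"
  unfolding smooth_real_def
proof
  fix k
  have "C_k_on m (Suc k) U F" using assms(1) by (simp add: smooth_real_def del: C_k_on.simps)
  then show "C_k_on m k U (pderiv_at a F)" using assms(2) by simp
qed

lemma C_k_on_cong:
  assumes "openin (Euclidean_space m) U"
  shows "(\<And>v. v \<in> U \<Longrightarrow> F v = G v) \<Longrightarrow> C_k_on m k U F \<Longrightarrow> C_k_on m k U G"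
proof (induction k arbitrary: F G)
  case 0
  then show ?case using continuous_on_cong[of U U F G] by simp
next
  case (Suc k)
  show ?case unfolding C_k_on.simps
  proof (intro conjI allI impI ballI)
    show "continuous_on U G" using Suc.prems continuous_on_cong[of U U F G] by simp
    fix a assume a: "a < m"
    show "C_k_on m k U (pderiv_at a G)"
      by (rule Suc.IH[of "pderiv_at a F"])
        (use Suc.prems a pderiv_at_cong[OF assms _ a, of _ F G] in auto)
    fix u assume u: "u \<in> U"
    have "(\<lambda>t. F (u(a := t))) differentiable at (u a)" using Suc.prems a u by simp
    then have "has_pderiv a F u (pderiv_at a F u)" by (rule differentiable_has_pderiv)
    from has_pderiv_cong[OF assms u a Suc.prems(1) this]
    show "(\<lambda>t. G (u(a := t))) differentiable at (u a)"
      unfolding has_pderiv_def real_differentiable_def by blast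
  qed
qed

lemma smooth_real_cong:
  assumes "openin (Euclidean_space m) U" "\<And>v. v \<in> U \<Longrightarrow> F v = G v" "smooth_real m U F"
  shows "smooth_real m U G"
  using assms C_k_on_cong[OF assms(1,2)] by (auto simp: smooth_real_def)

lemma C_k_on_has_pderiv:
  assumes "C_k_on m (Suc k) U F" "u \<in> U" "a < m" shows "has_pderiv a F u (pderiv_at a F u)"
proof (rule differentiable_has_pderiv)
  show "(\<lambda>t. F (u(a := t))) differentiable at (u a)" using assms by simp
qed

lemma C_k_on_const: "C_k_on m k U (\<lambda>_. c)"
proof (induction k arbitrary: c)
  case (Suc k)
  have "pderiv_at a (\<lambda>_. c) = (\<lambda>_. 0)" for a
    by (simp add: fun_eq_iff has_pderiv_imp[OF has_pderiv_const])
  then show ?case using Suc by simp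
qed simp

lemma C_k_on_add:
  assumes U: "openin (Euclidean_space m) U"
  shows "C_k_on m k U F \<Longrightarrow> C_k_on m k U G \<Longrightarrow> C_k_on m k U (\<lambda>v. F v + G v)"
proof (induction k arbitrary: F G)
  case (Suc k)
  have d: "has_pderiv a (\<lambda>v. F v + G v) u (pderiv_at a F u + pderiv_at a G u)" if "u \<in> U" "a < m" for a u
    using Suc.prems that by (intro has_pderiv_add C_k_on_has_pderiv)
  show ?case unfolding C_k_on.simps
  proof (intro conjI allI impI ballI)
    show "continuous_on U (\<lambda>v. F v + G v)" using Suc.prems by (auto intro: continuous_intros)
    fix a assume a: "a < m"
    show "C_k_on m k U (pderiv_at a (\<lambda>v. F v + G v))"
    proof (rule C_k_on_cong[OF U _ Suc.IH[of "pderiv_at a F" "pderiv_at a G"]])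
      fix v assume "v \<in> U"
      from has_pderiv_imp[OF d[OF this a]]
      show "pderiv_at a F v + pderiv_at a G v = pderiv_at a (\<lambda>v. F v + G v) v" by simp
    qed (use Suc.prems a in auto)
    fix u assume "u \<in> U"
    from d[OF this a] show "(\<lambda>t. F (u(a := t)) + G (u(a := t))) differentiable at (u a)"
      by (auto simp: has_pderiv_def real_differentiable_def)
  qed
qed (auto intro: continuous_intros)

lemma C_k_on_cmult:
  assumes U: "openin (Euclidean_space m) U"
  shows "C_k_on m k U F \<Longrightarrow> C_k_on m k U (\<lambda>v. c * F v)"
proof (induction k arbitrary: F)
  case (Suc k)
  have d: "has_pderiv a (\<lambda>v. c * F v) u (c * pderiv_at a F u)" if "u \<in> U" "a < m" for a u
    using Suc.prems that by (intro has_pderiv_cmult C_k_on_has_pderiv)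
  show ?case unfolding C_k_on.simps
  proof (intro conjI allI impI ballI)
    show "continuous_on U (\<lambda>v. c * F v)" using Suc.prems by (auto intro: continuous_intros)
    fix a assume a: "a < m"
    show "C_k_on m k U (pderiv_at a (\<lambda>v. c * F v))"
    proof (rule C_k_on_cong[OF U _ Suc.IH[of "pderiv_at a F"]])
      fix v assume "v \<in> U"
      from has_pderiv_imp[OF d[OF this a]]
      show "c * pderiv_at a F v = pderiv_at a (\<lambda>v. c * F v) v" by simp
    qed (use Suc.prems a in auto)
    fix u assume "u \<in> U"
    from d[OF this a] show "(\<lambda>t. c * F (u(a := t))) differentiable at (u a)"
      by (auto simp: has_pderiv_def real_differentiable_def)
  qed
qed (auto intro: continuous_intros)

lemma smooth_real_const: "smooth_real m U (\<lambda>_. c)"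
  by (simp add: smooth_real_def C_k_on_const)

lemma smooth_real_add:
  "openin (Euclidean_space m) U \<Longrightarrow> smooth_real m U F \<Longrightarrow> smooth_real m U G \<Longrightarrow> smooth_real m U (\<lambda>v. F v + G v)"
  by (simp add: smooth_real_def C_k_on_add)

lemma smooth_real_cmult:
  "openin (Euclidean_space m) U \<Longrightarrow> smooth_real m U F \<Longrightarrow> smooth_real m U (\<lambda>v. c * F v)"
  by (simp add: smooth_real_def C_k_on_cmult)

lemma smooth_real_lincomb:
  assumes "openin (Euclidean_space m) U" "\<And>i. i \<in> I \<Longrightarrow> smooth_real m U (F i)"
  shows "smooth_real m U (\<lambda>v. \<Sum>i\<in>I. w i * F i v)"
  using assms(2)
  by (induction I rule: infinite_finite_induct)
    (auto intro!: smooth_real_const smooth_real_add smooth_real_cmult assms(1))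

text \<open>Both mixed partials are limits of the same second difference quotient.\<close>

lemma mixed_difference_mean_value:
  assumes F: "smooth_real m U F" and ab: "a < m" "b < m" "a \<noteq> b" and h: "h > 0"
    and in_U: "\<And>s t. 0 \<le> s \<Longrightarrow> s \<le> h \<Longrightarrow> 0 \<le> t \<Longrightarrow> t \<le> h \<Longrightarrow> u(a := u a + s, b := u b + t) \<in> U"
  shows "\<exists>s t. 0 < s \<and> s < h \<and> 0 < t \<and> t < h \<and>
     F (u(a := u a + h, b := u b + h)) - F (u(a := u a + h)) - F (u(b := u b + h)) + F u
       = h\<^sup>2 * pderiv_at b (pderiv_at a F) (u(a := u a + s, b := u b + t))"
proof -
  have da: "((\<lambda>s. F (u(a := u a + s, b := u b + t))) has_real_derivative
      pderiv_at a F (u(a := u a + s, b := u b + t))) (at s)"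
    if "0 \<le> s" "s \<le> h" "0 \<le> t" "t \<le> h" for s t
  proof -
    have "has_pderiv a F (u(a := u a + s, b := u b + t)) (pderiv_at a F (u(a := u a + s, b := u b + t)))"
      by (rule smooth_real_has_pderiv[OF F in_U[OF that] ab(1)])
    then have "((\<lambda>x. F (u(b := u b + t, a := x))) has_real_derivative
        pderiv_at a F (u(a := u a + s, b := u b + t))) (at (u a + s))"
      using ab(3) by (simp add: has_pderiv_def fun_upd_twist)
    then have "((\<lambda>s. F (u(b := u b + t, a := u a + s))) has_real_derivative
        pderiv_at a F (u(a := u a + s, b := u b + t)) * (0 + 1)) (at s)"
      by (rule DERIV_chain2) (auto intro!: derivative_eq_intros)
    then show ?thesis using ab(3) by (simp add: fun_upd_twist)
  qed
  \<comment> \<open>The second difference is the increment of \<open>d\<close> over the interval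
    from 0 to \<open>h\<close>. The mean value theorem in direction \<open>a\<close> turns it into
    an increment of the first partial derivative, and once more in direction \<open>b\<close> into
    the mixed one.\<close>
  define d where "d s = F (u(a := u a + s, b := u b + h)) - F (u(a := u a + s, b := u b + 0))" for s
  have "\<exists>s>0. s < h \<and> d h - d 0 = (h - 0) * (pderiv_at a F (u(a := u a + s, b := u b + h))
      - pderiv_at a F (u(a := u a + s, b := u b + 0)))"
    by (rule MVT2[OF h]) (unfold d_def, intro DERIV_diff da, use h in auto)
  then obtain s where s: "s > 0" "s < h" "d h - d 0 = h * (pderiv_at a F (u(a := u a + s, b := u b + h))
      - pderiv_at a F (u(a := u a + s, b := u b + 0)))"
    by auto
  let ?P = "\<lambda>t. pderiv_at b (pderiv_at a F) (u(a := u a + s, b := u b + t))"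
  have db: "((\<lambda>t. pderiv_at a F (u(a := u a + s, b := u b + t))) has_real_derivative ?P t) (at t)"
    if "0 \<le> t" "t \<le> h" for t
  proof -
    have "has_pderiv b (pderiv_at a F) (u(a := u a + s, b := u b + t)) (?P t)"
      using that s in_U ab by (intro smooth_real_has_pderiv[OF smooth_real_pderiv[OF F]]) auto
    then have "((\<lambda>x. pderiv_at a F (u(a := u a + s, b := x))) has_real_derivative ?P t) (at (u b + t))"
      by (simp add: has_pderiv_def)
    then have "((\<lambda>t. pderiv_at a F (u(a := u a + s, b := u b + t))) has_real_derivative ?P t * (0 + 1)) (at t)"
      by (rule DERIV_chain2) (auto intro!: derivative_eq_intros)
    then show ?thesis by simp
  qed
  have "\<exists>t>0. t < h \<and> pderiv_at a F (u(a := u a + s, b := u b + h)) - pderiv_at a F (u(a := u a + s, b := u b + 0))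
      = (h - 0) * ?P t"
    by (rule MVT2[OF h], rule db)
  then obtain t where t: "t > 0" "t < h" "pderiv_at a F (u(a := u a + s, b := u b + h))
      - pderiv_at a F (u(a := u a + s, b := u b + 0)) = h * ?P t" by auto
  have u1: "u(a := u a + h, b := u b) = u(a := u a + h)" "u(a := u a, b := u b) = u" "u(a := u a) = u"
    using ab(3) by (auto simp: fun_eq_iff)
  have "d h - d 0 = F (u(a := u a + h, b := u b + h)) - F (u(a := u a + h)) - F (u(b := u b + h)) + F u"
    using ab(3) by (simp add: d_def u1)
  with s(3) t(3) have "F (u(a := u a + h, b := u b + h)) - F (u(a := u a + h)) - F (u(b := u b + h)) + F u
      = h\<^sup>2 * ?P t" by (simp add: power2_eq_square)
  with s t show ?thesis by blast
qed

lemma pderiv_at_commute: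
  assumes U: "openin (Euclidean_space m) U" and F: "smooth_real m U F" and "u \<in> U" "a < m" "b < m"
  shows "pderiv_at a (pderiv_at b F) u = pderiv_at b (pderiv_at a F) u"
proof (cases "a = b")
  case False
  let ?P = "pderiv_at a (pderiv_at b F)" and ?Q = "pderiv_at b (pderiv_at a F)"
  show ?thesis
  proof (rule ccontr)
    assume ne: "?P u \<noteq> ?Q u"
    \<comment> \<open>Half the gap, so that the balls of this radius about the two values are
      disjoint. For small \<open>h\<close> the common difference quotient would lie in both.\<close>
    define \<epsilon> where "\<epsilon> = \<bar>?P u - ?Q u\<bar> / 2"
    have \<epsilon>: "\<epsilon> > 0" using ne by (simp add: \<epsilon>_def)
    have cont: "continuous_on U ?P" "continuous_on U ?Q"
      using assms by (auto intro!: smooth_real_continuous smooth_real_pderiv)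
    have "eventually (\<lambda>v. ?P v \<in> ball (?P u) \<epsilon>) (nhds_in U u)"
      by (rule continuous_on_eventually_nhds_in[OF cont(1) assms(3)]) (use \<epsilon> in auto)
    moreover have "eventually (\<lambda>v. ?Q v \<in> ball (?Q u) \<epsilon>) (nhds_in U u)"
      by (rule continuous_on_eventually_nhds_in[OF cont(2) assms(3)]) (use \<epsilon> in auto)
    ultimately have "eventually (\<lambda>v. ?P v \<in> ball (?P u) \<epsilon> \<and> ?Q v \<in> ball (?Q u) \<epsilon>) (nhds_in U u)"
      by (rule eventually_conj)
    from eventually_nhds_in_cube[OF U assms(3) this]
    obtain e where e: "e > 0" "cube m u e \<subseteq> U" "\<And>v. v \<in> cube m u e \<Longrightarrow> ?P v \<in> ball (?P u) \<epsilon> \<and> ?Q v \<in> ball (?Q u) \<epsilon>"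
      by blast
    define h where "h = e / 2"
    have h: "h > 0" using e by (simp add: h_def)
    have inb: "u(a := u a + s, b := u b + t) \<in> cube m u e" if "0 \<le> s" "s \<le> h" "0 \<le> t" "t \<le> h" for s t
      using that e(1) False assms(4,5) by (auto simp: cube_def h_def)
    have inb': "u(b := u b + t, a := u a + s) \<in> cube m u e" if "0 \<le> s" "s \<le> h" "0 \<le> t" "t \<le> h" for s t
      using inb[OF that] False by (simp add: fun_upd_twist)
    obtain s t where st: "0 < s" "s < h" "0 < t" "t < h"
      "F (u(a := u a + h, b := u b + h)) - F (u(a := u a + h)) - F (u(b := u b + h)) + F u
       = h\<^sup>2 * ?Q (u(a := u a + s, b := u b + t))"
      using mixed_difference_mean_value[OF F assms(4,5) False h] inb e(2) by blast
    obtain s' t' where st': "0 < s'" "s' < h" "0 < t'" "t' < h"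
      "F (u(b := u b + h, a := u a + h)) - F (u(b := u b + h)) - F (u(a := u a + h)) + F u
       = h\<^sup>2 * ?P (u(b := u b + s', a := u a + t'))"
      using mixed_difference_mean_value[OF F assms(5,4) not_sym[OF False] h, of u] inb' e(2) by blast
    have "F (u(b := u b + h, a := u a + h)) = F (u(a := u a + h, b := u b + h))"
      using False by (simp add: fun_upd_twist)
    with st(5) st'(5) have "h\<^sup>2 * ?Q (u(a := u a + s, b := u b + t)) = h\<^sup>2 * ?P (u(b := u b + s', a := u a + t'))"
      by linarith
    with h have "?Q (u(a := u a + s, b := u b + t)) = ?P (u(b := u b + s', a := u a + t'))" by simp
    moreover have "?Q (u(a := u a + s, b := u b + t)) \<in> ball (?Q u) \<epsilon>" using e(3) inb st by simp
    moreover have "?P (u(b := u b + s', a := u a + t')) \<in> ball (?P u) \<epsilon>" using e(3) inb' st' by simp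
    ultimately have "dist (?P u) (?Q u) < \<epsilon> + \<epsilon>"
      by (metis dist_commute mem_ball dist_triangle_less_add)
    then show False by (simp add: \<epsilon>_def dist_real_def)
  qed
qed simp

subsection \<open>Uniqueness for linear differential inequalities\<close>

text \<open>The energy \<open>E\<close> satisfies \<open>\<bar>E'\<bar> \<le> K * E\<close>. Hence
  \<open>E\<close> times \<open>exp (- K * t)\<close> does not increase to the right of
  \<open>t0\<close>, and \<open>E\<close> times \<open>exp (K * t)\<close> does not decrease up to
  \<open>t0\<close>; as \<open>E t0 = 0\<close>, the energy vanishes on both sides.\<close>

lemma gronwall_zero:
  fixes y y' :: "'k \<Rightarrow> real \<Rightarrow> real"
  assumes fin: "finite I" and der: "\<And>i t. i \<in> I \<Longrightarrow> l < t \<Longrightarrow> t < r \<Longrightarrow> (y i has_real_derivative y' i t) (at t)"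
    and bound: "\<And>i t. i \<in> I \<Longrightarrow> l < t \<Longrightarrow> t < r \<Longrightarrow> \<bar>y' i t\<bar> \<le> C * (\<Sum>j\<in>I. \<bar>y j t\<bar>)"
    and C: "C \<ge> 0" and t0: "l < t0" "t0 < r" "\<And>i. i \<in> I \<Longrightarrow> y i t0 = 0"
    and t: "l < t" "t < r" and i: "i \<in> I"
  shows "y i t = 0"
proof -
  define E where "E t = (\<Sum>i\<in>I. (y i t)\<^sup>2)" for t
  define E' where "E' t = (\<Sum>i\<in>I. 2 * y i t * y' i t)" for t
  \<comment> \<open>The factor 2 comes from differentiating the squares, and \<open>card I\<close>
    from Cauchy-Schwarz when the square of the sum is bounded by the sum of squares.\<close>
  define K where "K = 2 * C * real (card I)"
  have dE: "(E has_real_derivative E' t) (at t)" if "l < t" "t < r" for t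
    unfolding E_def E'_def using der[OF _ that]
    by (intro DERIV_sum) (auto intro!: derivative_eq_intros)
  have E'_le: "\<bar>E' t\<bar> \<le> K * E t" if tt: "l < t" "t < r" for t
  proof -
    have "\<bar>E' t\<bar> \<le> (\<Sum>i\<in>I. \<bar>2 * y i t * y' i t\<bar>)" unfolding E'_def by (rule sum_abs)
    also have "\<dots> \<le> (\<Sum>i\<in>I. 2 * \<bar>y i t\<bar> * (C * (\<Sum>j\<in>I. \<bar>y j t\<bar>)))"
      using bound[OF _ tt] by (intro sum_mono) (auto simp: abs_mult intro!: mult_left_mono)
    also have "\<dots> = 2 * C * (\<Sum>i\<in>I. \<bar>y i t\<bar>)\<^sup>2"
      by (simp add: power2_eq_square sum_distrib_left sum_distrib_right algebra_simps)
    also have "\<dots> \<le> 2 * C * (real (card I) * E t)"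
    proof -
      have "(\<Sum>i\<in>I. \<bar>y i t\<bar>)\<^sup>2 \<le> real (card I) * (\<Sum>i\<in>I. \<bar>y i t\<bar>\<^sup>2)"
        using sum_squared_le_sum_of_squares[of "\<lambda>i. \<bar>y i t\<bar>" I] by (simp add: mult.commute)
      then show ?thesis using C by (intro mult_left_mono) (auto simp: E_def)
    qed
    finally show ?thesis by (simp add: K_def)
  qed
  have E0: "E t0 = 0" using t0 by (simp add: E_def)
  have "E t \<le> 0"
  proof (cases "t0 \<le> t")
    case True
    have "E t * exp (- K * t) \<le> E t0 * exp (- K * t0)"
    proof (rule DERIV_nonpos_imp_nonincreasing[OF True, of "\<lambda>x. E x * exp (- K * x)"])
      fix x assume "t0 \<le> x" "x \<le> t"
      then have x: "l < x" "x < r" using t t0 by auto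
      have "((\<lambda>x. E x * exp (- K * x)) has_real_derivative (E' x - K * E x) * exp (- K * x)) (at x)"
        by (rule derivative_eq_intros dE[OF x] refl | simp add: algebra_simps)+
      moreover have "(E' x - K * E x) * exp (- K * x) \<le> 0"
        using E'_le[OF x] by (intro mult_nonpos_nonneg) auto
      ultimately show "\<exists>y. ((\<lambda>x. E x * exp (- K * x)) has_real_derivative y) (at x) \<and> y \<le> 0" by blast
    qed
    then show ?thesis by (simp add: E0 mult_le_0_iff not_le)
  next
    case False
    have "E t * exp (K * t) \<le> E t0 * exp (K * t0)"
    proof (rule DERIV_nonneg_imp_nondecreasing[of _ _ "\<lambda>x. E x * exp (K * x)"])
      show "t \<le> t0" using False by simp
      fix x assume "t \<le> x" "x \<le> t0"
      then have x: "l < x" "x < r" using t t0 by auto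
      have "((\<lambda>x. E x * exp (K * x)) has_real_derivative (E' x + K * E x) * exp (K * x)) (at x)"
        by (rule derivative_eq_intros dE[OF x] refl | simp add: algebra_simps)+
      moreover have "(E' x + K * E x) * exp (K * x) \<ge> 0"
        using E'_le[OF x] by (intro mult_nonneg_nonneg) auto
      ultimately show "\<exists>y. ((\<lambda>x. E x * exp (K * x)) has_real_derivative y) (at x) \<and> y \<ge> 0" by blast
    qed
    then show ?thesis by (simp add: E0 mult_le_0_iff not_le)
  qed
  moreover have "E t \<ge> 0" unfolding E_def by (rule sum_nonneg) simp
  ultimately have "(\<Sum>i\<in>I. (y i t)\<^sup>2) = 0" by (simp add: E_def)
  then show ?thesis using fin i by (subst (asm) sum_nonneg_eq_0_iff) auto
qed

text \<open>The points \<open>u\<close> and \<open>v\<close> are joined by a staircase of segments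
  parallel to the axes, which stays in the cube; on each segment the estimate is an ordinary
  differential inequality.\<close>

lemma cube_zero:
  fixes y y' :: "'k \<Rightarrow> (nat \<Rightarrow> real) \<Rightarrow> real"
  assumes fin: "finite I" and C: "C \<ge> 0"
    and der: "\<And>i a v. i \<in> I \<Longrightarrow> a < m \<Longrightarrow> v \<in> cube m u e \<Longrightarrow> has_pderiv a (y i) v (D a i v)"
    and bound: "\<And>i a v. i \<in> I \<Longrightarrow> a < m \<Longrightarrow> v \<in> cube m u e \<Longrightarrow> \<bar>D a i v\<bar> \<le> C * (\<Sum>j\<in>I. \<bar>y j v\<bar>)"
    and y0: "\<And>i. i \<in> I \<Longrightarrow> y i u = 0" and v: "v \<in> cube m u e" and i: "i \<in> I"
  shows "y i v = 0"
proof -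
  \<comment> \<open>The corners of the staircase: \<open>w k\<close> has already taken over the
    coordinates of \<open>v\<close> below \<open>k\<close>.\<close>
  define w where "w k = (\<lambda>j. if j < k then v j else u j)" for k :: nat
  have "\<forall>i\<in>I. y i (w k) = 0" if "k \<le> m" for k
    using that
  proof (induction k)
    case 0
    then show ?case using y0 by (simp add: w_def)
  next
    case (Suc k)
    have e: "e > 0" using v Suc.prems by (auto simp: cube_def)
    have "\<bar>v k - u k\<bar> < e" using v Suc.prems by (simp add: cube_def)
    then have vk: "u k - e < v k" "v k < u k + e" by linarith+
    have wk: "w k k = u k" by (simp add: w_def)
    have inb: "(w k)(k := t) \<in> cube m u e" if "u k - e < t" "t < u k + e" for t
      using that v e Suc.prems by (auto simp: cube_def w_def)
    have "y i ((w k)(k := v k)) = 0" if i: "i \<in> I" for i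
    proof (rule gronwall_zero[where y = "\<lambda>i t. y i ((w k)(k := t))" and y' = "\<lambda>i t. D k i ((w k)(k := t))"
          and l = "u k - e" and r = "u k + e" and ?t0.0 = "u k" and C = C])
      fix i t assume "i \<in> I" and t: "u k - e < t" "t < u k + e"
      then show "((\<lambda>t. y i ((w k)(k := t))) has_real_derivative D k i ((w k)(k := t))) (at t)"
        using der[OF \<open>i \<in> I\<close> _ inb[OF t], of k] Suc.prems by (simp add: has_pderiv_def)
      show "\<bar>D k i ((w k)(k := t))\<bar> \<le> C * (\<Sum>j\<in>I. \<bar>y j ((w k)(k := t))\<bar>)"
        using bound[OF \<open>i \<in> I\<close> _ inb[OF t], of k] Suc.prems by simp
    next
      fix i assume "i \<in> I"
      then show "y i ((w k)(k := u k)) = 0" using Suc wk by (metis Suc_leD fun_upd_triv)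
    qed (use vk e i fin C in auto)
    moreover have "(w k)(k := v k) = w (Suc k)" by (auto simp: w_def fun_eq_iff less_Suc_eq)
    ultimately show ?case by simp
  qed
  moreover have "w m = v" using v by (auto simp: w_def cube_def fun_eq_iff)
  ultimately show ?thesis using i by (metis order_refl)
qed

subsection \<open>Pairs\<close>

lemma vfst_vpair [simp]: "vfst (vpair x y) = x"
  and vsnd_vpair [simp]: "vsnd (vpair x y) = y"
  and vpair_vfst_vsnd [simp]: "vpair (vfst z) (vsnd z) = z"
  by (auto simp: vfst_def vsnd_def vpair_def fun_eq_iff split: sum.splits)

lemma vpair_simps [simp]: "vpair x y (Inl i) = x i" "vpair x y (Inr j) = y j"
  by (auto simp: vpair_def)

lemma vpair_eq_iff: "z = w \<longleftrightarrow> vfst z = vfst w \<and> vsnd z = vsnd w"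
  by (metis vpair_vfst_vsnd)

lemma vpair_support: "{i. vpair \<eta> \<theta> i \<noteq> (0::real)} = {i. \<eta> i \<noteq> 0} <+> {j. \<theta> j \<noteq> 0}"
proof (rule set_eqI)
  fix i show "i \<in> {i. vpair \<eta> \<theta> i \<noteq> 0} \<longleftrightarrow> i \<in> {i. \<eta> i \<noteq> 0} <+> {j. \<theta> j \<noteq> 0}"
    by (cases i) auto
qed

text \<open>Sums over infinite sets are 0 by convention; both supports have to be finite for the sum
  over the disjoint union to split.\<close>

lemma ip_vpair:
  assumes "finite {i. \<eta> i \<noteq> 0}" "finite {j. \<theta> j \<noteq> 0}"
  shows "ip (vpair \<eta> \<theta>) x y = ip \<eta> (vfst x) (vfst y) + ip \<theta> (vsnd x) (vsnd y)"
  unfolding ip_def vpair_support using assms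
  by (simp add: sum.Plus vfst_def vsnd_def comp_def)

lemma vfst_linear [simp]: "vfst (\<lambda>i. x i + y i) = (\<lambda>i. vfst x i + vfst y i)"
    "vfst (\<lambda>i. x i - y i) = (\<lambda>i. vfst x i - vfst y i)"
    "vfst (\<lambda>i. c * x i) = (\<lambda>i. c * vfst x i)" "vfst (\<lambda>i. 0) = (\<lambda>i. 0)"
  and vsnd_linear [simp]: "vsnd (\<lambda>i. x i + y i) = (\<lambda>i. vsnd x i + vsnd y i)"
    "vsnd (\<lambda>i. x i - y i) = (\<lambda>i. vsnd x i - vsnd y i)"
    "vsnd (\<lambda>i. c * x i) = (\<lambda>i. c * vsnd x i)" "vsnd (\<lambda>i. 0) = (\<lambda>i. 0)"
  by (simp_all add: vfst_def vsnd_def)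

lemma vfst_sum: "vfst (\<lambda>i. \<Sum>a\<in>A. w a * x a i) = (\<lambda>i. \<Sum>a\<in>A. w a * vfst (x a) i)"
  and vsnd_sum: "vsnd (\<lambda>i. \<Sum>a\<in>A. w a * x a i) = (\<lambda>i. \<Sum>a\<in>A. w a * vsnd (x a) i)"
  by (simp_all add: vfst_def vsnd_def)

subsection \<open>Space forms\<close>

definition amb_dim :: "real \<Rightarrow> nat \<Rightarrow> nat" where
  "amb_dim k n = (if k = 0 then n else Suc n)"

lemma space_form_form_support: "{i. space_form_form k n i \<noteq> 0} = {..<amb_dim k n}"
  by (auto simp: space_form_form_def amb_dim_def)

lemma space_form_form_eq_0: "space_form_form k n i = 0 \<longleftrightarrow> i \<ge> amb_dim k n"
  by (auto simp: space_form_form_def amb_dim_def)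

lemma finite_space_form_form: "finite {i. space_form_form k n i \<noteq> 0}"
  by (simp add: space_form_form_support)

lemma ip_space_form: "ip (space_form_form k n) x y = (\<Sum>i<amb_dim k n. space_form_form k n i * x i * y i)"
  by (simp add: ip_def space_form_form_support)

lemma ip_space_form_flat: "ip (space_form_form 0 n) x y = (\<Sum>i<n. x i * y i)"
  unfolding ip_space_form by (intro sum.cong) (auto simp: amb_dim_def space_form_form_def)

lemma ip_space_form_nonflat:
  assumes "k \<noteq> 0"
  shows "ip (space_form_form k n) x y = (if k < 0 then -1 else 1) * x 0 * y 0 + (\<Sum>i<n. x (Suc i) * y (Suc i))"
proof -
  have "ip (space_form_form k n) x y = (\<Sum>i<Suc n. space_form_form k n i * x i * y i)"
    using assms by (simp add: ip_space_form amb_dim_def)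
  also have "\<dots> = space_form_form k n 0 * x 0 * y 0 + (\<Sum>i<n. space_form_form k n (Suc i) * x (Suc i) * y (Suc i))"
    by (rule sum.lessThan_Suc_shift)
  also have "(\<Sum>i<n. space_form_form k n (Suc i) * x (Suc i) * y (Suc i)) = (\<Sum>i<n. x (Suc i) * y (Suc i))"
    using assms by (intro sum.cong) (auto simp: space_form_form_def)
  also have "space_form_form k n 0 = (if k < 0 then -1 else 1)"
    using assms by (simp add: space_form_form_def)
  finally show ?thesis .
qed

lemma pts_space_form:
  "x \<in> pts (space_form k n) \<longleftrightarrow> (\<forall>i\<ge>amb_dim k n. x i = 0) \<and>
     (k \<noteq> 0 \<longrightarrow> ip (space_form_form k n) x x = 1 / k \<and> (k < 0 \<longrightarrow> x 0 > 0))"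
  by (auto simp: space_form_def amb_dim_def)

lemma form_space_form [simp]: "form (space_form k n) = space_form_form k n"
  and sdim_space_form [simp]: "sdim (space_form k n) = n"
  by (simp_all add: space_form_def)

text \<open>The orthogonal complement of a timelike vector is spacelike: Cauchy-Schwarz for the
  space parts of \<open>v\<close> and \<open>p\<close>, with the time part of \<open>p\<close>
  exceeding its space part by \<open>c\<close>. In the case of equality, \<open>c > 0\<close> forces
  the space part of \<open>v\<close> to vanish.\<close>

lemma lorentz_orthogonal_pos:
  fixes p v :: "nat \<Rightarrow> real"
  assumes c: "c > 0" and p: "p 0 * p 0 = c + (\<Sum>i<n. p (Suc i) * p (Suc i))"
    and orth: "v 0 * p 0 = (\<Sum>i<n. v (Suc i) * p (Suc i))"
  shows "v 0 * v 0 \<le> (\<Sum>i<n. v (Suc i) * v (Suc i))"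
    and "v 0 * v 0 = (\<Sum>i<n. v (Suc i) * v (Suc i)) \<Longrightarrow> v 0 = 0 \<and> (\<forall>i<n. v (Suc i) = 0)"
proof -
  define V where "V = (\<Sum>i<n. v (Suc i) * v (Suc i))"
  define W where "W = (\<Sum>i<n. p (Suc i) * p (Suc i))"
  have V0: "V \<ge> 0" unfolding V_def by (rule sum_nonneg) simp
  have W0: "W \<ge> 0" unfolding W_def by (rule sum_nonneg) simp
  have cs: "(v 0 * p 0)\<^sup>2 \<le> V * W"
    unfolding orth V_def W_def
    using Cauchy_Schwarz_ineq_sum[of "\<lambda>i. v (Suc i)" "\<lambda>i. p (Suc i)" "{..<n}"] by (simp add: power2_eq_square)
  have p0: "p 0 * p 0 = c + W" using p by (simp add: W_def)
  have "(v 0 * v 0) * (p 0 * p 0) \<le> V * W" using cs by (simp add: power2_eq_square mult_ac)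
  then have "(v 0 * v 0) * (c + W) \<le> V * W" unfolding p0 .
  then have key: "(V - v 0 * v 0) * (c + W) \<ge> c * V" by (simp add: algebra_simps)
  show "v 0 * v 0 \<le> V"
  proof (rule ccontr)
    assume "\<not> v 0 * v 0 \<le> V"
    then have "(V - v 0 * v 0) * (c + W) < 0" using c W0 by (intro mult_neg_pos) auto
    moreover have "c * V \<ge> 0" using c V0 by simp
    ultimately show False using key by linarith
  qed
  show "v 0 = 0 \<and> (\<forall>i<n. v (Suc i) = 0)" if "v 0 * v 0 = V"
  proof -
    have "c * V \<le> 0" using key that by simp
    then have "V = 0" using c V0 by (simp add: mult_le_0_iff)
    then have "\<forall>i\<in>{..<n}. v (Suc i) * v (Suc i) = 0"
      unfolding V_def by (subst (asm) sum_nonneg_eq_0_iff) auto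
    with \<open>V = 0\<close> that show ?thesis by auto
  qed
qed

text \<open>By Cauchy-Schwarz the space part of the product is strictly smaller in modulus than
  \<open>q 0 * p 0\<close>, so the sign of the product is opposite to that of
  \<open>q 0 * p 0\<close>. This tests the sheet of the hyperboloid without reference to the
  coordinate 0, as is needed after a change of frame.\<close>

lemma same_sheet_iff:
  assumes k: "k < 0" and p: "p \<in> pts (space_form k n)"
    and q: "ip (space_form_form k n) q q = 1 / k"
  shows "q 0 > 0 \<longleftrightarrow> ip (space_form_form k n) q p < 0"
proof -
  define V where "V = (\<Sum>i<n. q (Suc i) * q (Suc i))"
  define W where "W = (\<Sum>i<n. p (Suc i) * p (Suc i))"
  define Z where "Z = (\<Sum>i<n. q (Suc i) * p (Suc i))"
  define c where "c = - 1 / k"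
  have c: "c > 0" using k by (simp add: c_def)
  have V0: "V \<ge> 0" unfolding V_def by (rule sum_nonneg) simp
  have W0: "W \<ge> 0" unfolding W_def by (rule sum_nonneg) simp
  have p0: "p 0 * p 0 = c + W" "p 0 > 0"
    using p k by (auto simp: pts_space_form ip_space_form_nonflat W_def c_def)
  have q0: "q 0 * q 0 = c + V" using q k by (auto simp: ip_space_form_nonflat V_def c_def)
  have "Z\<^sup>2 \<le> V * W"
    unfolding Z_def V_def W_def
    using Cauchy_Schwarz_ineq_sum[of "\<lambda>i. q (Suc i)" "\<lambda>i. p (Suc i)" "{..<n}"] by (simp add: power2_eq_square)
  also have "V * W < (c + V) * (c + W)"
  proof -
    have "c * c > 0" "c * V \<ge> 0" "c * W \<ge> 0" using c V0 W0 by auto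
    then show ?thesis by (simp add: algebra_simps)
  qed
  also have "\<dots> = (q 0 * p 0)\<^sup>2" using p0 q0 by (simp add: power2_eq_square algebra_simps)
  finally have "\<bar>Z\<bar> < \<bar>q 0 * p 0\<bar>" using abs_le_square_iff[of "q 0 * p 0" Z] by linarith
  moreover have "ip (space_form_form k n) q p = - (q 0 * p 0) + Z"
    using k by (simp add: ip_space_form_nonflat Z_def)
  moreover have "q 0 * p 0 > 0 \<longleftrightarrow> q 0 > 0" using p0(2) by (simp add: zero_less_mult_iff)
  ultimately show ?thesis by (smt (verit))
qed

subsection \<open>Tangent spaces\<close>

text \<open>One inclusion differentiates the defining equation along a curve. For the other, the
  line \<open>p + t * v\<close> is pushed back to the quadric by rescaling.\<close>

lemma tangent_space_space_form:
  assumes p: "p \<in> pts (space_form k n)"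
  shows "tangent_space (space_form k n) p =
    {v. (\<forall>i\<ge>amb_dim k n. v i = 0) \<and> (k \<noteq> 0 \<longrightarrow> ip (space_form_form k n) v p = 0)}" (is "_ = ?T")
proof (intro subset_antisym subsetI)
  fix v assume "v \<in> tangent_space (space_form k n) p"
  then obtain c e where ce: "e > 0" "c 0 = p" "\<And>t::real. \<bar>t\<bar> < e \<Longrightarrow> c t \<in> pts (space_form k n)"
    "\<And>i. ((\<lambda>t. c t i) has_real_derivative v i) (at 0)" by (auto simp: tangent_space_def)
  have ev: "eventually (\<lambda>t. \<bar>t\<bar> < e) (nhds (0::real))"
    using ce(1) by (auto simp: eventually_nhds_metric dist_real_def)
  have "v i = 0" if "i \<ge> amb_dim k n" for i
  proof -
    have "eventually (\<lambda>t. c t i = 0) (nhds 0)"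
      using ev by eventually_elim (use ce(3) that in \<open>auto simp: pts_space_form\<close>)
    then have "((\<lambda>t. c t i) has_real_derivative 0) (at 0)"
      by (subst DERIV_cong_ev[OF refl _ refl]) auto
    then show ?thesis using ce(4) DERIV_unique by blast
  qed
  moreover have "ip (space_form_form k n) v p = 0" if "k \<noteq> 0"
  proof -
    have "((\<lambda>t. ip (space_form_form k n) (c t) (c t)) has_real_derivative
       (\<Sum>i<amb_dim k n. space_form_form k n i * v i * c 0 i + space_form_form k n i * c 0 i * v i)) (at 0)"
      unfolding ip_space_form
      by (rule DERIV_sum) (rule derivative_eq_intros ce(4) refl | simp add: algebra_simps)+
    moreover have "eventually (\<lambda>t. ip (space_form_form k n) (c t) (c t) = 1 / k) (nhds 0)"
      using ev by eventually_elim (use ce(3) that in \<open>auto simp: pts_space_form\<close>)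
    then have "((\<lambda>t. ip (space_form_form k n) (c t) (c t)) has_real_derivative 0) (at 0)"
      by (subst DERIV_cong_ev[OF refl _ refl]) auto
    ultimately have "(\<Sum>i<amb_dim k n. space_form_form k n i * v i * c 0 i + space_form_form k n i * c 0 i * v i) = 0"
      using DERIV_unique by blast
    then have "ip (space_form_form k n) v p + ip (space_form_form k n) p v = 0"
      by (simp only: ip_space_form ce(2) sum.distrib)
    then show ?thesis by (simp add: ip_comm[of _ p v])
  qed
  ultimately show "v \<in> ?T" by simp
next
  fix v assume v: "v \<in> ?T"
  show "v \<in> tangent_space (space_form k n) p"
  proof (cases "k = 0")
    case True
    have "((\<lambda>t. p i + t * v i) has_real_derivative v i) (at 0)" for i
      by (auto intro!: derivative_eq_intros)
    then show ?thesis unfolding tangent_space_def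
      using True v p by (intro CollectI exI[of _ "\<lambda>t i. p i + t * v i"] exI[of _ 1]) (auto simp: pts_space_form)
  next
    case False
    define q where "q = ip (space_form_form k n) v v"
    \<comment> \<open>\<open>k\<close> times the square of \<open>p + t * v\<close>. Division by its
      root restores the value \<open>1 / k\<close> and does not change the derivative at 0, since
      \<open>N\<close> has none of first order there.\<close>
    define N where "N t = 1 + k * t\<^sup>2 * q" for t
    have "\<forall>\<^sub>F t in nhds 0. N t \<in> {0<..}"
      by (rule topological_tendstoD[of _ _ _ "{0<..}", OF _ open_greaterThan])
        (auto simp: N_def intro!: tendsto_eq_intros filterlim_ident)
    moreover have "\<forall>\<^sub>F t in nhds 0. k < 0 \<longrightarrow> p 0 + t * v 0 > 0"
    proof (cases "k < 0")
      case True
      then have p0: "p 0 > 0" using p by (simp add: pts_space_form)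
      have "\<forall>\<^sub>F t in nhds 0. p 0 + t * v 0 \<in> {0<..}"
        by (rule topological_tendstoD[of _ "p 0", OF _ open_greaterThan])
          (use p0 in \<open>auto intro!: tendsto_eq_intros filterlim_ident\<close>)
      then show ?thesis by (auto elim: eventually_mono)
    qed simp
    ultimately have "\<forall>\<^sub>F t in nhds 0. N t > 0 \<and> (k < 0 \<longrightarrow> p 0 + t * v 0 > 0)"
      by eventually_elim auto
    then obtain e where e: "e > 0" "\<And>t. \<bar>t\<bar> < e \<Longrightarrow> N t > 0 \<and> (k < 0 \<longrightarrow> p 0 + t * v 0 > 0)"
      by (auto simp: eventually_nhds_metric dist_real_def)
    define c where "c t = (\<lambda>i. (1 / sqrt (N t)) * (p i + t * v i))" for t
    have "c t \<in> pts (space_form k n)" if "\<bar>t\<bar> < e" for t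
    proof -
      have N: "N t > 0" using e(2)[OF that] by simp
      have "ip (space_form_form k n) (c t) (c t) = (1 / sqrt (N t)) * ((1 / sqrt (N t)) *
         ip (space_form_form k n) (\<lambda>i. p i + t * v i) (\<lambda>i. p i + t * v i))"
        unfolding c_def ip_scale_left ip_scale_right by simp
      also have "ip (space_form_form k n) (\<lambda>i. p i + t * v i) (\<lambda>i. p i + t * v i) = 1 / k + t\<^sup>2 * q"
        using p v False by (simp add: ip_linear pts_space_form ip_comm[of _ p v] q_def power2_eq_square)
      also have "(1 / sqrt (N t)) * ((1 / sqrt (N t)) * (1 / k + t\<^sup>2 * q)) = 1 / k"
      proof -
        have "1 / k + t\<^sup>2 * q = N t / k" using False by (simp add: N_def field_simps)
        moreover have "sqrt (N t) * sqrt (N t) = N t" using N by simp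
        ultimately show ?thesis using N by (simp add: field_simps)
      qed
      finally show ?thesis using p v N e(2)[OF that] False
        by (auto simp: pts_space_form c_def)
    qed
    moreover have "c 0 = p" by (simp add: c_def N_def)
    moreover have "((\<lambda>t. c t i) has_real_derivative v i) (at 0)" for i
      unfolding c_def N_def by (auto intro!: derivative_eq_intros)
    ultimately show ?thesis unfolding tangent_space_def using e(1) by blast
  qed
qed

text \<open>An interface that gathers what is used of an ambient submanifold: finite signature,
  positive definite tangent spaces of dimension at most \<open>sdim S\<close>, and an explicit
  orthogonal projection \<open>P\<close>. Space forms satisfy it and products inherit it, so both
  are treated alike afterwards.\<close>

definition tangent_projection :: "'i submfd \<Rightarrow> (('i \<Rightarrow> real) \<Rightarrow> ('i \<Rightarrow> real) \<Rightarrow> 'i \<Rightarrow> real) \<Rightarrow> bool" where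
  "tangent_projection S P \<longleftrightarrow> finite {i. form S i \<noteq> 0} \<and>
     (\<forall>p\<in>pts S. (\<forall>i. form S i = 0 \<longrightarrow> p i = 0) \<and>
        subsp (tangent_space S p) \<and> posdef_on (form S) (tangent_space S p) \<and>
        (\<exists>I. determined_by (tangent_space S p) I \<and> card I = sdim S) \<and>
        (\<forall>x. P p x \<in> tangent_space S p \<and>
           (\<forall>v\<in>tangent_space S p. ip (form S) (\<lambda>i. x i - P p x i) v = 0)))"

text \<open>The position vector \<open>p\<close> is normal with square \<open>1 / k\<close>, so the
  normal component of \<open>x\<close> is \<open>k * ip x p\<close> times \<open>p\<close>. For
  \<open>k = 0\<close> only the cut-off to the ambient coordinates is left.\<close>

definition sf_proj :: "real \<Rightarrow> nat \<Rightarrow> (nat \<Rightarrow> real) \<Rightarrow> (nat \<Rightarrow> real) \<Rightarrow> nat \<Rightarrow> real" where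
  "sf_proj k n p x = (\<lambda>i. if i < amb_dim k n then x i - k * ip (space_form_form k n) x p * p i else 0)"

lemma ip_sf_proj:
  "ip (space_form_form k n) (sf_proj k n p x) y =
     ip (space_form_form k n) x y - k * ip (space_form_form k n) x p * ip (space_form_form k n) p y"
proof -
  have "ip (space_form_form k n) (sf_proj k n p x) y
      = ip (space_form_form k n) (\<lambda>i. x i - (k * ip (space_form_form k n) x p) * p i) y"
    by (rule ip_cong) (auto simp: sf_proj_def space_form_form_eq_0)
  then show ?thesis unfolding ip_diff_left ip_scale_left by simp
qed

text \<open>For \<open>k < 0\<close> the point \<open>p\<close> is timelike and its orthogonal
  complement spacelike; otherwise the ambient form is already positive definite.\<close>

lemma posdef_tangent_space_form:
  assumes p: "p \<in> pts (space_form k n)" and v: "\<forall>i\<ge>amb_dim k n. v i = 0"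
    and orth: "k \<noteq> 0 \<Longrightarrow> ip (space_form_form k n) v p = 0" and nz: "v \<noteq> (\<lambda>i. 0)"
  shows "ip (space_form_form k n) v v > 0"
proof (cases "k < 0")
  case True
  have c: "- 1 / k > 0" using True by (simp add: divide_pos_neg)
  have "ip (space_form_form k n) p p = 1 / k" using p True by (simp add: pts_space_form)
  then have p2: "p 0 * p 0 = - 1 / k + (\<Sum>i<n. p (Suc i) * p (Suc i))"
    using True by (simp add: ip_space_form_nonflat)
  have "ip (space_form_form k n) v p = 0" using orth True by simp
  then have o2: "v 0 * p 0 = (\<Sum>i<n. v (Suc i) * p (Suc i))"
    using True by (simp add: ip_space_form_nonflat)
  note eq = lorentz_orthogonal_pos(2)[OF c p2 o2]
  have "v 0 * v 0 \<le> (\<Sum>i<n. v (Suc i) * v (Suc i))" by (rule lorentz_orthogonal_pos(1)[OF c p2 o2])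
  moreover have "v 0 * v 0 \<noteq> (\<Sum>i<n. v (Suc i) * v (Suc i))"
  proof
    assume "v 0 * v 0 = (\<Sum>i<n. v (Suc i) * v (Suc i))"
    from eq[OF this] have "v i = 0" for i using v True by (cases i) (auto simp: amb_dim_def not_less[symmetric])
    with nz show False by auto
  qed
  ultimately show ?thesis using True by (simp add: ip_space_form_nonflat)
next
  case False
  have e: "ip (space_form_form k n) v v = (\<Sum>i<amb_dim k n. v i * v i)"
    unfolding ip_space_form using False by (intro sum.cong) (auto simp: space_form_form_def amb_dim_def split: if_splits)
  obtain i where i: "v i \<noteq> 0" using nz by auto
  then have "i < amb_dim k n" using v not_le by blast
  moreover have "0 < v i * v i" using i not_real_square_gt_zero by blast
  ultimately show ?thesis unfolding e by (intro sum_pos2[of _ i]) auto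
qed

lemma tangent_projection_space_form: "tangent_projection (space_form k n) (sf_proj k n)"
  unfolding tangent_projection_def form_space_form sdim_space_form
proof (intro conjI ballI finite_space_form_form)
  fix p assume p: "p \<in> pts (space_form k n)"
  note T = tangent_space_space_form[OF p]
  show "\<forall>i. space_form_form k n i = 0 \<longrightarrow> p i = 0"
    using p by (simp add: pts_space_form space_form_form_eq_0)
  show "subsp (tangent_space (space_form k n) p)"
    unfolding T subsp_def by (auto simp: ip_linear)
  show "posdef_on (space_form_form k n) (tangent_space (space_form k n) p)"
    unfolding T posdef_on_def using posdef_tangent_space_form[OF p] by blast
  show "\<exists>I. determined_by (tangent_space (space_form k n) p) I \<and> card I = n"
  proof (cases "k = 0")
    case True
    have "v = (\<lambda>i. 0)" if "\<forall>i\<ge>n. v i = 0" "\<forall>i\<in>{..<n}. v i = 0" for v :: "nat \<Rightarrow> real"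
      using that by (metis ext lessThan_iff linorder_not_less)
    then show ?thesis unfolding T determined_by_def using True
      by (intro exI[of _ "{..<n}"]) (auto simp: amb_dim_def)
  next
    case False
    \<comment> \<open>A tangent vector is determined by its \<open>n\<close> coordinates other than
      \<open>i0\<close>: orthogonality to \<open>p\<close> yields the missing one, since
      \<open>p i0\<close> is nonzero.\<close>
    obtain i0 where i0: "i0 \<le> n" "p i0 \<noteq> 0"
    proof (rule ccontr)
      assume "\<not> thesis"
      then have "\<forall>i\<le>n. p i = 0" using that by blast
      then have "ip (space_form_form k n) p p = 0"
        by (auto simp: ip_space_form amb_dim_def less_Suc_eq_le intro!: sum.neutral)
      then show False using p False by (simp add: pts_space_form)
    qed
    have "v = (\<lambda>i. 0)" if v: "\<forall>i\<ge>Suc n. v i = 0" "ip (space_form_form k n) v p = 0" "\<forall>i\<in>{..n} - {i0}. v i = 0" for v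
    proof -
      have "ip (space_form_form k n) v p = (\<Sum>i\<in>{..<Suc n}. space_form_form k n i * v i * p i)"
        using False by (simp add: ip_space_form amb_dim_def)
      also have "\<dots> = (\<Sum>i\<in>{i0}. space_form_form k n i * v i * p i)"
        by (rule sum.mono_neutral_right) (use i0 v(3) in auto)
      finally have "v i0 = 0" using v(2) i0 False
        by (auto simp: space_form_form_eq_0 amb_dim_def)
      have "v i = 0" for i
        using v \<open>v i0 = 0\<close> by (cases "i \<le> n"; cases "i = i0") (auto simp: not_le Suc_le_eq)
      then show ?thesis by auto
    qed
    then show ?thesis unfolding T determined_by_def using False i0
      by (intro exI[of _ "{..n} - {i0}"]) (auto simp: amb_dim_def)
  qed
  show "\<forall>x. sf_proj k n p x \<in> tangent_space (space_form k n) p \<and>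
     (\<forall>v\<in>tangent_space (space_form k n) p. ip (space_form_form k n) (\<lambda>i. x i - sf_proj k n p x i) v = 0)"
  proof (intro allI conjI ballI)
    fix x
    have pp: "k * ip (space_form_form k n) p p = 1" if "k \<noteq> 0" using p that by (simp add: pts_space_form)
    have "ip (space_form_form k n) (sf_proj k n p x) p = 0" if "k \<noteq> 0"
    proof -
      have "ip (space_form_form k n) (sf_proj k n p x) p
        = ip (space_form_form k n) x p - ip (space_form_form k n) x p * (k * ip (space_form_form k n) p p)"
        unfolding ip_sf_proj by simp
      then show ?thesis unfolding pp[OF that] by simp
    qed
    then show "sf_proj k n p x \<in> tangent_space (space_form k n) p"
      unfolding T by (auto simp: sf_proj_def)
    fix v assume "v \<in> tangent_space (space_form k n) p"
    then show "ip (space_form_form k n) (\<lambda>i. x i - sf_proj k n p x i) v = 0"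
      unfolding T by (auto simp: ip_diff_left ip_sf_proj ip_comm[of _ p v])
  qed
qed

lemma pts_prod: "z \<in> pts (prod_submfd S T) \<longleftrightarrow> vfst z \<in> pts S \<and> vsnd z \<in> pts T"
  by (simp add: prod_submfd_def) (metis vfst_vpair vsnd_vpair vpair_vfst_vsnd)

lemma form_prod [simp]: "form (prod_submfd S T) = vpair (form S) (form T)"
  and sdim_prod [simp]: "sdim (prod_submfd S T) = sdim S + sdim T"
  by (simp_all add: prod_submfd_def)

lemma tangent_space_prod:
  "v \<in> tangent_space (prod_submfd S T) z \<longleftrightarrow>
     vfst v \<in> tangent_space S (vfst z) \<and> vsnd v \<in> tangent_space T (vsnd z)"
proof
  assume "v \<in> tangent_space (prod_submfd S T) z"
  then obtain c e where ce: "e > 0" "c 0 = z" "\<And>t::real. \<bar>t\<bar> < e \<Longrightarrow> c t \<in> pts (prod_submfd S T)"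
    "\<And>i. ((\<lambda>t. c t i) has_real_derivative v i) (at 0)" by (auto simp: tangent_space_def)
  have "((\<lambda>t. vfst (c t) i) has_real_derivative vfst v i) (at 0)" for i
    using ce(4)[of "Inl i"] by (simp add: vfst_def)
  moreover have "((\<lambda>t. vsnd (c t) i) has_real_derivative vsnd v i) (at 0)" for i
    using ce(4)[of "Inr i"] by (simp add: vsnd_def)
  ultimately show "vfst v \<in> tangent_space S (vfst z) \<and> vsnd v \<in> tangent_space T (vsnd z)"
    unfolding tangent_space_def using ce(1-3)
    by (intro conjI CollectI exI[of _ "\<lambda>t. vfst (c t)"] exI[of _ "\<lambda>t. vsnd (c t)"] exI[of _ e]) (auto simp: pts_prod)
next
  assume "vfst v \<in> tangent_space S (vfst z) \<and> vsnd v \<in> tangent_space T (vsnd z)"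
  then obtain c e d e' where ce: "e > 0" "c 0 = vfst z" "\<And>t::real. \<bar>t\<bar> < e \<Longrightarrow> c t \<in> pts S"
    "\<And>i. ((\<lambda>t. c t i) has_real_derivative vfst v i) (at 0)"
    and de: "e' > 0" "d 0 = vsnd z" "\<And>t::real. \<bar>t\<bar> < e' \<Longrightarrow> d t \<in> pts T"
    "\<And>i. ((\<lambda>t. d t i) has_real_derivative vsnd v i) (at 0)"
    by (auto simp: tangent_space_def)
  have "((\<lambda>t. vpair (c t) (d t) i) has_real_derivative v i) (at 0)" for i
    using ce(4) de(4) by (cases i) (auto simp: vfst_def vsnd_def)
  then show "v \<in> tangent_space (prod_submfd S T) z"
    unfolding tangent_space_def using ce(1-3) de(1-3)
    by (intro CollectI exI[of _ "\<lambda>t. vpair (c t) (d t)"] exI[of _ "min e e'"]) (auto simp: pts_prod)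
qed

definition prod_proj where
  "prod_proj P Q z x = vpair (P (vfst z) (vfst x)) (Q (vsnd z) (vsnd x))"

lemma tangent_projection_prod:
  assumes S: "tangent_projection S P" and T: "tangent_projection T Q"
  shows "tangent_projection (prod_submfd S T) (prod_proj P Q)"
proof -
  have fin: "finite {i. form S i \<noteq> 0}" "finite {i. form T i \<noteq> 0}"
    using S T by (auto simp: tangent_projection_def)
  note ipv = ip_vpair[OF fin]
  show ?thesis
    unfolding tangent_projection_def form_prod sdim_prod
  proof (intro conjI ballI)
    show "finite {i. vpair (form S) (form T) i \<noteq> 0}" using fin by (simp add: vpair_support)
    fix z assume "z \<in> pts (prod_submfd S T)"
    then have z: "vfst z \<in> pts S" "vsnd z \<in> pts T" by (auto simp: pts_prod)
    note Sz = S[unfolded tangent_projection_def, THEN conjunct2, rule_format, OF z(1)]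
    note Tz = T[unfolded tangent_projection_def, THEN conjunct2, rule_format, OF z(2)]
    show "\<forall>i. vpair (form S) (form T) i = 0 \<longrightarrow> z i = 0"
    proof
      fix i show "vpair (form S) (form T) i = 0 \<longrightarrow> z i = 0"
        using Sz Tz by (cases i) (auto simp: vfst_def vsnd_def)
    qed
    have sub: "subsp (tangent_space S (vfst z))" "subsp (tangent_space T (vsnd z))" using Sz Tz by auto
    show "subsp (tangent_space (prod_submfd S T) z)"
      using sub by (simp add: subsp_def tangent_space_prod)
    show "posdef_on (vpair (form S) (form T)) (tangent_space (prod_submfd S T) z)"
      unfolding posdef_on_def
    proof (intro ballI impI)
      fix v assume v: "v \<in> tangent_space (prod_submfd S T) z" "v \<noteq> (\<lambda>i. 0)"
      then have v1: "vfst v \<in> tangent_space S (vfst z)" and v2: "vsnd v \<in> tangent_space T (vsnd z)"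
        by (auto simp: tangent_space_prod)
      have pd: "posdef_on (form S) (tangent_space S (vfst z))" "posdef_on (form T) (tangent_space T (vsnd z))"
        using Sz Tz by auto
      have "vfst v \<noteq> (\<lambda>i. 0) \<or> vsnd v \<noteq> (\<lambda>i. 0)"
        using v(2) vpair_eq_iff[of v "\<lambda>i. 0"] by auto
      then show "ip (vpair (form S) (form T)) v v > 0"
      proof
        assume "vfst v \<noteq> (\<lambda>i. 0)"
        then show ?thesis unfolding ipv using pd(1) v1 posdef_on_nonneg[OF pd(2) v2]
          by (auto simp: posdef_on_def intro: add_pos_nonneg)
      next
        assume "vsnd v \<noteq> (\<lambda>i. 0)"
        then show ?thesis unfolding ipv using pd(2) v2 posdef_on_nonneg[OF pd(1) v1]
          by (auto simp: posdef_on_def intro: add_nonneg_pos)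
      qed
    qed
    obtain I J where I: "determined_by (tangent_space S (vfst z)) I" "card I = sdim S"
      and J: "determined_by (tangent_space T (vsnd z)) J" "card J = sdim T" using Sz Tz by auto
    have "v = (\<lambda>i. 0)" if "v \<in> tangent_space (prod_submfd S T) z" "\<forall>i\<in>I <+> J. v i = 0" for v
    proof -
      have "vfst v = (\<lambda>i. 0)" "vsnd v = (\<lambda>i. 0)"
        using that I(1) J(1) by (auto simp: determined_by_def tangent_space_prod vfst_def vsnd_def)
      then show ?thesis using vpair_eq_iff[of v "\<lambda>i. 0"] by auto
    qed
    then show "\<exists>I. determined_by (tangent_space (prod_submfd S T) z) I \<and> card I = sdim S + sdim T"
      using I J by (intro exI[of _ "I <+> J"]) (auto simp: determined_by_def card_Plus)
    show "\<forall>x. prod_proj P Q z x \<in> tangent_space (prod_submfd S T) z \<and>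
       (\<forall>v\<in>tangent_space (prod_submfd S T) z. ip (vpair (form S) (form T)) (\<lambda>i. x i - prod_proj P Q z x i) v = 0)"
    proof (intro allI conjI ballI)
      fix x
      show "prod_proj P Q z x \<in> tangent_space (prod_submfd S T) z"
        using Sz Tz by (auto simp: tangent_space_prod prod_proj_def)
      fix v assume "v \<in> tangent_space (prod_submfd S T) z"
      then have "vfst v \<in> tangent_space S (vfst z)" "vsnd v \<in> tangent_space T (vsnd z)"
        by (auto simp: tangent_space_prod)
      then have "ip (form S) (\<lambda>i. vfst x i - P (vfst z) (vfst x) i) (vfst v) = 0"
        "ip (form T) (\<lambda>i. vsnd x i - Q (vsnd z) (vsnd x) i) (vsnd v) = 0"
        using Sz Tz by auto
      moreover have "vfst (\<lambda>i. x i - prod_proj P Q z x i) = (\<lambda>i. vfst x i - P (vfst z) (vfst x) i)"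
        "vsnd (\<lambda>i. x i - prod_proj P Q z x i) = (\<lambda>i. vsnd x i - Q (vsnd z) (vsnd x) i)"
        by (simp_all add: prod_proj_def)
      ultimately show "ip (vpair (form S) (form T)) (\<lambda>i. x i - prod_proj P Q z x i) v = 0"
        unfolding ipv by simp
    qed
  qed
qed

subsection \<open>Second fundamental forms\<close>

lemma smooth_vec_has_pderiv:
  assumes "smooth_vec m U F" "u \<in> U" "a < m"
  shows "has_pderiv a (\<lambda>x. F x i) u (vpderiv a F u i)"
  using assms smooth_real_has_pderiv unfolding smooth_vec_def vpderiv_def by blast

lemma smooth_vec_vpderiv:
  assumes "smooth_vec m U F" "a < m" shows "smooth_vec m U (vpderiv a F)"
  unfolding smooth_vec_def vpderiv_def
proof
  fix i
  have "smooth_real m U (pderiv_at a (\<lambda>x. F x i))"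
    by (rule smooth_real_pderiv) (use assms in \<open>auto simp: smooth_vec_def\<close>)
  then show "smooth_real m U (\<lambda>u. pderiv_at a (\<lambda>x. F x i) u)" by simp
qed

lemma vpderiv_tangent:
  assumes U: "openin (Euclidean_space m) U" "u \<in> U" "a < m" and F: "smooth_vec m U F"
    and S: "\<And>v. v \<in> U \<Longrightarrow> F v \<in> pts S"
  shows "vpderiv a F u \<in> tangent_space S (F u)"
proof -
  obtain e where e: "e > 0" "\<And>t. dist t (u a) < e \<Longrightarrow> u(a := t) \<in> U"
    using line_in_open[OF U] by (auto simp: eventually_nhds_metric)
  have "((\<lambda>t. F (u(a := u a + t)) i) has_real_derivative vpderiv a F u i) (at 0)" for i
  proof -
    have "((\<lambda>t. F (u(a := t)) i) has_real_derivative vpderiv a F u i) (at (u a + 0))"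
      using smooth_vec_has_pderiv[OF F U(2,3)] by (simp add: has_pderiv_def)
    then have "((\<lambda>t. F (u(a := u a + t)) i) has_real_derivative vpderiv a F u i * (0 + 1)) (at 0)"
      by (rule DERIV_chain2) (auto intro!: derivative_eq_intros)
    then show ?thesis by simp
  qed
  moreover have "F (u(a := u a + t)) \<in> pts S" if "\<bar>t\<bar> < e" for t
    using that by (intro S e(2)) (simp add: dist_real_def)
  ultimately show ?thesis unfolding tangent_space_def using e(1)
    by (intro CollectI exI[of _ "\<lambda>t. F (u(a := u a + t))"] exI[of _ e]) auto
qed

lemma subsp_span: "subsp {(\<lambda>i. \<Sum>a<m. w a * x a i) | w. True}"
proof -
  have "\<exists>w. (\<lambda>i. 0) = (\<lambda>i. \<Sum>a<m. w a * x a i)" by (rule exI[of _ "\<lambda>_. 0"]) simp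
  moreover have "\<exists>w. (\<lambda>i. (\<Sum>a<m. w1 a * x a i) + (\<Sum>a<m. w2 a * x a i)) = (\<lambda>i. \<Sum>a<m. w a * x a i)" for w1 w2
    by (rule exI[of _ "\<lambda>a. w1 a + w2 a"]) (simp add: sum.distrib algebra_simps)
  moreover have "\<exists>w. (\<lambda>i. c * (\<Sum>a<m. w1 a * x a i)) = (\<lambda>i. \<Sum>a<m. w a * x a i)" for w1 c
    by (rule exI[of _ "\<lambda>a. c * w1 a"]) (simp add: sum_distrib_left algebra_simps)
  ultimately show ?thesis unfolding subsp_def by auto
qed

lemma subsp_diff_image: "subsp (diff_image M f c u)"
  unfolding diff_image_def by (rule subsp_span)

lemma span_member:
  fixes x :: "nat \<Rightarrow> 'i \<Rightarrow> real"
  assumes "a < m" shows "x a \<in> {(\<lambda>i. \<Sum>a<m. w a * x a i) | w. True}"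
proof -
  have "x a = (\<lambda>i. \<Sum>b<m. (if b = a then 1 else 0) * x b i)"
    using assms by (simp add: if_distrib[of "\<lambda>c. c * _"] cong: if_cong)
  then show ?thesis by (intro CollectI exI[of _ "\<lambda>b. if b = a then 1 else 0"] conjI TrueI)
qed

lemma normal_space_subsp:
  assumes "subsp (tangent_space S (f (snd c u)))"
  shows "subsp (normal_space M S f c u)"
  using assms unfolding subsp_def normal_space_def by (auto simp: ip_linear)

lemma cov_deriv_eq:
  assumes "tangent_projection S P" "f (snd c u) \<in> pts S"
  shows "cov_deriv S f c u a b = P (f (snd c u)) (vpderiv a (vpderiv b (f \<circ> snd c)) u)"
  unfolding cov_deriv_def using assms
  by (intro orth_proj_eqI) (auto simp: tangent_projection_def)

lemma second_fundamental_form_zeroI: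
  assumes P: "tangent_projection S P" and p: "f (snd c u) \<in> pts S"
    and y: "P (f (snd c u)) (vpderiv a (vpderiv b (f \<circ> snd c)) u) \<in> diff_image M f c u"
  shows "second_fundamental_form M S f c u a b = (\<lambda>i. 0)"
  unfolding second_fundamental_form_def cov_deriv_eq[where f = f and c = c and u = u, OF P p]
proof (rule orth_proj_eqI)
  have T: "subsp (tangent_space S (f (snd c u)))" "posdef_on (form S) (tangent_space S (f (snd c u)))"
    using P p by (auto simp: tangent_projection_def)
  show N: "subsp (normal_space M S f c u)" by (rule normal_space_subsp[where f = f, OF T(1)])
  show "posdef_on (form S) (normal_space M S f c u)"
    using T(2) by (auto simp: posdef_on_def normal_space_def)
  show "(\<lambda>i. 0) \<in> normal_space M S f c u" by (rule subsp_0[OF N])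
  fix v assume "v \<in> normal_space M S f c u"
  then show "ip (form S) (\<lambda>i. P (f (snd c u)) (vpderiv a (vpderiv b (f \<circ> snd c)) u) i - 0) v = 0"
    using y by (auto simp: normal_space_def ip_comm[of _ _ v])
qed

text \<open>Weighting equation \<open>b\<close> by \<open>w b\<close> and adding up gives the value
  of the Gram form at \<open>w\<close>, which must then be 0.\<close>

lemma gram_independent:
  fixes x :: "nat \<Rightarrow> 'i \<Rightarrow> real"
  assumes pos: "\<And>w. \<exists>a<m. w a \<noteq> 0 \<Longrightarrow> (\<Sum>a<m. \<Sum>b<m. ip \<eta> (x a) (x b) * w a * w b) > 0"
    and "\<forall>b<m. (\<Sum>a<m. w a * ip \<eta> (x a) (x b)) = 0"
  shows "\<forall>a<m. w a = 0"
proof (rule ccontr)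
  assume "\<not> (\<forall>a<m. w a = 0)"
  then have "0 < (\<Sum>a<m. \<Sum>b<m. ip \<eta> (x a) (x b) * w a * w b)" by (intro pos) auto
  also have "\<dots> = (\<Sum>b<m. w b * (\<Sum>a<m. w a * ip \<eta> (x a) (x b)))"
    by (subst sum.swap) (simp add: sum_distrib_left algebra_simps)
  also have "\<dots> = 0" using assms(2) by simp
  finally show False by simp
qed

text \<open>The covariant derivative \<open>Y\<close> is split by hand: \<open>Z\<close> is its
  projection to the image of the differential, found from the normal equations, whose Gram matrix is
  invertible. The second fundamental form is \<open>Y - Z\<close>, so its vanishing puts
  \<open>Y\<close> into that image.\<close>

lemma second_fundamental_form_zeroD:
  fixes f :: "'a \<Rightarrow> 'i \<Rightarrow> real"
  assumes P: "tangent_projection S P" and p: "f (snd c u) \<in> pts S"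
    and tang: "\<And>a. a < rdim M \<Longrightarrow> vpderiv a (f \<circ> snd c) u \<in> tangent_space S (f (snd c u))"
    and pos: "\<And>w. \<exists>a<rdim M. w a \<noteq> 0 \<Longrightarrow> (\<Sum>a<rdim M. \<Sum>b<rdim M.
       ip (form S) (vpderiv a (f \<circ> snd c) u) (vpderiv b (f \<circ> snd c) u) * w a * w b) > 0"
    and sff: "second_fundamental_form M S f c u a b = (\<lambda>i. 0)"
  shows "P (f (snd c u)) (vpderiv a (vpderiv b (f \<circ> snd c)) u) \<in> diff_image M f c u"
proof -
  define Y where "Y = P (f (snd c u)) (vpderiv a (vpderiv b (f \<circ> snd c)) u)"
  define x where "x a = vpderiv a (f \<circ> snd c) u" for a
  let ?T = "tangent_space S (f (snd c u))"
  have T: "subsp ?T" "posdef_on (form S) ?T" "Y \<in> ?T"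
    using P p by (auto simp: tangent_projection_def Y_def)
  have "\<exists>w. \<forall>e<rdim M. (\<Sum>d<rdim M. ip (form S) (x d) (x e) * w d) = ip (form S) Y (x e)"
  proof (rule square_system_solvable[of _ "\<lambda>e d. ip (form S) (x d) (x e)"])
    fix w assume "\<forall>e<rdim M. (\<Sum>d<rdim M. ip (form S) (x d) (x e) * w d) = 0"
    then have "\<forall>b<rdim M. (\<Sum>a<rdim M. w a * ip (form S) (x a) (x b)) = 0" by (simp add: mult.commute)
    then show "\<forall>d<rdim M. w d = 0"
      by (rule gram_independent[where x = x, rotated]) (use pos in \<open>simp add: x_def\<close>)
  qed
  then obtain w where w: "\<And>e. e < rdim M \<Longrightarrow> (\<Sum>d<rdim M. w d * ip (form S) (x d) (x e)) = ip (form S) Y (x e)"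
    by (auto simp: mult.commute)
  define Z where "Z = (\<lambda>i. \<Sum>d<rdim M. w d * x d i)"
  have Z: "Z \<in> diff_image M f c u" unfolding Z_def x_def diff_image_def by blast
  have ZT: "Z \<in> ?T" unfolding Z_def using tang by (intro subsp_sum T(1)) (simp add: x_def)
  have \<nu>: "(\<lambda>i. Y i - Z i) \<in> normal_space M S f c u"
    unfolding normal_space_def
  proof (intro CollectI conjI ballI)
    show "(\<lambda>i. Y i - Z i) \<in> ?T" by (rule subsp_diff[OF T(1,3) ZT])
    fix v assume "v \<in> diff_image M f c u"
    then obtain w' where v: "v = (\<lambda>i. \<Sum>a<rdim M. w' a * x a i)" by (auto simp: diff_image_def x_def)
    have "ip (form S) (\<lambda>i. Y i - Z i) (x e) = 0" if "e < rdim M" for e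
      using w[OF that] by (simp add: ip_diff_left Z_def ip_sum_left)
    then show "ip (form S) (\<lambda>i. Y i - Z i) v = 0" unfolding v ip_sum_right by simp
  qed
  have "orth_proj (form S) (normal_space M S f c u) Y = (\<lambda>i. Y i - Z i)"
  proof (rule orth_proj_eqI[OF _ _ \<nu>])
    show "subsp (normal_space M S f c u)" by (rule normal_space_subsp[where f = f, OF T(1)])
    show "posdef_on (form S) (normal_space M S f c u)"
      using T(2) by (auto simp: posdef_on_def normal_space_def)
    fix v assume "v \<in> normal_space M S f c u"
    then show "ip (form S) (\<lambda>i. Y i - (Y i - Z i)) v = 0"
      using Z by (auto simp: normal_space_def ip_comm[of _ _ v])
  qed
  then have "(\<lambda>i. Y i - Z i) = (\<lambda>i. 0)"
    using sff unfolding second_fundamental_form_def cov_deriv_eq[where f = f and c = c and u = u, OF P p] Y_def by simp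
  then have "Y = Z" by (auto simp: fun_eq_iff)
  with Z show ?thesis by (simp add: Y_def)
qed

subsection \<open>Totally geodesic affine inclusions\<close>

text \<open>The linear map with the vectors \<open>b j\<close> as columns. The sum extends only over
  the coordinates that \<open>\<eta>\<close> declares present.\<close>

definition frame_lin :: "('j \<Rightarrow> real) \<Rightarrow> ('j \<Rightarrow> 'i \<Rightarrow> real) \<Rightarrow> ('j \<Rightarrow> real) \<Rightarrow> 'i \<Rightarrow> real" where
  "frame_lin \<eta> b x = (\<lambda>i. \<Sum>j | \<eta> j \<noteq> 0. x j * b j i)"

definition frame_map :: "('i \<Rightarrow> real) \<Rightarrow> ('j \<Rightarrow> real) \<Rightarrow> ('j \<Rightarrow> 'i \<Rightarrow> real) \<Rightarrow> ('j \<Rightarrow> real) \<Rightarrow> 'i \<Rightarrow> real" where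
  "frame_map c \<eta> b x = (\<lambda>i. c i + frame_lin \<eta> b x i)"

text \<open>The last condition says that the frame maps normal vectors to normal vectors.\<close>

definition affine_inclusion where
  "affine_inclusion S S' P c b \<longleftrightarrow>
     (\<forall>j l. form S j \<noteq> 0 \<longrightarrow> form S l \<noteq> 0 \<longrightarrow> ip (form S') (b j) (b l) = (if j = l then form S j else 0)) \<and>
     (\<forall>x\<in>pts S. frame_map c (form S) b x \<in> pts S') \<and>
     (\<forall>p\<in>pts S. \<forall>x. \<forall>v\<in>tangent_space S' (frame_map c (form S) b p).
        ip (form S') (frame_lin (form S) b (\<lambda>i. x i - P p x i)) v = 0)"

lemma frame_lin_cong: "(\<And>j. \<eta> j \<noteq> 0 \<Longrightarrow> x j = y j) \<Longrightarrow> frame_lin \<eta> b x = frame_lin \<eta> b y"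
  by (auto simp: frame_lin_def intro!: sum.cong)

lemma frame_lin_add: "frame_lin \<eta> b (\<lambda>j. x j + y j) = (\<lambda>i. frame_lin \<eta> b x i + frame_lin \<eta> b y i)"
  and frame_lin_diff: "frame_lin \<eta> b (\<lambda>j. x j - y j) = (\<lambda>i. frame_lin \<eta> b x i - frame_lin \<eta> b y i)"
  and frame_lin_scale: "frame_lin \<eta> b (\<lambda>j. s * x j) = (\<lambda>i. s * frame_lin \<eta> b x i)"
  by (simp_all add: frame_lin_def sum.distrib sum_subtractf sum_distrib_left algebra_simps)

lemma frame_lin_sum: "frame_lin \<eta> b (\<lambda>j. \<Sum>a\<in>A. w a * x a j) = (\<lambda>i. \<Sum>a\<in>A. w a * frame_lin \<eta> b (x a) i)"
proof
  fix i
  have "frame_lin \<eta> b (\<lambda>j. \<Sum>a\<in>A. w a * x a j) i = (\<Sum>j | \<eta> j \<noteq> 0. \<Sum>a\<in>A. w a * (x a j * b j i))"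
    by (simp add: frame_lin_def sum_distrib_right mult.assoc)
  also have "\<dots> = (\<Sum>a\<in>A. w a * frame_lin \<eta> b (x a) i)"
    by (subst sum.swap) (simp add: frame_lin_def sum_distrib_left)
  finally show "frame_lin \<eta> b (\<lambda>j. \<Sum>a\<in>A. w a * x a j) i = (\<Sum>a\<in>A. w a * frame_lin \<eta> b (x a) i)" .
qed

lemma ip_frame_lin_frame:
  assumes fin: "finite {j. \<eta> j \<noteq> 0}"
    and b: "\<And>j l. \<eta> j \<noteq> 0 \<Longrightarrow> \<eta> l \<noteq> 0 \<Longrightarrow> ip \<theta> (b j) (b l) = (if j = l then \<eta> j else 0)" and l: "\<eta> l \<noteq> 0"
  shows "ip \<theta> (frame_lin \<eta> b x) (b l) = \<eta> l * x l"
proof -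
  have "ip \<theta> (frame_lin \<eta> b x) (b l) = (\<Sum>j | \<eta> j \<noteq> 0. x j * (if j = l then \<eta> j else 0))"
    unfolding frame_lin_def ip_sum_left by (rule sum.cong) (use b l in auto)
  also have "\<dots> = (\<Sum>j | \<eta> j \<noteq> 0. if j = l then x j * \<eta> j else 0)" by (rule sum.cong) auto
  finally show ?thesis using fin l by simp
qed

lemma ip_frame_lin:
  assumes "finite {j. \<eta> j \<noteq> 0}"
    and "\<And>j l. \<eta> j \<noteq> 0 \<Longrightarrow> \<eta> l \<noteq> 0 \<Longrightarrow> ip \<theta> (b j) (b l) = (if j = l then \<eta> j else 0)"
  shows "ip \<theta> (frame_lin \<eta> b x) (frame_lin \<eta> b y) = ip \<eta> x y"
proof -
  have "ip \<theta> (frame_lin \<eta> b x) (frame_lin \<eta> b y) = (\<Sum>l | \<eta> l \<noteq> 0. y l * ip \<theta> (frame_lin \<eta> b x) (b l))"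
    by (subst (2) frame_lin_def) (rule ip_sum_right)
  also have "\<dots> = (\<Sum>l | \<eta> l \<noteq> 0. \<eta> l * x l * y l)"
    by (rule sum.cong) (simp_all add: ip_frame_lin_frame[OF assms])
  finally show ?thesis by (simp add: ip_def)
qed

lemma has_pderiv_frame_map:
  assumes "\<And>j. \<eta> j \<noteq> 0 \<Longrightarrow> has_pderiv a (\<lambda>u. F u j) u (D j)"
  shows "has_pderiv a (\<lambda>u. frame_map c \<eta> b (F u) i) u (frame_lin \<eta> b D i)"
proof -
  have "has_pderiv a (\<lambda>u. c i + (\<Sum>j | \<eta> j \<noteq> 0. b j i * F u j)) u (0 + (\<Sum>j | \<eta> j \<noteq> 0. b j i * D j))"
    using assms by (intro has_pderiv_add has_pderiv_const has_pderiv_sum has_pderiv_cmult) auto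
  then show ?thesis by (simp add: frame_map_def frame_lin_def mult.commute)
qed

lemma smooth_vec_frame_map:
  assumes U: "openin (Euclidean_space m) U" and F: "smooth_vec m U F"
  shows "smooth_vec m U (\<lambda>u. frame_map c \<eta> b (F u))"
  unfolding smooth_vec_def
proof
  fix i
  have "smooth_real m U (\<lambda>u. c i + (\<Sum>j | \<eta> j \<noteq> 0. b j i * F u j))"
    using F by (intro smooth_real_add smooth_real_const smooth_real_lincomb U) (auto simp: smooth_vec_def)
  then show "smooth_real m U (\<lambda>u. frame_map c \<eta> b (F u) i)"
    by (simp add: frame_map_def frame_lin_def mult.commute)
qed

lemma smooth_vec_cong:
  assumes "openin (Euclidean_space m) U" "\<And>v. v \<in> U \<Longrightarrow> F v = G v" "smooth_vec m U F"
  shows "smooth_vec m U G"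
  using assms(3) smooth_real_cong[OF assms(1), of "\<lambda>u. F u i" "\<lambda>u. G u i" for i] assms(2)
  by (auto simp: smooth_vec_def)

lemma vpderiv_frame_map:
  assumes U: "openin (Euclidean_space m) U" "u \<in> U" "a < m"
    and F: "\<And>j. \<eta> j \<noteq> 0 \<Longrightarrow> has_pderiv a (\<lambda>u. F u j) u (vpderiv a F u j)"
    and G: "\<And>v. v \<in> U \<Longrightarrow> G v = frame_map c \<eta> b (F v)"
  shows "vpderiv a G u = frame_lin \<eta> b (vpderiv a F u)"
proof
  fix i
  have "has_pderiv a (\<lambda>v. G v i) u (frame_lin \<eta> b (vpderiv a F u) i)"
    by (rule has_pderiv_cong[OF U _ has_pderiv_frame_map[OF F]]) (use G in auto)
  then show "vpderiv a G u i = frame_lin \<eta> b (vpderiv a F u) i"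
    by (simp add: vpderiv_def has_pderiv_imp)
qed

lemma is_param_openin: "is_param m X c \<Longrightarrow> openin (Euclidean_space m) (fst c)"
  by (simp add: is_param_def)

lemma is_param_image:
  assumes "is_param m X c" "u \<in> fst c" shows "snd c u \<in> topspace X"
  using assms openin_subset[of X "snd c ` fst c"] by (auto simp: is_param_def)

lemma topspace_subtop [simp]: "topspace (subtop S) = pts S"
  by (simp add: subtop_def)

lemma subtop_eq: "subtop S = top_of_set (pts S)"
  by (simp add: subtop_def euclidean_product_topology)

text \<open>The coordinates of a point are recovered by pairing with the frame; the left inverse
  \<open>K\<close> obtained in this way is continuous on the whole ambient space.\<close>

lemma embedding_map_affine:
  fixes J :: "('j \<Rightarrow> real) \<Rightarrow> 'i \<Rightarrow> real"
  assumes fin: "finite {j. \<eta> j \<noteq> 0}"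
    and b: "\<And>j l. \<eta> j \<noteq> 0 \<Longrightarrow> \<eta> l \<noteq> 0 \<Longrightarrow> ip \<theta> (b j) (b l) = (if j = l then \<eta> j else 0)"
    and supp: "\<And>x j. x \<in> pts S \<Longrightarrow> \<eta> j = 0 \<Longrightarrow> x j = 0"
    and J: "\<And>x. x \<in> pts S \<Longrightarrow> J x = frame_map c \<eta> b x" and im: "J ` pts S \<subseteq> pts S'"
  shows "embedding_map (subtop S) (subtop S') J"
proof -
  define K where "K y = (\<lambda>j. if \<eta> j = 0 then 0 else ip \<theta> (\<lambda>i. y i - c i) (b j) / \<eta> j)" for y
  have KJ: "K (J x) = x" if "x \<in> pts S" for x
  proof
    fix j
    have "(\<lambda>i. J x i - c i) = frame_lin \<eta> b x" using J[OF that] by (simp add: frame_map_def)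
    then show "K (J x) j = x j"
      using supp[OF that, of j] ip_frame_lin_frame[OF fin b, of j x] by (auto simp: K_def)
  qed
  have contJ: "continuous_on (pts S) J"
  proof (subst continuous_on_cong[OF refl J])
    show "continuous_on (pts S) (frame_map c \<eta> b)"
      unfolding frame_map_def frame_lin_def
      by (intro continuous_on_coordinatewise_then_product continuous_intros)
        (auto intro: continuous_on_subset[OF continuous_on_product_coordinates])
  qed
  have contK: "continuous_on A K" for A
  proof (rule continuous_on_coordinatewise_then_product)
    fix j
    show "continuous_on A (\<lambda>y. K y j)"
      unfolding K_def ip_def
      by (cases "\<eta> j = 0") (auto intro!: continuous_intros
         intro: continuous_on_subset[OF continuous_on_product_coordinates])
  qed
  have "homeomorphic_maps (subtop S) (subtopology (subtop S') (J ` topspace (subtop S))) J K"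
    unfolding homeomorphic_maps_def subtop_eq
    using contJ contK im KJ
    by (auto simp: subtopology_subtopology inf.absorb2)
  then show ?thesis unfolding embedding_map_def homeomorphic_map_maps by blast
qed

text \<open>Second derivatives of \<open>J\<close> in a chart are images under the frame of those of
  the chart. Their part tangent to \<open>S\<close> goes to the image of the differential, and their
  part normal to \<open>S\<close> to vectors normal to \<open>S'\<close>; so the projection to the
  tangent space of \<open>S'\<close> lies in the image of the differential.\<close>

lemma affine_tg_inclusion:
  fixes J :: "('j \<Rightarrow> real) \<Rightarrow> 'i \<Rightarrow> real"
  assumes P: "tangent_projection S P" and P': "tangent_projection S' P'"
    and A: "affine_inclusion S S' P c b"
    and J: "\<And>x. x \<in> pts S \<Longrightarrow> J x = frame_map c (form S) b x"
  shows "tg_inclusion S S' J"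
proof -
  have fin: "finite {j. form S j \<noteq> 0}" using P by (simp add: tangent_projection_def)
  have b: "ip (form S') (b j) (b l) = (if j = l then form S j else 0)" if "form S j \<noteq> 0" "form S l \<noteq> 0" for j l
    using A that by (simp add: affine_inclusion_def)
  note ipl = ip_frame_lin[OF fin b]
  have im: "J ` pts S \<subseteq> pts S'" using A J by (auto simp: affine_inclusion_def)
  have supp: "x j = 0" if "x \<in> pts S" "form S j = 0" for x j
    using P that by (auto simp: tangent_projection_def)
  have chart: "openin (Euclidean_space (sdim S)) (fst d)" "smooth_vec (sdim S) (fst d) (snd d)"
      "\<And>u. u \<in> fst d \<Longrightarrow> snd d u \<in> pts S"
      "\<And>u w. u \<in> fst d \<Longrightarrow> \<forall>i. (\<Sum>a<sdim S. w a * vpderiv a (snd d) u i) = 0 \<Longrightarrow> \<forall>a<sdim S. w a = 0"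
    if "d \<in> atlas (induced S)" for d
  proof -
    have d: "is_param (sdim S) (subtop S) d" using that by (simp add: induced_def)
    show "openin (Euclidean_space (sdim S)) (fst d)" by (rule is_param_openin[OF d])
    show "snd d u \<in> pts S" if "u \<in> fst d" for u using is_param_image[OF d that] by simp
    show "smooth_vec (sdim S) (fst d) (snd d)" using that by (simp add: induced_def)
    show "\<forall>a<sdim S. w a = 0" if "u \<in> fst d" "\<forall>i. (\<Sum>a<sdim S. w a * vpderiv a (snd d) u i) = 0" for u w
      using \<open>d \<in> atlas (induced S)\<close> that by (auto simp: induced_def)
  qed
  have d1: "vpderiv a (J \<circ> snd d) u = frame_lin (form S) b (vpderiv a (snd d) u)"
    if "d \<in> atlas (induced S)" "u \<in> fst d" "a < sdim S" for d u a
    using chart[OF that(1)] that J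
    by (intro vpderiv_frame_map[where c = c] smooth_vec_has_pderiv) auto
  have d2: "vpderiv a (vpderiv b' (J \<circ> snd d)) u = frame_lin (form S) b (vpderiv a (vpderiv b' (snd d)) u)"
    if "d \<in> atlas (induced S)" "u \<in> fst d" "a < sdim S" "b' < sdim S" for d u a b'
    using chart[OF that(1)] that d1[OF that(1) _ that(4)]
    by (intro vpderiv_frame_map[where c = "\<lambda>_. 0"] smooth_vec_has_pderiv smooth_vec_vpderiv)
      (auto simp: frame_map_def)
  have rd: "rdim (induced S) = sdim S" and rt: "rtop (induced S) = subtop S"
    and gr: "gram (induced S) = (\<lambda>c u a b. ip (form S) (vpderiv a (snd c) u) (vpderiv b (snd c) u))"
    by (simp_all add: induced_def)
  have "smooth_vec (sdim S) (fst d) (J \<circ> snd d)" if "d \<in> atlas (induced S)" for d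
    by (rule smooth_vec_cong[OF chart(1)[OF that] _ smooth_vec_frame_map[OF chart(1,2)[OF that]]])
      (use chart(3)[OF that] J in auto)
  then have iso: "isometric_immersion (induced S) S' J"
    unfolding isometric_immersion_def rd rt gr using im by (auto simp: d1 ipl)
  moreover have "embedding_map (subtop S) (subtop S') J"
    by (rule embedding_map_affine[where \<eta> = "form S" and \<theta> = "form S'" and b = b and c = c, OF fin])
      (rule b supp J im; assumption)+
  moreover have "totally_geodesic (induced S) S' J"
    unfolding totally_geodesic_def rd
  proof (intro ballI allI impI)
    fix d u a b' assume d: "d \<in> atlas (induced S)" and u: "u \<in> fst d" and a: "a < sdim S" and b': "b' < sdim S"
    define p where "p = snd d u"
    define x where "x = vpderiv a (vpderiv b' (snd d)) u"
    have p: "p \<in> pts S" "J p \<in> pts S'" using chart(3)[OF d u] im by (auto simp: p_def)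
    have T: "subsp (tangent_space S p)" "P p x \<in> tangent_space S p"
      using P p by (auto simp: tangent_projection_def)
    obtain I where I: "determined_by (tangent_space S p) I" "card I = sdim S"
      using P p unfolding tangent_projection_def by blast
    have tang: "vpderiv e (snd d) u \<in> tangent_space S p" if "e < sdim S" for e
      unfolding p_def by (rule vpderiv_tangent[OF chart(1)[OF d] u that chart(2)[OF d] chart(3)[OF d]])
    \<comment> \<open>The coordinate vectors of the chart are independent and as many as the
      dimension of the tangent space, hence they span it.\<close>
    obtain w where w: "P p x = (\<lambda>i. \<Sum>e<sdim S. w e * vpderiv e (snd d) u i)"
      using independent_spans[OF T(1) I(1), where n = "sdim S" and w = "\<lambda>e. vpderiv e (snd d) u" and v = "P p x"]
        tang I(2) chart(4)[OF d u] T(2) by auto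
    let ?Y = "frame_lin (form S) b (P p x)"
    have Y: "?Y \<in> diff_image (induced S) J d u"
      unfolding diff_image_def rd w frame_lin_sum using d1[OF d u] by fastforce
    have T': "subsp (tangent_space S' (J p))" "posdef_on (form S') (tangent_space S' (J p))"
      "P' (J p) y \<in> tangent_space S' (J p)"
      "\<And>v. v \<in> tangent_space S' (J p) \<Longrightarrow> ip (form S') (\<lambda>i. y i - P' (J p) y i) v = 0" for y
      using P' p unfolding tangent_projection_def by blast+
    have tang': "vpderiv e (J \<circ> snd d) u \<in> tangent_space S' (J p)" if "e < sdim S" for e
      using vpderiv_tangent[OF chart(1)[OF d] u that, of "J \<circ> snd d" S'] iso d chart(3)[OF d] im
      by (auto simp: isometric_immersion_def rd p_def)
    have YT: "?Y \<in> tangent_space S' (J p)"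
    proof -
      from Y obtain w' where "?Y = (\<lambda>i. \<Sum>e<sdim S. w' e * vpderiv e (J \<circ> snd d) u i)"
        unfolding diff_image_def rd by blast
      then show ?thesis using subsp_sum[OF T'(1), of "{..<sdim S}" "\<lambda>e. vpderiv e (J \<circ> snd d) u" w'] tang'
        by simp
    qed
    \<comment> \<open>Projecting commutes with the frame: both \<open>P'\<close> of the image and
      the image of \<open>P p x\<close> meet the characterisation of the orthogonal
      projection.\<close>
    have "P' (J p) (frame_lin (form S) b x) = orth_proj (form S') (tangent_space S' (J p)) (frame_lin (form S) b x)"
      by (rule orth_proj_eqI[OF T'(1,2,3) T'(4), symmetric])
    also have "\<dots> = ?Y"
    proof (rule orth_proj_eqI[OF T'(1,2) YT])
      fix v assume "v \<in> tangent_space S' (J p)"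
      then show "ip (form S') (\<lambda>i. frame_lin (form S) b x i - frame_lin (form S) b (P p x) i) v = 0"
        using A p J[OF p(1)] unfolding affine_inclusion_def frame_lin_diff[symmetric] by simp
    qed
    finally have "P' (J p) (frame_lin (form S) b x) = ?Y" .
    with Y show "second_fundamental_form (induced S) S' J d u a b' = (\<lambda>i. 0)"
      using p d2[OF d u a b'] by (intro second_fundamental_form_zeroI[OF P']) (auto simp: p_def x_def)
  qed
  ultimately show ?thesis by (simp add: tg_inclusion_def)
qed

section \<open>Products, slices and the diagonal embedding\<close>

text \<open>Points, tangent vectors, normal vectors and forms of a product are pairs, so the
  block-diagonal frame \<open>bb\<close> inherits the conditions from the two factors.\<close>

lemma affine_inclusion_prod:
  assumes S: "tangent_projection S P" and T: "tangent_projection T Q"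
    and S': "tangent_projection S' P'" and T': "tangent_projection T' Q'"
    and A: "affine_inclusion S S' P c b" and B: "affine_inclusion T T' Q d b'"
  defines "bb \<equiv> case_sum (\<lambda>j. vpair (b j) (\<lambda>_. 0)) (\<lambda>j. vpair (\<lambda>_. 0) (b' j))"
  shows "affine_inclusion (prod_submfd S T) (prod_submfd S' T') (prod_proj P Q) (vpair c d) bb"
    and "frame_map (vpair c d) (vpair (form S) (form T)) bb =
      prod_map (frame_map c (form S) b) (frame_map d (form T) b')"
proof -
  have fin: "finite {i. form S i \<noteq> 0}" "finite {i. form T i \<noteq> 0}"
    "finite {i. form S' i \<noteq> 0}" "finite {i. form T' i \<noteq> 0}"
    using assms by (auto simp: tangent_projection_def)
  have lin: "frame_lin (vpair (form S) (form T)) bb x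
      = vpair (frame_lin (form S) b (vfst x)) (frame_lin (form T) b' (vsnd x))" for x
  proof
    fix i
    show "frame_lin (vpair (form S) (form T)) bb x i
      = vpair (frame_lin (form S) b (vfst x)) (frame_lin (form T) b' (vsnd x)) i"
      unfolding frame_lin_def vpair_support using fin
      by (cases i) (simp_all add: sum.Plus comp_def bb_def vfst_def vsnd_def)
  qed
  show map: "frame_map (vpair c d) (vpair (form S) (form T)) bb =
      prod_map (frame_map c (form S) b) (frame_map d (form T) b')"
  proof (intro ext)
    fix x i
    show "frame_map (vpair c d) (vpair (form S) (form T)) bb x i =
      prod_map (frame_map c (form S) b) (frame_map d (form T) b') x i"
      by (cases i) (simp_all add: frame_map_def lin prod_map_def)
  qed
  show "affine_inclusion (prod_submfd S T) (prod_submfd S' T') (prod_proj P Q) (vpair c d) bb"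
    unfolding affine_inclusion_def form_prod map lin
  proof (intro conjI allI impI ballI)
    fix j l assume "vpair (form S) (form T) j \<noteq> 0" "vpair (form S) (form T) l \<noteq> 0"
    then show "ip (vpair (form S') (form T')) (bb j) (bb l) = (if j = l then vpair (form S) (form T) j else 0)"
      using A B by (cases j; cases l) (auto simp: affine_inclusion_def bb_def ip_vpair[OF fin(3,4)] ip_linear)
  next
    fix x assume "x \<in> pts (prod_submfd S T)"
    then show "prod_map (frame_map c (form S) b) (frame_map d (form T) b') x \<in> pts (prod_submfd S' T')"
      using A B by (auto simp: pts_prod prod_map_def affine_inclusion_def)
  next
    fix p x v assume "p \<in> pts (prod_submfd S T)"
      and "v \<in> tangent_space (prod_submfd S' T') (prod_map (frame_map c (form S) b) (frame_map d (form T) b') p)"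
    then show "ip (vpair (form S') (form T')) (vpair (frame_lin (form S) b (vfst (\<lambda>i. x i - prod_proj P Q p x i)))
       (frame_lin (form T) b' (vsnd (\<lambda>i. x i - prod_proj P Q p x i)))) v = 0"
      using A B by (auto simp: pts_prod tangent_space_prod prod_map_def prod_proj_def affine_inclusion_def
          ip_vpair[OF fin(3,4)])
  qed
qed

lemma ip_unit_vectors:
  assumes "finite {i. \<eta> i \<noteq> 0}" "\<eta> j \<noteq> 0"
  shows "ip \<eta> (\<lambda>i. if i = j then s else 0) y = s * (\<eta> j * y j)"
proof -
  have "ip \<eta> (\<lambda>i. if i = j then s else 0) y = (\<Sum>i | \<eta> i \<noteq> 0. if i = j then s * (\<eta> i * y i) else 0)"
    unfolding ip_def by (rule sum.cong) auto
  then show ?thesis using assms by simp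
qed

lemma frame_lin_unit_vectors:
  assumes "finite {i. \<eta> i \<noteq> 0}"
  shows "frame_lin \<eta> (\<lambda>j i. if i = j then s else 0) x = (\<lambda>i. if \<eta> i \<noteq> 0 then s * x i else 0)"
proof
  fix i
  have "frame_lin \<eta> (\<lambda>j i. if i = j then s else 0) x i = (\<Sum>j | \<eta> j \<noteq> 0. if i = j then s * x j else 0)"
    unfolding frame_lin_def by (rule sum.cong) auto
  then show "frame_lin \<eta> (\<lambda>j i. if i = j then s else 0) x i = (if \<eta> i \<noteq> 0 then s * x i else 0)"
    using assms by simp
qed

lemma frame_lin_vpair:
  "frame_lin \<eta> (\<lambda>j. vpair (b j) (b' j)) x = vpair (frame_lin \<eta> b x) (frame_lin \<eta> b' x)"
proof
  fix i show "frame_lin \<eta> (\<lambda>j. vpair (b j) (b' j)) x i = vpair (frame_lin \<eta> b x) (frame_lin \<eta> b' x) i"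
    by (cases i) (simp_all add: frame_lin_def)
qed

text \<open>The frame consists of the coordinate vectors of the first factor; the second factor
  enters only through the translation by \<open>q\<close>.\<close>

lemma slice_tg_inclusion:
  assumes S: "tangent_projection S P" and T: "tangent_projection T Q" and q: "q \<in> pts T"
  shows "tg_inclusion S (prod_submfd S T) (\<lambda>x. vpair x q)"
proof (rule affine_tg_inclusion[OF S tangent_projection_prod[OF S T],
      where c = "vpair (\<lambda>_. 0) q" and b = "\<lambda>j. vpair (\<lambda>i. if i = j then 1 else 0) (\<lambda>_. 0)"])
  have fin: "finite {i. form S i \<noteq> 0}" "finite {i. form T i \<noteq> 0}"
    using S T by (auto simp: tangent_projection_def)
  have lin: "frame_lin (form S) (\<lambda>j. vpair (\<lambda>i. if i = j then 1 else 0) (\<lambda>_. 0)) x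
      = vpair (\<lambda>i. if form S i \<noteq> 0 then x i else 0) (\<lambda>_. 0)" for x
    unfolding frame_lin_vpair frame_lin_unit_vectors[OF fin(1)]
    by (intro arg_cong2[of _ _ _ _ vpair]) (auto simp: frame_lin_def)
  have map: "frame_map (vpair (\<lambda>_. 0) q) (form S) (\<lambda>j. vpair (\<lambda>i. if i = j then 1 else 0) (\<lambda>_. 0)) x = vpair x q"
    if "x \<in> pts S" for x
  proof
    fix i show "frame_map (vpair (\<lambda>_. 0) q) (form S) (\<lambda>j. vpair (\<lambda>i. if i = j then 1 else 0) (\<lambda>_. 0)) x i = vpair x q i"
      using S that by (cases i) (auto simp: frame_map_def lin tangent_projection_def)
  qed
  then show "\<And>x. x \<in> pts S \<Longrightarrow> vpair x q
      = frame_map (vpair (\<lambda>_. 0) q) (form S) (\<lambda>j. vpair (\<lambda>i. if i = j then 1 else 0) (\<lambda>_. 0)) x" by simp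
  show "affine_inclusion S (prod_submfd S T) P (vpair (\<lambda>_. 0) q) (\<lambda>j. vpair (\<lambda>i. if i = j then 1 else 0) (\<lambda>_. 0))"
    unfolding affine_inclusion_def form_prod lin
  proof (intro conjI allI impI ballI)
    fix j l assume "form S j \<noteq> 0" "form S l \<noteq> 0"
    then show "ip (vpair (form S) (form T)) (vpair (\<lambda>i. if i = j then 1 else 0) (\<lambda>_. 0))
        (vpair (\<lambda>i. if i = l then 1 else 0) (\<lambda>_. 0)) = (if j = l then form S j else 0)"
      by (simp add: ip_vpair[OF fin] ip_unit_vectors[OF fin(1)] ip_linear)
  next
    fix x assume "x \<in> pts S"
    then show "frame_map (vpair (\<lambda>_. 0) q) (form S) (\<lambda>j. vpair (\<lambda>i. if i = j then 1 else 0) (\<lambda>_. 0)) x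
        \<in> pts (prod_submfd S T)" using q by (simp add: map pts_prod)
  next
    fix p x v assume p: "p \<in> pts S" and "v \<in> tangent_space (prod_submfd S T)
      (frame_map (vpair (\<lambda>_. 0) q) (form S) (\<lambda>j. vpair (\<lambda>i. if i = j then 1 else 0) (\<lambda>_. 0)) p)"
    then have v: "vfst v \<in> tangent_space S p" by (simp add: map tangent_space_prod)
    have "ip (form S) (\<lambda>i. if form S i \<noteq> 0 then x i - P p x i else 0) (vfst v)
        = ip (form S) (\<lambda>i. x i - P p x i) (vfst v)" by (rule ip_cong) auto
    also have "\<dots> = 0" using S p v by (simp add: tangent_projection_def)
    finally show "ip (vpair (form S) (form T)) (vpair (\<lambda>i. if form S i \<noteq> 0 then x i - P p x i else 0) (\<lambda>_. 0)) v = 0"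
      by (simp add: ip_vpair[OF fin] ip_linear)
  qed
qed

text \<open>The normal space of a space form at \<open>p\<close> is the line of \<open>p\<close>,
  and trivial for \<open>k = 0\<close>. To see that a frame preserves normality, it is therefore
  enough to look at the image of \<open>p\<close>.\<close>

lemma frame_lin_normal:
  "frame_lin (space_form_form k n) b (\<lambda>i. x i - sf_proj k n p x i) =
     (\<lambda>i. (k * ip (space_form_form k n) x p) * frame_lin (space_form_form k n) b p i)"
  unfolding frame_lin_scale[symmetric]
  by (rule frame_lin_cong) (auto simp: sf_proj_def space_form_form_eq_0)

lemma space_form_form_sign:
  assumes "k \<noteq> 0" "l \<noteq> 0" "k < 0 \<longleftrightarrow> l < 0" shows "space_form_form k n = space_form_form l n"
  using assms by (auto simp: space_form_form_def fun_eq_iff)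

text \<open>The constants solve \<open>a * a + b * b = 1\<close>, which makes the map isometric, and
  \<open>k1 * (a * a) = k2 * (b * b) = k\<close>, which puts the two components on the quadrics of
  curvature \<open>k1\<close> and \<open>k2\<close>. The normal vector \<open>p\<close> is sent to a
  pair of multiples of position vectors, which is normal in the product. All three forms coincide
  because the curvatures have the same sign.\<close>

lemma diagonal_tg_inclusion:
  fixes k1 k2 :: real
  assumes k12: "k1 * k2 > 0" and k: "k = k1 * k2 / (k1 + k2)"
    and a: "a > 0" "a\<^sup>2 = k2 / (k1 + k2)" and b: "b > 0" "b\<^sup>2 = k1 / (k1 + k2)"
  shows "tg_inclusion (space_form k m) (prod_submfd (space_form k1 m) (space_form k2 m))
    (\<lambda>x. vpair (\<lambda>i. a * x i) (\<lambda>i. b * x i))"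
proof -
  have nz: "k1 \<noteq> 0" "k2 \<noteq> 0" "k1 < 0 \<longleftrightarrow> k2 < 0" using k12 by (auto simp: zero_less_mult_iff)
  have nz': "k1 + k2 \<noteq> 0" "k1 + k2 < 0 \<longleftrightarrow> k1 < 0" using nz by auto
  have k0: "k \<noteq> 0" "k < 0 \<longleftrightarrow> k1 < 0"
    using k12 nz nz' by (auto simp: k divide_less_0_iff)
  have ab: "a * a + b * b = 1" "k1 * (a * a) = k" "k2 * (b * b) = k"
    using a(2) b(2) nz' by (auto simp: power2_eq_square k add_divide_distrib[symmetric] add.commute)
  have \<eta>: "space_form_form k1 m = space_form_form k m" "space_form_form k2 m = space_form_form k m"
    using nz k0 by (auto intro!: space_form_form_sign)
  have ad: "amb_dim k1 m = amb_dim k m" "amb_dim k2 m = amb_dim k m" using nz k0 by (auto simp: amb_dim_def)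
  define B :: "nat \<Rightarrow> nat + nat \<Rightarrow> real"
    where "B j = vpair (\<lambda>i. if i = j then a else 0) (\<lambda>i. if i = j then b else 0)" for j
  note fin = finite_space_form_form[of k m]
  have lin: "frame_lin (space_form_form k m) B x = vpair (\<lambda>i. if space_form_form k m i \<noteq> 0 then a * x i else 0)
      (\<lambda>i. if space_form_form k m i \<noteq> 0 then b * x i else 0)" for x
    unfolding B_def frame_lin_vpair frame_lin_unit_vectors[OF fin] by simp
  have lin': "frame_lin (space_form_form k m) B x = vpair (\<lambda>i. a * x i) (\<lambda>i. b * x i)"
    if "x \<in> pts (space_form k m)" for x
    unfolding lin using that
    by (intro arg_cong2[of _ _ _ _ vpair]) (auto simp: pts_space_form space_form_form_eq_0)
  have pt: "(\<lambda>i. a * x i) \<in> pts (space_form k1 m)" "(\<lambda>i. b * x i) \<in> pts (space_form k2 m)"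
    if "x \<in> pts (space_form k m)" for x
  proof -
    have x: "ip (space_form_form k m) x x = 1 / k" using that k0 by (simp add: pts_space_form)
    have "a * a * (1 / k) = 1 / k1" "b * b * (1 / k) = 1 / k2"
      using ab(2,3) nz k0 by (auto simp: field_simps)
    then show "(\<lambda>i. a * x i) \<in> pts (space_form k1 m)" "(\<lambda>i. b * x i) \<in> pts (space_form k2 m)"
      using that x a(1) b(1) nz k0 unfolding pts_space_form \<eta> ad ip_scale_left ip_scale_right
      by (auto simp: mult.assoc)
  qed
  have "affine_inclusion (space_form k m) (prod_submfd (space_form k1 m) (space_form k2 m)) (sf_proj k m) (\<lambda>_. 0) B"
    unfolding affine_inclusion_def form_prod form_space_form \<eta> frame_lin_normal
  proof (intro conjI allI impI ballI)
    fix j l assume j: "space_form_form k m j \<noteq> 0" "space_form_form k m l \<noteq> 0"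
    have "ip (vpair (space_form_form k m) (space_form_form k m)) (B j) (B l)
        = (if j = l then (a * a + b * b) * space_form_form k m j else 0)"
      using j by (simp add: B_def ip_vpair[OF fin fin] ip_unit_vectors[OF fin] algebra_simps)
    then show "ip (vpair (space_form_form k m) (space_form_form k m)) (B j) (B l)
        = (if j = l then space_form_form k m j else 0)" by (simp add: ab)
  next
    fix x assume x: "x \<in> pts (space_form k m)"
    show "frame_map (\<lambda>_. 0) (space_form_form k m) B x \<in> pts (prod_submfd (space_form k1 m) (space_form k2 m))"
      using pt[OF x] by (simp add: frame_map_def lin'[OF x] pts_prod)
  next
    fix p x v assume p: "p \<in> pts (space_form k m)" and v: "v \<in> tangent_space (prod_submfd (space_form k1 m) (space_form k2 m))
           (frame_map (\<lambda>_. 0) (space_form_form k m) B p)"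
    have "ip (space_form_form k m) (\<lambda>i. a * p i) (vfst v) = 0" "ip (space_form_form k m) (\<lambda>i. b * p i) (vsnd v) = 0"
      using v nz tangent_space_space_form[OF pt(1)[OF p]] tangent_space_space_form[OF pt(2)[OF p]]
      by (auto simp: tangent_space_prod frame_map_def lin'[OF p] \<eta> ip_comm[of _ _ "vfst v"] ip_comm[of _ _ "vsnd v"])
    then show "ip (vpair (space_form_form k m) (space_form_form k m))
        (\<lambda>i. k * ip (space_form_form k m) x p * frame_lin (space_form_form k m) B p i) v = 0"
      unfolding lin'[OF p] by (auto simp: ip_vpair[OF fin fin] ip_scale_left)
  qed
  then show ?thesis
    by (rule affine_tg_inclusion[OF tangent_projection_space_form
        tangent_projection_prod[OF tangent_projection_space_form tangent_projection_space_form]])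
      (simp add: frame_map_def lin')
qed

text \<open>The totally geodesic subspace of a space form through \<open>p\<close> that is spanned by the vectors \<open>e\<close>.\<close>

definition base_point :: "real \<Rightarrow> (nat \<Rightarrow> real) \<Rightarrow> nat \<Rightarrow> real" where
  "base_point k p = (if k = 0 then p else (\<lambda>_. 0))"

text \<open>For \<open>k \<noteq> 0\<close> the position vector, normalised to square
  \<open>1\<close> or \<open>- 1\<close>, takes index 0 and shifts the tangent vectors by one. For
  \<open>k = 0\<close> the point is no direction but the translation part of the affine map.\<close>

definition adapted_frame :: "real \<Rightarrow> (nat \<Rightarrow> real) \<Rightarrow> (nat \<Rightarrow> nat \<Rightarrow> real) \<Rightarrow> nat \<Rightarrow> nat \<Rightarrow> real" where
  "adapted_frame k p e j = (if k = 0 then e j else if j = 0 then (\<lambda>i. sqrt \<bar>k\<bar> * p i) else e (j - 1))"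

text \<open>The vectors \<open>e\<close> are tangent at \<open>p\<close>, hence orthogonal to it, so
  the frame is orthonormal with the signature of the smaller space form. The image is the section of
  the quadric by a linear subspace through \<open>p\<close>, or an affine subspace if
  \<open>k = 0\<close>.\<close>

lemma adapted_frame_affine_inclusion:
  assumes p: "p \<in> pts (space_form k n)" and e: "\<And>i. i < r \<Longrightarrow> e i \<in> tangent_space (space_form k n) p"
    and on: "orthonormal (space_form_form k n) r e"
  shows "affine_inclusion (space_form k r) (space_form k n) (sf_proj k r) (base_point k p) (adapted_frame k p e)"
proof -
  let ?\<eta> = "space_form_form k r" and ?\<theta> = "space_form_form k n" and ?b = "adapted_frame k p e"
  note T = tangent_space_space_form[OF p]
  have frame: "ip ?\<theta> (?b j) (?b l) = (if j = l then ?\<eta> j else 0)" if "?\<eta> j \<noteq> 0" "?\<eta> l \<noteq> 0" for j l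
  proof (cases "k = 0")
    case True
    then show ?thesis using that on
      by (auto simp: orthonormal_def adapted_frame_def space_form_form_def split: if_splits)
  next
    case False
    have jl: "j < Suc r" "l < Suc r" using that False by (auto simp: space_form_form_eq_0 amb_dim_def not_le)
    have ep: "ip ?\<theta> (e i) p = 0" "ip ?\<theta> p (e i) = 0" if "i < r" for i
      using e[OF that] False unfolding T by (auto simp: ip_comm[of _ p])
    have pp: "ip ?\<theta> (\<lambda>i. sqrt \<bar>k\<bar> * p i) (\<lambda>i. sqrt \<bar>k\<bar> * p i) = (if k < 0 then - 1 else 1)"
    proof -
      have "ip ?\<theta> (\<lambda>i. sqrt \<bar>k\<bar> * p i) (\<lambda>i. sqrt \<bar>k\<bar> * p i) = sqrt \<bar>k\<bar> * sqrt \<bar>k\<bar> * ip ?\<theta> p p"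
        unfolding ip_scale_left ip_scale_right by simp
      also have "\<dots> = \<bar>k\<bar> / k" using p False by (simp add: pts_space_form)
      finally show ?thesis using False by simp
    qed
    show ?thesis
    proof (cases j)
      case 0
      then show ?thesis using pp ep jl False
        by (cases l) (auto simp: adapted_frame_def ip_scale_left space_form_form_def)
    next
      case (Suc j')
      then show ?thesis using ep jl False on
        by (cases l) (auto simp: adapted_frame_def ip_scale_right space_form_form_def orthonormal_def)
    qed
  qed
  have ipl: "ip ?\<theta> (frame_lin ?\<eta> ?b x) (frame_lin ?\<eta> ?b y) = ip ?\<eta> x y" for x y
    by (rule ip_frame_lin[OF finite_space_form_form frame])
  have supp: "?b j i = 0" if "?\<eta> j \<noteq> 0" "i \<ge> amb_dim k n" for i j
  proof -
    have "e l i = 0" if "l < r" for l using e[OF that] \<open>i \<ge> amb_dim k n\<close> unfolding T by auto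
    moreover have "p i = 0" using p that by (simp add: pts_space_form)
    ultimately show ?thesis using that
      by (auto simp: adapted_frame_def space_form_form_eq_0 amb_dim_def)
  qed
  have pt: "frame_map (base_point k p) ?\<eta> ?b x \<in> pts (space_form k n)" if x: "x \<in> pts (space_form k r)" for x
  proof -
    have s: "frame_lin ?\<eta> ?b x i = 0" if "i \<ge> amb_dim k n" for i
      unfolding frame_lin_def using supp[OF _ that] by (intro sum.neutral) auto
    show ?thesis
    proof (cases "k = 0")
      case True
      then show ?thesis using p s by (simp add: pts_space_form frame_map_def base_point_def)
    next
      case False
      let ?J = "frame_lin ?\<eta> ?b x"
      have J: "frame_map (base_point k p) ?\<eta> ?b x = ?J" using False by (simp add: frame_map_def base_point_def)
      have i: "ip ?\<theta> ?J ?J = 1 / k" unfolding ipl using x False by (simp add: pts_space_form)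
      \<comment> \<open>The frame need not respect the time coordinate. Pairing with its index-0
        vector shows that the image point has a negative product with \<open>p\<close>, so it lies
        on the sheet of \<open>p\<close>.\<close>
      have "?J 0 > 0" if k: "k < 0"
      proof -
        have "ip ?\<theta> ?J (?b 0) = ?\<eta> 0 * x 0"
          by (rule ip_frame_lin_frame[OF finite_space_form_form frame])
            (use False in \<open>auto simp: space_form_form_def\<close>)
        then have "sqrt \<bar>k\<bar> * ip ?\<theta> ?J p = - x 0"
          using k by (simp add: adapted_frame_def ip_scale_right space_form_form_def)
        also have "\<dots> < 0" using x k by (simp add: pts_space_form)
        finally have "ip ?\<theta> ?J p < 0" using k by (simp add: mult_less_0_iff)
        then show ?thesis using same_sheet_iff[OF k p i] by simp
      qed
      then show ?thesis unfolding J using s i by (simp add: pts_space_form)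
    qed
  qed
  show ?thesis
    unfolding affine_inclusion_def form_space_form
  proof (intro conjI allI impI ballI)
    fix q x v assume q: "q \<in> pts (space_form k r)"
      and v: "v \<in> tangent_space (space_form k n) (frame_map (base_point k p) ?\<eta> ?b q)"
    show "ip ?\<theta> (frame_lin ?\<eta> ?b (\<lambda>i. x i - sf_proj k r q x i)) v = 0"
    proof (cases "k = 0")
      case False
      then have "ip ?\<theta> v (frame_lin ?\<eta> ?b q) = 0"
        using v unfolding tangent_space_space_form[OF pt[OF q]] by (simp add: frame_map_def base_point_def)
      then show ?thesis unfolding frame_lin_normal ip_scale_left by (simp add: ip_comm[of _ _ v])
    qed (simp add: frame_lin_normal ip_linear)
  qed (use frame pt in auto)
qed

subsection \<open>Uniqueness on a connected manifold\<close>

lemma bigo_cong_on: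
  fixes X Y :: "(nat \<Rightarrow> real) \<Rightarrow> real"
  assumes "X \<in> O[nhds_in U u](E)" "\<And>v. v \<in> U \<Longrightarrow> X v = Y v" shows "Y \<in> O[nhds_in U u](E)"
proof -
  have "eventually (\<lambda>v. X v = Y v) (nhds_in U u)"
    unfolding eventually_nhds_in using assms(2) by (intro exI[of _ UNIV]) auto
  with assms(1) show ?thesis using landau_o.big.in_cong by blast
qed

lemma bigo_cont_mult:
  fixes X Y :: "(nat \<Rightarrow> real) \<Rightarrow> real"
  assumes "continuous_on U X" "u \<in> U" "Y \<in> O[nhds_in U u](E)"
  shows "(\<lambda>v. X v * Y v) \<in> O[nhds_in U u](E)"
  using landau_o.big_mult[OF continuous_on_bigo_1[OF assms(1,2)] assms(3)] by simp

text \<open>A sum of absolute values of the first jet. It plays two parts: as the bound for second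
  derivatives, by which differential equations enter the uniqueness argument, and as a continuous
  function whose zeros are the zeros of the jet.\<close>

definition jet_norm :: "nat \<Rightarrow> 'k set \<Rightarrow> ('k \<Rightarrow> (nat \<Rightarrow> real) \<Rightarrow> real) \<Rightarrow> (nat \<Rightarrow> real) \<Rightarrow> real" where
  "jet_norm m I H v = (\<Sum>j\<in>I. \<bar>H j v\<bar> + (\<Sum>d<m. \<bar>pderiv_at d (H j) v\<bar>))"

lemma jet_norm_nonneg: "jet_norm m I H v \<ge> 0"
  unfolding jet_norm_def by (intro sum_nonneg add_nonneg_nonneg) auto

lemma jet_norm_ge:
  assumes "finite I" "j \<in> I"
  shows "\<bar>H j v\<bar> + (\<Sum>d<m. \<bar>pderiv_at d (H j) v\<bar>) \<le> jet_norm m I H v"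
  unfolding jet_norm_def using assms
  by (intro member_le_sum[of j I "\<lambda>j. \<bar>H j v\<bar> + (\<Sum>d<m. \<bar>pderiv_at d (H j) v\<bar>)"]) (auto intro!: add_nonneg_nonneg sum_nonneg)

lemma value_bigo_jet_norm:
  assumes "finite I" "j \<in> I" shows "H j \<in> O[F](jet_norm m I H)"
proof (rule bigoI[of _ 1], rule always_eventually, rule allI)
  fix v
  have "(\<Sum>d<m. \<bar>pderiv_at d (H j) v\<bar>) \<ge> 0" by (intro sum_nonneg) auto
  then have "\<bar>H j v\<bar> \<le> jet_norm m I H v" using jet_norm_ge[OF assms, of H v m] by linarith
  then show "norm (H j v) \<le> 1 * norm (jet_norm m I H v)" using jet_norm_nonneg[of m I H v] by simp
qed

lemma pderiv_bigo_jet_norm: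
  assumes "finite I" "j \<in> I" "d < m" shows "pderiv_at d (H j) \<in> O[F](jet_norm m I H)"
proof (rule bigoI[of _ 1], rule always_eventually, rule allI)
  fix v
  have "\<bar>pderiv_at d (H j) v\<bar> \<le> (\<Sum>d<m. \<bar>pderiv_at d (H j) v\<bar>)"
    using assms(3) by (intro member_le_sum[of d "{..<m}" "\<lambda>d. \<bar>pderiv_at d (H j) v\<bar>"]) auto
  with jet_norm_ge[OF assms(1,2), of H v m] show "norm (pderiv_at d (H j) v) \<le> 1 * norm (jet_norm m I H v)" by simp
qed

lemma jet_norm_zero_iff:
  assumes "finite I"
  shows "jet_norm m I H v = 0 \<longleftrightarrow> (\<forall>j\<in>I. H j v = 0 \<and> (\<forall>d<m. pderiv_at d (H j) v = 0))"
proof -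
  have nn: "0 \<le> (\<Sum>d<m. \<bar>pderiv_at d (H j) v\<bar>)" for j by (intro sum_nonneg) auto
  have "jet_norm m I H v = 0 \<longleftrightarrow> (\<forall>j\<in>I. \<bar>H j v\<bar> + (\<Sum>d<m. \<bar>pderiv_at d (H j) v\<bar>) = 0)"
    unfolding jet_norm_def using assms nn by (intro sum_nonneg_eq_0_iff) (auto intro!: add_nonneg_nonneg)
  also have "\<dots> \<longleftrightarrow> (\<forall>j\<in>I. \<bar>H j v\<bar> = 0 \<and> (\<Sum>d<m. \<bar>pderiv_at d (H j) v\<bar>) = 0)"
    using nn by (intro ball_cong refl add_nonneg_eq_0_iff) auto
  also have "\<dots> \<longleftrightarrow> (\<forall>j\<in>I. H j v = 0 \<and> (\<forall>d<m. pderiv_at d (H j) v = 0))"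
    by (subst sum_nonneg_eq_0_iff) auto
  finally show ?thesis .
qed

text \<open>Values and first derivatives together form the unknowns of a first-order system, so the
  Hessian bound becomes the differential inequality of \<open>cube_zero\<close>.\<close>

lemma local_uniqueness:
  assumes U: "openin (Euclidean_space m) U" "u \<in> U" and fin: "finite I"
    and smooth: "\<And>i. i \<in> I \<Longrightarrow> smooth_real m U (H i)"
    and hess: "\<And>i a b. i \<in> I \<Longrightarrow> a < m \<Longrightarrow> b < m \<Longrightarrow>
       pderiv_at a (pderiv_at b (H i)) \<in> O[nhds_in U u](jet_norm m I H)"
    and zero: "jet_norm m I H u = 0"
  shows "eventually (\<lambda>v. \<forall>i\<in>I. H i v = 0) (nhds_in U u)"
proof -
  let ?E = "jet_norm m I H"
  have "\<exists>C. \<forall>i\<in>I. \<forall>a<m. \<forall>b<m. C i a b > 0 \<and>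
     eventually (\<lambda>v. \<bar>pderiv_at a (pderiv_at b (H i)) v\<bar> \<le> C i a b * ?E v) (nhds_in U u)"
    using hess jet_norm_nonneg[of m I H] unfolding bigo_def
    by (simp add: abs_of_nonneg) metis
  then obtain C where C: "\<And>i a b. i \<in> I \<Longrightarrow> a < m \<Longrightarrow> b < m \<Longrightarrow> C i a b > 0"
    "\<And>i a b. i \<in> I \<Longrightarrow> a < m \<Longrightarrow> b < m \<Longrightarrow>
      eventually (\<lambda>v. \<bar>pderiv_at a (pderiv_at b (H i)) v\<bar> \<le> C i a b * ?E v) (nhds_in U u)" by blast
  have "eventually (\<lambda>v. \<forall>i\<in>I. \<forall>a\<in>{..<m}. \<forall>b\<in>{..<m}.
      \<bar>pderiv_at a (pderiv_at b (H i)) v\<bar> \<le> C i a b * ?E v) (nhds_in U u)"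
    using fin C(2) by (intro eventually_ball_finite ballI) auto
  from eventually_nhds_in_cube[OF U this] obtain e where e: "e > 0" "cube m u e \<subseteq> U"
    "\<And>v i a b. v \<in> cube m u e \<Longrightarrow> i \<in> I \<Longrightarrow> a < m \<Longrightarrow> b < m \<Longrightarrow>
      \<bar>pderiv_at a (pderiv_at b (H i)) v\<bar> \<le> C i a b * ?E v" by auto
  \<comment> \<open>Larger than all constants of the Hessian bounds. The summand 1 takes care of the
    derivatives of the values, which are themselves unknowns.\<close>
  define K where "K = 1 + (\<Sum>i\<in>I. \<Sum>a<m. \<Sum>b<m. C i a b)"
  have nn: "0 \<le> (\<Sum>a<m. \<Sum>b<m. C i a b)" if "i \<in> I" for i
    using C(1) that by (intro sum_nonneg) (auto intro: less_imp_le)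
  have "0 \<le> (\<Sum>i\<in>I. \<Sum>a<m. \<Sum>b<m. C i a b)" by (rule sum_nonneg[OF nn])
  then have K0: "K \<ge> 1" by (simp add: K_def)
  have CK: "C i a b \<le> K" if "i \<in> I" "a < m" "b < m" for i a b
  proof -
    have "C i a b \<le> (\<Sum>b<m. C i a b)" using that C(1)
      by (intro member_le_sum[of b "{..<m}" "C i a"]) (auto intro: less_imp_le)
    also have "\<dots> \<le> (\<Sum>a<m. \<Sum>b<m. C i a b)" using that C(1)
      by (intro member_le_sum[of a "{..<m}" "\<lambda>a. \<Sum>b<m. C i a b"]) (auto intro!: sum_nonneg intro: less_imp_le)
    also have "\<dots> \<le> (\<Sum>i\<in>I. \<Sum>a<m. \<Sum>b<m. C i a b)" using that nn fin
      by (intro member_le_sum[of i I "\<lambda>i. \<Sum>a<m. \<Sum>b<m. C i a b"]) auto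
    finally show ?thesis by (simp add: K_def)
  qed
  \<comment> \<open>The index \<open>d = m\<close>, which is not a direction, stands for the
    function itself.\<close>
  define y where "y q = (case q of (i, d) \<Rightarrow> if d < m then pderiv_at d (H i) else H i)" for q
  define D where "D a q v = pderiv_at a (y q) v" for a q v
  have sumy: "(\<Sum>q\<in>I \<times> {..m}. \<bar>y q v\<bar>) = ?E v" for v
  proof -
    have "(\<Sum>q\<in>I \<times> {..m}. \<bar>y q v\<bar>) = (\<Sum>i\<in>I. \<Sum>d\<in>{..m}. \<bar>y (i, d) v\<bar>)"
      by (simp add: sum.cartesian_product)
    also have "\<dots> = ?E v" unfolding jet_norm_def
      by (intro sum.cong refl) (simp add: lessThan_Suc_atMost[symmetric] y_def add.commute)
    finally show ?thesis .
  qed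
  have ysmooth: "smooth_real m U (y q)" if "q \<in> I \<times> {..m}" for q
    using that smooth smooth_real_pderiv by (auto simp: y_def split: prod.splits)
  have "y q v = 0" if v: "v \<in> cube m u e" and q: "q \<in> I \<times> {..m}" for q v
  proof (rule cube_zero[where I = "I \<times> {..m}" and C = K and D = D and y = y])
    fix q a v assume q: "q \<in> I \<times> {..m}" and a: "a < m" and v: "v \<in> cube m u e"
    show "has_pderiv a (y q) v (D a q v)" unfolding D_def
      by (rule smooth_real_has_pderiv[OF ysmooth[OF q] _ a]) (use v e(2) in auto)
    obtain i d where qid: "q = (i, d)" "i \<in> I" "d \<le> m" using q by auto
    show "\<bar>D a q v\<bar> \<le> K * (\<Sum>q\<in>I \<times> {..m}. \<bar>y q v\<bar>)"
    proof (cases "d < m")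
      case True
      then have "\<bar>D a q v\<bar> \<le> C i a d * ?E v" using e(3)[OF v qid(2) a] by (simp add: D_def y_def qid(1))
      also have "\<dots> \<le> K * ?E v" using CK[OF qid(2) a True] by (intro mult_right_mono jet_norm_nonneg)
      finally show ?thesis by (simp add: sumy)
    next
      case False
      have "\<bar>D a q v\<bar> \<le> (\<Sum>d<m. \<bar>pderiv_at d (H i) v\<bar>)"
        using False a by (auto simp: D_def y_def qid(1) intro!: member_le_sum[of a "{..<m}" "\<lambda>d. \<bar>pderiv_at d (H i) v\<bar>"])
      also have "\<dots> \<le> ?E v" using jet_norm_ge[OF fin qid(2), of H v m] by simp
      also have "\<dots> \<le> K * ?E v" using K0 jet_norm_nonneg[of m I H v] mult_right_mono[of 1 K "?E v"] by simp
      finally show ?thesis by (simp add: sumy)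
    qed
  next
    fix q assume "q \<in> I \<times> {..m}"
    then show "y q u = 0" using zero unfolding jet_norm_zero_iff[OF fin] by (auto simp: y_def)
  qed (use fin K0 v q in auto)
  then have "\<forall>i\<in>I. H i v = 0" if "v \<in> cube m u e" for v
    using that by (force simp: y_def)
  then show ?thesis by (intro eventually_nhds_inI_cube[OF U e(1)]) auto
qed

lemma pderiv_zero_of_eventually_zero:
  assumes U: "openin (Euclidean_space m) U" "u \<in> U" "a < m" and ev: "eventually (\<lambda>v. F v = 0) (nhds_in U u)"
  shows "pderiv_at a F u = 0"
proof -
  obtain S where S: "open S" "u \<in> S" "\<forall>v\<in>S \<inter> U. F v = 0" using ev by (auto simp: eventually_nhds_in)
  have o: "openin (Euclidean_space m) (S \<inter> U)"
  proof -
    obtain T where "open T" "U = T \<inter> {x. \<forall>i\<ge>m. x i = 0}" using openin_Euclidean_spaceD(2)[OF U(1)] by blast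
    then show ?thesis unfolding Euclidean_space_def openin_subtopology euclidean_product_topology
      using S(1) by (intro exI[of _ "S \<inter> T"]) auto
  qed
  have "pderiv_at a F u = pderiv_at a (\<lambda>_. 0) u"
    by (rule pderiv_at_cong[OF o _ U(3)]) (use S U in auto)
  then show ?thesis by (simp add: has_pderiv_imp[OF has_pderiv_const])
qed

lemma manifold_chart:
  assumes "riemannian_manifold M" "c \<in> atlas M"
  shows "is_param (rdim M) (rtop M) c" "openin (Euclidean_space (rdim M)) (fst c)"
    "u \<in> fst c \<Longrightarrow> snd c u \<in> topspace (rtop M)"
proof -
  show c: "is_param (rdim M) (rtop M) c" using assms by (simp add: riemannian_manifold_def smooth_atlas_def)
  show "openin (Euclidean_space (rdim M)) (fst c)" by (rule is_param_openin[OF c])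
  show "u \<in> fst c \<Longrightarrow> snd c u \<in> topspace (rtop M)" by (rule is_param_image[OF c])
qed

lemma manifold_point:
  assumes "riemannian_manifold M" "x \<in> topspace (rtop M)"
  obtains c u where "c \<in> atlas M" "u \<in> fst c" "x = snd c u"
proof -
  have "x \<in> (\<Union>c\<in>atlas M. snd c ` fst c)" using assms by (simp add: riemannian_manifold_def smooth_atlas_def)
  then show thesis using that by auto
qed

lemma is_param_open_image:
  assumes c: "is_param m X c" and S: "open S"
  shows "openin X (snd c ` (S \<inter> fst c))"
proof -
  have hm: "homeomorphic_map (subtopology (Euclidean_space m) (fst c)) (subtopology X (snd c ` fst c)) (snd c)"
    and o: "openin X (snd c ` fst c)" and U: "openin (Euclidean_space m) (fst c)"
    using c openin_subset[of "Euclidean_space m" "fst c"]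
    by (auto simp: is_param_def embedding_map_def inf.absorb2)
  have "openin (subtopology (Euclidean_space m) (fst c)) (S \<inter> fst c)"
    unfolding openin_subtopology
  proof (intro exI conjI)
    show "openin (Euclidean_space m) (S \<inter> {x. \<forall>i\<ge>m. x i = 0})"
      unfolding Euclidean_space_def openin_subtopology euclidean_product_topology using S by auto
    show "S \<inter> fst c = S \<inter> {x. \<forall>i\<ge>m. x i = 0} \<inter> fst c" using openin_Euclidean_spaceD(1)[OF U] by auto
  qed
  then have "openin (subtopology X (snd c ` fst c)) (snd c ` (S \<inter> fst c))"
    using homeomorphic_imp_open_map[OF hm] by (simp add: open_map_def)
  then show ?thesis using openin_trans_full[OF _ o] by blast
qed

lemma is_param_vimage:
  assumes c: "is_param m X c" and V: "openin X V" and u: "u \<in> fst c" "snd c u \<in> V"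
  shows "eventually (\<lambda>w. snd c w \<in> V) (nhds_in (fst c) u)"
proof -
  have U: "openin (Euclidean_space m) (fst c)" using c by (simp add: is_param_def)
  have "continuous_map (subtopology (Euclidean_space m) (fst c)) X (snd c)"
    using c homeomorphic_imp_continuous_map[of "subtopology (Euclidean_space m) (fst c)" _ "snd c"]
    unfolding is_param_def embedding_map_def continuous_map_in_subtopology[symmetric]
    by (metis continuous_map_in_subtopology)
  from openin_continuous_map_preimage[OF this V]
  have "openin (subtopology (Euclidean_space m) (fst c)) {w \<in> fst c. snd c w \<in> V}"
    using openin_subset[OF U] by (simp add: inf.absorb2)
  then have "openin (Euclidean_space m) {w \<in> fst c. snd c w \<in> V}" using openin_trans_full U by blast
  from openin_Euclidean_spaceD(2)[OF this]
  obtain T where T: "open T" "{w \<in> fst c. snd c w \<in> V} = T \<inter> {x. \<forall>i\<ge>m. x i = 0}" by blast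
  then have "\<forall>v\<in>T \<inter> fst c. snd c v \<in> V" "u \<in> T" using openin_Euclidean_spaceD(1)[OF U] u by blast+
  with T(1) show ?thesis unfolding eventually_nhds_in by blast
qed

text \<open>Vanishing in a neighbourhood, unlike vanishing of the first jet, does not refer to a chart; so no
  change of charts is needed in the connectedness argument.\<close>

theorem unique_continuation:
  assumes M: "riemannian_manifold M" and fin: "finite I"
    and smooth: "\<And>c i. c \<in> atlas M \<Longrightarrow> i \<in> I \<Longrightarrow> smooth_real (rdim M) (fst c) (h i \<circ> snd c)"
    and hess: "\<And>c u i a b. c \<in> atlas M \<Longrightarrow> u \<in> fst c \<Longrightarrow> i \<in> I \<Longrightarrow> a < rdim M \<Longrightarrow> b < rdim M \<Longrightarrow>
       pderiv_at a (pderiv_at b (h i \<circ> snd c)) \<in> O[nhds_in (fst c) u](jet_norm (rdim M) I (\<lambda>i. h i \<circ> snd c))"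
    and c0: "c0 \<in> atlas M" "u0 \<in> fst c0"
    and init: "\<And>i. i \<in> I \<Longrightarrow> h i (snd c0 u0) = 0"
      "\<And>i a. i \<in> I \<Longrightarrow> a < rdim M \<Longrightarrow> pderiv_at a (h i \<circ> snd c0) u0 = 0"
    and x: "x \<in> topspace (rtop M)" and i: "i \<in> I"
  shows "h i x = 0"
proof -
  let ?X = "rtop M" and ?m = "rdim M"
  define Z where "Z c u \<longleftrightarrow> jet_norm ?m I (\<lambda>i. h i \<circ> snd c) u = 0" for c :: "'a param" and u
  define A where "A = {x \<in> topspace ?X. \<exists>V. openin ?X V \<and> x \<in> V \<and> (\<forall>y\<in>V. \<forall>i\<in>I. h i y = 0)}"
  have ZA: "snd c u \<in> A" if "c \<in> atlas M" "u \<in> fst c" "Z c u" for c u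
  proof -
    note c = manifold_chart[OF M that(1)]
    have "eventually (\<lambda>v. \<forall>i\<in>I. (h i \<circ> snd c) v = 0) (nhds_in (fst c) u)"
      by (rule local_uniqueness[OF c(2) that(2) fin smooth[OF that(1)] hess[OF that(1,2)] that(3)[unfolded Z_def]])
    then obtain S where S: "open S" "u \<in> S" "\<forall>v\<in>S \<inter> fst c. \<forall>i\<in>I. h i (snd c v) = 0"
      by (auto simp: eventually_nhds_in)
    show ?thesis unfolding A_def
      using is_param_open_image[OF c(1) S(1)] S that(2) c(3)[OF that(2)]
      by (intro CollectI conjI exI[of _ "snd c ` (S \<inter> fst c)"]) auto
  qed
  have AZ: "Z c u" if cA: "c \<in> atlas M" "u \<in> fst c" "snd c u \<in> A" for c u
  proof -
    note c = manifold_chart[OF M cA(1)]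
    obtain V where V: "openin ?X V" "snd c u \<in> V" "\<forall>y\<in>V. \<forall>i\<in>I. h i y = 0" using cA by (auto simp: A_def)
    have "eventually (\<lambda>w. snd c w \<in> V) (nhds_in (fst c) u)" by (rule is_param_vimage[OF c(1) V(1) cA(2) V(2)])
    then have "eventually (\<lambda>w. (h i \<circ> snd c) w = 0) (nhds_in (fst c) u)" if "i \<in> I" for i
      by eventually_elim (use V(3) that in auto)
    then have "pderiv_at a (h i \<circ> snd c) u = 0" if "i \<in> I" "a < ?m" for i a
      using pderiv_zero_of_eventually_zero[OF c(2) \<open>u \<in> fst c\<close> that(2)] that by blast
    then show ?thesis unfolding Z_def jet_norm_zero_iff[OF fin] using V by auto
  qed
  have "openin ?X A"
  proof (subst openin_subopen, rule ballI)
    fix x assume "x \<in> A"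
    then obtain V where V: "openin ?X V" "x \<in> V" "\<forall>y\<in>V. \<forall>i\<in>I. h i y = 0" by (auto simp: A_def)
    moreover have "V \<subseteq> A" using V openin_subset[OF V(1)] by (auto simp: A_def)
    ultimately show "\<exists>T. openin ?X T \<and> x \<in> T \<and> T \<subseteq> A" by blast
  qed
  \<comment> \<open>By \<open>ZA\<close> the jet at a point outside \<open>A\<close> is nonzero. It
    stays nonzero nearby by continuity, and by \<open>AZ\<close> no point with a nonzero jet belongs
    to \<open>A\<close>.\<close>
  moreover have "openin ?X (topspace ?X - A)"
  proof (subst openin_subopen, rule ballI)
    fix x assume x: "x \<in> topspace ?X - A"
    then obtain c u where cu: "c \<in> atlas M" "u \<in> fst c" "x = snd c u" using manifold_point[OF M] by blast
    note c = manifold_chart[OF M cu(1)]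
    let ?E = "jet_norm ?m I (\<lambda>i. h i \<circ> snd c)"
    have "continuous_on (fst c) ?E"
      unfolding jet_norm_def
      by (intro continuous_intros smooth_real_continuous[OF smooth[OF cu(1)]]
          smooth_real_continuous[OF smooth_real_pderiv[OF smooth[OF cu(1)]]]) auto
    then have "eventually (\<lambda>v. ?E v \<in> - {0}) (nhds_in (fst c) u)"
      by (rule continuous_on_eventually_nhds_in) (use cu x ZA[OF cu(1,2)] in \<open>auto simp: Z_def\<close>)
    then obtain S where S: "open S" "u \<in> S" "\<forall>v\<in>S \<inter> fst c. ?E v \<noteq> 0" by (auto simp: eventually_nhds_in)
    have "snd c ` (S \<inter> fst c) \<subseteq> topspace ?X - A" using S(3) AZ[OF cu(1)] c(3) by (auto simp: Z_def)
    then show "\<exists>T. openin ?X T \<and> x \<in> T \<and> T \<subseteq> topspace ?X - A"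
      using is_param_open_image[OF c(1) S(1)] S(2) cu by (intro exI[of _ "snd c ` (S \<inter> fst c)"]) auto
  qed
  moreover have "snd c0 u0 \<in> A"
    by (rule ZA[OF c0]) (use init in \<open>auto simp: Z_def jet_norm_zero_iff[OF fin]\<close>)
  moreover have "connected_space ?X" "A \<subseteq> topspace ?X" using M by (auto simp: riemannian_manifold_def A_def)
  ultimately have "A = topspace ?X"
    unfolding connected_space_clopen_in closedin_def by blast
  with x i show ?thesis by (auto simp: A_def)
qed

subsection \<open>Totally geodesic maps into a space form\<close>

text \<open>The differential equation of the components of a totally geodesic immersion into a product, where
  \<open>\<Gamma>\<close> are the Christoffel symbols of \<open>M\<close>.\<close>

definition affine_map_eq :: "'a riem \<Rightarrow> ('a param \<Rightarrow> (nat \<Rightarrow> real) \<Rightarrow> nat \<Rightarrow> nat \<Rightarrow> nat \<Rightarrow> real) \<Rightarrow>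
    real \<Rightarrow> nat \<Rightarrow> ('a \<Rightarrow> nat \<Rightarrow> real) \<Rightarrow> bool" where
  "affine_map_eq M \<Gamma> k n f \<longleftrightarrow>
     (\<forall>x\<in>topspace (rtop M). f x \<in> pts (space_form k n)) \<and>
     (\<forall>c\<in>atlas M. smooth_vec (rdim M) (fst c) (f \<circ> snd c) \<and>
       (\<forall>u\<in>fst c. \<forall>a<rdim M. \<forall>b<rdim M.
          vpderiv a (vpderiv b (f \<circ> snd c)) u = (\<lambda>i. (\<Sum>d<rdim M. \<Gamma> c u a b d * vpderiv d (f \<circ> snd c) u i) -
            k * ip (space_form_form k n) (vpderiv a (f \<circ> snd c) u) (vpderiv b (f \<circ> snd c) u) * f (snd c u) i)))"

definition continuous_symbols :: "'a riem \<Rightarrow> ('a param \<Rightarrow> (nat \<Rightarrow> real) \<Rightarrow> nat \<Rightarrow> nat \<Rightarrow> nat \<Rightarrow> real) \<Rightarrow> bool" where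
  "continuous_symbols M \<Gamma> \<longleftrightarrow> (\<forall>c\<in>atlas M. \<forall>a<rdim M. \<forall>b<rdim M. \<forall>d<rdim M.
     continuous_on (fst c) (\<lambda>u. \<Gamma> c u a b d))"

lemma affine_map_eqD:
  assumes "affine_map_eq M \<Gamma> k n f"
  shows "x \<in> topspace (rtop M) \<Longrightarrow> f x \<in> pts (space_form k n)"
    and "c \<in> atlas M \<Longrightarrow> smooth_vec (rdim M) (fst c) (f \<circ> snd c)"
    and "c \<in> atlas M \<Longrightarrow> u \<in> fst c \<Longrightarrow> a < rdim M \<Longrightarrow> b < rdim M \<Longrightarrow>
      vpderiv a (vpderiv b (f \<circ> snd c)) u = (\<lambda>i. (\<Sum>d<rdim M. \<Gamma> c u a b d * vpderiv d (f \<circ> snd c) u i) -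
            k * ip (space_form_form k n) (vpderiv a (f \<circ> snd c) u) (vpderiv b (f \<circ> snd c) u) * f (snd c u) i)"
  using assms by (auto simp: affine_map_eq_def)

lemma affine_map_eq_tangent:
  assumes "riemannian_manifold M" "affine_map_eq M \<Gamma> k n f" "c \<in> atlas M" "u \<in> fst c" "a < rdim M"
  shows "vpderiv a (f \<circ> snd c) u \<in> tangent_space (space_form k n) (f (snd c u))"
  using vpderiv_tangent[OF manifold_chart(2)[OF assms(1,3)] assms(4,5) affine_map_eqD(2)[OF assms(2,3)]]
    affine_map_eqD(1)[OF assms(2)] manifold_chart(3)[OF assms(1,3)] by auto

lemma continuous_on_vpderiv:
  assumes "smooth_vec m U F" "a < m" shows "continuous_on U (\<lambda>v. vpderiv a F v i)"
  using smooth_vec_vpderiv[OF assms] smooth_real_continuous unfolding smooth_vec_def by blast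

lemma continuous_on_ip:
  assumes "\<And>i. continuous_on U (\<lambda>v. F v i)" "\<And>i. continuous_on U (\<lambda>v. G v i)"
  shows "continuous_on U (\<lambda>v. ip \<eta> (F v) (G v))"
  unfolding ip_def using assms by (intro continuous_intros)

text \<open>The part of \<open>f\<close> orthogonal to the frame satisfies the same equation, which
  is linear in it once the products of first derivatives are taken as coefficients; its first jet
  vanishes at the base point, hence it vanishes identically. The frame coordinates
  \<open>\<phi>\<close> of \<open>f\<close> satisfy the equation again, now in the small space form.
  Their initial value and derivative are recorded because the later cases compare reduced components
  through them.\<close>

lemma reduction_of_codimension:
  fixes f :: "'a \<Rightarrow> nat \<Rightarrow> real"
  assumes M: "riemannian_manifold M" and \<Gamma>: "continuous_symbols M \<Gamma>" and f: "affine_map_eq M \<Gamma> k n f"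
    and c0: "c0 \<in> atlas M" "u0 \<in> fst c0" and p: "p = f (snd c0 u0)"
    and e: "\<And>i. i < r \<Longrightarrow> e i \<in> tangent_space (space_form k n) p"
    and on: "orthonormal (space_form_form k n) r e"
    and span: "\<And>a. a < rdim M \<Longrightarrow> \<exists>w. vpderiv a (f \<circ> snd c0) u0 = (\<lambda>i. \<Sum>j<r. w j * e j i)"
  defines "J \<equiv> frame_map (base_point k p) (space_form_form k r) (adapted_frame k p e)"
  shows "\<exists>\<phi>. affine_map_eq M \<Gamma> k r \<phi> \<and> (\<forall>x\<in>topspace (rtop M). f x = J (\<phi> x)) \<and>
     \<phi> (snd c0 u0) = (\<lambda>j. if k \<noteq> 0 \<and> j = 0 then 1 / sqrt \<bar>k\<bar> else 0) \<and>
     (\<forall>a<rdim M. vpderiv a (\<phi> \<circ> snd c0) u0 = (\<lambda>j. if j < amb_dim k r then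
        (if k = 0 then ip (space_form_form k n) (vpderiv a (f \<circ> snd c0) u0) (e j)
         else if j = 0 then 0 else ip (space_form_form k n) (vpderiv a (f \<circ> snd c0) u0) (e (j - 1))) else 0)) \<and>
     (\<forall>c\<in>atlas M. \<forall>u\<in>fst c. \<forall>a<rdim M. \<forall>b<rdim M.
        ip (space_form_form k r) (vpderiv a (\<phi> \<circ> snd c) u) (vpderiv b (\<phi> \<circ> snd c) u) =
        ip (space_form_form k n) (vpderiv a (f \<circ> snd c) u) (vpderiv b (f \<circ> snd c) u))"
proof -
  let ?\<eta> = "space_form_form k r" and ?\<theta> = "space_form_form k n" and ?b = "adapted_frame k p e" and ?m = "rdim M"
  have pS: "p \<in> pts (space_form k n)" using affine_map_eqD(1)[OF f] manifold_chart(3)[OF M c0(1,2)] p by simp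
  note T = tangent_space_space_form[OF pS]
  note AI = adapted_frame_affine_inclusion[OF pS e on]
  have frame: "ip ?\<theta> (?b j) (?b l) = (if j = l then ?\<eta> j else 0)" if "?\<eta> j \<noteq> 0" "?\<eta> l \<noteq> 0" for j l
    using AI that unfolding affine_inclusion_def form_space_form by blast
  note fin = finite_space_form_form
  have ipl: "ip ?\<theta> (frame_lin ?\<eta> ?b x) (frame_lin ?\<eta> ?b y) = ip ?\<eta> x y" for x y
    by (rule ip_frame_lin[OF fin frame])
  \<comment> \<open>The matrix of the coordinate map. It is written as a frame so that the rules for
    derivatives of frame maps apply to coordinates as well; the factor \<open>\<eta> j\<close> is
    its own inverse.\<close>
  define B where "B l = (\<lambda>j. if ?\<eta> j = 0 then 0 else ?\<eta> j * ?\<theta> l * ?b j l)" for l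
  define coef where "coef = frame_lin ?\<theta> B"
  have coef: "coef v j = (if ?\<eta> j = 0 then 0 else ?\<eta> j * ip ?\<theta> v (?b j))" for v j
    by (auto simp: coef_def frame_lin_def B_def ip_def sum_distrib_left algebra_simps)
  have \<eta>1: "?\<eta> j * ?\<eta> j = 1" if "?\<eta> j \<noteq> 0" for j using that by (auto simp: space_form_form_def split: if_splits)
  \<comment> \<open>The projection to the orthogonal complement of the frame. \<open>R\<close> is
    linear and kills the frame vectors, in particular the vectors \<open>e\<close> and the position
    vector or its offset.\<close>
  define R where "R v = (\<lambda>i. v i - frame_lin ?\<eta> ?b (coef v) i)" for v
  have coef_lin: "coef (\<lambda>i. x i + y i) = (\<lambda>j. coef x j + coef y j)" "coef (\<lambda>i. x i - y i) = (\<lambda>j. coef x j - coef y j)"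
     "coef (\<lambda>i. s * x i) = (\<lambda>j. s * coef x j)" "coef (\<lambda>i. \<Sum>d\<in>A. w d * z d i) = (\<lambda>j. \<Sum>d\<in>A. w d * coef (z d) j)"
    for x y s w z and A :: "nat set"
    unfolding coef_def by (rule frame_lin_add frame_lin_diff frame_lin_scale frame_lin_sum)+
  have R_diff: "R (\<lambda>i. x i - y i) = (\<lambda>i. R x i - R y i)" and R_scale: "R (\<lambda>i. s * x i) = (\<lambda>i. s * R x i)"
    and R_sum: "R (\<lambda>i. \<Sum>d\<in>A. w d * z d i) = (\<lambda>i. \<Sum>d\<in>A. w d * R (z d) i)"
    for x y s w z and A :: "nat set"
    unfolding R_def coef_lin frame_lin_diff frame_lin_scale frame_lin_sum
    by (simp_all add: fun_eq_iff algebra_simps sum_subtractf)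
  have R_frame: "R (?b l) = (\<lambda>i. 0)" if l: "?\<eta> l \<noteq> 0" for l
  proof -
    have "coef (?b l) = (\<lambda>j. if j = l then 1 else 0)"
      using frame l \<eta>1 by (auto simp: coef fun_eq_iff)
    then have "frame_lin ?\<eta> ?b (coef (?b l)) i = ?b l i" for i
      using l fin by (simp add: frame_lin_def if_distrib[of "\<lambda>c. c * _"] cong: if_cong)
    then show ?thesis by (simp add: R_def)
  qed
  have ej: "R (e j) = (\<lambda>i. 0)" if "j < r" for j
    using R_frame[of j] R_frame[of "Suc j"] that
    by (cases "k = 0") (simp_all add: adapted_frame_def space_form_form_eq_0 amb_dim_def)
  have Rp: "R (\<lambda>i. p i - base_point k p i) = (\<lambda>i. 0)"
  proof (cases "k = 0")
    case True
    then show ?thesis using R_scale[of 0 "\<lambda>_. 0"] by (simp add: base_point_def)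
  next
    case False
    have "(\<lambda>i. p i - base_point k p i) = (\<lambda>i. (1 / sqrt \<bar>k\<bar>) * ?b 0 i)"
      using False by (simp add: base_point_def adapted_frame_def)
    then show ?thesis using R_frame[of 0] False
      by (simp only: R_scale) (simp add: space_form_form_def)
  qed
  define \<phi> where "\<phi> x = frame_map (\<lambda>j. - coef (base_point k p) j) ?\<theta> B (f x)" for x
  have \<phi>: "\<phi> x = coef (\<lambda>i. f x i - base_point k p i)" for x
    by (simp add: \<phi>_def frame_map_def coef_lin coef_def[symmetric])
  note chart = manifold_chart[OF M]
  have sm: "smooth_vec ?m (fst c) (f \<circ> snd c)" if "c \<in> atlas M" for c by (rule affine_map_eqD(2)[OF f that])
  have sm\<phi>: "smooth_vec ?m (fst c) (\<phi> \<circ> snd c)" if "c \<in> atlas M" for c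
    using smooth_vec_frame_map[OF chart(2)[OF that] sm[OF that], of "\<lambda>j. - coef (base_point k p) j" ?\<theta> B]
    by (simp add: \<phi>_def comp_def)
  have d\<phi>: "vpderiv a (\<phi> \<circ> snd c) u = coef (vpderiv a (f \<circ> snd c) u)"
    if "c \<in> atlas M" "u \<in> fst c" "a < ?m" for c u a
    unfolding coef_def
    by (rule vpderiv_frame_map[where c = "\<lambda>j. - coef (base_point k p) j", OF chart(2)[OF that(1)] that(2,3)
          smooth_vec_has_pderiv[OF sm[OF that(1)] that(2,3)]]) (simp add: \<phi>_def)
  have dd\<phi>: "vpderiv a (vpderiv b (\<phi> \<circ> snd c)) u = coef (vpderiv a (vpderiv b (f \<circ> snd c)) u)"
    if "c \<in> atlas M" "u \<in> fst c" "a < ?m" "b < ?m" for c u a b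
    unfolding coef_def
    by (rule vpderiv_frame_map[where c = "\<lambda>j. 0", OF chart(2)[OF that(1)] that(2,3)
          smooth_vec_has_pderiv[OF smooth_vec_vpderiv[OF sm[OF that(1)] that(4)] that(2,3)]])
      (simp add: frame_map_def d\<phi>[OF that(1) _ that(4)] coef_def)
  define h where "h i x = f x i - J (\<phi> x) i" for i x
  have hR: "h i x = R (\<lambda>i. f x i - base_point k p i) i" for i x
    by (simp add: h_def J_def frame_map_def R_def \<phi>)
  have hp: "has_pderiv a (h i \<circ> snd c) u (R (vpderiv a (f \<circ> snd c) u) i)"
    if "c \<in> atlas M" "u \<in> fst c" "a < ?m" for c u a i
  proof -
    have "has_pderiv a (\<lambda>v. (f \<circ> snd c) v i - frame_map (base_point k p) ?\<eta> ?b ((\<phi> \<circ> snd c) v) i) u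
       (vpderiv a (f \<circ> snd c) u i - frame_lin ?\<eta> ?b (vpderiv a (\<phi> \<circ> snd c) u) i)"
      using that sm sm\<phi> by (intro has_pderiv_diff has_pderiv_frame_map smooth_vec_has_pderiv)
    from this[unfolded d\<phi>[OF that]] show ?thesis by (simp add: R_def h_def J_def comp_def)
  qed
  have hp2: "has_pderiv a (pderiv_at b (h i \<circ> snd c)) u (R (vpderiv a (vpderiv b (f \<circ> snd c)) u) i)"
    if "c \<in> atlas M" "u \<in> fst c" "a < ?m" "b < ?m" for c u a b i
  proof -
    have "has_pderiv a (\<lambda>v. vpderiv b (f \<circ> snd c) v i - frame_map (\<lambda>_. 0) ?\<eta> ?b (vpderiv b (\<phi> \<circ> snd c) v) i) u
       (vpderiv a (vpderiv b (f \<circ> snd c)) u i - frame_lin ?\<eta> ?b (vpderiv a (vpderiv b (\<phi> \<circ> snd c)) u) i)"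
      using that sm sm\<phi> by (intro has_pderiv_diff has_pderiv_frame_map smooth_vec_has_pderiv smooth_vec_vpderiv)
    then have "has_pderiv a (\<lambda>v. vpderiv b (f \<circ> snd c) v i - frame_map (\<lambda>_. 0) ?\<eta> ?b (vpderiv b (\<phi> \<circ> snd c) v) i) u
        (R (vpderiv a (vpderiv b (f \<circ> snd c)) u) i)"
      unfolding dd\<phi>[OF that] R_def .
    then show ?thesis
    proof (rule has_pderiv_cong[OF chart(2)[OF that(1)] that(2,3), rotated])
      fix v assume v: "v \<in> fst c"
      show "vpderiv b (f \<circ> snd c) v i - frame_map (\<lambda>_. 0) ?\<eta> ?b (vpderiv b (\<phi> \<circ> snd c) v) i = pderiv_at b (h i \<circ> snd c) v"
        using has_pderiv_imp[OF hp[OF that(1) v that(4)]]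
        by (simp add: R_def d\<phi>[OF that(1) v that(4)] frame_map_def)
    qed
  qed
  have J0: "h i x = 0" if x: "x \<in> topspace (rtop M)" and i: "i \<in> {..<amb_dim k n}" for i x
  proof (rule unique_continuation[OF M, where h = h and I = "{..<amb_dim k n}", OF _ _ _ c0 _ _ x i])
    show "smooth_real ?m (fst c) (h i \<circ> snd c)" if c: "c \<in> atlas M" for c i
    proof -
      have "smooth_real ?m (fst c) (\<lambda>v. (f \<circ> snd c) v i + (-1) * frame_map (base_point k p) ?\<eta> ?b ((\<phi> \<circ> snd c) v) i)"
        using sm[OF c] smooth_vec_frame_map[OF chart(2)[OF c] sm\<phi>[OF c], of "base_point k p" ?\<eta> ?b]
        by (intro smooth_real_add smooth_real_cmult chart(2)[OF c]) (auto simp: smooth_vec_def)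
      then show ?thesis by (simp add: h_def J_def comp_def)
    qed
    show "pderiv_at a (pderiv_at b (h i \<circ> snd c)) \<in> O[nhds_in (fst c) u](jet_norm ?m {..<amb_dim k n} (\<lambda>i. h i \<circ> snd c))"
      if c: "c \<in> atlas M" and u: "u \<in> fst c" and i: "i \<in> {..<amb_dim k n}" and a: "a < ?m" and b: "b < ?m" for c u i a b
    proof (rule bigo_cong_on)
      \<comment> \<open>This factor contains derivatives of \<open>f\<close>, but it is a known
        continuous function; the equation for \<open>h\<close> is linear with it as a
        coefficient.\<close>
      let ?L = "\<lambda>v. k * ip ?\<theta> (vpderiv a (f \<circ> snd c) v) (vpderiv b (f \<circ> snd c) v)"
      show "(\<lambda>v. (\<Sum>d<?m. \<Gamma> c v a b d * pderiv_at d (h i \<circ> snd c) v) - ?L v * (h i \<circ> snd c) v)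
          \<in> O[nhds_in (fst c) u](jet_norm ?m {..<amb_dim k n} (\<lambda>i. h i \<circ> snd c))"
      proof (intro sum_in_bigo(2) big_sum_in_bigo bigo_cont_mult u)
        show "continuous_on (fst c) (\<lambda>v. \<Gamma> c v a b d)" if "d \<in> {..<?m}" for d
          using \<Gamma> c a b that by (simp add: continuous_symbols_def)
        show "pderiv_at d (h i \<circ> snd c) \<in> O[nhds_in (fst c) u](jet_norm ?m {..<amb_dim k n} (\<lambda>i. h i \<circ> snd c))"
          if "d \<in> {..<?m}" for d
          using pderiv_bigo_jet_norm[of "{..<amb_dim k n}" i d ?m "\<lambda>i. h i \<circ> snd c"] i that by simp
        show "continuous_on (fst c) ?L"
          by (intro continuous_intros continuous_on_ip continuous_on_vpderiv[OF sm[OF c]] a b)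
        show "(h i \<circ> snd c) \<in> O[nhds_in (fst c) u](jet_norm ?m {..<amb_dim k n} (\<lambda>i. h i \<circ> snd c))"
          using value_bigo_jet_norm[of "{..<amb_dim k n}" i "\<lambda>i. h i \<circ> snd c"] i by simp
      qed
      fix v assume v: "v \<in> fst c"
      have "pderiv_at a (pderiv_at b (h i \<circ> snd c)) v = R (vpderiv a (vpderiv b (f \<circ> snd c)) v) i"
        by (rule has_pderiv_imp[OF hp2[OF c v a b]])
      also have "\<dots> = (\<Sum>d<?m. \<Gamma> c v a b d * R (vpderiv d (f \<circ> snd c) v) i) - ?L v * R (f (snd c v)) i"
        unfolding affine_map_eqD(3)[OF f c v a b] R_diff R_sum R_scale ..
      \<comment> \<open>For \<open>k \<noteq> 0\<close> the base point is 0, so the two vectors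
        agree. For \<open>k = 0\<close> they may differ, but then \<open>?L\<close> is 0.\<close>
      also have "?L v * R (f (snd c v)) i = ?L v * h i (snd c v)"
        by (cases "k = 0") (simp_all add: hR base_point_def)
      also have "(\<Sum>d<?m. \<Gamma> c v a b d * R (vpderiv d (f \<circ> snd c) v) i) = (\<Sum>d<?m. \<Gamma> c v a b d * pderiv_at d (h i \<circ> snd c) v)"
        by (intro sum.cong refl) (simp add: has_pderiv_imp[OF hp[OF c v]])
      finally show "(\<Sum>d<?m. \<Gamma> c v a b d * pderiv_at d (h i \<circ> snd c) v) - ?L v * (h i \<circ> snd c) v
          = pderiv_at a (pderiv_at b (h i \<circ> snd c)) v" by (simp add: comp_def)
    qed
    show "h i (snd c0 u0) = 0" for i unfolding hR p[symmetric] Rp ..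
    show "pderiv_at a (h i \<circ> snd c0) u0 = 0" if am: "a < ?m" for i a
    proof -
      obtain w where w: "vpderiv a (f \<circ> snd c0) u0 = (\<lambda>i. \<Sum>j<r. w j * e j i)" using span[OF am] by blast
      have "pderiv_at a (h i \<circ> snd c0) u0 = R (vpderiv a (f \<circ> snd c0) u0) i"
        by (rule has_pderiv_imp[OF hp[OF c0 am]])
      also have "\<dots> = 0" unfolding w R_sum using ej by (intro sum.neutral) auto
      finally show ?thesis .
    qed
  qed auto
  have fJ: "f x = J (\<phi> x)" if x: "x \<in> topspace (rtop M)" for x
  proof
    fix i
    show "f x i = J (\<phi> x) i"
    proof (cases "i < amb_dim k n")
      case True
      then show ?thesis using J0[OF x, of i] by (simp add: h_def)
    next
      case False
      have "e l i = 0" if "l < r" for l using e[OF that] False unfolding T by auto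
      moreover have "p i = 0" using pS False by (simp add: pts_space_form)
      ultimately have "?b j i = 0" if "?\<eta> j \<noteq> 0" for j using that
        by (auto simp: adapted_frame_def space_form_form_eq_0 amb_dim_def)
      then have "frame_lin ?\<eta> ?b (\<phi> x) i = 0" unfolding frame_lin_def by (intro sum.neutral) auto
      then show ?thesis using False affine_map_eqD(1)[OF f x] \<open>p i = 0\<close>
        by (simp add: J_def frame_map_def base_point_def pts_space_form)
    qed
  qed
  have df: "vpderiv a (f \<circ> snd c) u = frame_lin ?\<eta> ?b (vpderiv a (\<phi> \<circ> snd c) u)"
    if "c \<in> atlas M" "u \<in> fst c" "a < ?m" for c u a
    by (rule vpderiv_frame_map[where c = "base_point k p", OF chart(2)[OF that(1)] that(2,3)
          smooth_vec_has_pderiv[OF sm\<phi>[OF that(1)] that(2,3)]])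
      (simp add: fJ[OF chart(3)[OF that(1)]] J_def)
  have "affine_map_eq M \<Gamma> k r \<phi>"
    unfolding affine_map_eq_def
  proof (intro conjI ballI allI impI)
    fix x assume x: "x \<in> topspace (rtop M)"
    note fx = affine_map_eqD(1)[OF f x]
    have s: "\<phi> x j = 0" if "j \<ge> amb_dim k r" for j
      using that by (simp add: \<phi> coef space_form_form_eq_0)
    show "\<phi> x \<in> pts (space_form k r)"
    proof (cases "k = 0")
      case False
      have "f x = frame_lin ?\<eta> ?b (\<phi> x)" using fJ[OF x] False by (simp add: J_def frame_map_def base_point_def)
      then have i: "ip ?\<eta> (\<phi> x) (\<phi> x) = 1 / k" using ipl[of "\<phi> x" "\<phi> x"] fx False by (simp add: pts_space_form)
      \<comment> \<open>The coordinate 0 of \<open>\<phi> x\<close> is a negative multiple of the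
        product of \<open>f x\<close> with \<open>p\<close>, which is negative because both points
        lie on one sheet.\<close>
      have "\<phi> x 0 > 0" if k: "k < 0"
      proof -
        have "ip ?\<theta> (f x) p < 0" using same_sheet_iff[OF k pS] fx k by (auto simp: pts_space_form)
        moreover have "\<phi> x 0 = - (sqrt \<bar>k\<bar> * ip ?\<theta> (f x) p)"
          using k by (simp add: \<phi> coef base_point_def adapted_frame_def ip_scale_right space_form_form_def)
        ultimately show ?thesis using k by (simp add: mult_less_0_iff)
      qed
      with s i show ?thesis by (simp add: pts_space_form)
    qed (use s in \<open>simp add: pts_space_form\<close>)
  next
    fix c assume c: "c \<in> atlas M"
    show "smooth_vec ?m (fst c) (\<phi> \<circ> snd c)" by (rule sm\<phi>[OF c])
    fix u a b assume u: "u \<in> fst c" and a: "a < ?m" and b: "b < ?m"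
    have "vpderiv a (vpderiv b (\<phi> \<circ> snd c)) u = (\<lambda>i. (\<Sum>d<?m. \<Gamma> c u a b d * coef (vpderiv d (f \<circ> snd c) u) i) -
            k * ip ?\<theta> (vpderiv a (f \<circ> snd c) u) (vpderiv b (f \<circ> snd c) u) * coef (f (snd c u)) i)"
      unfolding dd\<phi>[OF c u a b] affine_map_eqD(3)[OF f c u a b] coef_lin ..
    also have "\<dots> = (\<lambda>i. (\<Sum>d<?m. \<Gamma> c u a b d * vpderiv d (\<phi> \<circ> snd c) u i) -
            k * ip ?\<eta> (vpderiv a (\<phi> \<circ> snd c) u) (vpderiv b (\<phi> \<circ> snd c) u) * \<phi> (snd c u) i)"
    proof
      fix i
      have "(\<Sum>d<?m. \<Gamma> c u a b d * coef (vpderiv d (f \<circ> snd c) u) i) = (\<Sum>d<?m. \<Gamma> c u a b d * vpderiv d (\<phi> \<circ> snd c) u i)"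
        by (intro sum.cong refl) (simp add: d\<phi>[OF c u])
      moreover have "ip ?\<theta> (vpderiv a (f \<circ> snd c) u) (vpderiv b (f \<circ> snd c) u)
          = ip ?\<eta> (vpderiv a (\<phi> \<circ> snd c) u) (vpderiv b (\<phi> \<circ> snd c) u)"
        by (simp add: df[OF c u a] df[OF c u b] ipl)
      moreover have "k * coef (f (snd c u)) i = k * \<phi> (snd c u) i"
        by (cases "k = 0") (simp_all add: \<phi> base_point_def)
      ultimately show "(\<Sum>d<?m. \<Gamma> c u a b d * coef (vpderiv d (f \<circ> snd c) u) i) -
            k * ip ?\<theta> (vpderiv a (f \<circ> snd c) u) (vpderiv b (f \<circ> snd c) u) * coef (f (snd c u)) i
          = (\<Sum>d<?m. \<Gamma> c u a b d * vpderiv d (\<phi> \<circ> snd c) u i) -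
            k * ip ?\<eta> (vpderiv a (\<phi> \<circ> snd c) u) (vpderiv b (\<phi> \<circ> snd c) u) * \<phi> (snd c u) i"
        by auto
    qed
    finally show "vpderiv a (vpderiv b (\<phi> \<circ> snd c)) u = \<dots>" .
  qed
  moreover have "\<phi> (snd c0 u0) = (\<lambda>j. if k \<noteq> 0 \<and> j = 0 then 1 / sqrt \<bar>k\<bar> else 0)"
  proof
    fix j
    show "\<phi> (snd c0 u0) j = (if k \<noteq> 0 \<and> j = 0 then 1 / sqrt \<bar>k\<bar> else 0)"
    proof (cases "k = 0")
      case True
      then show ?thesis by (simp add: \<phi> p[symmetric] base_point_def coef ip_zero_left)
    next
      case False
      have pp: "ip ?\<theta> p p = 1 / k" using pS False by (simp add: pts_space_form)
      have pe: "ip ?\<theta> p (e i) = 0" if "i < r" for i using e[OF that] False unfolding T by (simp add: ip_comm[of _ p])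
      have "\<phi> (snd c0 u0) j = coef p j" using False by (simp add: \<phi> p[symmetric] base_point_def)
      also have "\<dots> = (if j = 0 then 1 / sqrt \<bar>k\<bar> else 0)"
      proof (cases j)
        case 0
        have "coef p 0 = (if k < 0 then -1 else 1) * (sqrt \<bar>k\<bar> * (1 / k))"
          using False by (simp add: coef adapted_frame_def ip_scale_right pp space_form_form_def)
        also have "\<dots> = sqrt \<bar>k\<bar> / \<bar>k\<bar>" by simp
        also have "\<dots> = 1 / sqrt \<bar>k\<bar>" using False by (simp add: real_div_sqrt field_simps)
        finally show ?thesis using 0 by simp
      next
        case (Suc i)
        then show ?thesis using pe[of i] False
          by (auto simp: coef adapted_frame_def space_form_form_eq_0 amb_dim_def)
      qed
      finally show ?thesis using False by simp
    qed
  qed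
  moreover have "vpderiv a (\<phi> \<circ> snd c0) u0 = (\<lambda>j. if j < amb_dim k r then
        (if k = 0 then ip ?\<theta> (vpderiv a (f \<circ> snd c0) u0) (e j)
         else if j = 0 then 0 else ip ?\<theta> (vpderiv a (f \<circ> snd c0) u0) (e (j - 1))) else 0)" if a: "a < ?m" for a
  proof
    fix j
    have "ip ?\<theta> (vpderiv a (f \<circ> snd c0) u0) p = 0" if "k \<noteq> 0"
      using affine_map_eq_tangent[OF M f c0 a] that unfolding p[symmetric] T by simp
    then show "vpderiv a (\<phi> \<circ> snd c0) u0 j = (if j < amb_dim k r then
        (if k = 0 then ip ?\<theta> (vpderiv a (f \<circ> snd c0) u0) (e j)
         else if j = 0 then 0 else ip ?\<theta> (vpderiv a (f \<circ> snd c0) u0) (e (j - 1))) else 0)"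
      unfolding d\<phi>[OF c0 a] coef
      by (auto simp: space_form_form_eq_0 not_le adapted_frame_def ip_scale_right space_form_form_def amb_dim_def)
  qed
  moreover have "ip ?\<eta> (vpderiv a (\<phi> \<circ> snd c) u) (vpderiv b (\<phi> \<circ> snd c) u) =
      ip ?\<theta> (vpderiv a (f \<circ> snd c) u) (vpderiv b (f \<circ> snd c) u)"
    if "c \<in> atlas M" "u \<in> fst c" "a < ?m" "b < ?m" for c u a b
    unfolding df[OF that(1-3)] df[OF that(1,2,4)] ipl ..
  ultimately show ?thesis using fJ by blast
qed

subsection \<open>Christoffel symbols of a totally geodesic immersion\<close>

lemma has_pderiv_ip:
  assumes "\<And>i. has_pderiv a (\<lambda>v. F v i) u (F' i)" "\<And>i. has_pderiv a (\<lambda>v. G v i) u (G' i)"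
  shows "has_pderiv a (\<lambda>v. ip \<eta> (F v) (G v)) u (ip \<eta> F' (G u) + ip \<eta> (F u) G')"
proof -
  have "has_pderiv a (\<lambda>v. \<Sum>i | \<eta> i \<noteq> 0. \<eta> i * (F v i * G v i)) u
     (\<Sum>i | \<eta> i \<noteq> 0. \<eta> i * (F' i * G u i + F u i * G' i))"
    by (intro has_pderiv_sum has_pderiv_cmult has_pderiv_mult assms)
  moreover have "(\<Sum>i | \<eta> i \<noteq> 0. \<eta> i * (F' i * G u i + F u i * G' i)) = ip \<eta> F' (G u) + ip \<eta> (F u) G'"
    by (simp add: ip_def sum.distrib[symmetric] algebra_simps)
  ultimately show ?thesis by (simp add: ip_def mult.assoc)
qed

lemma smooth_vec_has_pderiv_ip:
  assumes "smooth_vec m U F" "smooth_vec m U G" "u \<in> U" "a < m"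
  shows "has_pderiv a (\<lambda>v. ip \<eta> (F v) (G v)) u (ip \<eta> (vpderiv a F u) (G u) + ip \<eta> (F u) (vpderiv a G u))"
  using assms by (intro has_pderiv_ip smooth_vec_has_pderiv)

text \<open>Differentiating the orthogonality of a first derivative to the position vector gives the
  product of the second derivative with \<open>F u\<close> as minus the product of the first
  derivatives. This is the Gauss formula of the quadric in flat space.\<close>

lemma space_form_second_derivative:
  assumes U: "openin (Euclidean_space m) U" "u \<in> U" and ab: "a < m" "b < m"
    and F: "smooth_vec m U F" and S: "\<And>v. v \<in> U \<Longrightarrow> F v \<in> pts (space_form k n)"
  shows "sf_proj k n (F u) (vpderiv a (vpderiv b F) u) =
    (\<lambda>i. vpderiv a (vpderiv b F) u i + k * ip (space_form_form k n) (vpderiv a F u) (vpderiv b F u) * F u i)"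
proof -
  let ?\<theta> = "space_form_form k n" and ?x = "vpderiv a (vpderiv b F) u"
  have T: "vpderiv b F v \<in> tangent_space (space_form k n) (F v)" if "v \<in> U" for v
    by (rule vpderiv_tangent[OF U(1) that ab(2) F S])
  note TT = tangent_space_space_form[OF S]
  have supp: "?x i = 0" if "i \<ge> amb_dim k n" for i
  proof -
    have "pderiv_at a (\<lambda>v. vpderiv b F v i) u = pderiv_at a (\<lambda>_. 0) u"
      by (rule pderiv_at_cong[OF U ab(1)]) (use T TT that in auto)
    then show ?thesis by (simp add: vpderiv_def[of a] has_pderiv_imp[OF has_pderiv_const])
  qed
  have "k * ip ?\<theta> ?x (F u) = - k * ip ?\<theta> (vpderiv a F u) (vpderiv b F u)"
  proof (cases "k = 0")
    case False
    have "has_pderiv a (\<lambda>v. ip ?\<theta> (vpderiv b F v) (F v)) u (ip ?\<theta> ?x (F u) + ip ?\<theta> (vpderiv b F u) (vpderiv a F u))"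
      by (rule smooth_vec_has_pderiv_ip[OF smooth_vec_vpderiv[OF F ab(2)] F U(2) ab(1)])
    moreover have "has_pderiv a (\<lambda>v. ip ?\<theta> (vpderiv b F v) (F v)) u 0"
      by (rule has_pderiv_cong[OF U ab(1) _ has_pderiv_const]) (use T TT False in auto)
    ultimately have "ip ?\<theta> ?x (F u) + ip ?\<theta> (vpderiv b F u) (vpderiv a F u) = 0"
      by (rule has_pderiv_unique)
    then have "ip ?\<theta> ?x (F u) = - ip ?\<theta> (vpderiv a F u) (vpderiv b F u)"
      unfolding ip_comm[of _ "vpderiv b F u"] by linarith
    then show ?thesis by simp
  qed simp
  moreover have "F u i = 0" if "i \<ge> amb_dim k n" for i using S[OF U(2)] that by (simp add: pts_space_form)
  ultimately show ?thesis using supp by (auto simp: sf_proj_def fun_eq_iff not_less)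
qed

lemma vpderiv_vfst: "vpderiv a ((vfst \<circ> f) \<circ> g) u = vfst (vpderiv a (f \<circ> g) u)"
  and vpderiv_vsnd: "vpderiv a ((vsnd \<circ> f) \<circ> g) u = vsnd (vpderiv a (f \<circ> g) u)"
  by (simp_all add: vpderiv_def vfst_def vsnd_def comp_def)

lemma vpderiv2_vfst: "vpderiv a (vpderiv b ((vfst \<circ> f) \<circ> g)) u = vfst (vpderiv a (vpderiv b (f \<circ> g)) u)"
  and vpderiv2_vsnd: "vpderiv a (vpderiv b ((vsnd \<circ> f) \<circ> g)) u = vsnd (vpderiv a (vpderiv b (f \<circ> g)) u)"
  by (simp_all add: vpderiv_def vfst_def vsnd_def comp_def)

definition differentiable_symbols :: "'a riem \<Rightarrow> ('a param \<Rightarrow> (nat \<Rightarrow> real) \<Rightarrow> nat \<Rightarrow> nat \<Rightarrow> nat \<Rightarrow> real) \<Rightarrow> bool" where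
  "differentiable_symbols M \<Gamma> \<longleftrightarrow> (\<forall>c\<in>atlas M. \<forall>u\<in>fst c. \<forall>a<rdim M. \<forall>b<rdim M. \<forall>d<rdim M. \<forall>e<rdim M.
     has_pderiv e (\<lambda>v. \<Gamma> c v a b d) u (pderiv_at e (\<lambda>v. \<Gamma> c v a b d) u))"

text \<open>The vanishing second fundamental form puts the covariant derivative of the pair into the
  image of its differential; the coefficients there are the symbols. Splitting that single identity
  into components gives both equations with the same \<open>\<Gamma>\<close>.\<close>

lemma christoffel_symbols_exist:
  fixes f :: "'a \<Rightarrow> nat + nat \<Rightarrow> real" and k1 k2 :: real and n1 n2 :: nat
  defines "S \<equiv> prod_submfd (space_form k1 n1) (space_form k2 n2)"
  assumes M: "riemannian_manifold M" and iso: "isometric_immersion M S f" and tg: "totally_geodesic M S f"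
  shows "\<exists>\<Gamma>. continuous_symbols M \<Gamma> \<and> differentiable_symbols M \<Gamma> \<and>
     affine_map_eq M \<Gamma> k1 n1 (vfst \<circ> f) \<and> affine_map_eq M \<Gamma> k2 n2 (vsnd \<circ> f)"
proof -
  let ?m = "rdim M"
  define P where "P = prod_proj (sf_proj k1 n1) (sf_proj k2 n2)"
  have tp: "tangent_projection S P"
    unfolding S_def P_def by (intro tangent_projection_prod tangent_projection_space_form)
  note chart = manifold_chart[OF M]
  have im: "f x \<in> pts S" if "x \<in> topspace (rtop M)" for x using iso that by (auto simp: isometric_immersion_def)
  have sm: "smooth_vec ?m (fst c) (f \<circ> snd c)" if "c \<in> atlas M" for c
    using iso that by (simp add: isometric_immersion_def)
  have gram: "ip (form S) (vpderiv a (f \<circ> snd c) u) (vpderiv b (f \<circ> snd c) u) = gram M c u a b"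
    if "c \<in> atlas M" "u \<in> fst c" "a < ?m" "b < ?m" for c u a b
    using iso that by (simp add: isometric_immersion_def)
  have metric: "riemannian_metric M" using M by (simp add: riemannian_manifold_def)
  have pos: "(\<Sum>a<?m. \<Sum>b<?m. gram M c u a b * w a * w b) > 0"
    if "c \<in> atlas M" "u \<in> fst c" "\<exists>a<?m. w a \<noteq> 0" for c u w
    using metric that by (simp add: riemannian_metric_def)
  have tang: "vpderiv a (f \<circ> snd c) u \<in> tangent_space S (f (snd c u))"
    if "c \<in> atlas M" "u \<in> fst c" "a < ?m" for c u a
    using vpderiv_tangent[OF chart(2)[OF that(1)] that(2,3) sm[OF that(1)]] im chart(3)[OF that(1)] by auto
  define Q where "Q c u a b \<gamma> \<longleftrightarrow> P (f (snd c u)) (vpderiv a (vpderiv b (f \<circ> snd c)) u)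
       = (\<lambda>i. \<Sum>d<?m. \<gamma> d * vpderiv d (f \<circ> snd c) u i)" for c :: "'a param" and u a b \<gamma>
  have exQ: "\<exists>\<gamma>. Q c u a b \<gamma>" if c: "c \<in> atlas M" and u: "u \<in> fst c" and ab: "a < ?m" "b < ?m" for c u a b
  proof -
    have "P (f (snd c u)) (vpderiv a (vpderiv b (f \<circ> snd c)) u) \<in> diff_image M f c u"
    proof (rule second_fundamental_form_zeroD[OF tp])
      show "f (snd c u) \<in> pts S" by (rule im[OF chart(3)[OF c u]])
      show "vpderiv a (f \<circ> snd c) u \<in> tangent_space S (f (snd c u))" if "a < ?m" for a by (rule tang[OF c u that])
      show "second_fundamental_form M S f c u a b = (\<lambda>i. 0)" using tg c u ab by (simp add: totally_geodesic_def)
      fix w :: "nat \<Rightarrow> real" assume "\<exists>a<?m. w a \<noteq> 0"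
      from pos[OF c u this]
      show "(\<Sum>a<?m. \<Sum>b<?m. ip (form S) (vpderiv a (f \<circ> snd c) u) (vpderiv b (f \<circ> snd c) u) * w a * w b) > 0"
        using gram[OF c u] by simp
    qed
    then show ?thesis by (auto simp: diff_image_def Q_def)
  qed
  \<comment> \<open>A choice at each point separately; regularity in \<open>u\<close> is recovered
    afterwards from the linear system that determines the coefficients.\<close>
  define \<Gamma> where "\<Gamma> c u a b = (SOME \<gamma>. Q c u a b \<gamma>)" for c :: "'a param" and u a b
  have Q: "Q c u a b (\<Gamma> c u a b)" if "c \<in> atlas M" "u \<in> fst c" "a < ?m" "b < ?m" for c u a b
    unfolding \<Gamma>_def using exQ[OF that] by (rule someI_ex)
  have reg: "continuous_on (fst c) (\<lambda>u. \<Gamma> c u a b d) \<and>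
      (\<forall>u\<in>fst c. \<forall>e<?m. has_pderiv e (\<lambda>v. \<Gamma> c v a b d) u (pderiv_at e (\<lambda>v. \<Gamma> c v a b d) u))"
    if c: "c \<in> atlas M" and ab: "a < ?m" "b < ?m" and d: "d < ?m" for c a b d
  proof -
    let ?U = "fst c"
    \<comment> \<open>Closed under the field operations and just strong enough: continuity serves
      the unique continuation, partial derivatives the curvature.\<close>
    define A where "A = {F. continuous_on ?U F \<and> (\<forall>u\<in>?U. \<forall>e<?m. \<exists>D. has_pderiv e F u D)}"
    have smA: "F \<in> A" if "smooth_real ?m ?U F" for F
      using smooth_real_continuous[OF that] smooth_real_has_pderiv[OF that] by (auto simp: A_def)
    have "(\<lambda>u. \<Gamma> c u a b d) \<in> A"
    proof (rule solution_in_class[where U = ?U and n = ?m and j = d and x = "\<lambda>d u. \<Gamma> c u a b d"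
          and G = "\<lambda>i j u. gram M c u i j"
          and r = "\<lambda>e u. ip (form S) (vpderiv a (vpderiv b (f \<circ> snd c)) u) (vpderiv e (f \<circ> snd c) u)"])
      show "(\<lambda>u. F u - G u) \<in> A" if "F \<in> A" "G \<in> A" for F G
        using that has_pderiv_diff unfolding A_def by (auto intro!: continuous_intros) blast
      show "(\<lambda>u. F u * G u) \<in> A" if "F \<in> A" "G \<in> A" for F G
        using that has_pderiv_mult unfolding A_def by (auto intro!: continuous_intros) blast
      show "(\<lambda>u. F u / G u) \<in> A" if FG: "F \<in> A" "G \<in> A" "\<forall>u\<in>?U. G u \<noteq> 0" for F G
        unfolding A_def
      proof (intro CollectI conjI ballI allI impI)
        show "continuous_on ?U (\<lambda>u. F u / G u)" using that by (auto simp: A_def intro!: continuous_intros)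
        fix u e assume ue: "u \<in> ?U" "e < ?m"
        obtain D E where "has_pderiv e F u D" "has_pderiv e G u E" using FG(1,2) ue unfolding A_def by blast
        from DERIV_divide[OF this[unfolded has_pderiv_def]] FG(3) ue
        show "\<exists>D. has_pderiv e (\<lambda>u. F u / G u) u D" unfolding has_pderiv_def by fastforce
      qed
      show "G \<in> A" if FG: "F \<in> A" "\<forall>u\<in>?U. F u = G u" for F G
        unfolding A_def
      proof (intro CollectI conjI ballI allI impI)
        show "continuous_on ?U G" using that continuous_on_cong[of ?U ?U F G] by (simp add: A_def)
        fix u e assume ue: "u \<in> ?U" "e < ?m"
        obtain D where "has_pderiv e F u D" using FG(1) ue unfolding A_def by blast
        from has_pderiv_cong[OF chart(2)[OF c] ue _ this] FG(2)
        show "\<exists>D. has_pderiv e G u D" by blast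
      qed
      show "(\<lambda>u. gram M c u i j) \<in> A" if "i < ?m" "j < ?m" for i j
        using metric c that by (intro smA) (simp add: riemannian_metric_def)
      show "(\<lambda>u. ip (form S) (vpderiv a (vpderiv b (f \<circ> snd c)) u) (vpderiv e (f \<circ> snd c) u)) \<in> A" if "e < ?m" for e
        unfolding A_def
      proof (intro CollectI conjI ballI allI impI)
        note sm2 = smooth_vec_vpderiv[OF smooth_vec_vpderiv[OF sm[OF c] ab(2)] ab(1)]
        note sm1 = smooth_vec_vpderiv[OF sm[OF c] that]
        show "continuous_on ?U (\<lambda>u. ip (form S) (vpderiv a (vpderiv b (f \<circ> snd c)) u) (vpderiv e (f \<circ> snd c) u))"
          by (intro continuous_on_ip continuous_on_vpderiv[OF smooth_vec_vpderiv[OF sm[OF c] ab(2)] ab(1)]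
              continuous_on_vpderiv[OF sm[OF c] that])
        fix u e' assume ue: "u \<in> ?U" "e' < ?m"
        from smooth_vec_has_pderiv_ip[OF sm2 sm1 ue]
        show "\<exists>D. has_pderiv e' (\<lambda>u. ip (form S) (vpderiv a (vpderiv b (f \<circ> snd c)) u) (vpderiv e (f \<circ> snd c) u)) u D"
          by blast
      qed
      show "gram M c u i j = gram M c u j i" if "i < ?m" "j < ?m" "u \<in> ?U" for i j u
        using metric c that by (simp add: riemannian_metric_def)
      show "(\<Sum>i<?m. \<Sum>j<?m. gram M c u i j * w i * w j) > 0" if "u \<in> ?U" "\<exists>i<?m. w i \<noteq> 0" for u w
        by (rule pos[OF c that])
      \<comment> \<open>The system for the symbols: pairing with a coordinate vector of
        \<open>f\<close> does not see the difference between the second derivative and its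
        tangential part.\<close>
      show "(\<Sum>j<?m. gram M c u e j * \<Gamma> c u a b j)
         = ip (form S) (vpderiv a (vpderiv b (f \<circ> snd c)) u) (vpderiv e (f \<circ> snd c) u)" if u: "u \<in> ?U" and e: "e < ?m" for u e
      proof -
        have "ip (form S) (\<lambda>i. vpderiv a (vpderiv b (f \<circ> snd c)) u i -
            P (f (snd c u)) (vpderiv a (vpderiv b (f \<circ> snd c)) u) i) (vpderiv e (f \<circ> snd c) u) = 0"
          using tp im[OF chart(3)[OF c u]] tang[OF c u e] unfolding tangent_projection_def by blast
        then have "ip (form S) (vpderiv a (vpderiv b (f \<circ> snd c)) u) (vpderiv e (f \<circ> snd c) u)
           = ip (form S) (P (f (snd c u)) (vpderiv a (vpderiv b (f \<circ> snd c)) u)) (vpderiv e (f \<circ> snd c) u)"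
          by (simp add: ip_diff_left)
        also have "\<dots> = (\<Sum>j<?m. \<Gamma> c u a b j * gram M c u j e)"
          unfolding Q[OF c u ab, unfolded Q_def] ip_sum_left
          by (intro sum.cong refl) (simp add: gram[OF c u _ e])
        also have "\<dots> = (\<Sum>j<?m. gram M c u e j * \<Gamma> c u a b j)"
          using metric c u e by (intro sum.cong refl) (simp add: riemannian_metric_def mult.commute)
        finally show ?thesis ..
      qed
    qed (rule d)
    then show ?thesis by (auto simp: A_def dest!: bspec) (metis has_pderiv_imp)
  qed
  have "continuous_symbols M \<Gamma>" using reg by (simp add: continuous_symbols_def)
  moreover have "differentiable_symbols M \<Gamma>" using reg by (simp add: differentiable_symbols_def)
  moreover have "affine_map_eq M \<Gamma> k1 n1 (vfst \<circ> f)" "affine_map_eq M \<Gamma> k2 n2 (vsnd \<circ> f)"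
  proof -
    have pt: "(vfst \<circ> f) x \<in> pts (space_form k1 n1)" "(vsnd \<circ> f) x \<in> pts (space_form k2 n2)"
      if "x \<in> topspace (rtop M)" for x using im[OF that] by (auto simp: S_def pts_prod)
    have sm12: "smooth_vec ?m (fst c) ((vfst \<circ> f) \<circ> snd c)" "smooth_vec ?m (fst c) ((vsnd \<circ> f) \<circ> snd c)"
      if "c \<in> atlas M" for c using sm[OF that] by (auto simp: smooth_vec_def vfst_def vsnd_def comp_def)
    have eq: "vpderiv a (vpderiv b ((vfst \<circ> f) \<circ> snd c)) u = (\<lambda>i. (\<Sum>d<?m. \<Gamma> c u a b d * vpderiv d ((vfst \<circ> f) \<circ> snd c) u i) -
        k1 * ip (space_form_form k1 n1) (vpderiv a ((vfst \<circ> f) \<circ> snd c) u) (vpderiv b ((vfst \<circ> f) \<circ> snd c) u) * (vfst \<circ> f) (snd c u) i)"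
      "vpderiv a (vpderiv b ((vsnd \<circ> f) \<circ> snd c)) u = (\<lambda>i. (\<Sum>d<?m. \<Gamma> c u a b d * vpderiv d ((vsnd \<circ> f) \<circ> snd c) u i) -
        k2 * ip (space_form_form k2 n2) (vpderiv a ((vsnd \<circ> f) \<circ> snd c) u) (vpderiv b ((vsnd \<circ> f) \<circ> snd c) u) * (vsnd \<circ> f) (snd c u) i)"
      if c: "c \<in> atlas M" and u: "u \<in> fst c" and ab: "a < ?m" "b < ?m" for c u a b
    proof -
      let ?x = "vpderiv a (vpderiv b (f \<circ> snd c)) u"
      have q: "vpair (sf_proj k1 n1 (vfst (f (snd c u))) (vfst ?x)) (sf_proj k2 n2 (vsnd (f (snd c u))) (vsnd ?x))
        = (\<lambda>i. \<Sum>d<?m. \<Gamma> c u a b d * vpderiv d (f \<circ> snd c) u i)"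
        using Q[OF c u ab] by (simp add: Q_def P_def prod_proj_def)
      have q1: "sf_proj k1 n1 (vfst (f (snd c u))) (vfst ?x) = (\<lambda>i. \<Sum>d<?m. \<Gamma> c u a b d * vfst (vpderiv d (f \<circ> snd c) u) i)"
        using arg_cong[OF q, of vfst] unfolding vfst_vpair vfst_sum .
      have q2: "sf_proj k2 n2 (vsnd (f (snd c u))) (vsnd ?x) = (\<lambda>i. \<Sum>d<?m. \<Gamma> c u a b d * vsnd (vpderiv d (f \<circ> snd c) u) i)"
        using arg_cong[OF q, of vsnd] unfolding vsnd_vpair vsnd_sum .
      have s1: "sf_proj k1 n1 (((vfst \<circ> f) \<circ> snd c) u) (vpderiv a (vpderiv b ((vfst \<circ> f) \<circ> snd c)) u) =
         (\<lambda>i. vpderiv a (vpderiv b ((vfst \<circ> f) \<circ> snd c)) u i + k1 * ip (space_form_form k1 n1)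
            (vpderiv a ((vfst \<circ> f) \<circ> snd c) u) (vpderiv b ((vfst \<circ> f) \<circ> snd c) u) * ((vfst \<circ> f) \<circ> snd c) u i)"
        by (rule space_form_second_derivative[OF chart(2)[OF c] u ab sm12(1)[OF c]])
          (use pt(1)[OF chart(3)[OF c]] in simp)
      have s2: "sf_proj k2 n2 (((vsnd \<circ> f) \<circ> snd c) u) (vpderiv a (vpderiv b ((vsnd \<circ> f) \<circ> snd c)) u) =
         (\<lambda>i. vpderiv a (vpderiv b ((vsnd \<circ> f) \<circ> snd c)) u i + k2 * ip (space_form_form k2 n2)
            (vpderiv a ((vsnd \<circ> f) \<circ> snd c) u) (vpderiv b ((vsnd \<circ> f) \<circ> snd c) u) * ((vsnd \<circ> f) \<circ> snd c) u i)"
        by (rule space_form_second_derivative[OF chart(2)[OF c] u ab sm12(2)[OF c]])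
          (use pt(2)[OF chart(3)[OF c]] in simp)
      show "vpderiv a (vpderiv b ((vfst \<circ> f) \<circ> snd c)) u = (\<lambda>i. (\<Sum>d<?m. \<Gamma> c u a b d * vpderiv d ((vfst \<circ> f) \<circ> snd c) u i) -
        k1 * ip (space_form_form k1 n1) (vpderiv a ((vfst \<circ> f) \<circ> snd c) u) (vpderiv b ((vfst \<circ> f) \<circ> snd c) u) * (vfst \<circ> f) (snd c u) i)"
        using s1 q1 unfolding vpderiv2_vfst vpderiv_vfst comp_apply by (auto simp: fun_eq_iff)
      show "vpderiv a (vpderiv b ((vsnd \<circ> f) \<circ> snd c)) u = (\<lambda>i. (\<Sum>d<?m. \<Gamma> c u a b d * vpderiv d ((vsnd \<circ> f) \<circ> snd c) u i) -
        k2 * ip (space_form_form k2 n2) (vpderiv a ((vsnd \<circ> f) \<circ> snd c) u) (vpderiv b ((vsnd \<circ> f) \<circ> snd c) u) * (vsnd \<circ> f) (snd c u) i)"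
        using s2 q2 unfolding vpderiv2_vsnd vpderiv_vsnd comp_apply by (auto simp: fun_eq_iff)
    qed
    show "affine_map_eq M \<Gamma> k1 n1 (vfst \<circ> f)" unfolding affine_map_eq_def using pt sm12 eq by blast
    show "affine_map_eq M \<Gamma> k2 n2 (vsnd \<circ> f)" unfolding affine_map_eq_def using pt sm12 eq by blast
  qed
  ultimately show ?thesis by blast
qed

subsection \<open>The curvature identity\<close>

text \<open>The coefficient of the coordinate field \<open>d\<close> in \<open>R(c, a) b\<close>,
  where \<open>R\<close> is the Riemann tensor of the connection with symbols
  \<open>G\<close>.\<close>

definition curvature :: "nat \<Rightarrow> ((nat \<Rightarrow> real) \<Rightarrow> nat \<Rightarrow> nat \<Rightarrow> nat \<Rightarrow> real) \<Rightarrow> (nat \<Rightarrow> real) \<Rightarrow> nat \<Rightarrow> nat \<Rightarrow> nat \<Rightarrow> nat \<Rightarrow> real" where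
  "curvature m G u c a b d = pderiv_at c (\<lambda>v. G v a b d) u - pderiv_at a (\<lambda>v. G v c b d) u +
     (\<Sum>p<m. G u a b p * G u c p d) - (\<Sum>p<m. G u c b p * G u a p d)"

text \<open>Comparison of the third derivatives \<open>\<partial>\<^sub>c\<partial>\<^sub>a\<partial>\<^sub>bf\<close> and \<open>\<partial>\<^sub>a\<partial>\<^sub>c\<partial>\<^sub>bf\<close>.\<close>

lemma curvature_identity:
  assumes M: "riemannian_manifold M" and \<Gamma>: "differentiable_symbols M \<Gamma>" and f: "affine_map_eq M \<Gamma> k n f"
    and ch: "ch \<in> atlas M" "u \<in> fst ch" and abc: "a < rdim M" "b < rdim M" "c < rdim M"
  shows "(\<Sum>d<rdim M. curvature (rdim M) (\<Gamma> ch) u c a b d * vpderiv d (f \<circ> snd ch) u i) =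
    k * (ip (space_form_form k n) (vpderiv a (f \<circ> snd ch) u) (vpderiv b (f \<circ> snd ch) u) * vpderiv c (f \<circ> snd ch) u i
       - ip (space_form_form k n) (vpderiv c (f \<circ> snd ch) u) (vpderiv b (f \<circ> snd ch) u) * vpderiv a (f \<circ> snd ch) u i)"
proof -
  let ?m = "rdim M" and ?\<theta> = "space_form_form k n" and ?U = "fst ch"
  define F where "F = f \<circ> snd ch"
  define G where "G = \<Gamma> ch"
  define L where "L a b v = ip ?\<theta> (vpderiv a F v) (vpderiv b F v)" for a b v
  note chart = manifold_chart[OF M ch(1)]
  have F: "smooth_vec ?m ?U F" unfolding F_def by (rule affine_map_eqD(2)[OF f ch(1)])
  have eq: "vpderiv a (vpderiv b F) v i = (\<Sum>d<?m. G v a b d * vpderiv d F v i) - k * (L a b v * F v i)"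
    if "v \<in> ?U" "a < ?m" "b < ?m" for a b v i
    using affine_map_eqD(3)[OF f ch(1) that] by (simp add: F_def G_def L_def mult.assoc)
  have dG: "has_pderiv e (\<lambda>v. G v a b d) u (pderiv_at e (\<lambda>v. G v a b d) u)"
    if "a < ?m" "b < ?m" "d < ?m" "e < ?m" for a b d e
    using \<Gamma> ch that by (simp add: differentiable_symbols_def G_def)
  have dL: "has_pderiv e (L a b) u (pderiv_at e (L a b) u)" if "a < ?m" "b < ?m" "e < ?m" for a b e
  proof -
    have "\<exists>D. has_pderiv e (L a b) u D" unfolding L_def
      using smooth_vec_has_pderiv_ip[OF smooth_vec_vpderiv[OF F that(1)] smooth_vec_vpderiv[OF F that(2)] ch(2) that(3)]
      by blast
    then show ?thesis using has_pderiv_imp by metis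
  qed
  \<comment> \<open>Up to the factor \<open>- k\<close>, the coefficient of \<open>F\<close> itself
    in the third derivative; everything else there is a combination of first derivatives.\<close>
  define q where "q a b c = pderiv_at c (L a b) u + (\<Sum>d<?m. G u a b d * L c d u)" for a b c
  have third: "vpderiv c (vpderiv a (vpderiv b F)) u i =
      (\<Sum>d<?m. (pderiv_at c (\<lambda>v. G v a b d) u + (\<Sum>p<?m. G u a b p * G u c p d)) * vpderiv d F u i)
      - k * (L a b u * vpderiv c F u i) - k * (q a b c * F u i)"
    if abc: "a < ?m" "b < ?m" "c < ?m" for a b c i
  proof -
    have "has_pderiv c (\<lambda>v. (\<Sum>d<?m. G v a b d * vpderiv d F v i) - k * (L a b v * F v i)) u
       ((\<Sum>d<?m. pderiv_at c (\<lambda>v. G v a b d) u * vpderiv d F u i + G u a b d * vpderiv c (vpderiv d F) u i)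
         - k * (pderiv_at c (L a b) u * F u i + L a b u * vpderiv c F u i))"
      using abc by (intro has_pderiv_diff has_pderiv_sum has_pderiv_cmult has_pderiv_mult dG dL
        smooth_vec_has_pderiv[OF smooth_vec_vpderiv[OF F] ch(2)] smooth_vec_has_pderiv[OF F ch(2)]) auto
    then have "has_pderiv c (\<lambda>v. vpderiv a (vpderiv b F) v i) u
       ((\<Sum>d<?m. pderiv_at c (\<lambda>v. G v a b d) u * vpderiv d F u i + G u a b d * vpderiv c (vpderiv d F) u i)
         - k * (pderiv_at c (L a b) u * F u i + L a b u * vpderiv c F u i))"
      by (rule has_pderiv_cong[OF chart(2) ch(2) abc(3), rotated]) (simp add: eq abc)
    then have "vpderiv c (vpderiv a (vpderiv b F)) u i =
       (\<Sum>d<?m. pderiv_at c (\<lambda>v. G v a b d) u * vpderiv d F u i + G u a b d * vpderiv c (vpderiv d F) u i)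
         - k * (pderiv_at c (L a b) u * F u i + L a b u * vpderiv c F u i)"
      unfolding vpderiv_def[of c "vpderiv a (vpderiv b F)"] by (rule has_pderiv_imp)
    also have "(\<Sum>d<?m. pderiv_at c (\<lambda>v. G v a b d) u * vpderiv d F u i + G u a b d * vpderiv c (vpderiv d F) u i)
       = (\<Sum>d<?m. pderiv_at c (\<lambda>v. G v a b d) u * vpderiv d F u i)
         + (\<Sum>p<?m. G u a b p * vpderiv c (vpderiv p F) u i)" by (rule sum.distrib)
    also have "(\<Sum>p<?m. G u a b p * vpderiv c (vpderiv p F) u i)
       = (\<Sum>p<?m. (\<Sum>d<?m. G u a b p * G u c p d * vpderiv d F u i) - k * (G u a b p * L c p u * F u i))"
      using abc ch(2) by (intro sum.cong refl) (simp add: eq right_diff_distrib sum_distrib_left algebra_simps)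
    also have "\<dots> = (\<Sum>d<?m. (\<Sum>p<?m. G u a b p * G u c p d) * vpderiv d F u i)
        - k * ((\<Sum>p<?m. G u a b p * L c p u) * F u i)"
      unfolding sum_subtractf by (subst sum.swap) (simp add: sum_distrib_left sum_distrib_right mult.assoc)
    finally show ?thesis by (simp add: q_def algebra_simps sum.distrib)
  qed
  have sch: "vpderiv c (vpderiv a (vpderiv b F)) u i = vpderiv a (vpderiv c (vpderiv b F)) u i" for i
  proof -
    have "smooth_real ?m ?U (\<lambda>v. vpderiv b F v i)" using smooth_vec_vpderiv[OF F abc(2)] by (simp add: smooth_vec_def)
    from pderiv_at_commute[OF chart(2) this ch(2) abc(3,1)] show ?thesis
      by (simp add: vpderiv_def)
  qed
  define K where "K d = curvature ?m G u c a b d" for d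
  define X where "X i = (\<Sum>d<?m. K d * vpderiv d F u i)" for i
  have main: "X i = k * (L a b u * vpderiv c F u i - L c b u * vpderiv a F u i) + (k * (q a b c - q c b a)) * F u i" for i
  proof -
    have "X i = (\<Sum>d<?m. (pderiv_at c (\<lambda>v. G v a b d) u + (\<Sum>p<?m. G u a b p * G u c p d)) * vpderiv d F u i)
        - (\<Sum>d<?m. (pderiv_at a (\<lambda>v. G v c b d) u + (\<Sum>p<?m. G u c b p * G u a p d)) * vpderiv d F u i)"
      unfolding X_def K_def curvature_def sum_subtractf[symmetric]
      by (intro sum.cong refl) (simp add: algebra_simps)
    then show ?thesis using sch[of i] unfolding third[OF abc] third[OF abc(3,2,1)]
      by (simp add: algebra_simps)
  qed
  have tang: "ip ?\<theta> (vpderiv d F u) (F u) = 0" if "d < ?m" "k \<noteq> 0" for d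
    using affine_map_eq_tangent[OF M f ch that(1)] that(2)
      tangent_space_space_form[OF affine_map_eqD(1)[OF f chart(3)[OF ch(2)]]] by (simp add: F_def)
  \<comment> \<open>For \<open>k \<noteq> 0\<close>, pairing with \<open>F u\<close> annihilates all
    tangential terms, and the square \<open>1 / k\<close> of \<open>F u\<close> leaves exactly this
    coefficient.\<close>
  have "k * (q a b c - q c b a) = 0"
  proof (cases "k = 0")
    case False
    have FF: "ip ?\<theta> (F u) (F u) = 1 / k"
      using affine_map_eqD(1)[OF f chart(3)[OF ch(2)]] False by (simp add: pts_space_form F_def)
    have "ip ?\<theta> X (F u) = 0" unfolding X_def ip_sum_left using tang False by simp
    moreover have "X = (\<lambda>i. k * (L a b u * vpderiv c F u i - L c b u * vpderiv a F u i) + (k * (q a b c - q c b a)) * F u i)"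
      using main by auto
    ultimately have "k * (L a b u * ip ?\<theta> (vpderiv c F u) (F u) - L c b u * ip ?\<theta> (vpderiv a F u) (F u))
       + (k * (q a b c - q c b a)) * ip ?\<theta> (F u) (F u) = 0"
      by (simp only: ip_linear)
    then show ?thesis using tang abc False FF by simp
  qed simp
  then show ?thesis using main[of i] by (simp add: X_def K_def F_def G_def L_def)
qed

subsection \<open>Curvature-invariant subspaces\<close>

text \<open>The curvature tensor of a space of constant curvature \<open>k\<close>, applied to
  \<open>X\<close>, \<open>Y\<close> and \<open>Z\<close>.\<close>

definition curvature_op :: "real \<Rightarrow> ('i \<Rightarrow> real) \<Rightarrow> ('i \<Rightarrow> real) \<Rightarrow> ('i \<Rightarrow> real) \<Rightarrow> ('i \<Rightarrow> real) \<Rightarrow> 'i \<Rightarrow> real" where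
  "curvature_op k \<eta> X Y Z = (\<lambda>i. k * (ip \<eta> Y Z * X i - ip \<eta> X Z * Y i))"

lemma curvature_op_sum:
  shows "curvature_op k \<eta> (\<lambda>i. \<Sum>a\<in>A. w a * x a i) Y Z = (\<lambda>i. \<Sum>a\<in>A. w a * curvature_op k \<eta> (x a) Y Z i)"
    and "curvature_op k \<eta> X (\<lambda>i. \<Sum>a\<in>A. w a * x a i) Z = (\<lambda>i. \<Sum>a\<in>A. w a * curvature_op k \<eta> X (x a) Z i)"
    and "curvature_op k \<eta> X Y (\<lambda>i. \<Sum>a\<in>A. w a * x a i) = (\<lambda>i. \<Sum>a\<in>A. w a * curvature_op k \<eta> X Y (x a) i)"
  unfolding curvature_op_def ip_sum_left ip_sum_right sum_distrib_left sum_distrib_right sum_subtractf[symmetric]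
  by (auto intro!: sum.cong simp: algebra_simps)

lemma vpair_sum:
  "vpair (\<lambda>i. \<Sum>a\<in>A. w a * x a i) (\<lambda>i. \<Sum>a\<in>A. w a * y a i) = (\<lambda>i. \<Sum>a\<in>A. w a * vpair (x a) (y a) i)"
proof
  fix i show "vpair (\<lambda>i. \<Sum>a\<in>A. w a * x a i) (\<lambda>i. \<Sum>a\<in>A. w a * y a i) i = (\<Sum>a\<in>A. w a * vpair (x a) (y a) i)"
    by (cases i) auto
qed

text \<open>On coordinate vectors, the curvature identities of the two components have the same
  coefficients, those of the curvature of \<open>M\<close>. So the pair of right-hand sides is one
  combination of the vectors \<open>x d\<close> and belongs to their span.\<close>

lemma diff_image_curvature_invariant:
  fixes f :: "'a \<Rightarrow> nat + nat \<Rightarrow> real"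
  assumes M: "riemannian_manifold M" and \<Gamma>: "differentiable_symbols M \<Gamma>"
    and f1: "affine_map_eq M \<Gamma> k1 n1 (vfst \<circ> f)" and f2: "affine_map_eq M \<Gamma> k2 n2 (vsnd \<circ> f)"
    and ch: "ch \<in> atlas M" "u \<in> fst ch"
    and XYZ: "X \<in> diff_image M f ch u" "Y \<in> diff_image M f ch u" "Z \<in> diff_image M f ch u"
  shows "vpair (curvature_op k1 (space_form_form k1 n1) (vfst X) (vfst Y) (vfst Z))
    (curvature_op k2 (space_form_form k2 n2) (vsnd X) (vsnd Y) (vsnd Z)) \<in> diff_image M f ch u"
proof -
  let ?m = "rdim M"
  define V where "V = diff_image M f ch u"
  define x where "x a = vpderiv a (f \<circ> snd ch) u" for a
  define W where "W X Y Z = vpair (curvature_op k1 (space_form_form k1 n1) (vfst X) (vfst Y) (vfst Z))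
    (curvature_op k2 (space_form_form k2 n2) (vsnd X) (vsnd Y) (vsnd Z))" for X Y Z :: "nat + nat \<Rightarrow> real"
  have sub: "subsp V" unfolding V_def by (rule subsp_diff_image)
  have V: "\<exists>w. X = (\<lambda>i. \<Sum>a<?m. w a * x a i)" if "X \<in> V" for X
    using that by (auto simp: V_def diff_image_def x_def)
  have W_sum: "W (\<lambda>i. \<Sum>a<?m. w a * y a i) Y Z = (\<lambda>i. \<Sum>a<?m. w a * W (y a) Y Z i)"
    "W X (\<lambda>i. \<Sum>a<?m. w a * y a i) Z = (\<lambda>i. \<Sum>a<?m. w a * W X (y a) Z i)"
    "W X Y (\<lambda>i. \<Sum>a<?m. w a * y a i) = (\<lambda>i. \<Sum>a<?m. w a * W X Y (y a) i)" for w y X Y Z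
    unfolding W_def vfst_sum vsnd_sum curvature_op_sum vpair_sum by (rule refl)+
  have "W (x c) (x a) (x b) \<in> V" if abc: "a < ?m" "b < ?m" "c < ?m" for a b c
  proof -
    have "W (x c) (x a) (x b) = (\<lambda>i. \<Sum>d<?m. curvature ?m (\<Gamma> ch) u c a b d * x d i)"
      unfolding vpair_eq_iff[of "W (x c) (x a) (x b)"] vfst_sum vsnd_sum
      using curvature_identity[OF M \<Gamma> f1 ch abc] curvature_identity[OF M \<Gamma> f2 ch abc]
      unfolding vpderiv_vfst vpderiv_vsnd by (simp add: W_def curvature_op_def x_def)
    then show ?thesis unfolding V_def diff_image_def x_def by blast
  qed
  \<comment> \<open>Multilinear extension from coordinate vectors to the whole span, one argument at
    a time.\<close>
  then have "W (x c) (x a) Z \<in> V" if "a < ?m" "c < ?m" "Z \<in> V" for a c Z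
    using V[OF that(3)] that by (auto simp: W_sum intro!: subsp_sum[OF sub])
  then have "W (x c) Y Z \<in> V" if "c < ?m" "Y \<in> V" "Z \<in> V" for c Y Z
    using V[OF that(2)] that by (auto simp: W_sum intro!: subsp_sum[OF sub])
  then have "W X Y Z \<in> V" if "X \<in> V" "Y \<in> V" "Z \<in> V" for X Y Z
    using V[OF that(1)] that by (auto simp: W_sum intro!: subsp_sum[OF sub])
  then show ?thesis using XYZ by (simp add: V_def W_def)
qed

text \<open>Write \<open>B(Y,Z) = k1 \<langle>Y1,Z1\<rangle> - k2 \<langle>Y2,Z2\<rangle>\<close>. Subtracting \<open>k2 (\<langle>Y2,Z2\<rangle> X - \<langle>X2,Z2\<rangle> Y)\<close> from the curvature
  shows that \<open>B(Y,Z) X - B(X,Z) Y\<close> lies in the subspace of vectors whose components belong to \<open>V\<close>.\<close>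

lemma curvature_invariant_cases:
  fixes V :: "('i + 'j \<Rightarrow> real) set"
  assumes V: "subsp V" and det: "determined_by V I"
    and fin: "finite {i. \<eta> i \<noteq> 0}" "finite {j. \<theta> j \<noteq> 0}"
    and pd1: "\<And>X. X \<in> V \<Longrightarrow> vfst X \<noteq> (\<lambda>_. 0) \<Longrightarrow> ip \<eta> (vfst X) (vfst X) > 0"
    and pd2: "\<And>X. X \<in> V \<Longrightarrow> vsnd X \<noteq> (\<lambda>_. 0) \<Longrightarrow> ip \<theta> (vsnd X) (vsnd X) > 0"
    and tri: "\<And>X Y Z. X \<in> V \<Longrightarrow> Y \<in> V \<Longrightarrow> Z \<in> V \<Longrightarrow>
      vpair (curvature_op k1 \<eta> (vfst X) (vfst Y) (vfst Z)) (curvature_op k2 \<theta> (vsnd X) (vsnd Y) (vsnd Z)) \<in> V"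
    and k12: "(k1, k2) \<noteq> (0, 0)"
  shows "(\<forall>X\<in>V. vpair (vfst X) (\<lambda>_. 0) \<in> V) \<or>
    (k1 * k2 > 0 \<and> (\<forall>X\<in>V. \<forall>Y\<in>V. k1 * ip \<eta> (vfst X) (vfst Y) = k2 * ip \<theta> (vsnd X) (vsnd Y))) \<or>
    (\<exists>s\<in>V. ip (vpair \<eta> \<theta>) s s = 1 \<and> vfst s \<noteq> (\<lambda>_. 0) \<and> vsnd s \<noteq> (\<lambda>_. 0) \<and>
       (\<forall>Y\<in>V. vpair (vfst (\<lambda>i. Y i - ip (vpair \<eta> \<theta>) Y s * s i)) (\<lambda>_. 0) \<in> V) \<and>
       (\<forall>Z\<in>V. vpair (vfst Z) (\<lambda>_. 0) \<in> V \<longrightarrow>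
          ip (vpair \<eta> \<theta>) Z s = 0 \<and> k1 * ip \<eta> (vfst Z) (vfst Z) = k2 * ip \<theta> (vsnd Z) (vsnd Z)))"
proof (cases "\<forall>X\<in>V. vpair (vfst X) (\<lambda>_. 0) \<in> V")
  case False
  let ?g = "ip (vpair \<eta> \<theta>)"
  note ipv = ip_vpair[OF fin]
  \<comment> \<open>The sum of the intersections of \<open>V\<close> with the two factors; in the
    case at hand it is a proper subspace.\<close>
  define N where "N = {X \<in> V. vpair (vfst X) (\<lambda>_. 0) \<in> V}"
  define B where "B Y Z = k1 * ip \<eta> (vfst Y) (vfst Z) - k2 * ip \<theta> (vsnd Y) (vsnd Z)" for Y Z
  have B_sym: "B Y Z = B Z Y" for Y Z unfolding B_def by (simp add: ip_comm[of _ "vfst Y"] ip_comm[of _ "vsnd Y"])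
  have pv0: "vpair (\<lambda>i. x i + y i) (\<lambda>_. 0::real) = (\<lambda>i. vpair x (\<lambda>_. 0) i + vpair y (\<lambda>_. 0) i)"
    "vpair (\<lambda>i. c * x i) (\<lambda>_. 0::real) = (\<lambda>i. c * vpair x (\<lambda>_. 0) i)" for x y :: "'i \<Rightarrow> real" and c
    by (auto simp: fun_eq_iff vpair_def split: sum.splits)
  have z0: "vpair (\<lambda>_. 0) (\<lambda>_. 0::real) = (\<lambda>_. 0)" by (auto simp: fun_eq_iff vpair_def split: sum.splits)
  have N: "subsp N"
    unfolding subsp_def N_def using subspD[OF V] by (auto simp: pv0 z0)
  have posV: "posdef_on (vpair \<eta> \<theta>) V"
    unfolding posdef_on_def
  proof (intro ballI impI)
    fix X assume X: "X \<in> V" "X \<noteq> (\<lambda>i. 0)"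
    then have "vfst X \<noteq> (\<lambda>_. 0) \<or> vsnd X \<noteq> (\<lambda>_. 0)" using vpair_eq_iff[of X "\<lambda>i. 0"] by auto
    moreover have "ip \<eta> (vfst X) (vfst X) \<ge> 0" using pd1[OF X(1)] ip_zero_left by (metis less_imp_le order_refl)
    moreover have "ip \<theta> (vsnd X) (vsnd X) \<ge> 0" using pd2[OF X(1)] ip_zero_left by (metis less_imp_le order_refl)
    ultimately show "?g X X > 0" unfolding ipv using pd1[OF X(1)] pd2[OF X(1)] by linarith
  qed
  have detN: "determined_by N I" "posdef_on (vpair \<eta> \<theta>) N"
    using det posV by (auto simp: determined_by_def posdef_on_def N_def)
  obtain r e where e: "orthonormal (vpair \<eta> \<theta>) r e" "\<forall>a<r. e a \<in> N"
    "\<And>v. v \<in> N \<Longrightarrow> v = (\<lambda>i. \<Sum>a<r. ?g v (e a) * e a i)"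
    using orthonormal_basis_exists[OF N detN(2,1)] by blast
  obtain X where X: "X \<in> V" "X \<notin> N" using False by (auto simp: N_def)
  \<comment> \<open>The part of \<open>X\<close> orthogonal to \<open>N\<close>. Normalised, it
    becomes the vector \<open>s\<close> against which membership in \<open>N\<close> is
    tested.\<close>
  define t where "t = (\<lambda>i. X i - (\<Sum>a<r. ?g X (e a) * e a i))"
  have sumN: "(\<lambda>i. \<Sum>a<r. ?g X (e a) * e a i) \<in> N" by (rule subsp_sum[OF N]) (use e(2) in auto)
  have tV: "t \<in> V" unfolding t_def using X(1) sumN by (intro subsp_diff[OF V]) (auto simp: N_def)
  have te: "?g t (e b) = 0" if "b < r" for b
    unfolding t_def ip_diff_left orthonormal_coeff[OF e(1) that] by simp
  have tN: "?g Z t = 0" if "Z \<in> N" for Z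
  proof -
    have "?g Z t = ?g (\<lambda>i. \<Sum>a<r. ?g Z (e a) * e a i) t" using e(3)[OF that] by simp
    then show ?thesis unfolding ip_sum_left by (simp add: ip_comm[of _ "e _" t] te)
  qed
  have t0: "t \<noteq> (\<lambda>i. 0)"
  proof
    assume "t = (\<lambda>i. 0)"
    then have "X = (\<lambda>i. \<Sum>a<r. ?g X (e a) * e a i)" by (auto simp: t_def fun_eq_iff)
    with sumN X(2) show False by simp
  qed
  then have tpos: "?g t t > 0" using posV tV by (auto simp: posdef_on_def)
  define s where "s = (\<lambda>i. (1 / sqrt (?g t t)) * t i)"
  have sV: "s \<in> V" unfolding s_def by (rule subsp_scale[OF V tV])
  have ss: "?g s s = 1" using tpos unfolding s_def ip_scale_left ip_scale_right by simp
  have sN: "?g Z s = 0" if "Z \<in> N" for Z using tN[OF that] unfolding s_def ip_scale_right by simp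
  have s_notN: "s \<notin> N" using sN[of s] ss by auto
  have s1: "vfst s \<noteq> (\<lambda>_. 0)" using s_notN sV subsp_0[OF V] by (auto simp: N_def z0)
  have s2: "vsnd s \<noteq> (\<lambda>_. 0)"
  proof
    assume "vsnd s = (\<lambda>_. 0)"
    then have "vpair (vfst s) (\<lambda>_. 0) = s" by (metis vpair_vfst_vsnd)
    with s_notN sV show False by (simp add: N_def)
  qed
  have inN: "(\<lambda>i. B Y Z * X i - B X Z * Y i) \<in> N" if XYZ: "X \<in> V" "Y \<in> V" "Z \<in> V" for X Y Z
  proof -
    let ?W = "\<lambda>i. B Y Z * X i - B X Z * Y i"
    have W: "?W \<in> V" using XYZ by (intro subsp_diff[OF V] subsp_scale[OF V])
    define R where "R = vpair (curvature_op k1 \<eta> (vfst X) (vfst Y) (vfst Z)) (curvature_op k2 \<theta> (vsnd X) (vsnd Y) (vsnd Z))"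
    define D where "D = (\<lambda>i. (k2 * ip \<theta> (vsnd Y) (vsnd Z)) * X i - (k2 * ip \<theta> (vsnd X) (vsnd Z)) * Y i)"
    have "R \<in> V" "D \<in> V" unfolding R_def D_def using XYZ tri by (auto intro!: subsp_diff[OF V] subsp_scale[OF V])
    then have "(\<lambda>i. R i - D i) \<in> V" by (rule subsp_diff[OF V])
    moreover have "(\<lambda>i. R i - D i) = vpair (vfst ?W) (\<lambda>_. 0)"
      unfolding vpair_eq_iff[of "\<lambda>i. R i - D i"]
      by (simp add: R_def D_def curvature_op_def B_def fun_eq_iff) (simp add: algebra_simps)
    ultimately show ?thesis using W by (simp add: N_def)
  qed
  show ?thesis
  proof (cases "\<forall>Y\<in>V. \<forall>Z\<in>V. B Y Z = 0")
    case True
    then have "k1 * ip \<eta> (vfst s) (vfst s) = k2 * ip \<theta> (vsnd s) (vsnd s)" using sV by (auto simp: B_def)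
    \<comment> \<open>Both components of \<open>s\<close> have positive length, so \<open>k1\<close>
      and \<open>k2\<close> have the same sign; if one vanished, the other would too.\<close>
    then have "k1 * k2 > 0"
      using pd1[OF sV s1] pd2[OF sV s2] k12
      by (smt (verit) mult_neg_pos mult_pos_pos mult_neg_neg mult_eq_0_iff prod.inject)
    then show ?thesis using True by (auto simp: B_def)
  next
    case False
    then obtain Y0 Z0 where YZ0: "Y0 \<in> V" "Z0 \<in> V" "B Y0 Z0 \<noteq> 0" by blast
    \<comment> \<open>The vector \<open>B Y Z * s - B s Z * Y\<close> lies in \<open>N\<close> and
      is thus orthogonal to \<open>s\<close>. Applied twice, this shows that \<open>B\<close> has
      rank one: it is \<open>B s s\<close> times the product of the
      \<open>s\<close>-coefficients.\<close>
    have B1: "B Y Z = B s Z * ?g Y s" if "Y \<in> V" "Z \<in> V" for Y Z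
      using sN[OF inN[OF sV that]] by (simp add: ip_diff_left ip_scale_left ss)
    have B2: "B Y Z = B s s * ?g Z s * ?g Y s" if "Y \<in> V" "Z \<in> V" for Y Z
      using B1[OF that] B1[OF that(2) sV] B_sym[of s Z] by simp
    have \<beta>: "B s s \<noteq> 0" using B2[OF YZ0(1,2)] YZ0(3) by auto
    \<comment> \<open>The remainder \<open>?Z\<close> is orthogonal to \<open>s\<close>, so
      \<open>B ?Z s = 0\<close>, and what is left of the membership in \<open>N\<close> is
      \<open>B s s\<close> times \<open>?Z\<close>. Hence \<open>N\<close> has codimension
      one.\<close>
    have "(\<lambda>i. Y i - ?g Y s * s i) \<in> N" if Y: "Y \<in> V" for Y
    proof -
      let ?Z = "\<lambda>i. Y i - ?g Y s * s i"
      have ZV: "?Z \<in> V" using Y sV by (intro subsp_diff[OF V] subsp_scale[OF V])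
      have "?g ?Z s = 0" by (simp add: ip_diff_left ip_scale_left ss)
      then have "B ?Z s = 0" using B2[OF ZV sV] by simp
      then have "(\<lambda>i. - B s s * ?Z i) \<in> N" using inN[OF sV ZV sV] by simp
      from subsp_scale[OF N this, of "- 1 / B s s"] \<beta> show ?thesis by simp
    qed
    moreover have "k1 * ip \<eta> (vfst Z) (vfst Z) = k2 * ip \<theta> (vsnd Z) (vsnd Z)" if "Z \<in> N" for Z
      using B2[of Z Z] sN[OF that] that by (simp add: B_def N_def)
    ultimately show ?thesis using sV ss s1 s2 sN unfolding N_def by blast
  qed
qed blast

section \<open>Local isometries and bases of the tangent space\<close>

text \<open>Surjectivity of the differential by counting: the images of the coordinate vectors are
  independent, because their Gram matrix is that of the metric, and their number is the dimension of
  the target.\<close>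

lemma local_isometryI:
  assumes M: "riemannian_manifold M" and iso: "isometric_immersion M S \<phi>" and P: "tangent_projection S P"
    and dim: "sdim S = rdim M"
  shows "local_isometry M S \<phi>"
  unfolding local_isometry_def
proof (intro conjI ballI iso subset_antisym subsetI)
  fix c u assume c: "c \<in> atlas M" and u: "u \<in> fst c"
  note chart = manifold_chart[OF M c]
  have pt: "\<phi> (snd c v) \<in> pts S" if "v \<in> fst c" for v
    using iso chart(3)[OF that] by (auto simp: isometric_immersion_def)
  have T: "subsp (tangent_space S (\<phi> (snd c u)))" using P pt[OF u] by (simp add: tangent_projection_def)
  have sm: "smooth_vec (rdim M) (fst c) (\<phi> \<circ> snd c)" using iso c by (simp add: isometric_immersion_def)
  have tang: "vpderiv a (\<phi> \<circ> snd c) u \<in> tangent_space S (\<phi> (snd c u))" if "a < rdim M" for a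
    using vpderiv_tangent[OF chart(2) u that sm] pt by simp
  {
    fix v assume "v \<in> diff_image M \<phi> c u"
    then show "v \<in> tangent_space S (\<phi> (snd c u))"
      using tang by (auto simp: diff_image_def intro!: subsp_sum[OF T])
  next
    fix v assume v: "v \<in> tangent_space S (\<phi> (snd c u))"
    obtain I where I: "determined_by (tangent_space S (\<phi> (snd c u))) I" "card I = sdim S"
      using P pt[OF u] unfolding tangent_projection_def by blast
    have "\<exists>x. v = (\<lambda>i. \<Sum>a<rdim M. x a * vpderiv a (\<phi> \<circ> snd c) u i)"
    proof (rule independent_spans[OF T I(1) _ _ _ v])
      fix x assume "\<forall>i. (\<Sum>a<rdim M. x a * vpderiv a (\<phi> \<circ> snd c) u i) = 0"
      then have "(\<lambda>i. \<Sum>a<rdim M. x a * vpderiv a (\<phi> \<circ> snd c) u i) = (\<lambda>i. 0)" by auto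
      then have z: "(\<Sum>a<rdim M. x a * ip (form S) (vpderiv a (\<phi> \<circ> snd c) u) y) = 0" for y
        using ip_sum_left[of "form S" x "\<lambda>a. vpderiv a (\<phi> \<circ> snd c) u" "{..<rdim M}" y] by (simp add: ip_zero_left)
      show "\<forall>a<rdim M. x a = 0"
      proof (rule gram_independent[where x = "\<lambda>a. vpderiv a (\<phi> \<circ> snd c) u" and \<eta> = "form S"])
        fix w :: "nat \<Rightarrow> real" assume "\<exists>a<rdim M. w a \<noteq> 0"
        then have "0 < (\<Sum>a<rdim M. \<Sum>b<rdim M. gram M c u a b * w a * w b)"
          using M c u by (simp add: riemannian_manifold_def riemannian_metric_def)
        also have "\<dots> = (\<Sum>a<rdim M. \<Sum>b<rdim M.
            ip (form S) (vpderiv a (\<phi> \<circ> snd c) u) (vpderiv b (\<phi> \<circ> snd c) u) * w a * w b)"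
          using iso c u by (intro sum.cong refl) (simp add: isometric_immersion_def)
        finally show "0 < \<dots>" .
      qed (use z in simp)
    qed (use tang I(2) dim in auto)
    then show "v \<in> diff_image M \<phi> c u" by (auto simp: diff_image_def)
  }
qed

lemma orthonormal_basis_card:
  fixes x e :: "nat \<Rightarrow> 'i \<Rightarrow> real"
  assumes on: "orthonormal \<eta> r e" and e: "\<And>b. b < r \<Longrightarrow> \<exists>w. e b = (\<lambda>i. \<Sum>a<m. w a * x a i)"
    and x: "\<And>a. a < m \<Longrightarrow> \<exists>w. x a = (\<lambda>i. \<Sum>b<r. w b * e b i)"
    and ind: "\<And>w. \<forall>i. (\<Sum>a<m. w a * x a i) = 0 \<Longrightarrow> \<forall>a<m. w a = 0"
  shows "r = m"
proof (rule antisym)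
  show "r \<le> m" by (rule independent_card_le_span[OF e]) (use orthonormal_independent[OF on] in auto)
  show "m \<le> r" by (rule independent_card_le_span[OF x ind]) auto
qed

subsection \<open>Products and compositions of smooth functions\<close>

lemma C_k_on_Suc: "C_k_on m (Suc k) U F \<Longrightarrow> C_k_on m k U F"
  by (induction k arbitrary: F) auto

lemma C_k_on_mult:
  assumes U: "openin (Euclidean_space m) U"
  shows "C_k_on m k U F \<Longrightarrow> C_k_on m k U G \<Longrightarrow> C_k_on m k U (\<lambda>v. F v * G v)"
proof (induction k arbitrary: F G)
  case (Suc k)
  have d: "has_pderiv a (\<lambda>v. F v * G v) u (pderiv_at a F u * G u + F u * pderiv_at a G u)" if "u \<in> U" "a < m" for a u
    using Suc.prems that by (intro has_pderiv_mult C_k_on_has_pderiv)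
  show ?case unfolding C_k_on.simps
  proof (intro conjI allI impI ballI)
    show "continuous_on U (\<lambda>v. F v * G v)" using Suc.prems by (auto intro: continuous_intros)
    fix a assume a: "a < m"
    show "C_k_on m k U (pderiv_at a (\<lambda>v. F v * G v))"
    proof (rule C_k_on_cong[OF U, of "\<lambda>v. pderiv_at a F v * G v + F v * pderiv_at a G v"])
      show "C_k_on m k U (\<lambda>v. pderiv_at a F v * G v + F v * pderiv_at a G v)"
        using Suc.prems a C_k_on_Suc[OF Suc.prems(1)] C_k_on_Suc[OF Suc.prems(2)]
        by (intro C_k_on_add[OF U] Suc.IH) auto
    qed (use has_pderiv_imp[OF d[OF _ a]] in simp)
    fix u assume "u \<in> U"
    from d[OF this a] show "(\<lambda>t. F (u(a := t)) * G (u(a := t))) differentiable at (u a)"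
      by (auto simp: has_pderiv_def real_differentiable_def)
  qed
qed (auto intro: continuous_intros)

text \<open>A class of functions closed under differentiation makes the induction on the order
  self-contained: the derivative of the composition is a function of the class composed with
  \<open>y\<close>, times a smooth function.\<close>

lemma C_k_on_compose:
  fixes \<G> :: "(real \<Rightarrow> real) set"
  assumes U: "openin (Euclidean_space m) U" and y: "smooth_real m U y"
    and \<G>: "\<And>g. g \<in> \<G> \<Longrightarrow> \<exists>g'\<in>\<G>. \<forall>t. (g has_real_derivative g' t) (at t)"
  shows "g \<in> \<G> \<Longrightarrow> C_k_on m k U (\<lambda>v. g (y v))"
proof (induction k arbitrary: g)
  case 0
  obtain g' where "\<forall>t. (g has_real_derivative g' t) (at t)" using \<G>[OF 0] by blast
  then have "continuous_on UNIV g" by (metis DERIV_isCont continuous_at_imp_continuous_on)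
  then show ?case using continuous_on_compose2[of UNIV g U y] smooth_real_continuous[OF y] by simp
next
  case (Suc k)
  obtain g' where g': "g' \<in> \<G>" "\<And>t. (g has_real_derivative g' t) (at t)" using \<G>[OF Suc.prems] by blast
  have d: "has_pderiv a (\<lambda>v. g (y v)) u (g' (y u) * pderiv_at a y u)" if "u \<in> U" "a < m" for a u
    by (rule has_pderiv_chain[OF g'(2) smooth_real_has_pderiv[OF y that]])
  show ?case unfolding C_k_on.simps
  proof (intro conjI allI impI ballI)
    have "continuous_on UNIV g" using g'(2) by (metis DERIV_isCont continuous_at_imp_continuous_on)
    then show "continuous_on U (\<lambda>v. g (y v))"
      using continuous_on_compose2[of UNIV g U y] smooth_real_continuous[OF y] by simp
    fix a assume a: "a < m"
    show "C_k_on m k U (pderiv_at a (\<lambda>v. g (y v)))"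
    proof (rule C_k_on_cong[OF U, of "\<lambda>v. g' (y v) * pderiv_at a y v"])
      show "C_k_on m k U (\<lambda>v. g' (y v) * pderiv_at a y v)"
        using smooth_real_pderiv[OF y a] by (intro C_k_on_mult[OF U] Suc.IH g'(1)) (simp add: smooth_real_def)
    qed (use has_pderiv_imp[OF d[OF _ a]] in simp)
    fix u assume "u \<in> U"
    from d[OF this a] show "(\<lambda>t. g (y (u(a := t)))) differentiable at (u a)"
      by (auto simp: has_pderiv_def real_differentiable_def)
  qed
qed

lemma iterated_deriv_mem:
  fixes \<G> :: "(real \<Rightarrow> real) set"
  assumes \<G>: "\<And>g. g \<in> \<G> \<Longrightarrow> \<exists>g'\<in>\<G>. \<forall>t. (g has_real_derivative g' t) (at t)" and g: "g \<in> \<G>"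
  shows "(deriv ^^ k) g \<in> \<G>"
proof (induction k)
  case (Suc k)
  obtain g' where g': "g' \<in> \<G>" "\<And>t. ((deriv ^^ k) g has_real_derivative g' t) (at t)" using \<G>[OF Suc] by blast
  have "deriv ((deriv ^^ k) g) = g'" using g'(2) by (auto intro!: DERIV_imp_deriv)
  then show ?case using g'(1) by simp
qed (use g in simp)

lemma iterated_deriv_differentiable:
  fixes \<G> :: "(real \<Rightarrow> real) set"
  assumes \<G>: "\<And>g. g \<in> \<G> \<Longrightarrow> \<exists>g'\<in>\<G>. \<forall>t. (g has_real_derivative g' t) (at t)" and g: "g \<in> \<G>"
  shows "(deriv ^^ k) g differentiable (at t)"
  using \<G>[OF iterated_deriv_mem[OF \<G> g, of k]] by (auto simp: real_differentiable_def)

section \<open>Generalized trigonometric functions\<close>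

text \<open>For \<open>\<kappa> \<noteq> 0\<close>, \<open>gen_cos\<close> and
  \<open>gen_sin\<close> are the solutions of \<open>y'' = - \<kappa> * y\<close> with initial data
  \<open>(1, 0)\<close> and \<open>(0, 1)\<close>. At \<open>\<kappa> = 0\<close> division by zero
  makes \<open>gen_sin\<close> vanish, whence the assumption \<open>\<kappa> \<noteq> 0\<close> in
  the rules below.\<close>

definition gen_cos :: "real \<Rightarrow> real \<Rightarrow> real" where
  "gen_cos \<kappa> t = (if \<kappa> > 0 then cos (sqrt \<kappa> * t) else cosh (sqrt (- \<kappa>) * t))"

definition gen_sin :: "real \<Rightarrow> real \<Rightarrow> real" where
  "gen_sin \<kappa> t = (if \<kappa> > 0 then sin (sqrt \<kappa> * t) / sqrt \<kappa> else sinh (sqrt (- \<kappa>) * t) / sqrt (- \<kappa>))"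

lemma gen_cos_0 [simp]: "gen_cos \<kappa> 0 = 1" and gen_sin_0 [simp]: "gen_sin \<kappa> 0 = 0"
  by (simp_all add: gen_cos_def gen_sin_def)

lemma gen_sin_derivative:
  assumes "\<kappa> \<noteq> 0" shows "(gen_sin \<kappa> has_real_derivative gen_cos \<kappa> t) (at t)"
proof (cases "\<kappa> > 0")
  case True
  then have "gen_sin \<kappa> = (\<lambda>t. sin (sqrt \<kappa> * t) / sqrt \<kappa>)" by (simp add: gen_sin_def fun_eq_iff)
  moreover have "((\<lambda>t. sin (sqrt \<kappa> * t) / sqrt \<kappa>) has_real_derivative cos (sqrt \<kappa> * t) * sqrt \<kappa> / sqrt \<kappa>) (at t)"
    by (rule DERIV_cdivide) (auto intro!: derivative_eq_intros)
  ultimately show ?thesis using True by (simp add: gen_cos_def)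
next
  case False
  then have "gen_sin \<kappa> = (\<lambda>t. sinh (sqrt (- \<kappa>) * t) / sqrt (- \<kappa>))" by (simp add: gen_sin_def fun_eq_iff)
  moreover have "((\<lambda>t. sinh (sqrt (- \<kappa>) * t) / sqrt (- \<kappa>)) has_real_derivative
      cosh (sqrt (- \<kappa>) * t) * sqrt (- \<kappa>) / sqrt (- \<kappa>)) (at t)"
    by (rule DERIV_cdivide) (auto intro!: derivative_eq_intros)
  ultimately show ?thesis using False assms by (simp add: gen_cos_def)
qed

lemma gen_cos_derivative:
  assumes "\<kappa> \<noteq> 0" shows "(gen_cos \<kappa> has_real_derivative - \<kappa> * gen_sin \<kappa> t) (at t)"
proof (cases "\<kappa> > 0")
  case True
  then have e: "gen_cos \<kappa> = (\<lambda>t. cos (sqrt \<kappa> * t))" by (simp add: gen_cos_def fun_eq_iff)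
  have "((\<lambda>t. cos (sqrt \<kappa> * t)) has_real_derivative - sin (sqrt \<kappa> * t) * sqrt \<kappa>) (at t)"
    by (auto intro!: derivative_eq_intros)
  moreover have "- sin (sqrt \<kappa> * t) * sqrt \<kappa> = - \<kappa> * gen_sin \<kappa> t"
  proof -
    have "- \<kappa> * gen_sin \<kappa> t = - (\<kappa> / sqrt \<kappa>) * sin (sqrt \<kappa> * t)" using True by (simp add: gen_sin_def)
    also have "\<kappa> / sqrt \<kappa> = sqrt \<kappa>" using True by (simp add: real_div_sqrt)
    finally show ?thesis by simp
  qed
  ultimately show ?thesis unfolding e by simp
next
  case False
  then have e: "gen_cos \<kappa> = (\<lambda>t. cosh (sqrt (- \<kappa>) * t))" by (simp add: gen_cos_def fun_eq_iff)
  have "((\<lambda>t. cosh (sqrt (- \<kappa>) * t)) has_real_derivative sinh (sqrt (- \<kappa>) * t) * sqrt (- \<kappa>)) (at t)"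
    by (auto intro!: derivative_eq_intros)
  moreover have "sinh (sqrt (- \<kappa>) * t) * sqrt (- \<kappa>) = - \<kappa> * gen_sin \<kappa> t"
  proof -
    have "- \<kappa> * gen_sin \<kappa> t = (- \<kappa> / sqrt (- \<kappa>)) * sinh (sqrt (- \<kappa>) * t)" using False by (simp add: gen_sin_def)
    also have "- \<kappa> / sqrt (- \<kappa>) = sqrt (- \<kappa>)" using False by (intro real_div_sqrt) simp
    finally show ?thesis by simp
  qed
  ultimately show ?thesis unfolding e by simp
qed

lemma gen_cos_sin_squared:
  assumes "\<kappa> \<noteq> 0" shows "gen_cos \<kappa> t * gen_cos \<kappa> t + \<kappa> * (gen_sin \<kappa> t * gen_sin \<kappa> t) = 1"
proof (cases "\<kappa> > 0")
  case True
  have "\<kappa> * (gen_sin \<kappa> t * gen_sin \<kappa> t) = sin (sqrt \<kappa> * t) * sin (sqrt \<kappa> * t)"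
    using True by (simp add: gen_sin_def)
  moreover have "gen_cos \<kappa> t = cos (sqrt \<kappa> * t)" using True by (simp add: gen_cos_def)
  ultimately show ?thesis using sin_cos_squared_add2[of "sqrt \<kappa> * t"] by (simp add: power2_eq_square)
next
  case False
  have "\<kappa> * (gen_sin \<kappa> t * gen_sin \<kappa> t) = - (sinh (sqrt (- \<kappa>) * t) * sinh (sqrt (- \<kappa>) * t))"
    using False assms by (simp add: gen_sin_def)
  moreover have "gen_cos \<kappa> t = cosh (sqrt (- \<kappa>) * t)" using False by (simp add: gen_cos_def)
  ultimately show ?thesis using cosh_square_eq[of "sqrt (- \<kappa>) * t"] by (simp add: power2_eq_square)
qed

lemma gen_cos_pos: "\<kappa> < 0 \<Longrightarrow> gen_cos \<kappa> t > 0"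
  by (simp add: gen_cos_def)

text \<open>The solution space of \<open>y'' = - \<kappa> * y\<close> for
  \<open>\<kappa> \<noteq> 0\<close>. Being closed under differentiation, it can serve as the class
  of functions in the composition lemma.\<close>

definition gen_trig :: "real \<Rightarrow> (real \<Rightarrow> real) set" where
  "gen_trig \<kappa> = {(\<lambda>t. A * gen_cos \<kappa> t + B * gen_sin \<kappa> t) | A B. True}"

lemma gen_trig_derivative:
  assumes "\<kappa> \<noteq> 0" "g \<in> gen_trig \<kappa>"
  shows "\<exists>g'\<in>gen_trig \<kappa>. \<forall>t. (g has_real_derivative g' t) (at t)"
proof -
  obtain A B where g: "g = (\<lambda>t. A * gen_cos \<kappa> t + B * gen_sin \<kappa> t)" using assms(2) by (auto simp: gen_trig_def)
  have "(g has_real_derivative B * gen_cos \<kappa> t + (- \<kappa> * A) * gen_sin \<kappa> t) (at t)" for t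
    unfolding g by (rule derivative_eq_intros gen_cos_derivative[OF assms(1)] gen_sin_derivative[OF assms(1)] refl | simp)+
  moreover have "(\<lambda>t. B * gen_cos \<kappa> t + (- \<kappa> * A) * gen_sin \<kappa> t) \<in> gen_trig \<kappa>" unfolding gen_trig_def by blast
  ultimately show ?thesis by (intro bexI[of _ "\<lambda>t. B * gen_cos \<kappa> t + (- \<kappa> * A) * gen_sin \<kappa> t"]) auto
qed

subsection \<open>Totally geodesic maps into a product\<close>

lemma vpderiv_vpair:
  "vpderiv a ((\<lambda>x. vpair (\<phi>1 x) (\<phi>2 x)) \<circ> g) u = vpair (vpderiv a (\<phi>1 \<circ> g) u) (vpderiv a (\<phi>2 \<circ> g) u)"
proof
  fix i show "vpderiv a ((\<lambda>x. vpair (\<phi>1 x) (\<phi>2 x)) \<circ> g) u i = vpair (vpderiv a (\<phi>1 \<circ> g) u) (vpderiv a (\<phi>2 \<circ> g) u) i"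
    by (cases i) (simp_all add: vpderiv_def comp_def)
qed

lemma smooth_vec_vpair:
  assumes "smooth_vec m U (\<phi>1 \<circ> g)" "smooth_vec m U (\<phi>2 \<circ> g)"
  shows "smooth_vec m U ((\<lambda>x. vpair (\<phi>1 x) (\<phi>2 x)) \<circ> g)"
  unfolding smooth_vec_def
proof
  fix i show "smooth_real m U (\<lambda>u. ((\<lambda>x. vpair (\<phi>1 x) (\<phi>2 x)) \<circ> g) u i)"
    using assms by (cases i) (auto simp: smooth_vec_def comp_def)
qed

lemma adapted_product_tg_inclusion:
  assumes "p1 \<in> pts (space_form k1 n1)" "\<And>i. i < r1 \<Longrightarrow> e1 i \<in> tangent_space (space_form k1 n1) p1"
    "orthonormal (space_form_form k1 n1) r1 e1"
    and "p2 \<in> pts (space_form k2 n2)" "\<And>i. i < r2 \<Longrightarrow> e2 i \<in> tangent_space (space_form k2 n2) p2"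
    "orthonormal (space_form_form k2 n2) r2 e2"
  shows "tg_inclusion (prod_submfd (space_form k1 r1) (space_form k2 r2)) (prod_submfd (space_form k1 n1) (space_form k2 n2))
    (prod_map (frame_map (base_point k1 p1) (space_form_form k1 r1) (adapted_frame k1 p1 e1))
      (frame_map (base_point k2 p2) (space_form_form k2 r2) (adapted_frame k2 p2 e2)))"
proof -
  note tp = tangent_projection_space_form
  have A1: "affine_inclusion (space_form k1 r1) (space_form k1 n1) (sf_proj k1 r1) (base_point k1 p1) (adapted_frame k1 p1 e1)"
    by (rule adapted_frame_affine_inclusion[OF assms(1) _ assms(3)]) (rule assms(2))
  have A2: "affine_inclusion (space_form k2 r2) (space_form k2 n2) (sf_proj k2 r2) (base_point k2 p2) (adapted_frame k2 p2 e2)"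
    by (rule adapted_frame_affine_inclusion[OF assms(4) _ assms(6)]) (rule assms(5))
  note A = affine_inclusion_prod[OF tp tp tp tp A1 A2]
  show ?thesis
    by (rule affine_tg_inclusion[OF tangent_projection_prod[OF tp tp] tangent_projection_prod[OF tp tp] A(1)])
      (unfold form_prod, unfold A(2), unfold form_space_form, rule refl)
qed

lemma sum_lessThan_add:
  fixes g :: "nat \<Rightarrow> real"
  shows "(\<Sum>b<r + s. g b) = (\<Sum>b<r. g b) + (\<Sum>b<s. g (r + b))"
  by (induction s) (simp_all add: add.assoc)

text \<open>The difference from the initial value has the derivatives of \<open>f\<close>. In the
  quadratic term one derivative is kept as the unknown, while the other one and \<open>f\<close>
  itself count as coefficients, so the Hessian is bounded by the jet of the difference.\<close>

lemma affine_map_constant: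
  assumes M: "riemannian_manifold M" and \<Gamma>: "continuous_symbols M \<Gamma>" and f: "affine_map_eq M \<Gamma> k n f"
    and c0: "c0 \<in> atlas M" "u0 \<in> fst c0" and d0: "\<And>a. a < rdim M \<Longrightarrow> vpderiv a (f \<circ> snd c0) u0 = (\<lambda>i. 0)"
    and x: "x \<in> topspace (rtop M)"
  shows "f x = f (snd c0 u0)"
proof
  fix i
  let ?m = "rdim M" and ?\<theta> = "space_form_form k n" and ?I = "{..<amb_dim k n}"
  note chart = manifold_chart[OF M]
  have sm: "smooth_vec ?m (fst c) (f \<circ> snd c)" if "c \<in> atlas M" for c by (rule affine_map_eqD(2)[OF f that])
  define h where "h i x = f x i - f (snd c0 u0) i" for i x
  have hp: "has_pderiv a (h i \<circ> snd c) u (vpderiv a (f \<circ> snd c) u i)"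
    if "c \<in> atlas M" "u \<in> fst c" "a < ?m" for c u a i
    using has_pderiv_diff[OF smooth_vec_has_pderiv[OF sm[OF that(1)] that(2,3)] has_pderiv_const, of i "f (snd c0 u0) i"]
    by (simp add: h_def comp_def)
  have hp1: "pderiv_at a (h i \<circ> snd c) u = vpderiv a (f \<circ> snd c) u i"
    if "c \<in> atlas M" "u \<in> fst c" "a < ?m" for c u a i
    by (rule has_pderiv_imp[OF hp[OF that]])
  have hp2: "pderiv_at a (pderiv_at b (h i \<circ> snd c)) u = vpderiv a (vpderiv b (f \<circ> snd c)) u i"
    if "c \<in> atlas M" "u \<in> fst c" "a < ?m" "b < ?m" for c u a b i
    unfolding vpderiv_def[of a "vpderiv b (f \<circ> snd c)"]
    by (rule pderiv_at_cong[OF chart(2)[OF that(1)] that(2,3)]) (use hp1 that in auto)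
  have h0: "h i x = 0" if i: "i \<in> ?I" for i
  proof (rule unique_continuation[OF M, where h = h and I = ?I, OF _ _ _ c0 _ _ x i])
    show "smooth_real ?m (fst c) (h i \<circ> snd c)" if c: "c \<in> atlas M" for c i
      using smooth_real_add[OF chart(2)[OF c] _ smooth_real_const, of "\<lambda>v. (f \<circ> snd c) v i" "- f (snd c0 u0) i"] sm[OF c]
      by (simp add: h_def smooth_vec_def comp_def)
    show "pderiv_at a (pderiv_at b (h i \<circ> snd c)) \<in> O[nhds_in (fst c) u](jet_norm ?m ?I (\<lambda>i. h i \<circ> snd c))"
      if c: "c \<in> atlas M" and u: "u \<in> fst c" and i: "i \<in> ?I" and a: "a < ?m" and b: "b < ?m" for c u i a b
    proof (rule bigo_cong_on)
      let ?E = "jet_norm ?m ?I (\<lambda>i. h i \<circ> snd c)"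
      have jet: "pderiv_at d (h j \<circ> snd c) \<in> O[nhds_in (fst c) u](?E)" if "d < ?m" "j \<in> ?I" for d j
        using pderiv_bigo_jet_norm[of ?I j d ?m "\<lambda>i. h i \<circ> snd c"] that by simp
      show "(\<lambda>v. (\<Sum>d<?m. \<Gamma> c v a b d * pderiv_at d (h i \<circ> snd c) v)
          - (\<Sum>j<amb_dim k n. (k * ?\<theta> j * vpderiv a (f \<circ> snd c) v j * (f \<circ> snd c) v i) * pderiv_at b (h j \<circ> snd c) v))
          \<in> O[nhds_in (fst c) u](?E)"
      proof (intro sum_in_bigo(2) big_sum_in_bigo bigo_cont_mult u jet b)
        show "continuous_on (fst c) (\<lambda>v. \<Gamma> c v a b d)" if "d \<in> {..<?m}" for d
          using \<Gamma> c a b that by (simp add: continuous_symbols_def)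
        have "continuous_on (fst c) (\<lambda>v. (f \<circ> snd c) v i)"
          using sm[OF c] smooth_real_continuous unfolding smooth_vec_def by blast
        then show "continuous_on (fst c) (\<lambda>v. k * ?\<theta> j * vpderiv a (f \<circ> snd c) v j * (f \<circ> snd c) v i)" for j
          by (intro continuous_intros continuous_on_vpderiv[OF sm[OF c] a])
      qed (use i in auto)
      fix v assume v: "v \<in> fst c"
      show "(\<Sum>d<?m. \<Gamma> c v a b d * pderiv_at d (h i \<circ> snd c) v)
          - (\<Sum>j<amb_dim k n. (k * ?\<theta> j * vpderiv a (f \<circ> snd c) v j * (f \<circ> snd c) v i) * pderiv_at b (h j \<circ> snd c) v)
          = pderiv_at a (pderiv_at b (h i \<circ> snd c)) v"
        unfolding hp2[OF c v a b] affine_map_eqD(3)[OF f c v a b] ip_space_form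
        by (simp add: hp1[OF c v] hp1[OF c v b] sum_distrib_left sum_distrib_right mult_ac)
    qed
    show "h i (snd c0 u0) = 0" for i by (simp add: h_def)
    show "pderiv_at a (h i \<circ> snd c0) u0 = 0" if "a < ?m" for i a using hp1[OF c0 that] d0[OF that] by simp
  qed auto
  show "f x i = f (snd c0 u0) i"
  proof (cases "i < amb_dim k n")
    case True
    then show ?thesis using h0[of i] by (simp add: h_def)
  next
    case False
    then show ?thesis using affine_map_eqD(1)[OF f x] affine_map_eqD(1)[OF f chart(3)[OF c0]] by (simp add: pts_space_form)
  qed
qed

section \<open>Reduction of a pair of maps to the normal forms\<close>

text \<open>The two components enter as separate maps, so that the locale can be instantiated a
  second time with the factors interchanged. The base point is given by coordinates
  \<open>u0\<close> in the chart \<open>c0\<close>.\<close>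

locale geodesic_pair =
  fixes M :: "'a riem" and \<Gamma> and k1 k2 :: real and n1 n2 :: nat and f1 f2 :: "'a \<Rightarrow> nat \<Rightarrow> real"
    and c0 :: "'a param" and u0 :: "nat \<Rightarrow> real"
  assumes M: "riemannian_manifold M" and \<Gamma>: "continuous_symbols M \<Gamma>"
    and f1: "affine_map_eq M \<Gamma> k1 n1 f1" and f2: "affine_map_eq M \<Gamma> k2 n2 f2"
    and gram: "\<And>c u a b. c \<in> atlas M \<Longrightarrow> u \<in> fst c \<Longrightarrow> a < rdim M \<Longrightarrow> b < rdim M \<Longrightarrow> gram M c u a b =
      ip (space_form_form k1 n1) (vpderiv a (f1 \<circ> snd c) u) (vpderiv b (f1 \<circ> snd c) u) +
      ip (space_form_form k2 n2) (vpderiv a (f2 \<circ> snd c) u) (vpderiv b (f2 \<circ> snd c) u)"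
    and c0: "c0 \<in> atlas M" "u0 \<in> fst c0"
begin

abbreviation "p1 \<equiv> f1 (snd c0 u0)"
abbreviation "p2 \<equiv> f2 (snd c0 u0)"
abbreviation "X1 a \<equiv> vpderiv a (f1 \<circ> snd c0) u0"
abbreviation "X2 a \<equiv> vpderiv a (f2 \<circ> snd c0) u0"

lemma p1: "p1 \<in> pts (space_form k1 n1)" and p2: "p2 \<in> pts (space_form k2 n2)"
  using affine_map_eqD(1)[OF f1] affine_map_eqD(1)[OF f2] manifold_chart(3)[OF M c0(1,2)] by auto

text \<open>A component whose differential vanishes at the base point is constant, so the other
  component carries the whole metric.\<close>

lemma into_slice_case:
  assumes d0: "\<And>a. a < rdim M \<Longrightarrow> X2 a = (\<lambda>i. 0)"
  shows "into_slice M (space_form k1 n1) (space_form k2 n2) (\<lambda>x. vpair (f1 x) (f2 x))"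
proof -
  have const: "f2 x = p2" if "x \<in> topspace (rtop M)" for x
    by (rule affine_map_constant[OF M \<Gamma> f2 c0 d0 that])
  have "vpderiv a (f2 \<circ> snd c) u = (\<lambda>i. 0)" if c: "c \<in> atlas M" "u \<in> fst c" "a < rdim M" for c u a
  proof
    fix i
    have "pderiv_at a (\<lambda>v. (f2 \<circ> snd c) v i) u = pderiv_at a (\<lambda>_. p2 i) u"
      by (rule pderiv_at_cong[OF manifold_chart(2)[OF M c(1)] c(2,3)])
        (use const manifold_chart(3)[OF M c(1)] in auto)
    then show "vpderiv a (f2 \<circ> snd c) u i = 0"
      by (simp add: vpderiv_def has_pderiv_imp[OF has_pderiv_const])
  qed
  then have "isometric_immersion M (space_form k1 n1) f1"
    unfolding isometric_immersion_def
    using affine_map_eqD(1,2)[OF f1] gram by (auto simp: ip_zero_left)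
  then show ?thesis
    unfolding into_slice_def
    using slice_tg_inclusion[OF tangent_projection_space_form tangent_projection_space_form p2, of k1 n1] p2 const
    by (intro exI[of _ f1] exI[of _ "\<lambda>x. vpair x p2"] exI[of _ p2]) auto
qed

lemma pair_isometric_immersion:
  assumes \<phi>1: "affine_map_eq M \<Gamma> k1 r1 \<phi>1" and \<phi>2: "affine_map_eq M \<Gamma> k2 r2 \<phi>2"
    and i1: "\<And>c u a b. c \<in> atlas M \<Longrightarrow> u \<in> fst c \<Longrightarrow> a < rdim M \<Longrightarrow> b < rdim M \<Longrightarrow>
      ip (space_form_form k1 r1) (vpderiv a (\<phi>1 \<circ> snd c) u) (vpderiv b (\<phi>1 \<circ> snd c) u) =
      ip (space_form_form k1 n1) (vpderiv a (f1 \<circ> snd c) u) (vpderiv b (f1 \<circ> snd c) u)"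
    and i2: "\<And>c u a b. c \<in> atlas M \<Longrightarrow> u \<in> fst c \<Longrightarrow> a < rdim M \<Longrightarrow> b < rdim M \<Longrightarrow>
      ip (space_form_form k2 r2) (vpderiv a (\<phi>2 \<circ> snd c) u) (vpderiv b (\<phi>2 \<circ> snd c) u) =
      ip (space_form_form k2 n2) (vpderiv a (f2 \<circ> snd c) u) (vpderiv b (f2 \<circ> snd c) u)"
  shows "isometric_immersion M (prod_submfd (space_form k1 r1) (space_form k2 r2)) (\<lambda>x. vpair (\<phi>1 x) (\<phi>2 x))"
  unfolding isometric_immersion_def
  using affine_map_eqD(1)[OF \<phi>1] affine_map_eqD(1)[OF \<phi>2]
    smooth_vec_vpair[OF affine_map_eqD(2)[OF \<phi>1] affine_map_eqD(2)[OF \<phi>2]] i1 i2 gram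
  by (auto simp: pts_prod vpderiv_vpair ip_vpair[OF finite_space_form_form finite_space_form_form])

text \<open>Each component is reduced separately to the space form spanned by its own frame. The
  pair of reduced maps is an immersion between spaces of equal dimension, hence a local
  isometry.\<close>

lemma product_case:
  assumes e1: "orthonormal (space_form_form k1 n1) r1 e1" "\<And>i. i < r1 \<Longrightarrow> e1 i \<in> tangent_space (space_form k1 n1) p1"
    "\<And>a. a < rdim M \<Longrightarrow> \<exists>w. X1 a = (\<lambda>i. \<Sum>j<r1. w j * e1 j i)"
    and e2: "orthonormal (space_form_form k2 n2) r2 e2" "\<And>i. i < r2 \<Longrightarrow> e2 i \<in> tangent_space (space_form k2 n2) p2"
    "\<And>a. a < rdim M \<Longrightarrow> \<exists>w. X2 a = (\<lambda>i. \<Sum>j<r2. w j * e2 j i)"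
    and dim: "r1 + r2 = rdim M"
  shows "\<exists>\<phi> j1 j2. local_isometry M (prod_submfd (space_form k1 r1) (space_form k2 r2)) \<phi> \<and>
    tg_inclusion (prod_submfd (space_form k1 r1) (space_form k2 r2)) (prod_submfd (space_form k1 n1) (space_form k2 n2)) (prod_map j1 j2) \<and>
    (\<forall>x\<in>topspace (rtop M). vpair (f1 x) (f2 x) = prod_map j1 j2 (\<phi> x))"
proof -
  note tp = tangent_projection_space_form
  obtain \<phi>1 where \<phi>1: "affine_map_eq M \<Gamma> k1 r1 \<phi>1"
    "\<forall>x\<in>topspace (rtop M). f1 x = frame_map (base_point k1 p1) (space_form_form k1 r1) (adapted_frame k1 p1 e1) (\<phi>1 x)"
    "\<forall>c\<in>atlas M. \<forall>u\<in>fst c. \<forall>a<rdim M. \<forall>b<rdim M.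
        ip (space_form_form k1 r1) (vpderiv a (\<phi>1 \<circ> snd c) u) (vpderiv b (\<phi>1 \<circ> snd c) u) =
        ip (space_form_form k1 n1) (vpderiv a (f1 \<circ> snd c) u) (vpderiv b (f1 \<circ> snd c) u)"
    using reduction_of_codimension[OF M \<Gamma> f1 c0 refl e1(2,1,3)] by blast
  obtain \<phi>2 where \<phi>2: "affine_map_eq M \<Gamma> k2 r2 \<phi>2"
    "\<forall>x\<in>topspace (rtop M). f2 x = frame_map (base_point k2 p2) (space_form_form k2 r2) (adapted_frame k2 p2 e2) (\<phi>2 x)"
    "\<forall>c\<in>atlas M. \<forall>u\<in>fst c. \<forall>a<rdim M. \<forall>b<rdim M.
        ip (space_form_form k2 r2) (vpderiv a (\<phi>2 \<circ> snd c) u) (vpderiv b (\<phi>2 \<circ> snd c) u) =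
        ip (space_form_form k2 n2) (vpderiv a (f2 \<circ> snd c) u) (vpderiv b (f2 \<circ> snd c) u)"
    using reduction_of_codimension[OF M \<Gamma> f2 c0 refl e2(2,1,3)] by blast
  have "local_isometry M (prod_submfd (space_form k1 r1) (space_form k2 r2)) (\<lambda>x. vpair (\<phi>1 x) (\<phi>2 x))"
    by (rule local_isometryI[OF M pair_isometric_immersion[OF \<phi>1(1) \<phi>2(1)] tangent_projection_prod[OF tp tp]])
      (use \<phi>1(3) \<phi>2(3) dim in auto)
  moreover note adapted_product_tg_inclusion[OF p1 e1(2,1) p2 e2(2,1)]
  moreover have "\<forall>x\<in>topspace (rtop M). vpair (f1 x) (f2 x) =
     prod_map (frame_map (base_point k1 p1) (space_form_form k1 r1) (adapted_frame k1 p1 e1))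
      (frame_map (base_point k2 p2) (space_form_form k2 r2) (adapted_frame k2 p2 e2)) (vpair (\<phi>1 x) (\<phi>2 x))"
    using \<phi>1(2) \<phi>2(2) by (simp add: prod_map_def)
  ultimately show ?thesis by blast
qed

text \<open>The components are reduced to maps \<open>F\<close> and \<open>G\<close> into space
  forms of dimension \<open>rdim M\<close>; it remains to see that \<open>F / A = G / B\<close>.
  Their equations correspond because \<open>k1 * (A * A) = k2 * (B * B)\<close>, and
  \<open>coef\<close> makes the initial derivatives correspond.\<close>

lemma diagonal_case:
  assumes k12: "k1 * k2 > 0" and k: "k = k1 * k2 / (k1 + k2)"
    and A: "A > 0" "A\<^sup>2 = k2 / (k1 + k2)" and B: "B > 0" "B\<^sup>2 = k1 / (k1 + k2)"
    and e1: "orthonormal (space_form_form k1 n1) (rdim M) e1" "\<And>i. i < rdim M \<Longrightarrow> e1 i \<in> tangent_space (space_form k1 n1) p1"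
    "\<And>a. a < rdim M \<Longrightarrow> \<exists>w. X1 a = (\<lambda>i. \<Sum>j<rdim M. w j * e1 j i)"
    and e2: "orthonormal (space_form_form k2 n2) (rdim M) e2" "\<And>i. i < rdim M \<Longrightarrow> e2 i \<in> tangent_space (space_form k2 n2) p2"
    "\<And>a. a < rdim M \<Longrightarrow> \<exists>w. X2 a = (\<lambda>i. \<Sum>j<rdim M. w j * e2 j i)"
    and coef: "\<And>a j. a < rdim M \<Longrightarrow> j < rdim M \<Longrightarrow>
      ip (space_form_form k1 n1) (X1 a) (e1 j) / A = ip (space_form_form k2 n2) (X2 a) (e2 j) / B"
  shows "\<exists>\<phi> j1 j2. local_isometry M (space_form k (rdim M)) \<phi> \<and>
    tg_inclusion (prod_submfd (space_form k1 (rdim M)) (space_form k2 (rdim M)))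
      (prod_submfd (space_form k1 n1) (space_form k2 n2)) (prod_map j1 j2) \<and>
    (\<forall>x\<in>topspace (rtop M). vpair (f1 x) (f2 x) = prod_map j1 j2 (vpair (\<lambda>i. A * \<phi> x i) (\<lambda>i. B * \<phi> x i)))"
proof -
  let ?m = "rdim M"
  have nz: "k1 \<noteq> 0" "k2 \<noteq> 0" "k1 < 0 \<longleftrightarrow> k2 < 0" using k12 by (auto simp: zero_less_mult_iff)
  have nz': "k1 + k2 \<noteq> 0" "k1 + k2 < 0 \<longleftrightarrow> k1 < 0" using nz by auto
  have k0: "k \<noteq> 0" "k < 0 \<longleftrightarrow> k1 < 0"
    using k12 nz nz' by (auto simp: k divide_less_0_iff)
  have AB: "A * A + B * B = 1" "k1 * (A * A) = k" "k2 * (B * B) = k"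
    using A(2) B(2) nz' by (auto simp: power2_eq_square k add_divide_distrib[symmetric] add.commute)
  define \<eta> where "\<eta> = space_form_form k ?m"
  have \<eta>: "space_form_form k1 ?m = \<eta>" "space_form_form k2 ?m = \<eta>"
    unfolding \<eta>_def using nz k0 by (auto intro!: space_form_form_sign)
  define N where "N = Suc ?m"
  have ad: "amb_dim k1 ?m = N" "amb_dim k2 ?m = N" "amb_dim k ?m = N" using nz k0 by (auto simp: amb_dim_def N_def)
  have ipN: "ip \<eta> x y = (\<Sum>i<N. \<eta> i * x i * y i)" for x y unfolding \<eta>_def ip_space_form ad ..
  let ?J1 = "frame_map (base_point k1 p1) (space_form_form k1 ?m) (adapted_frame k1 p1 e1)"
  let ?J2 = "frame_map (base_point k2 p2) (space_form_form k2 ?m) (adapted_frame k2 p2 e2)"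
  obtain F where F: "affine_map_eq M \<Gamma> k1 ?m F" "\<forall>x\<in>topspace (rtop M). f1 x = ?J1 (F x)"
    "F (snd c0 u0) = (\<lambda>j. if k1 \<noteq> 0 \<and> j = 0 then 1 / sqrt \<bar>k1\<bar> else 0)"
    "\<forall>a<?m. vpderiv a (F \<circ> snd c0) u0 = (\<lambda>j. if j < amb_dim k1 ?m then
        (if k1 = 0 then ip (space_form_form k1 n1) (X1 a) (e1 j)
         else if j = 0 then 0 else ip (space_form_form k1 n1) (X1 a) (e1 (j - 1))) else 0)"
    "\<forall>c\<in>atlas M. \<forall>u\<in>fst c. \<forall>a<?m. \<forall>b<?m.
        ip (space_form_form k1 ?m) (vpderiv a (F \<circ> snd c) u) (vpderiv b (F \<circ> snd c) u) =
        ip (space_form_form k1 n1) (vpderiv a (f1 \<circ> snd c) u) (vpderiv b (f1 \<circ> snd c) u)"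
    using reduction_of_codimension[OF M \<Gamma> f1 c0 refl e1(2,1,3)] by blast
  obtain G where G: "affine_map_eq M \<Gamma> k2 ?m G" "\<forall>x\<in>topspace (rtop M). f2 x = ?J2 (G x)"
    "G (snd c0 u0) = (\<lambda>j. if k2 \<noteq> 0 \<and> j = 0 then 1 / sqrt \<bar>k2\<bar> else 0)"
    "\<forall>a<?m. vpderiv a (G \<circ> snd c0) u0 = (\<lambda>j. if j < amb_dim k2 ?m then
        (if k2 = 0 then ip (space_form_form k2 n2) (X2 a) (e2 j)
         else if j = 0 then 0 else ip (space_form_form k2 n2) (X2 a) (e2 (j - 1))) else 0)"
    "\<forall>c\<in>atlas M. \<forall>u\<in>fst c. \<forall>a<?m. \<forall>b<?m.
        ip (space_form_form k2 ?m) (vpderiv a (G \<circ> snd c) u) (vpderiv b (G \<circ> snd c) u) =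
        ip (space_form_form k2 n2) (vpderiv a (f2 \<circ> snd c) u) (vpderiv b (f2 \<circ> snd c) u)"
    using reduction_of_codimension[OF M \<Gamma> f2 c0 refl e2(2,1,3)] by blast
  note chart = manifold_chart[OF M]
  have smF: "smooth_vec ?m (fst c) (F \<circ> snd c)" if "c \<in> atlas M" for c by (rule affine_map_eqD(2)[OF F(1) that])
  have smG: "smooth_vec ?m (fst c) (G \<circ> snd c)" if "c \<in> atlas M" for c by (rule affine_map_eqD(2)[OF G(1) that])
  define h where "h j x = (1 / A) * F x j - (1 / B) * G x j" for j x
  have hp1: "pderiv_at a (h j \<circ> snd c) u = (1 / A) * vpderiv a (F \<circ> snd c) u j - (1 / B) * vpderiv a (G \<circ> snd c) u j"
    if "c \<in> atlas M" "u \<in> fst c" "a < ?m" for c u a j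
    using has_pderiv_imp[OF has_pderiv_diff[OF has_pderiv_cmult[OF smooth_vec_has_pderiv[OF smF[OF that(1)] that(2,3)]]
       has_pderiv_cmult[OF smooth_vec_has_pderiv[OF smG[OF that(1)] that(2,3)]]], of "1 / A" j "1 / B" j]
    by (simp add: h_def comp_def)
  have hp2: "pderiv_at a (pderiv_at b (h j \<circ> snd c)) u
      = (1 / A) * vpderiv a (vpderiv b (F \<circ> snd c)) u j - (1 / B) * vpderiv a (vpderiv b (G \<circ> snd c)) u j"
    if "c \<in> atlas M" "u \<in> fst c" "a < ?m" "b < ?m" for c u a b j
  proof -
    have "pderiv_at a (pderiv_at b (h j \<circ> snd c)) u
        = pderiv_at a (\<lambda>v. (1 / A) * vpderiv b (F \<circ> snd c) v j - (1 / B) * vpderiv b (G \<circ> snd c) v j) u"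
      by (rule pderiv_at_cong[OF chart(2)[OF that(1)] that(2,3)]) (use hp1[OF that(1) _ that(4)] in auto)
    also have "\<dots> = (1 / A) * vpderiv a (vpderiv b (F \<circ> snd c)) u j - (1 / B) * vpderiv a (vpderiv b (G \<circ> snd c)) u j"
      by (intro has_pderiv_imp has_pderiv_diff has_pderiv_cmult
          smooth_vec_has_pderiv[OF smooth_vec_vpderiv[OF smF[OF that(1)] that(4)] that(2,3)]
          smooth_vec_has_pderiv[OF smooth_vec_vpderiv[OF smG[OF that(1)] that(4)] that(2,3)])
    finally show ?thesis .
  qed
  have h0: "h j x = 0" if x: "x \<in> topspace (rtop M)" and j: "j \<in> {..<N}" for j x
  proof (rule unique_continuation[OF M, where h = h and I = "{..<N}", OF _ _ _ c0 _ _ x j])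
    show "smooth_real ?m (fst c) (h j \<circ> snd c)" if c: "c \<in> atlas M" for c j
    proof -
      have "smooth_real ?m (fst c) (\<lambda>v. (1 / A) * (F \<circ> snd c) v j + (- 1 / B) * (G \<circ> snd c) v j)"
        using smF[OF c] smG[OF c] by (intro smooth_real_add smooth_real_cmult chart(2)[OF c]) (auto simp: smooth_vec_def)
      then show ?thesis by (simp add: h_def comp_def)
    qed
    show "pderiv_at a (pderiv_at b (h j \<circ> snd c)) \<in> O[nhds_in (fst c) u](jet_norm ?m {..<N} (\<lambda>i. h i \<circ> snd c))"
      if c: "c \<in> atlas M" and u: "u \<in> fst c" and j: "j \<in> {..<N}" and a: "a < ?m" and b: "b < ?m" for c u j a b
    proof (rule bigo_cong_on)
      let ?E = "jet_norm ?m {..<N} (\<lambda>i. h i \<circ> snd c)"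
      let ?Fa = "vpderiv a (F \<circ> snd c)" and ?Fb = "vpderiv b (F \<circ> snd c)"
      let ?Ga = "vpderiv a (G \<circ> snd c)" and ?Gb = "vpderiv b (G \<circ> snd c)"
      \<comment> \<open>The difference of the two cubic terms, expanded one factor at a time. Every
        summand contains exactly one value or first derivative of \<open>h\<close>, multiplied by a
        continuous coefficient.\<close>
      let ?R = "\<lambda>v. (\<Sum>d<?m. \<Gamma> c v a b d * pderiv_at d (h j \<circ> snd c) v)
          - (k2 * (B * B) / (A * A) * ip \<eta> (?Fa v) (?Fb v)) * (h j \<circ> snd c) v
          - (\<Sum>i<N. (k2 / B * (G \<circ> snd c) v j * \<eta> i * (B * B / A) * ?Fa v i) * pderiv_at b (h i \<circ> snd c) v)
          - (\<Sum>i<N. (k2 * (G \<circ> snd c) v j * \<eta> i * ?Gb v i) * pderiv_at a (h i \<circ> snd c) v)"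
      have jet: "pderiv_at d (h i \<circ> snd c) \<in> O[nhds_in (fst c) u](?E)" if "d < ?m" "i < N" for d i
        using pderiv_bigo_jet_norm[of "{..<N}" i d ?m "\<lambda>i. h i \<circ> snd c"] that by simp
      have val: "(h i \<circ> snd c) \<in> O[nhds_in (fst c) u](?E)" if "i < N" for i
        using value_bigo_jet_norm[of "{..<N}" i "\<lambda>i. h i \<circ> snd c"] that by simp
      have cG: "continuous_on (fst c) (\<lambda>v. (G \<circ> snd c) v j)"
        using smG[OF c] smooth_real_continuous unfolding smooth_vec_def by blast
      have c\<Gamma>: "continuous_on (fst c) (\<lambda>v. \<Gamma> c v a b d)" if "d < ?m" for d
        using \<Gamma> c a b that by (simp add: continuous_symbols_def)
      show "?R \<in> O[nhds_in (fst c) u](?E)"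
        by (intro sum_in_bigo(2) big_sum_in_bigo bigo_cont_mult u jet val a b c\<Gamma> continuous_intros cG
            continuous_on_ip continuous_on_vpderiv[OF smF[OF c]] continuous_on_vpderiv[OF smG[OF c]])
          (use j in auto)
      fix v assume v: "v \<in> fst c"
      define S where "S = (\<Sum>i<N. \<eta> i * ?Fa v i * ?Fb v i)"
      define Q where "Q = (\<Sum>i<N. \<eta> i * ?Ga v i * ?Gb v i)"
      define hj where "hj = h j (snd c v)"
      define X where "X = (\<Sum>i<N. \<eta> i * (B * B / A) * ?Fa v i * pderiv_at b (h i \<circ> snd c) v)
          + B * (\<Sum>i<N. \<eta> i * ?Gb v i * pderiv_at a (h i \<circ> snd c) v)"
      \<comment> \<open>Each derivative of \<open>G\<close> is \<open>B / A\<close> times that of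
        \<open>F\<close> minus \<open>B\<close> times that of \<open>h\<close>. This is substituted
        for the two factors in turn; \<open>X\<close> collects the terms with
        \<open>h\<close>.\<close>
      have QS: "Q = (B * B) / (A * A) * S - X"
      proof -
        have "\<eta> i * ?Ga v i * ?Gb v i = (B * B) / (A * A) * (\<eta> i * ?Fa v i * ?Fb v i)
            - (\<eta> i * (B * B / A) * ?Fa v i * pderiv_at b (h i \<circ> snd c) v
              + B * (\<eta> i * ?Gb v i * pderiv_at a (h i \<circ> snd c) v))" for i
          unfolding hp1[OF c v a] hp1[OF c v b] using A(1) B(1) by (simp add: field_simps)
        then show ?thesis
          unfolding Q_def S_def X_def sum_distrib_left sum.distrib[symmetric] sum_subtractf[symmetric]
          by (intro sum.cong refl)
      qed
      have k1A: "k1 = k2 * (B * B) / (A * A)" using AB A(1) by (simp add: field_simps)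
      have Gj: "G (snd c v) j = B / A * F (snd c v) j - B * hj" using A(1) B(1) by (simp add: hj_def h_def field_simps)
      have "pderiv_at a (pderiv_at b (h j \<circ> snd c)) v
         = (1 / A) * ((\<Sum>d<?m. \<Gamma> c v a b d * vpderiv d (F \<circ> snd c) v j) - k1 * S * F (snd c v) j)
         - (1 / B) * ((\<Sum>d<?m. \<Gamma> c v a b d * vpderiv d (G \<circ> snd c) v j) - k2 * Q * G (snd c v) j)"
        unfolding hp2[OF c v a b] affine_map_eqD(3)[OF F(1) c v a b] affine_map_eqD(3)[OF G(1) c v a b] \<eta> ipN S_def Q_def ..
      also have "\<dots> = (\<Sum>d<?m. \<Gamma> c v a b d * pderiv_at d (h j \<circ> snd c) v)
          + (- k1 / A * S * F (snd c v) j + k2 / B * Q * G (snd c v) j)"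
      proof -
        have "(\<Sum>d<?m. \<Gamma> c v a b d * pderiv_at d (h j \<circ> snd c) v)
          = (1 / A) * (\<Sum>d<?m. \<Gamma> c v a b d * vpderiv d (F \<circ> snd c) v j)
            - (1 / B) * (\<Sum>d<?m. \<Gamma> c v a b d * vpderiv d (G \<circ> snd c) v j)"
          unfolding sum_distrib_left sum_subtractf[symmetric]
          by (intro sum.cong refl) (simp add: hp1[OF c v] algebra_simps)
        then show ?thesis by (simp add: algebra_simps)
      qed
      also have "- k1 / A * S * F (snd c v) j + k2 / B * Q * G (snd c v) j
          = - (k2 * (B * B) / (A * A) * S) * hj - k2 / B * G (snd c v) j * X"
      proof -
        have "k2 / B * Q * G (snd c v) j = k2 / B * ((B * B) / (A * A) * S) * G (snd c v) j - k2 / B * G (snd c v) j * X"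
          unfolding QS by (simp add: algebra_simps)
        also have "k2 / B * ((B * B) / (A * A) * S) * G (snd c v) j
           = k1 / A * S * F (snd c v) j - (k2 * (B * B) / (A * A) * S) * hj"
          unfolding Gj k1A using A(1) B(1) by (simp add: field_simps)
        finally show ?thesis by simp
      qed
      also have "k2 / B * G (snd c v) j * X =
          (\<Sum>i<N. (k2 / B * (G \<circ> snd c) v j * \<eta> i * (B * B / A) * ?Fa v i) * pderiv_at b (h i \<circ> snd c) v)
          + (\<Sum>i<N. (k2 * (G \<circ> snd c) v j * \<eta> i * ?Gb v i) * pderiv_at a (h i \<circ> snd c) v)"
      proof -
        have "k2 / B * G (snd c v) j * X = k2 / B * G (snd c v) j * (\<Sum>i<N. \<eta> i * (B * B / A) * ?Fa v i * pderiv_at b (h i \<circ> snd c) v)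
          + k2 * G (snd c v) j * (\<Sum>i<N. \<eta> i * ?Gb v i * pderiv_at a (h i \<circ> snd c) v)"
          unfolding X_def using B(1) by (simp add: algebra_simps)
        then show ?thesis by (simp only: sum_distrib_left comp_apply mult.assoc)
      qed
      finally show "?R v = pderiv_at a (pderiv_at b (h j \<circ> snd c)) v"
        unfolding ipN by (simp add: S_def hj_def comp_def)
    qed
    \<comment> \<open>The reduced components start at \<open>1 / sqrt \<bar>k1\<bar>\<close> and
      \<open>1 / sqrt \<bar>k2\<bar>\<close> in the coordinate 0; division by \<open>A\<close> and
      \<open>B\<close> gives the same starting point, that of the quadric of curvature
      \<open>k\<close>.\<close>
    have sA: "1 / A * (1 / sqrt \<bar>k1\<bar>) = 1 / sqrt \<bar>k\<bar>"
    proof -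
      have "sqrt \<bar>k\<bar> = sqrt \<bar>k1\<bar> * A" unfolding AB(2)[symmetric] using A(1) by (simp add: abs_mult real_sqrt_mult)
      then show ?thesis by simp
    qed
    have sB: "1 / B * (1 / sqrt \<bar>k2\<bar>) = 1 / sqrt \<bar>k\<bar>"
    proof -
      have "sqrt \<bar>k\<bar> = sqrt \<bar>k2\<bar> * B" unfolding AB(3)[symmetric] using B(1) by (simp add: abs_mult real_sqrt_mult)
      then show ?thesis by simp
    qed
    show "h j (snd c0 u0) = 0" for j
      unfolding h_def F(3) G(3) using nz sA sB by (simp add: mult.commute)
    show "pderiv_at a (h j \<circ> snd c0) u0 = 0" if j: "j \<in> {..<N}" and a: "a < ?m" for j a
    proof (cases j)
      case 0
      then show ?thesis unfolding hp1[OF c0 a] F(4)[rule_format, OF a] G(4)[rule_format, OF a] using nz by simp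
    next
      case (Suc i)
      then have "i < ?m" using j by (simp add: N_def)
      then show ?thesis unfolding hp1[OF c0 a] F(4)[rule_format, OF a] G(4)[rule_format, OF a]
        using nz coef[OF a, of i] Suc by (simp add: ad N_def)
    qed
  qed simp
  define \<phi> where "\<phi> x = (\<lambda>j. (1 / A) * F x j)" for x
  have FG: "F x = (\<lambda>j. A * \<phi> x j)" "G x = (\<lambda>j. B * \<phi> x j)" if x: "x \<in> topspace (rtop M)" for x
  proof -
    show "F x = (\<lambda>j. A * \<phi> x j)" using A(1) by (simp add: \<phi>_def)
    show "G x = (\<lambda>j. B * \<phi> x j)"
    proof
      fix j
      show "G x j = B * \<phi> x j"
      proof (cases "j < N")
        case True
        then show ?thesis using h0[OF x, of j] B(1) by (simp add: h_def \<phi>_def field_simps)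
      next
        case False
        then have "G x j = 0" "F x j = 0"
          using affine_map_eqD(1)[OF F(1) x] affine_map_eqD(1)[OF G(1) x] by (auto simp: pts_space_form ad)
        then show ?thesis by (simp add: \<phi>_def)
      qed
    qed
  qed
  have sm\<phi>: "smooth_vec ?m (fst c) (\<phi> \<circ> snd c)" if c: "c \<in> atlas M" for c
    unfolding smooth_vec_def
  proof
    fix i
    have "smooth_real ?m (fst c) (\<lambda>v. (1 / A) * (F \<circ> snd c) v i)"
      using smF[OF c] by (intro smooth_real_cmult chart(2)[OF c]) (simp add: smooth_vec_def)
    then show "smooth_real ?m (fst c) (\<lambda>v. (\<phi> \<circ> snd c) v i)" by (simp add: \<phi>_def comp_def)
  qed
  have d\<phi>: "vpderiv a (F \<circ> snd c) u = (\<lambda>j. A * vpderiv a (\<phi> \<circ> snd c) u j)"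
    "vpderiv a (G \<circ> snd c) u = (\<lambda>j. B * vpderiv a (\<phi> \<circ> snd c) u j)"
    if c: "c \<in> atlas M" "u \<in> fst c" "a < ?m" for c u a
  proof -
    have "has_pderiv a (\<lambda>v. A * (\<phi> \<circ> snd c) v j) u (A * vpderiv a (\<phi> \<circ> snd c) u j)"
      "has_pderiv a (\<lambda>v. B * (\<phi> \<circ> snd c) v j) u (B * vpderiv a (\<phi> \<circ> snd c) u j)" for j
      by (intro has_pderiv_cmult smooth_vec_has_pderiv[OF sm\<phi>[OF c(1)] c(2,3)])+
    note hp = this
    have "vpderiv a (F \<circ> snd c) u j = A * vpderiv a (\<phi> \<circ> snd c) u j" for j
      unfolding vpderiv_def[of a "F \<circ> snd c"]
      by (rule has_pderiv_imp[OF has_pderiv_cong[OF chart(2)[OF c(1)] c(2,3) _ hp(1)]])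
        (use FG(1)[OF chart(3)[OF c(1)]] in simp)
    then show "vpderiv a (F \<circ> snd c) u = (\<lambda>j. A * vpderiv a (\<phi> \<circ> snd c) u j)" by auto
    have "vpderiv a (G \<circ> snd c) u j = B * vpderiv a (\<phi> \<circ> snd c) u j" for j
      unfolding vpderiv_def[of a "G \<circ> snd c"]
      by (rule has_pderiv_imp[OF has_pderiv_cong[OF chart(2)[OF c(1)] c(2,3) _ hp(2)]])
        (use FG(2)[OF chart(3)[OF c(1)]] in simp)
    then show "vpderiv a (G \<circ> snd c) u = (\<lambda>j. B * vpderiv a (\<phi> \<circ> snd c) u j)" by auto
  qed
  have iso: "isometric_immersion M (space_form k ?m) \<phi>"
    unfolding isometric_immersion_def form_space_form \<eta>_def[symmetric]
  proof (intro conjI ballI allI impI subsetI)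
    fix y assume "y \<in> \<phi> ` topspace (rtop M)"
    then obtain x where x: "x \<in> topspace (rtop M)" "y = \<phi> x" by blast
    have Fx: "F x \<in> pts (space_form k1 ?m)" by (rule affine_map_eqD(1)[OF F(1) x(1)])
    have s: "\<forall>i\<ge>N. \<phi> x i = 0" using Fx by (simp add: pts_space_form ad \<phi>_def)
    have "ip \<eta> (F x) (F x) = 1 / k1" using Fx nz by (simp add: pts_space_form \<eta>)
    then have "A * (A * ip \<eta> (\<phi> x) (\<phi> x)) = 1 / k1" unfolding FG(1)[OF x(1)] ip_scale_left ip_scale_right .
    then have "ip \<eta> (\<phi> x) (\<phi> x) = 1 / k" unfolding AB(2)[symmetric] using A(1) nz by (simp add: field_simps)
    moreover have "\<phi> x 0 > 0" if "k < 0" using that Fx k0 nz A(1) by (simp add: pts_space_form \<phi>_def)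
    ultimately show "y \<in> pts (space_form k ?m)" using s x(2) by (simp add: pts_space_form ad \<eta>_def)
  next
    fix c assume "c \<in> atlas M" then show "smooth_vec ?m (fst c) (\<phi> \<circ> snd c)" by (rule sm\<phi>)
  next
    fix c u a b assume c: "c \<in> atlas M" and u: "u \<in> fst c" and a: "a < ?m" and b: "b < ?m"
    have "gram M c u a b = A * (A * ip \<eta> (vpderiv a (\<phi> \<circ> snd c) u) (vpderiv b (\<phi> \<circ> snd c) u))
       + B * (B * ip \<eta> (vpderiv a (\<phi> \<circ> snd c) u) (vpderiv b (\<phi> \<circ> snd c) u))"
      unfolding gram[OF c u a b] F(5)[rule_format, OF c u a b, symmetric] G(5)[rule_format, OF c u a b, symmetric] \<eta>
        d\<phi>[OF c u a] d\<phi>[OF c u b] ip_scale_left ip_scale_right ..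
    also have "\<dots> = (A * A + B * B) * ip \<eta> (vpderiv a (\<phi> \<circ> snd c) u) (vpderiv b (\<phi> \<circ> snd c) u)"
      by (simp add: algebra_simps)
    finally show "ip \<eta> (vpderiv a (\<phi> \<circ> snd c) u) (vpderiv b (\<phi> \<circ> snd c) u) = gram M c u a b"
      by (simp add: AB)
  qed
  have "local_isometry M (space_form k ?m) \<phi>"
    by (rule local_isometryI[OF M iso tangent_projection_space_form]) simp
  moreover note adapted_product_tg_inclusion[OF p1 e1(2,1) p2 e2(2,1)]
  moreover have "\<forall>x\<in>topspace (rtop M). vpair (f1 x) (f2 x) = prod_map ?J1 ?J2 (vpair (\<lambda>i. A * \<phi> x i) (\<lambda>i. B * \<phi> x i))"
    using F(2) G(2) FG by (simp add: prod_map_def)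
  ultimately show ?thesis by blast
qed

text \<open>The curved component has rank one at the base point and reduces to a map
  \<open>F\<close> into a one-dimensional space form. The claim is \<open>F = al (y)\<close>, where
  \<open>al\<close> is a geodesic of speed \<open>sqrt \<rho>\<close> and \<open>y\<close> is the
  coordinate 0 of the flat component divided by its speed \<open>\<mu>\<close>. The slope is fixed
  by \<open>\<rho> + \<mu> * \<mu> = 1\<close>, which gives unit speed.\<close>

lemma flat_case:
  assumes k2: "k2 = 0" and k1: "k1 \<noteq> 0" and m: "rdim M \<ge> 1" and \<rho>: "0 < \<rho>" "\<rho> < 1"
    and e1: "orthonormal (space_form_form k1 n1) 1 e1" "\<And>i. i < 1 \<Longrightarrow> e1 i \<in> tangent_space (space_form k1 n1) p1"
    "\<And>a. a < rdim M \<Longrightarrow> \<exists>w. X1 a = (\<lambda>i. \<Sum>j<1. w j * e1 j i)"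
    and e2: "orthonormal (space_form_form k2 n2) (rdim M) e2" "\<And>i. i < rdim M \<Longrightarrow> e2 i \<in> tangent_space (space_form k2 n2) p2"
    "\<And>a. a < rdim M \<Longrightarrow> \<exists>w. X2 a = (\<lambda>i. \<Sum>j<rdim M. w j * e2 j i)"
    and coef: "\<And>a. a < rdim M \<Longrightarrow>
      ip (space_form_form k1 n1) (X1 a) (e1 0) / sqrt \<rho> = ip (space_form_form k2 n2) (X2 a) (e2 0) / sqrt (1 - \<rho>)"
  shows "geodesic_times_flat M k1 n1 n2 (\<lambda>x. vpair (f1 x) (f2 x))"
proof -
  let ?m = "rdim M"
  obtain q where q: "?m = Suc q" using m by (cases ?m) auto
  \<comment> \<open>A curve of speed \<open>sqrt \<rho>\<close> that is geodesic in curvature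
    \<open>k1\<close> satisfies \<open>al'' = - k1 * \<rho> * al\<close>.\<close>
  define \<kappa> where "\<kappa> = k1 * \<rho>"
  have \<kappa>0: "\<kappa> \<noteq> 0" "\<kappa> < 0 \<longleftrightarrow> k1 < 0" using k1 \<rho> by (auto simp: \<kappa>_def mult_less_0_iff)
  define \<mu> where "\<mu> = sqrt (1 - \<rho>)"
  have \<mu>: "\<mu> > 0" "\<mu> * \<mu> = 1 - \<rho>" using \<rho> by (auto simp: \<mu>_def)
  have s\<rho>: "sqrt \<rho> > 0" "sqrt \<rho> * sqrt \<rho> = \<rho>" using \<rho> by auto
  let ?\<eta> = "space_form_form k1 1"
  have ad: "amb_dim k1 1 = 2" "amb_dim k2 ?m = ?m" using k1 k2 by (auto simp: amb_dim_def)
  have ip2: "ip ?\<eta> x y = ?\<eta> 0 * x 0 * y 0 + ?\<eta> 1 * x 1 * y 1" for x y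
    unfolding ip_space_form ad by (simp add: numeral_2_eq_2)
  have \<eta>1: "?\<eta> 1 = 1" "?\<eta> 0 = (if k1 < 0 then -1 else 1)" using k1 by (auto simp: space_form_form_def)
  \<comment> \<open>The geodesic with the initial position of \<open>F\<close>, namely
    \<open>1 / sqrt \<bar>k1\<bar>\<close> in the coordinate 0, and with initial velocity
    \<open>sqrt \<rho>\<close> in the coordinate 1.\<close>
  define al where "al j = (if j = 0 then (\<lambda>t. (1 / sqrt \<bar>k1\<bar>) * gen_cos \<kappa> t) else (\<lambda>t. sqrt \<rho> * gen_sin \<kappa> t))" for j :: nat
  define al' where "al' j = (if j = 0 then (\<lambda>t. (1 / sqrt \<bar>k1\<bar>) * (- \<kappa> * gen_sin \<kappa> t)) else (\<lambda>t. sqrt \<rho> * gen_cos \<kappa> t))" for j :: nat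
  have dal: "(al j has_real_derivative al' j t) (at t)" for j t
  proof (cases "j = 0")
    case True
    have "((\<lambda>t. (1 / sqrt \<bar>k1\<bar>) * gen_cos \<kappa> t) has_real_derivative (1 / sqrt \<bar>k1\<bar>) * (- \<kappa> * gen_sin \<kappa> t)) (at t)"
      by (intro DERIV_cmult gen_cos_derivative \<kappa>0)
    then show ?thesis using True by (simp add: al_def al'_def)
  next
    case False
    have "((\<lambda>t. sqrt \<rho> * gen_sin \<kappa> t) has_real_derivative sqrt \<rho> * gen_cos \<kappa> t) (at t)"
      by (intro DERIV_cmult gen_sin_derivative \<kappa>0)
    then show ?thesis using False by (simp add: al_def al'_def)
  qed
  have dal': "(al' j has_real_derivative - \<kappa> * al j t) (at t)" for j t
  proof (cases "j = 0")
    case True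
    have "((\<lambda>t. (1 / sqrt \<bar>k1\<bar>) * (- \<kappa> * gen_sin \<kappa> t)) has_real_derivative (1 / sqrt \<bar>k1\<bar>) * (- \<kappa> * gen_cos \<kappa> t)) (at t)"
      by (intro DERIV_cmult gen_sin_derivative \<kappa>0)
    then show ?thesis using True by (simp add: al_def al'_def)
  next
    case False
    have "((\<lambda>t. sqrt \<rho> * gen_cos \<kappa> t) has_real_derivative sqrt \<rho> * (- \<kappa> * gen_sin \<kappa> t)) (at t)"
      by (intro DERIV_cmult gen_cos_derivative \<kappa>0)
    then show ?thesis using False by (simp add: al_def al'_def mult_ac)
  qed
  have trig: "al j \<in> gen_trig \<kappa>" for j
  proof (cases "j = 0")
    case True
    then have "al j = (\<lambda>t. (1 / sqrt \<bar>k1\<bar>) * gen_cos \<kappa> t + 0 * gen_sin \<kappa> t)" by (simp add: al_def)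
    then show ?thesis unfolding gen_trig_def by blast
  next
    case False
    then have "al j = (\<lambda>t. 0 * gen_cos \<kappa> t + sqrt \<rho> * gen_sin \<kappa> t)" by (simp add: al_def)
    then show ?thesis unfolding gen_trig_def by blast
  qed
  have k1abs: "(1 / sqrt \<bar>k1\<bar>) * (1 / sqrt \<bar>k1\<bar>) * (if k1 < 0 then -1 else 1) = 1 / k1" using k1 by simp
  have CS: "gen_cos \<kappa> t * gen_cos \<kappa> t = 1 - \<kappa> * (gen_sin \<kappa> t * gen_sin \<kappa> t)" for t
    using gen_cos_sin_squared[OF \<kappa>0(1), of t] by simp
  have al_pt: "?\<eta> 0 * al 0 t * al 0 t + ?\<eta> 1 * al 1 t * al 1 t = 1 / k1" for t
  proof -
    have "?\<eta> 0 * al 0 t * al 0 t + ?\<eta> 1 * al 1 t * al 1 t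
       = ((1 / sqrt \<bar>k1\<bar>) * (1 / sqrt \<bar>k1\<bar>) * (if k1 < 0 then -1 else 1)) * (gen_cos \<kappa> t * gen_cos \<kappa> t)
         + (sqrt \<rho> * sqrt \<rho>) * (gen_sin \<kappa> t * gen_sin \<kappa> t)"
      unfolding \<eta>1 al_def by (simp only: if_True if_False refl one_neq_zero mult_ac mult_1)
    also have "\<dots> = 1 / k1"
    proof -
      have "1 / k1 * (1 - \<kappa> * s) + \<rho> * s = 1 / k1" for s unfolding \<kappa>_def using k1 by (simp add: field_simps)
      then show ?thesis unfolding k1abs CS s\<rho>(2) .
    qed
    finally show ?thesis .
  qed
  have al'_sq: "?\<eta> 0 * al' 0 t * al' 0 t + ?\<eta> 1 * al' 1 t * al' 1 t = \<rho>" for t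
  proof -
    have "?\<eta> 0 * al' 0 t * al' 0 t + ?\<eta> 1 * al' 1 t * al' 1 t
       = ((1 / sqrt \<bar>k1\<bar>) * (1 / sqrt \<bar>k1\<bar>) * (if k1 < 0 then -1 else 1)) * (\<kappa> * \<kappa> * (gen_sin \<kappa> t * gen_sin \<kappa> t))
         + (sqrt \<rho> * sqrt \<rho>) * (gen_cos \<kappa> t * gen_cos \<kappa> t)"
      unfolding \<eta>1 al'_def by (simp only: if_True if_False refl one_neq_zero mult_ac mult_1 minus_mult_left[symmetric]
        minus_mult_right[symmetric] minus_minus)
    also have "\<dots> = \<rho>"
    proof -
      have "1 / k1 * (\<kappa> * \<kappa> * s) + \<rho> * (1 - \<kappa> * s) = \<rho>" for s unfolding \<kappa>_def using k1 by (simp add: field_simps)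
      then show ?thesis unfolding k1abs CS s\<rho>(2) .
    qed
    finally show ?thesis .
  qed
  let ?J1 = "frame_map (base_point k1 p1) (space_form_form k1 1) (adapted_frame k1 p1 e1)"
  let ?J2 = "frame_map (base_point k2 p2) (space_form_form k2 ?m) (adapted_frame k2 p2 e2)"
  obtain F where F: "affine_map_eq M \<Gamma> k1 1 F" "\<forall>x\<in>topspace (rtop M). f1 x = ?J1 (F x)"
    "F (snd c0 u0) = (\<lambda>j. if k1 \<noteq> 0 \<and> j = 0 then 1 / sqrt \<bar>k1\<bar> else 0)"
    "\<forall>a<?m. vpderiv a (F \<circ> snd c0) u0 = (\<lambda>j. if j < amb_dim k1 1 then
        (if k1 = 0 then ip (space_form_form k1 n1) (X1 a) (e1 j)
         else if j = 0 then 0 else ip (space_form_form k1 n1) (X1 a) (e1 (j - 1))) else 0)"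
    "\<forall>c\<in>atlas M. \<forall>u\<in>fst c. \<forall>a<?m. \<forall>b<?m.
        ip (space_form_form k1 1) (vpderiv a (F \<circ> snd c) u) (vpderiv b (F \<circ> snd c) u) =
        ip (space_form_form k1 n1) (vpderiv a (f1 \<circ> snd c) u) (vpderiv b (f1 \<circ> snd c) u)"
    using reduction_of_codimension[OF M \<Gamma> f1 c0 refl e1(2,1,3)] by blast
  obtain G where G: "affine_map_eq M \<Gamma> k2 ?m G" "\<forall>x\<in>topspace (rtop M). f2 x = ?J2 (G x)"
    "G (snd c0 u0) = (\<lambda>j. if k2 \<noteq> 0 \<and> j = 0 then 1 / sqrt \<bar>k2\<bar> else 0)"
    "\<forall>a<?m. vpderiv a (G \<circ> snd c0) u0 = (\<lambda>j. if j < amb_dim k2 ?m then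
        (if k2 = 0 then ip (space_form_form k2 n2) (X2 a) (e2 j)
         else if j = 0 then 0 else ip (space_form_form k2 n2) (X2 a) (e2 (j - 1))) else 0)"
    "\<forall>c\<in>atlas M. \<forall>u\<in>fst c. \<forall>a<?m. \<forall>b<?m.
        ip (space_form_form k2 ?m) (vpderiv a (G \<circ> snd c) u) (vpderiv b (G \<circ> snd c) u) =
        ip (space_form_form k2 n2) (vpderiv a (f2 \<circ> snd c) u) (vpderiv b (f2 \<circ> snd c) u)"
    using reduction_of_codimension[OF M \<Gamma> f2 c0 refl e2(2,1,3)] by blast
  note chart = manifold_chart[OF M]
  have smF: "smooth_vec ?m (fst c) (F \<circ> snd c)" if "c \<in> atlas M" for c by (rule affine_map_eqD(2)[OF F(1) that])
  have smG: "smooth_vec ?m (fst c) (G \<circ> snd c)" if "c \<in> atlas M" for c by (rule affine_map_eqD(2)[OF G(1) that])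
  \<comment> \<open>The prospective arc-length parameter. As \<open>k2 = 0\<close>, its second
    derivatives involve only the symbols and its first derivatives.\<close>
  define y where "y x = (1 / \<mu>) * G x 0" for x
  have smy: "smooth_real ?m (fst c) (\<lambda>v. y (snd c v))" if c: "c \<in> atlas M" for c
  proof -
    have "smooth_real ?m (fst c) (\<lambda>v. (1 / \<mu>) * (G \<circ> snd c) v 0)"
      using smG[OF c] by (intro smooth_real_cmult chart(2)[OF c]) (simp add: smooth_vec_def)
    then show ?thesis by (simp add: y_def comp_def)
  qed
  define dy where "dy c a v = (1 / \<mu>) * vpderiv a (G \<circ> snd c) v 0" for c :: "'a param" and a v
  have yp: "has_pderiv a (\<lambda>v. y (snd c v)) u (dy c a u)" if "c \<in> atlas M" "u \<in> fst c" "a < ?m" for c u a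
    using has_pderiv_cmult[OF smooth_vec_has_pderiv[OF smG[OF that(1)] that(2,3), of 0], of "1 / \<mu>"]
    by (simp add: y_def dy_def comp_def)
  have dyp: "has_pderiv a (dy c b) u (\<Sum>d<?m. \<Gamma> c u a b d * dy c d u)"
    if c: "c \<in> atlas M" "u \<in> fst c" "a < ?m" "b < ?m" for c u a b
  proof -
    have "has_pderiv a (dy c b) u ((1 / \<mu>) * vpderiv a (vpderiv b (G \<circ> snd c)) u 0)"
      unfolding dy_def
      by (intro has_pderiv_cmult smooth_vec_has_pderiv[OF smooth_vec_vpderiv[OF smG[OF c(1)] c(4)] c(2,3)])
    also have "(1 / \<mu>) * vpderiv a (vpderiv b (G \<circ> snd c)) u 0 = (\<Sum>d<?m. \<Gamma> c u a b d * dy c d u)"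
      unfolding affine_map_eqD(3)[OF G(1) c] k2 by (simp add: dy_def sum_divide_distrib)
    finally show ?thesis .
  qed
  define h where "h j x = F x j - al j (y x)" for j x
  have hp: "has_pderiv a (h j \<circ> snd c) u (vpderiv a (F \<circ> snd c) u j - al' j (y (snd c u)) * dy c a u)"
    if "c \<in> atlas M" "u \<in> fst c" "a < ?m" for c u a j
  proof -
    have "has_pderiv a (\<lambda>v. (F \<circ> snd c) v j - al j (y (snd c v))) u
        (vpderiv a (F \<circ> snd c) u j - al' j (y (snd c u)) * dy c a u)"
      by (intro has_pderiv_diff smooth_vec_has_pderiv[OF smF[OF that(1)] that(2,3)])
        (rule has_pderiv_chain[OF dal yp[OF that]])
    then show ?thesis by (simp add: h_def comp_def)
  qed
  have hp1: "pderiv_at a (h j \<circ> snd c) u = vpderiv a (F \<circ> snd c) u j - al' j (y (snd c u)) * dy c a u"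
    if "c \<in> atlas M" "u \<in> fst c" "a < ?m" for c u a j
    by (rule has_pderiv_imp[OF hp[OF that]])
  have hp2: "pderiv_at a (pderiv_at b (h j \<circ> snd c)) u
      = vpderiv a (vpderiv b (F \<circ> snd c)) u j - (- \<kappa> * al j (y (snd c u)) * dy c a u * dy c b u
        + al' j (y (snd c u)) * (\<Sum>d<?m. \<Gamma> c u a b d * dy c d u))"
    if "c \<in> atlas M" "u \<in> fst c" "a < ?m" "b < ?m" for c u a b j
  proof -
    have "pderiv_at a (pderiv_at b (h j \<circ> snd c)) u
        = pderiv_at a (\<lambda>v. vpderiv b (F \<circ> snd c) v j - al' j (y (snd c v)) * dy c b v) u"
      by (rule pderiv_at_cong[OF chart(2)[OF that(1)] that(2,3)]) (use hp1[OF that(1) _ that(4)] in auto)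
    also have "\<dots> = vpderiv a (vpderiv b (F \<circ> snd c)) u j - (- \<kappa> * al j (y (snd c u)) * dy c a u * dy c b u
        + al' j (y (snd c u)) * (\<Sum>d<?m. \<Gamma> c u a b d * dy c d u))"
      by (intro has_pderiv_imp has_pderiv_diff has_pderiv_mult
          smooth_vec_has_pderiv[OF smooth_vec_vpderiv[OF smF[OF that(1)] that(4)] that(2,3)]
          has_pderiv_chain[OF dal' yp[OF that(1-3)]] dyp[OF that])
    finally show ?thesis .
  qed
  have h0: "h j x = 0" if x: "x \<in> topspace (rtop M)" and j: "j \<in> {..<2}" for j x
  proof (rule unique_continuation[OF M, where h = h and I = "{..<2}", OF _ _ _ c0 _ _ x j])
    show "smooth_real ?m (fst c) (h j \<circ> snd c)" if c: "c \<in> atlas M" for c j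
    proof -
      have "smooth_real ?m (fst c) (\<lambda>v. al j (y (snd c v)))"
        unfolding smooth_real_def
        using C_k_on_compose[OF chart(2)[OF c] smy[OF c] gen_trig_derivative[OF \<kappa>0(1)] trig] by blast
      then have "smooth_real ?m (fst c) (\<lambda>v. (F \<circ> snd c) v j + (-1) * al j (y (snd c v)))"
        using smF[OF c] by (intro smooth_real_add smooth_real_cmult chart(2)[OF c]) (auto simp: smooth_vec_def)
      then show ?thesis by (simp add: h_def comp_def)
    qed
    show "pderiv_at a (pderiv_at b (h j \<circ> snd c)) \<in> O[nhds_in (fst c) u](jet_norm ?m {..<2} (\<lambda>i. h i \<circ> snd c))"
      if c: "c \<in> atlas M" and u: "u \<in> fst c" and j: "j \<in> {..<2}" and a: "a < ?m" and b: "b < ?m" for c u j a b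
    proof (rule bigo_cong_on)
      let ?E = "jet_norm ?m {..<2} (\<lambda>i. h i \<circ> snd c)"
      let ?Fa = "vpderiv a (F \<circ> snd c)" and ?Fb = "vpderiv b (F \<circ> snd c)"
      \<comment> \<open>The second derivative of \<open>F - al (y)\<close>, ordered by values and
        first derivatives of \<open>h\<close>. The terms without \<open>h\<close> cancel because the
        square of \<open>al'\<close> is \<open>\<rho>\<close> and
        \<open>\<kappa> = k1 * \<rho>\<close>.\<close>
      let ?R = "\<lambda>v. (\<Sum>d<?m. \<Gamma> c v a b d * pderiv_at d (h j \<circ> snd c) v)
          - (\<kappa> * dy c a v * dy c b v) * (h j \<circ> snd c) v
          - (\<Sum>i<2. (k1 * (F \<circ> snd c) v j * ?\<eta> i * ?Fb v i) * pderiv_at a (h i \<circ> snd c) v)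
          - (\<Sum>i<2. (k1 * (F \<circ> snd c) v j * ?\<eta> i * al' i (y (snd c v)) * dy c a v) * pderiv_at b (h i \<circ> snd c) v)"
      have jet: "pderiv_at d (h i \<circ> snd c) \<in> O[nhds_in (fst c) u](?E)" if "d < ?m" "i < 2" for d i
        using pderiv_bigo_jet_norm[of "{..<2}" i d ?m "\<lambda>i. h i \<circ> snd c"] that by simp
      have val: "(h i \<circ> snd c) \<in> O[nhds_in (fst c) u](?E)" if "i < 2" for i
        using value_bigo_jet_norm[of "{..<2}" i "\<lambda>i. h i \<circ> snd c"] that by simp
      have cF: "continuous_on (fst c) (\<lambda>v. (F \<circ> snd c) v j)"
        using smF[OF c] smooth_real_continuous unfolding smooth_vec_def by blast
      have c\<Gamma>: "continuous_on (fst c) (\<lambda>v. \<Gamma> c v a b d)" if "d < ?m" for d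
        using \<Gamma> c a b that by (simp add: continuous_symbols_def)
      have cdy: "continuous_on (fst c) (dy c d)" if "d < ?m" for d
        unfolding dy_def by (intro continuous_intros continuous_on_vpderiv[OF smG[OF c] that])
      have cal: "continuous_on (fst c) (\<lambda>v. al' i (y (snd c v)))" for i
      proof -
        have "continuous_on UNIV (al' i)" using dal' by (metis DERIV_isCont continuous_at_imp_continuous_on)
        then show ?thesis using continuous_on_compose2[of UNIV "al' i" "fst c" "\<lambda>v. y (snd c v)"]
            smooth_real_continuous[OF smy[OF c]] by simp
      qed
      show "?R \<in> O[nhds_in (fst c) u](?E)"
        by (intro sum_in_bigo(2) big_sum_in_bigo bigo_cont_mult u jet val a b c\<Gamma> cdy cal continuous_intros cF
            continuous_on_vpderiv[OF smF[OF c]])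
          (use j in auto)
      fix v assume v: "v \<in> fst c"
      define Y where "Y = y (snd c v)"
      define ya where "ya = dy c a v"
      define yb where "yb = dy c b v"
      define Fj where "Fj = F (snd c v) j"
      have ha: "pderiv_at a (h i \<circ> snd c) v = ?Fa v i - al' i Y * ya" for i
        unfolding hp1[OF c v a] Y_def ya_def ..
      have hb: "pderiv_at b (h i \<circ> snd c) v = ?Fb v i - al' i Y * yb" for i
        unfolding hp1[OF c v b] Y_def yb_def ..
      \<comment> \<open>Expansion of the product with each derivative of \<open>F\<close> replaced
        in turn by that of \<open>h\<close> plus \<open>al'\<close> times that of
        \<open>y\<close>.\<close>
      have L: "ip ?\<eta> (?Fa v) (?Fb v) = \<rho> * ya * yb
         + (\<Sum>i<2. ?\<eta> i * ?Fb v i * pderiv_at a (h i \<circ> snd c) v)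
         + (\<Sum>i<2. ?\<eta> i * al' i Y * ya * pderiv_at b (h i \<circ> snd c) v)"
      proof -
        have "(\<Sum>i<2. ?\<eta> i * ?Fb v i * pderiv_at a (h i \<circ> snd c) v)
            + (\<Sum>i<2. ?\<eta> i * al' i Y * ya * pderiv_at b (h i \<circ> snd c) v)
           = ip ?\<eta> (?Fa v) (?Fb v) - (?\<eta> 0 * al' 0 Y * al' 0 Y + ?\<eta> 1 * al' 1 Y * al' 1 Y) * (ya * yb)"
          unfolding ha hb ip2 by (simp add: numeral_2_eq_2 algebra_simps)
        then show ?thesis unfolding al'_sq by simp
      qed
      have "pderiv_at a (pderiv_at b (h j \<circ> snd c)) v
        = ((\<Sum>d<?m. \<Gamma> c v a b d * vpderiv d (F \<circ> snd c) v j) - k1 * ip ?\<eta> (?Fa v) (?Fb v) * Fj)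
          - (- \<kappa> * al j Y * ya * yb + al' j Y * (\<Sum>d<?m. \<Gamma> c v a b d * dy c d v))"
        unfolding hp2[OF c v a b] affine_map_eqD(3)[OF F(1) c v a b] Fj_def Y_def ya_def yb_def ..
      also have "\<dots> = (\<Sum>d<?m. \<Gamma> c v a b d * pderiv_at d (h j \<circ> snd c) v)
          - k1 * ip ?\<eta> (?Fa v) (?Fb v) * Fj + \<kappa> * al j Y * ya * yb"
      proof -
        have "(\<Sum>d<?m. \<Gamma> c v a b d * pderiv_at d (h j \<circ> snd c) v)
          = (\<Sum>d<?m. \<Gamma> c v a b d * vpderiv d (F \<circ> snd c) v j) - al' j Y * (\<Sum>d<?m. \<Gamma> c v a b d * dy c d v)"
          unfolding sum_distrib_left sum_subtractf[symmetric]
          by (intro sum.cong refl) (simp add: hp1[OF c v] Y_def algebra_simps)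
        then show ?thesis by simp
      qed
      also have "k1 * ip ?\<eta> (?Fa v) (?Fb v) * Fj = \<kappa> * Fj * ya * yb
         + (\<Sum>i<2. (k1 * Fj * ?\<eta> i * ?Fb v i) * pderiv_at a (h i \<circ> snd c) v)
         + (\<Sum>i<2. (k1 * Fj * ?\<eta> i * al' i Y * ya) * pderiv_at b (h i \<circ> snd c) v)"
      proof -
        have "k1 * ip ?\<eta> (?Fa v) (?Fb v) * Fj = \<kappa> * Fj * ya * yb
         + k1 * Fj * (\<Sum>i<2. ?\<eta> i * ?Fb v i * pderiv_at a (h i \<circ> snd c) v)
         + k1 * Fj * (\<Sum>i<2. ?\<eta> i * al' i Y * ya * pderiv_at b (h i \<circ> snd c) v)"
          unfolding L \<kappa>_def by (simp only: distrib_left distrib_right mult_ac)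
        then show ?thesis by (simp only: sum_distrib_left mult.assoc)
      qed
      finally show "?R v = pderiv_at a (pderiv_at b (h j \<circ> snd c)) v"
        by (simp add: Fj_def Y_def ya_def yb_def h_def algebra_simps comp_def)
    qed
    have y0: "y (snd c0 u0) = 0" unfolding y_def G(3) using k2 by simp
    have j2: "j = 0 \<or> j = 1" if "j \<in> {..<2::nat}" for j using that by auto
    show "h j (snd c0 u0) = 0" if "j \<in> {..<2}" for j
      unfolding h_def F(3) y0 using j2[OF that] k1 by (auto simp: al_def)
    show "pderiv_at a (h j \<circ> snd c0) u0 = 0" if j: "j \<in> {..<2}" and a: "a < ?m" for j a
    proof -
      have dya: "dy c0 a u0 = ip (space_form_form k1 n1) (X1 a) (e1 0) / sqrt \<rho>"
        unfolding dy_def G(4)[rule_format, OF a] ad using q k2 coef[OF a] by (simp add: \<mu>_def)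
      show ?thesis
        unfolding hp1[OF c0 a] F(4)[rule_format, OF a] y0 dya ad
        using j2[OF j] k1 s\<rho> by (auto simp: al'_def)
    qed
  qed simp
  have Fal: "F x = (\<lambda>i. if i < 2 then al i (y x) else 0)" if x: "x \<in> topspace (rtop M)" for x
  proof
    fix i show "F x i = (if i < 2 then al i (y x) else 0)"
      using h0[OF x, of i] affine_map_eqD(1)[OF F(1) x] unfolding pts_space_form ad h_def by auto
  qed
  \<comment> \<open>The flat coordinate 0, which is \<open>\<mu> * y\<close>, is replaced by
    \<open>y\<close>. Its share \<open>1 - \<rho>\<close> of the metric and the share
    \<open>\<rho>\<close> of the curved component add up to that of a Euclidean coordinate.\<close>
  define \<phi> where "\<phi> x = (\<lambda>i. if i = 0 then y x else G x i)" for x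
  have sm\<phi>: "smooth_vec ?m (fst c) (\<phi> \<circ> snd c)" if c: "c \<in> atlas M" for c
    unfolding smooth_vec_def
  proof
    fix i show "smooth_real ?m (fst c) (\<lambda>v. (\<phi> \<circ> snd c) v i)"
      using smG[OF c] smy[OF c] by (cases "i = 0") (auto simp: \<phi>_def smooth_vec_def comp_def)
  qed
  have d\<phi>: "vpderiv a (\<phi> \<circ> snd c) u i = (if i = 0 then dy c a u else vpderiv a (G \<circ> snd c) u i)"
    if c: "c \<in> atlas M" "u \<in> fst c" "a < ?m" for c u a i
    using has_pderiv_imp[OF yp[OF c]] by (cases "i = 0") (simp_all add: vpderiv_def \<phi>_def comp_def)
  have iso: "isometric_immersion M (space_form 0 ?m) \<phi>"
    unfolding isometric_immersion_def form_space_form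
  proof (intro conjI ballI allI impI subsetI)
    fix z assume "z \<in> \<phi> ` topspace (rtop M)"
    then show "z \<in> pts (space_form 0 ?m)"
      using affine_map_eqD(1)[OF G(1)] q k2 by (auto simp: pts_space_form amb_dim_def \<phi>_def)
  next
    fix c assume "c \<in> atlas M" then show "smooth_vec ?m (fst c) (\<phi> \<circ> snd c)" by (rule sm\<phi>)
  next
    fix c u a b assume c: "c \<in> atlas M" and u: "u \<in> fst c" and a: "a < ?m" and b: "b < ?m"
    have dF: "vpderiv d (F \<circ> snd c) u i = al' i (y (snd c u)) * dy c d u" if "i < 2" "d < ?m" for i d
    proof -
      have "has_pderiv d (\<lambda>v. (F \<circ> snd c) v i) u (al' i (y (snd c u)) * dy c d u)"
        by (rule has_pderiv_cong[OF chart(2)[OF c] u that(2) _ has_pderiv_chain[OF dal yp[OF c u that(2)]]])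
          (use that(1) Fal[OF chart(3)[OF c]] in simp)
      then show ?thesis by (simp add: vpderiv_def has_pderiv_imp)
    qed
    let ?Y = "y (snd c u)"
    have "ip ?\<eta> (vpderiv a (F \<circ> snd c) u) (vpderiv b (F \<circ> snd c) u)
       = (?\<eta> 0 * al' 0 ?Y * al' 0 ?Y + ?\<eta> 1 * al' 1 ?Y * al' 1 ?Y) * (dy c a u * dy c b u)"
      unfolding ip2 by (simp add: dF a b algebra_simps)
    then have L1: "ip ?\<eta> (vpderiv a (F \<circ> snd c) u) (vpderiv b (F \<circ> snd c) u) = \<rho> * (dy c a u * dy c b u)"
      unfolding al'_sq .
    have dG0: "vpderiv d (G \<circ> snd c) u 0 = \<mu> * dy c d u" for d using \<mu>(1) by (simp add: dy_def)
    have L2: "ip (space_form_form k2 ?m) (vpderiv a (G \<circ> snd c) u) (vpderiv b (G \<circ> snd c) u)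
       = (1 - \<rho>) * (dy c a u * dy c b u) + (\<Sum>i<q. vpderiv a (G \<circ> snd c) u (Suc i) * vpderiv b (G \<circ> snd c) u (Suc i))"
      unfolding k2 ip_space_form_flat q sum.lessThan_Suc_shift dG0 \<mu>(2)[symmetric] by (simp add: mult_ac)
    have "gram M c u a b = \<rho> * (dy c a u * dy c b u) + ((1 - \<rho>) * (dy c a u * dy c b u)
        + (\<Sum>i<q. vpderiv a (G \<circ> snd c) u (Suc i) * vpderiv b (G \<circ> snd c) u (Suc i)))"
      unfolding gram[OF c u a b] F(5)[rule_format, OF c u a b, symmetric] G(5)[rule_format, OF c u a b, symmetric] L1 L2 ..
    also have "\<dots> = ip (space_form_form 0 ?m) (vpderiv a (\<phi> \<circ> snd c) u) (vpderiv b (\<phi> \<circ> snd c) u)"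
      unfolding ip_space_form_flat q sum.lessThan_Suc_shift by (simp add: d\<phi>[OF c u a] d\<phi>[OF c u b] algebra_simps)
    finally show "ip (space_form_form 0 ?m) (vpderiv a (\<phi> \<circ> snd c) u) (vpderiv b (\<phi> \<circ> snd c) u) = gram M c u a b" ..
  qed
  have li: "local_isometry M (space_form 0 ?m) \<phi>"
    by (rule local_isometryI[OF M iso tangent_projection_space_form]) simp
  define S where "S = prod_submfd (space_form k1 1) (space_form 0 1)"
  \<comment> \<open>The acceleration of this curve is a multiple of the position vector in the
    curved factor and 0 in the flat one, hence normal to the product.\<close>
  define \<gamma> where "\<gamma> t = vpair (\<lambda>i. if i < 2 then al i t else 0) (\<lambda>i::nat. if i = 0 then \<mu> * t else 0)" for t
  have \<gamma>pt: "(\<lambda>i. if i < 2 then al i t else 0) \<in> pts (space_form k1 1)" for t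
  proof -
    have "al 0 t > 0" if "k1 < 0" using that gen_cos_pos[of \<kappa> t] \<kappa>0 by (simp add: al_def)
    then show ?thesis unfolding pts_space_form ad ip2 using al_pt[of t] by auto
  qed
  have vel: "velocity \<gamma> t = vpair (\<lambda>i. if i < 2 then al' i t else 0) (\<lambda>i. if i = 0 then \<mu> else 0)" for t
  proof
    fix i show "velocity \<gamma> t i = vpair (\<lambda>i. if i < 2 then al' i t else 0) (\<lambda>i. if i = 0 then \<mu> else 0) i"
    proof (cases i)
      case (Inl j)
      then show ?thesis using DERIV_imp_deriv[OF dal[of j t]] by (simp add: velocity_def \<gamma>_def)
    next
      case (Inr j)
      have "((\<lambda>t. \<mu> * t) has_real_derivative \<mu>) (at t)" by (auto intro!: derivative_eq_intros)
      then show ?thesis using Inr DERIV_imp_deriv by (auto simp: velocity_def \<gamma>_def)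
    qed
  qed
  have acc: "velocity (velocity \<gamma>) t = vpair (\<lambda>i. - \<kappa> * (if i < 2 then al i t else 0)) (\<lambda>i. 0)" for t
  proof
    fix i show "velocity (velocity \<gamma>) t i = vpair (\<lambda>i. - \<kappa> * (if i < 2 then al i t else 0)) (\<lambda>i. 0) i"
    proof (cases i)
      case (Inl j)
      then show ?thesis using DERIV_imp_deriv[OF dal'[of j t]] by (simp add: velocity_def[of "velocity \<gamma>"] vel)
    qed (simp add: velocity_def[of "velocity \<gamma>"] vel)
  qed
  have fin: "finite {i. space_form_form k1 1 i \<noteq> 0}" "finite {i. space_form_form 0 1 i \<noteq> 0}"
    by (rule finite_space_form_form)+
  have "unit_speed_geodesic S \<gamma>"
    unfolding unit_speed_geodesic_def
  proof (intro conjI allI)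
    fix t
    show pt: "\<gamma> t \<in> pts S" using \<gamma>pt by (simp add: S_def pts_prod \<gamma>_def) (simp add: pts_space_form amb_dim_def)
    have "ip ?\<eta> (\<lambda>i. if i < 2 then al' i t else 0) (\<lambda>i. if i < 2 then al' i t else 0) = \<rho>"
      unfolding ip2 using al'_sq[of t] by simp
    moreover have "ip (space_form_form 0 1) (\<lambda>i. if i = 0 then \<mu> else 0) (\<lambda>i. if i = 0 then \<mu> else 0) = 1 - \<rho>"
      unfolding ip_space_form_flat using \<mu>(2) by simp
    ultimately show "ip (form S) (velocity \<gamma> t) (velocity \<gamma> t) = 1"
      unfolding S_def form_prod form_space_form ip_vpair[OF fin] vel by simp
    show "orth_proj (form S) (tangent_space S (\<gamma> t)) (velocity (velocity \<gamma>) t) = (\<lambda>i. 0)"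
    proof (rule orth_proj_eqI)
      have tp: "tangent_projection S (prod_proj (sf_proj k1 1) (sf_proj 0 1))"
        unfolding S_def by (intro tangent_projection_prod tangent_projection_space_form)
      show T: "subsp (tangent_space S (\<gamma> t))" and "posdef_on (form S) (tangent_space S (\<gamma> t))"
        using tp pt unfolding tangent_projection_def by auto
      show "(\<lambda>i. 0) \<in> tangent_space S (\<gamma> t)" by (rule subsp_0[OF T])
      fix v assume "v \<in> tangent_space S (\<gamma> t)"
      then have "ip ?\<eta> (vfst v) (\<lambda>i. if i < 2 then al i t else 0) = 0"
        using tangent_space_space_form[OF \<gamma>pt[of t]] k1 by (simp add: S_def tangent_space_prod \<gamma>_def)
      then have "ip ?\<eta> (\<lambda>i. - \<kappa> * (if i < 2 then al i t else 0)) (vfst v) = 0"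
        unfolding ip_scale_left by (simp add: ip_comm[of _ _ "vfst v"])
      then show "ip (form S) (\<lambda>i. velocity (velocity \<gamma>) t i - 0) v = 0"
        unfolding S_def form_prod form_space_form ip_vpair[OF fin] acc by (simp add: ip_zero_left)
    qed
    fix i k
    show "(deriv ^^ k) (\<lambda>s. \<gamma> s i) differentiable (at t)"
    proof (cases i)
      case (Inl j)
      have "(\<lambda>t. 0) \<in> gen_trig \<kappa>" unfolding gen_trig_def by (rule CollectI) (intro exI[of _ 0], simp)
      then have "(\<lambda>s. \<gamma> s i) \<in> gen_trig \<kappa>" using trig[of j] Inl by (cases "j < 2") (simp_all add: \<gamma>_def)
      from iterated_deriv_differentiable[OF gen_trig_derivative[OF \<kappa>0(1)] this] show ?thesis .
    next
      case (Inr j)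
      let ?L = "{(\<lambda>t::real. a * t + b) | a b. True}"
      have der: "\<exists>g'\<in>?L. \<forall>t. (g has_real_derivative g' t) (at t)" if gL: "g \<in> ?L" for g
      proof -
        obtain a b where g: "g = (\<lambda>t. a * t + b)" using gL by blast
        have "(g has_real_derivative 0 * t + a) (at t)" for t unfolding g by (auto intro!: derivative_eq_intros)
        moreover have "(\<lambda>t. 0 * t + a) \<in> ?L" by blast
        ultimately show ?thesis by (intro bexI[of _ "\<lambda>t. 0 * t + a"]) auto
      qed
      have mem: "(\<lambda>s. \<gamma> s i) \<in> ?L"
      proof -
        have "(\<lambda>s. \<gamma> s i) = (\<lambda>s. (if j = 0 then \<mu> else 0) * s + 0)" using Inr by (simp add: \<gamma>_def fun_eq_iff)
        then show ?thesis by blast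
      qed
      show ?thesis by (rule iterated_deriv_differentiable[OF der mem])
    qed
  qed
  moreover have "tg_inclusion (prod_submfd (space_form k1 1) (space_form 0 ?m))
      (prod_submfd (space_form k1 n1) (space_form 0 n2)) (prod_map ?J1 ?J2)"
    using adapted_product_tg_inclusion[OF p1 e1(2,1) p2 e2(2,1)] unfolding k2 by blast
  moreover have "vpair (f1 x) (f2 x) = prod_map ?J1 ?J2 (curve_times_id \<gamma> (\<phi> x))" if x: "x \<in> topspace (rtop M)" for x
  proof -
    have "vfst (\<gamma> (\<phi> x 0)) = F x" unfolding Fal[OF x] by (simp add: \<gamma>_def \<phi>_def)
    moreover have "(\<phi> x)(0 := vsnd (\<gamma> (\<phi> x 0)) 0) = G x"
      using \<mu>(1) by (auto simp: \<gamma>_def \<phi>_def y_def fun_eq_iff)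
    ultimately have "curve_times_id \<gamma> (\<phi> x) = vpair (F x) (G x)" by (simp add: curve_times_id_def)
    then show ?thesis using F(2) G(2) x by (simp add: prod_map_def)
  qed
  ultimately show ?thesis
    unfolding geodesic_times_flat_def S_def using m li by blast
qed

abbreviation "xx a \<equiv> vpair (X1 a) (X2 a)"
abbreviation "gg \<equiv> ip (vpair (space_form_form k1 n1) (space_form_form k2 n2))"

subsection \<open>The tangent space at the base point\<close>

text \<open>The image of the differential of the pair at the base point, expressed by the two
  components alone.\<close>

definition tangent_span :: "(nat + nat \<Rightarrow> real) set" where
  "tangent_span = {(\<lambda>i. \<Sum>a<rdim M. w a * xx a i) | w. True}"

lemma gg: "gg X Y = ip (space_form_form k1 n1) (vfst X) (vfst Y) + ip (space_form_form k2 n2) (vsnd X) (vsnd Y)"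
  by (rule ip_vpair[OF finite_space_form_form finite_space_form_form])

lemma xx_independent:
  assumes "\<forall>i. (\<Sum>a<rdim M. w a * xx a i) = 0" shows "\<forall>a<rdim M. w a = 0"
proof -
  have "(\<lambda>i. \<Sum>a<rdim M. w a * xx a i) = (\<lambda>i. 0)" using assms by auto
  then have z: "(\<Sum>a<rdim M. w a * gg (xx a) y) = 0" for y
    using ip_sum_left[of "vpair (space_form_form k1 n1) (space_form_form k2 n2)" w xx "{..<rdim M}" y]
    by (simp add: ip_zero_left)
  show ?thesis
  proof (rule gram_independent[where x = xx and \<eta> = "vpair (space_form_form k1 n1) (space_form_form k2 n2)"])
    fix v :: "nat \<Rightarrow> real" assume "\<exists>a<rdim M. v a \<noteq> 0"
    then have "0 < (\<Sum>a<rdim M. \<Sum>b<rdim M. gram M c0 u0 a b * v a * v b)"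
      using M c0 by (simp add: riemannian_manifold_def riemannian_metric_def)
    also have "\<dots> = (\<Sum>a<rdim M. \<Sum>b<rdim M. gg (xx a) (xx b) * v a * v b)"
      by (intro sum.cong refl) (simp add: gram[OF c0] gg)
    finally show "0 < \<dots>" .
  qed (use z in simp)
qed

lemma tangent_span_subsp: "subsp tangent_span"
  unfolding tangent_span_def by (rule subsp_span)

lemma xx_mem: "a < rdim M \<Longrightarrow> xx a \<in> tangent_span"
  unfolding tangent_span_def by (rule span_member[of a "rdim M" xx])

lemma tangent_span_tangent:
  assumes "X \<in> tangent_span"
  shows "vfst X \<in> tangent_space (space_form k1 n1) p1" "vsnd X \<in> tangent_space (space_form k2 n2) p2"
proof -
  obtain w where X: "X = (\<lambda>i. \<Sum>a<rdim M. w a * xx a i)" using assms by (auto simp: tangent_span_def)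
  have T: "subsp (tangent_space (space_form k1 n1) p1)" "subsp (tangent_space (space_form k2 n2) p2)"
    using tangent_projection_space_form p1 p2 unfolding tangent_projection_def by blast+
  show "vfst X \<in> tangent_space (space_form k1 n1) p1" "vsnd X \<in> tangent_space (space_form k2 n2) p2"
    unfolding X vfst_sum vsnd_sum vfst_vpair vsnd_vpair
    by (intro subsp_sum T affine_map_eq_tangent[OF M f1 c0] affine_map_eq_tangent[OF M f2 c0]; simp)+
qed

lemma positive:
  shows "X \<in> tangent_span \<Longrightarrow> vfst X \<noteq> (\<lambda>_. 0) \<Longrightarrow> ip (space_form_form k1 n1) (vfst X) (vfst X) > 0"
    and "X \<in> tangent_span \<Longrightarrow> vsnd X \<noteq> (\<lambda>_. 0) \<Longrightarrow> ip (space_form_form k2 n2) (vsnd X) (vsnd X) > 0"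
proof -
  have "posdef_on (space_form_form k1 n1) (tangent_space (space_form k1 n1) p1)"
    "posdef_on (space_form_form k2 n2) (tangent_space (space_form k2 n2) p2)"
    using tangent_projection_space_form[of k1 n1] tangent_projection_space_form[of k2 n2] p1 p2
    unfolding tangent_projection_def by auto
  then show "X \<in> tangent_span \<Longrightarrow> vfst X \<noteq> (\<lambda>_. 0) \<Longrightarrow> ip (space_form_form k1 n1) (vfst X) (vfst X) > 0"
    "X \<in> tangent_span \<Longrightarrow> vsnd X \<noteq> (\<lambda>_. 0) \<Longrightarrow> ip (space_form_form k2 n2) (vsnd X) (vsnd X) > 0"
    using tangent_span_tangent[of X] by (auto simp: posdef_on_def)
qed

lemma tangent_span_facts:
  shows "posdef_on (vpair (space_form_form k1 n1) (space_form_form k2 n2)) tangent_span"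
    and "\<exists>I. determined_by tangent_span I"
proof -
  let ?S = "prod_submfd (space_form k1 n1) (space_form k2 n2)"
  have tp: "tangent_projection ?S (prod_proj (sf_proj k1 n1) (sf_proj k2 n2))"
    by (intro tangent_projection_prod tangent_projection_space_form)
  have pt: "vpair p1 p2 \<in> pts ?S" using p1 p2 by (simp add: pts_prod)
  have sub: "tangent_span \<subseteq> tangent_space ?S (vpair p1 p2)"
    using tangent_span_tangent by (auto simp: tangent_space_prod)
  have "posdef_on (form ?S) (tangent_space ?S (vpair p1 p2))" "\<exists>I. determined_by (tangent_space ?S (vpair p1 p2)) I"
    using tp pt unfolding tangent_projection_def by blast+
  then show "posdef_on (vpair (space_form_form k1 n1) (space_form_form k2 n2)) tangent_span"
    "\<exists>I. determined_by tangent_span I"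
    using sub unfolding posdef_on_def determined_by_def form_prod form_space_form by blast+
qed

lemma orthonormal_basis_in:
  assumes "subsp W" "W \<subseteq> tangent_span"
  shows "\<exists>r e. orthonormal (vpair (space_form_form k1 n1) (space_form_form k2 n2)) r e \<and> (\<forall>a<r. e a \<in> W) \<and>
    (\<forall>v\<in>W. v = (\<lambda>i. \<Sum>a<r. gg v (e a) * e a i))"
proof -
  obtain I where "determined_by tangent_span I" using tangent_span_facts(2) by blast
  then have "determined_by W I" using assms(2) by (auto simp: determined_by_def)
  moreover have "posdef_on (vpair (space_form_form k1 n1) (space_form_form k2 n2)) W"
    using tangent_span_facts(1) assms(2) by (auto simp: posdef_on_def)
  ultimately show ?thesis using orthonormal_basis_exists[OF assms(1)] by blast
qed

lemma basis_card:
  assumes on: "orthonormal (vpair (space_form_form k1 n1) (space_form_form k2 n2)) r e"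
    and e: "\<And>b. b < r \<Longrightarrow> e b \<in> tangent_span"
    and x: "\<And>a. a < rdim M \<Longrightarrow> \<exists>w. xx a = (\<lambda>i. \<Sum>b<r. w b * e b i)"
  shows "r = rdim M"
  by (rule orthonormal_basis_card[OF on _ x xx_independent]) (use e in \<open>auto simp: tangent_span_def\<close>)

section \<open>The three positions of the tangent space\<close>

text \<open>The tangent space is the orthogonal sum of \<open>V1\<close> and \<open>V2\<close>, its
  intersections with the factors. Orthonormal bases of these are frames for the components, and
  their lengths add up to \<open>rdim M\<close>.\<close>

lemma split_case:
  assumes split: "\<And>X. X \<in> tangent_span \<Longrightarrow> vpair (vfst X) (\<lambda>_. 0) \<in> tangent_span"
  shows "(\<forall>a<rdim M. X1 a = (\<lambda>_. 0)) \<or> (\<forall>a<rdim M. X2 a = (\<lambda>_. 0)) \<or>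
    (\<exists>m1 m2 \<phi> j1 j2. m1 \<ge> 1 \<and> m2 \<ge> 1 \<and> local_isometry M (prod_submfd (space_form k1 m1) (space_form k2 m2)) \<phi> \<and>
    tg_inclusion (prod_submfd (space_form k1 m1) (space_form k2 m2)) (prod_submfd (space_form k1 n1) (space_form k2 n2)) (prod_map j1 j2) \<and>
    (\<forall>x\<in>topspace (rtop M). vpair (f1 x) (f2 x) = prod_map j1 j2 (\<phi> x)))"
proof -
  let ?m = "rdim M" and ?\<eta> = "space_form_form k1 n1" and ?\<theta> = "space_form_form k2 n2"
  define V1 where "V1 = {X \<in> tangent_span. vsnd X = (\<lambda>_. 0)}"
  define V2 where "V2 = {X \<in> tangent_span. vfst X = (\<lambda>_. 0)}"
  note V = tangent_span_subsp
  have sub: "subsp V1" "subsp V2" using V unfolding subsp_def V1_def V2_def by auto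
  have "V1 \<subseteq> tangent_span" "V2 \<subseteq> tangent_span" by (auto simp: V1_def V2_def)
  from orthonormal_basis_in[OF sub(1) this(1)] orthonormal_basis_in[OF sub(2) this(2)]
  obtain r1 E1 r2 E2 where E1: "orthonormal (vpair ?\<eta> ?\<theta>) r1 E1" "\<And>a. a < r1 \<Longrightarrow> E1 a \<in> V1"
      "\<And>v. v \<in> V1 \<Longrightarrow> v = (\<lambda>i. \<Sum>a<r1. gg v (E1 a) * E1 a i)"
    and E2: "orthonormal (vpair ?\<eta> ?\<theta>) r2 E2" "\<And>a. a < r2 \<Longrightarrow> E2 a \<in> V2"
      "\<And>v. v \<in> V2 \<Longrightarrow> v = (\<lambda>i. \<Sum>a<r2. gg v (E2 a) * E2 a i)" by blast
  have comp: "vpair (X1 a) (\<lambda>_. 0) \<in> V1" "vpair (\<lambda>_. 0) (X2 a) \<in> V2" if "a < ?m" for a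
  proof -
    have x1: "vpair (X1 a) (\<lambda>_. 0) \<in> tangent_span" using split[OF xx_mem[OF that]] by simp
    then show "vpair (X1 a) (\<lambda>_. 0) \<in> V1" by (simp add: V1_def)
    have "(\<lambda>i. xx a i - vpair (X1 a) (\<lambda>_. 0) i) = vpair (\<lambda>_. 0) (X2 a)"
      unfolding vpair_eq_iff[of "\<lambda>i. xx a i - vpair (X1 a) (\<lambda>_. 0) i"] by simp
    with subsp_diff[OF V xx_mem[OF that] x1] show "vpair (\<lambda>_. 0) (X2 a) \<in> V2" by (simp add: V2_def)
  qed
  define w1 where "w1 a b = gg (vpair (X1 a) (\<lambda>_. 0)) (E1 b)" for a b
  define w2 where "w2 a b = gg (vpair (\<lambda>_. 0) (X2 a)) (E2 b)" for a b
  have w1: "vpair (X1 a) (\<lambda>_. 0) = (\<lambda>i. \<Sum>b<r1. w1 a b * E1 b i)" if "a < ?m" for a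
    unfolding w1_def by (rule E1(3)[OF comp(1)[OF that]])
  have w2: "vpair (\<lambda>_. 0) (X2 a) = (\<lambda>i. \<Sum>b<r2. w2 a b * E2 b i)" if "a < ?m" for a
    unfolding w2_def by (rule E2(3)[OF comp(2)[OF that]])
  have X1: "X1 a = (\<lambda>i. \<Sum>b<r1. w1 a b * vfst (E1 b) i)" if "a < ?m" for a
    using arg_cong[OF w1[OF that], of vfst] unfolding vfst_sum by simp
  have X2: "X2 a = (\<lambda>i. \<Sum>b<r2. w2 a b * vsnd (E2 b) i)" if "a < ?m" for a
    using arg_cong[OF w2[OF that], of vsnd] unfolding vsnd_sum by simp
  have on1: "orthonormal ?\<eta> r1 (\<lambda>b. vfst (E1 b))"
    using E1(1,2) unfolding orthonormal_def gg V1_def by (simp add: ip_zero_left)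
  have on2: "orthonormal ?\<theta> r2 (\<lambda>b. vsnd (E2 b))"
    using E2(1,2) unfolding orthonormal_def gg V2_def by (simp add: ip_zero_left)
  \<comment> \<open>The two bases one after the other, the second shifted by \<open>r1\<close>; that
    this is a basis of the whole tangent space yields the dimension.\<close>
  define E where "E b = (if b < r1 then E1 b else E2 (b - r1))" for b
  have "orthonormal (vpair ?\<eta> ?\<theta>) (r1 + r2) E"
  proof -
    have c12: "gg (E1 i) (E2 j) = 0" "gg (E2 j) (E1 i) = 0" if "i < r1" "j < r2" for i j
      using E1(2)[OF that(1)] E2(2)[OF that(2)] unfolding gg V1_def V2_def by (simp_all add: ip_linear)
    have d: "i - r1 < r2" if "i < r1 + r2" "\<not> i < r1" for i using that by simp
    show ?thesis
      unfolding orthonormal_def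
    proof (intro allI impI)
      fix i j assume ij: "i < r1 + r2" "j < r1 + r2"
      show "gg (E i) (E j) = (if i = j then 1 else 0)"
        using E1(1) E2(1) c12 d ij
        by (cases "i < r1"; cases "j < r1") (auto simp: E_def orthonormal_def)
    qed
  qed
  moreover have "E b \<in> tangent_span" if "b < r1 + r2" for b
    using that E1(2) E2(2)[of "b - r1"] by (auto simp: E_def V1_def V2_def)
  moreover have "\<exists>w. xx a = (\<lambda>i. \<Sum>b<r1 + r2. w b * E b i)" if a: "a < ?m" for a
  proof -
    define w where "w b = (if b < r1 then w1 a b else w2 a (b - r1))" for b
    have "xx a i = vpair (X1 a) (\<lambda>_. 0) i + vpair (\<lambda>_. 0) (X2 a) i" for i by (cases i) auto
    then have "xx a i = (\<Sum>b<r1 + r2. w b * E b i)" for i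
      unfolding w1[OF a] w2[OF a] sum_lessThan_add by (simp add: w_def E_def)
    then show ?thesis by blast
  qed
  ultimately have dim: "r1 + r2 = ?m" by (rule basis_card)
  \<comment> \<open>A factor that contributes no dimension means that the corresponding differential
    vanishes at the base point; these cases lead to slices.\<close>
  consider (zero1) "r1 = 0" | (zero2) "r2 = 0" | (both) "r1 \<ge> 1" "r2 \<ge> 1" by linarith
  then show ?thesis
  proof cases
    case both
    have "\<exists>\<phi> j1 j2. local_isometry M (prod_submfd (space_form k1 r1) (space_form k2 r2)) \<phi> \<and>
      tg_inclusion (prod_submfd (space_form k1 r1) (space_form k2 r2)) (prod_submfd (space_form k1 n1) (space_form k2 n2)) (prod_map j1 j2) \<and>
      (\<forall>x\<in>topspace (rtop M). vpair (f1 x) (f2 x) = prod_map j1 j2 (\<phi> x))"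
    proof (rule product_case[OF on1 _ _ on2 _ _ dim])
      show "vfst (E1 i) \<in> tangent_space (space_form k1 n1) p1" if "i < r1" for i
        using E1(2)[OF that] tangent_span_tangent(1) by (simp add: V1_def)
      show "vsnd (E2 i) \<in> tangent_space (space_form k2 n2) p2" if "i < r2" for i
        using E2(2)[OF that] tangent_span_tangent(2) by (simp add: V2_def)
    qed (use X1 X2 in blast)+
    with both show ?thesis by blast
  qed (use X1 X2 in auto)
qed

text \<open>The relation between the two products, together with their sum being the metric, makes
  each component conformal on the tangent space, with factors \<open>A * A\<close> and
  \<open>B * B\<close>. Hence one orthonormal basis, with components divided by \<open>A\<close> and
  \<open>B\<close>, yields orthonormal frames in both factors.\<close>

lemma proportional_case:
  assumes k12: "k1 * k2 > 0"
    and proportional: "\<And>X Y. X \<in> tangent_span \<Longrightarrow> Y \<in> tangent_span \<Longrightarrow>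
      k1 * ip (space_form_form k1 n1) (vfst X) (vfst Y) = k2 * ip (space_form_form k2 n2) (vsnd X) (vsnd Y)"
  shows "\<exists>k a b g \<phi> j1 j2. k = k1 * k2 / (k1 + k2) \<and>
        a > 0 \<and> b > 0 \<and> a\<^sup>2 = k2 / (k1 + k2) \<and> b\<^sup>2 = k1 / (k1 + k2) \<and>
        g = (\<lambda>x::nat \<Rightarrow> real. vpair (\<lambda>i. a * x i) (\<lambda>i. b * x i)) \<and>
        tg_inclusion (space_form k (rdim M)) (prod_submfd (space_form k1 (rdim M)) (space_form k2 (rdim M))) g \<and>
        local_isometry M (space_form k (rdim M)) \<phi> \<and>
        tg_inclusion (prod_submfd (space_form k1 (rdim M)) (space_form k2 (rdim M)))
          (prod_submfd (space_form k1 n1) (space_form k2 n2)) (prod_map j1 j2) \<and>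
        (\<forall>x\<in>topspace (rtop M). vpair (f1 x) (f2 x) = prod_map j1 j2 (g (\<phi> x)))"
proof -
  let ?m = "rdim M" and ?\<eta> = "space_form_form k1 n1" and ?\<theta> = "space_form_form k2 n2"
  have nz: "k1 \<noteq> 0" "k2 \<noteq> 0" "k1 < 0 \<longleftrightarrow> k2 < 0" using k12 by (auto simp: zero_less_mult_iff)
  have nz': "k1 + k2 \<noteq> 0" "k1 + k2 < 0 \<longleftrightarrow> k1 < 0" using nz by auto
  have pos: "k2 / (k1 + k2) > 0" "k1 / (k1 + k2) > 0"
    using nz nz' by (auto simp: zero_less_divide_iff linorder_neq_iff)
  \<comment> \<open>The quotients under the roots are positive since \<open>k1\<close>,
    \<open>k2\<close> and \<open>k1 + k2\<close> have the same sign.\<close>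
  define A where "A = sqrt (k2 / (k1 + k2))"
  define B where "B = sqrt (k1 / (k1 + k2))"
  have A: "A > 0" "A\<^sup>2 = k2 / (k1 + k2)" and B: "B > 0" "B\<^sup>2 = k1 / (k1 + k2)"
    using pos by (auto simp: A_def B_def)
  have i1: "ip ?\<eta> (vfst X) (vfst Y) = A * A * gg X Y" and i2: "ip ?\<theta> (vsnd X) (vsnd Y) = B * B * gg X Y"
    if "X \<in> tangent_span" "Y \<in> tangent_span" for X Y
  proof -
    have "ip ?\<eta> (vfst X) (vfst Y) * (k1 + k2) = k2 * gg X Y" "ip ?\<theta> (vsnd X) (vsnd Y) * (k1 + k2) = k1 * gg X Y"
      using proportional[OF that] by (simp_all add: gg algebra_simps)
    then have "ip ?\<eta> (vfst X) (vfst Y) = k2 / (k1 + k2) * gg X Y" "ip ?\<theta> (vsnd X) (vsnd Y) = k1 / (k1 + k2) * gg X Y"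
      using nz'(1) by (simp_all add: eq_divide_eq)
    then show "ip ?\<eta> (vfst X) (vfst Y) = A * A * gg X Y" "ip ?\<theta> (vsnd X) (vsnd Y) = B * B * gg X Y"
      using A(2) B(2) by (simp_all add: power2_eq_square)
  qed
  obtain r E where E: "orthonormal (vpair ?\<eta> ?\<theta>) r E" "\<And>a. a < r \<Longrightarrow> E a \<in> tangent_span"
      "\<And>v. v \<in> tangent_span \<Longrightarrow> v = (\<lambda>i. \<Sum>a<r. gg v (E a) * E a i)"
    using orthonormal_basis_in[OF tangent_span_subsp order_refl] by blast
  have "\<exists>w. xx a = (\<lambda>i. \<Sum>b<r. w b * E b i)" if "a < ?m" for a
    by (intro exI[of _ "\<lambda>b. gg (xx a) (E b)"] E(3)[OF xx_mem[OF that]])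
  then have r: "r = ?m" using basis_card[OF E(1,2)] by blast
  define e1 where "e1 j = (\<lambda>i. (1 / A) * vfst (E j) i)" for j
  define e2 where "e2 j = (\<lambda>i. (1 / B) * vsnd (E j) i)" for j
  have X1: "X1 a = (\<lambda>i. \<Sum>b<?m. (gg (xx a) (E b) * A) * e1 b i)" if "a < ?m" for a
    using arg_cong[OF E(3)[OF xx_mem[OF that]], of vfst] A(1) unfolding vfst_sum r by (simp add: e1_def)
  have X2: "X2 a = (\<lambda>i. \<Sum>b<?m. (gg (xx a) (E b) * B) * e2 b i)" if "a < ?m" for a
    using arg_cong[OF E(3)[OF xx_mem[OF that]], of vsnd] B(1) unfolding vsnd_sum r by (simp add: e2_def)
  have Eij: "gg (E i) (E j) = (if i = j then 1 else 0)" if "i < ?m" "j < ?m" for i j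
    using E(1) that by (simp add: orthonormal_def r)
  have on1: "orthonormal ?\<eta> ?m e1"
    unfolding orthonormal_def e1_def ip_scale_left ip_scale_right
    using i1[OF E(2) E(2)] Eij A(1) by (simp add: r)
  have on2: "orthonormal ?\<theta> ?m e2"
    unfolding orthonormal_def e2_def ip_scale_left ip_scale_right
    using i2[OF E(2) E(2)] Eij B(1) by (simp add: r)
  have T: "subsp (tangent_space (space_form k1 n1) p1)" "subsp (tangent_space (space_form k2 n2) p2)"
    using tangent_projection_space_form p1 p2 unfolding tangent_projection_def by blast+
  define k where "k = k1 * k2 / (k1 + k2)"
  have "\<exists>\<phi> j1 j2. local_isometry M (space_form k ?m) \<phi> \<and>
    tg_inclusion (prod_submfd (space_form k1 ?m) (space_form k2 ?m))
      (prod_submfd (space_form k1 n1) (space_form k2 n2)) (prod_map j1 j2) \<and>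
    (\<forall>x\<in>topspace (rtop M). vpair (f1 x) (f2 x) = prod_map j1 j2 (vpair (\<lambda>i. A * \<phi> x i) (\<lambda>i. B * \<phi> x i)))"
  proof (rule diagonal_case[OF k12 k_def A B on1 _ _ on2])
    show "e1 i \<in> tangent_space (space_form k1 n1) p1" if "i < ?m" for i
      unfolding e1_def using E(2)[of i] that r by (intro subsp_scale[OF T(1)] tangent_span_tangent) simp
    show "e2 i \<in> tangent_space (space_form k2 n2) p2" if "i < ?m" for i
      unfolding e2_def using E(2)[of i] that r by (intro subsp_scale[OF T(2)] tangent_span_tangent) simp
    show "\<exists>w. X1 a = (\<lambda>i. \<Sum>j<?m. w j * e1 j i)" if "a < ?m" for a
      by (rule exI[of _ "\<lambda>b. gg (xx a) (E b) * A"], rule X1[OF that])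
    show "\<exists>w. X2 a = (\<lambda>i. \<Sum>j<?m. w j * e2 j i)" if "a < ?m" for a
      by (rule exI[of _ "\<lambda>b. gg (xx a) (E b) * B"], rule X2[OF that])
    fix a j assume aj: "a < ?m" "j < ?m"
    show "ip ?\<eta> (X1 a) (e1 j) / A = ip ?\<theta> (X2 a) (e2 j) / B"
      unfolding e1_def e2_def ip_scale_right
      using i1[OF xx_mem[OF aj(1)] E(2)[of j]] i2[OF xx_mem[OF aj(1)] E(2)[of j]] aj(2) r A(1) B(1) by simp
  qed
  then obtain \<phi> j1 j2 where d: "local_isometry M (space_form k ?m) \<phi>"
    "tg_inclusion (prod_submfd (space_form k1 ?m) (space_form k2 ?m))
      (prod_submfd (space_form k1 n1) (space_form k2 n2)) (prod_map j1 j2)"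
    "\<forall>x\<in>topspace (rtop M). vpair (f1 x) (f2 x) = prod_map j1 j2 (vpair (\<lambda>i. A * \<phi> x i) (\<lambda>i. B * \<phi> x i))"
    by blast
  show ?thesis
    by (rule exI[of _ k], rule exI[of _ A], rule exI[of _ B], rule exI[of _ "\<lambda>x. vpair (\<lambda>i. A * x i) (\<lambda>i. B * x i)"],
        rule exI[of _ \<phi>], rule exI[of _ j1], rule exI[of _ j2])
      (intro conjI k_def A B refl diagonal_tg_inclusion[OF k12 k_def A B] d)
qed

text \<open>By \<open>first\<close>, the curved component has rank one, so the tangent space is the
  line of \<open>s\<close> plus the subspace \<open>N\<close> of vectors in the flat factor. The
  direction of \<open>s\<close> becomes that of the geodesic, \<open>\<rho>\<close> is the curved
  share of its squared length, and \<open>N\<close> supplies the remaining flat directions.\<close>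

lemma flat_splitting_case:
  assumes k2: "k2 = 0" and k1: "k1 \<noteq> 0" and s: "s \<in> tangent_span" "gg s s = 1"
    and s12: "vfst s \<noteq> (\<lambda>_. 0)" "vsnd s \<noteq> (\<lambda>_. 0)"
    and first: "\<And>X. X \<in> tangent_span \<Longrightarrow> vfst X = (\<lambda>i. gg X s * vfst s i)"
  shows "geodesic_times_flat M k1 n1 n2 (\<lambda>x. vpair (f1 x) (f2 x))"
proof -
  let ?m = "rdim M" and ?\<eta> = "space_form_form k1 n1" and ?\<theta> = "space_form_form k2 n2"
  note V = tangent_span_subsp
  define \<rho> where "\<rho> = ip ?\<eta> (vfst s) (vfst s)"
  have \<rho>: "\<rho> > 0" "ip ?\<theta> (vsnd s) (vsnd s) = 1 - \<rho>" "\<rho> < 1"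
    using positive[OF s(1)] s12 s(2) by (auto simp: \<rho>_def gg)
  define N where "N = {X \<in> tangent_span. vfst X = (\<lambda>_. 0)}"
  have N: "subsp N" "N \<subseteq> tangent_span" using V unfolding subsp_def N_def by auto
  have Ns: "gg X s = 0" "gg s X = 0" "ip ?\<theta> (vsnd X) (vsnd s) = 0" if X: "X \<in> N" for X
  proof -
    have "vfst X = (\<lambda>i. gg X s * vfst s i)" "vfst X = (\<lambda>_. 0)" using first[of X] X by (auto simp only: N_def)
    then have "gg X s * vfst s i = 0" for i by metis
    then show "gg X s = 0" using s12(1) by (auto simp: fun_eq_iff)
    then show "gg s X = 0" by (simp add: ip_comm[of _ s X])
    show "ip ?\<theta> (vsnd X) (vsnd s) = 0" using \<open>gg X s = 0\<close> X by (simp add: gg N_def ip_zero_left)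
  qed
  obtain q E where E: "orthonormal (vpair ?\<eta> ?\<theta>) q E" "\<And>a. a < q \<Longrightarrow> E a \<in> N"
      "\<And>v. v \<in> N \<Longrightarrow> v = (\<lambda>i. \<Sum>a<q. gg v (E a) * E a i)"
    using orthonormal_basis_in[OF N] by blast
  \<comment> \<open>The part of a coordinate vector orthogonal to \<open>s\<close>; by
    \<open>first\<close> its curved component is 0.\<close>
  define Z where "Z a = (\<lambda>i. xx a i - gg (xx a) s * s i)" for a
  have Z: "Z a \<in> N" if "a < ?m" for a
    using subsp_diff[OF V xx_mem[OF that] subsp_scale[OF V s(1)]] first[OF xx_mem[OF that]]
    by (simp add: N_def Z_def)
  define e where "e b = (case b of 0 \<Rightarrow> s | Suc i \<Rightarrow> E i)" for b
  have "orthonormal (vpair ?\<eta> ?\<theta>) (Suc q) e"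
    unfolding orthonormal_def
  proof (intro allI impI)
    fix i j assume "i < Suc q" "j < Suc q"
    then show "gg (e i) (e j) = (if i = j then 1 else 0)"
      using E(1,2) s(2) Ns by (cases i; cases j) (auto simp: e_def orthonormal_def)
  qed
  moreover have "e b \<in> tangent_span" if "b < Suc q" for b
    using that E(2) s(1) N(2) by (cases b) (auto simp: e_def)
  moreover have "\<exists>w. xx a = (\<lambda>i. \<Sum>b<Suc q. w b * e b i)" if a: "a < ?m" for a
  proof -
    define w where "w b = (case b of 0 \<Rightarrow> gg (xx a) s | Suc i \<Rightarrow> gg (Z a) (E i))" for b
    have "xx a i = gg (xx a) s * s i + Z a i" for i by (simp add: Z_def)
    then have "xx a i = (\<Sum>b<Suc q. w b * e b i)" for i
      unfolding sum.lessThan_Suc_shift using fun_cong[OF E(3)[OF Z[OF a]], of i] by (simp add: w_def e_def)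
    then show ?thesis by blast
  qed
  ultimately have dim: "Suc q = ?m" by (rule basis_card)
  define e1 where "e1 = (\<lambda>(j::nat) i. (1 / sqrt \<rho>) * vfst s i)"
  \<comment> \<open>The second component of \<open>s\<close> takes index 0, since
    \<open>flat_case\<close> reads the geodesic direction off the coordinate 0 of the flat
    factor.\<close>
  define e2 where "e2 j = (case j of 0 \<Rightarrow> (\<lambda>i. (1 / sqrt (1 - \<rho>)) * vsnd s i) | Suc i \<Rightarrow> vsnd (E i))" for j
  have e2_0: "e2 0 = (\<lambda>i. (1 / sqrt (1 - \<rho>)) * vsnd s i)" and e2_Suc: "e2 (Suc i) = vsnd (E i)" for i
    by (simp_all add: e2_def)
  have sq: "sqrt \<rho> > 0" "sqrt \<rho> * sqrt \<rho> = \<rho>" "sqrt (1 - \<rho>) > 0" "sqrt (1 - \<rho>) * sqrt (1 - \<rho>) = 1 - \<rho>"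
    using \<rho> by auto
  have T: "subsp (tangent_space (space_form k1 n1) p1)" "subsp (tangent_space (space_form k2 n2) p2)"
    using tangent_projection_space_form p1 p2 unfolding tangent_projection_def by blast+
  show ?thesis
  proof (rule flat_case[OF k2 k1 _ \<rho>(1,3)])
    show "1 \<le> ?m" using dim by simp
    show "orthonormal ?\<eta> 1 e1"
      unfolding orthonormal_def e1_def ip_scale_left ip_scale_right \<rho>_def[symmetric] using sq \<rho> by simp
    show "e1 i \<in> tangent_space (space_form k1 n1) p1" for i
      unfolding e1_def by (intro subsp_scale[OF T(1)] tangent_span_tangent s)
    have EE: "ip ?\<theta> (vsnd (E i)) (vsnd (E j)) = (if i = j then 1 else 0)" if "i < q" "j < q" for i j
    proof -
      have "gg (E i) (E j) = (if i = j then 1 else 0)" using E(1) that by (simp add: orthonormal_def)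
      moreover have "vfst (E i) = (\<lambda>_. 0)" using E(2)[OF that(1)] by (simp add: N_def)
      ultimately show ?thesis by (simp add: gg ip_zero_left)
    qed
    have tE: "ip ?\<theta> (vsnd (E i)) (e2 0) = 0" if "i < q" for i
      unfolding e2_0 ip_scale_right using Ns(3)[OF E(2)[OF that]] by simp
    have tt: "ip ?\<theta> (e2 0) (e2 0) = 1"
    proof -
      have "ip ?\<theta> (e2 0) (e2 0) = (1 - \<rho>) / (sqrt (1 - \<rho>) * sqrt (1 - \<rho>))"
        unfolding e2_0 ip_scale_left ip_scale_right \<rho>(2) by simp
      also have "\<dots> = 1" unfolding sq(4) using \<rho>(3) by simp
      finally show ?thesis .
    qed
    show "orthonormal ?\<theta> ?m e2"
      unfolding orthonormal_def dim[symmetric]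
    proof (intro allI impI)
      fix i j assume ij: "i < Suc q" "j < Suc q"
      show "ip ?\<theta> (e2 i) (e2 j) = (if i = j then 1 else 0)"
      proof (cases i)
        case 0
        show ?thesis
        proof (cases j)
          case 0 then show ?thesis using \<open>i = 0\<close> tt by simp
        next
          case (Suc j')
          then show ?thesis using \<open>i = 0\<close> ij tE[of j'] by (simp only: e2_Suc ip_comm[of _ "e2 0"]) simp
        qed
      next
        case (Suc i')
        show ?thesis
        proof (cases j)
          case 0 then show ?thesis using \<open>i = Suc i'\<close> ij tE[of i'] by (simp only: e2_Suc) simp
        next
          case (Suc j')
          then show ?thesis using \<open>i = Suc i'\<close> ij EE[of i' j'] by (simp only: e2_Suc) simp
        qed
      qed
    qed
    show "e2 i \<in> tangent_space (space_form k2 n2) p2" if "i < ?m" for i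
    proof (cases i)
      case 0
      then show ?thesis unfolding 0 e2_0 by (intro subsp_scale[OF T(2)] tangent_span_tangent(2) s(1))
    next
      case (Suc i')
      have "E i' \<in> tangent_span" using E(2)[of i'] N(2) that dim Suc by auto
      then show ?thesis unfolding Suc e2_Suc by (rule tangent_span_tangent(2))
    qed
    show "\<exists>w. X1 a = (\<lambda>i. \<Sum>j<1. w j * e1 j i)" if "a < ?m" for a
    proof -
      have "X1 a = (\<lambda>i. gg (xx a) s * vfst s i)" using first[OF xx_mem[OF that]] by simp
      also have "\<dots> = (\<lambda>i. \<Sum>j<1. (gg (xx a) s * sqrt \<rho>) * e1 j i)" using sq by (simp add: e1_def)
      finally show ?thesis by (rule exI[of _ "\<lambda>_. gg (xx a) s * sqrt \<rho>"])
    qed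
    show "\<exists>w. X2 a = (\<lambda>i. \<Sum>j<?m. w j * e2 j i)" if a: "a < ?m" for a
    proof -
      define w where "w b = (case b of 0 \<Rightarrow> gg (xx a) s * sqrt (1 - \<rho>) | Suc i \<Rightarrow> gg (Z a) (E i))" for b
      have zs: "vsnd (Z a) = (\<lambda>i. \<Sum>b<q. gg (Z a) (E b) * vsnd (E b) i)"
        using arg_cong[OF E(3)[OF Z[OF a]], of vsnd] unfolding vsnd_sum .
      have "X2 a i = gg (xx a) s * vsnd s i + vsnd (Z a) i" for i by (simp add: Z_def)
      then have "X2 a i = (\<Sum>b<Suc q. w b * e2 b i)" for i
        unfolding sum.lessThan_Suc_shift zs using sq by (simp add: w_def e2_0 e2_Suc)
      then show ?thesis unfolding dim by (intro exI[of _ w] ext)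
    qed
    fix a assume a: "a < ?m"
    have v1: "ip ?\<eta> (X1 a) (vfst s) = gg (xx a) s * \<rho>"
    proof -
      have "X1 a = (\<lambda>i. gg (xx a) s * vfst s i)" using first[OF xx_mem[OF a]] by simp
      from arg_cong[OF this, of "\<lambda>v. ip ?\<eta> v (vfst s)"] show ?thesis unfolding \<rho>_def ip_scale_left .
    qed
    have "gg (xx a) s = ip ?\<eta> (X1 a) (vfst s) + ip ?\<theta> (X2 a) (vsnd s)" by (simp add: gg)
    then have v2: "ip ?\<theta> (X2 a) (vsnd s) = gg (xx a) s * (1 - \<rho>)" unfolding v1 by (simp add: algebra_simps)
    have "ip ?\<eta> (X1 a) (e1 0) / sqrt \<rho> = gg (xx a) s * \<rho> / (sqrt \<rho> * sqrt \<rho>)"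
      unfolding e1_def ip_scale_right v1 by simp
    also have "\<dots> = gg (xx a) s" unfolding sq(2) using \<rho> by simp
    also have "\<dots> = gg (xx a) s * (1 - \<rho>) / (sqrt (1 - \<rho>) * sqrt (1 - \<rho>))" unfolding sq(4) using \<rho> by simp
    also have "\<dots> = ip ?\<theta> (X2 a) (e2 0) / sqrt (1 - \<rho>)"
      unfolding e2_0 ip_scale_right v2 by simp
    finally show "ip ?\<eta> (X1 a) (e1 0) / sqrt \<rho> = ip ?\<theta> (X2 a) (e2 0) / sqrt (1 - \<rho>)" .
  qed
qed

end

section \<open>The case distinction at a base point\<close>

text \<open>A geodesic in a product of two curved factors can have components of arbitrary nonzero
  speeds, and at most one ratio of speeds is that of the diagonal embedding; the hypothesis on
  \<open>m = 1\<close> excludes such curves. The bounds on \<open>m1\<close> and \<open>m2\<close>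
  keep the product form apart from the slices.\<close>

theorem corollary3:
  fixes k1 k2 :: real and n1 n2 m :: nat
    and M :: "'a riem" and f :: "'a \<Rightarrow> nat + nat \<Rightarrow> real"
  assumes "(k1, k2) \<noteq> (0, 0)"
    and "riemannian_manifold M" and "rdim M = m"
    and "m = 1 \<longrightarrow> k1 * k2 = 0"
    and "isometric_immersion M (prod_submfd (space_form k1 n1) (space_form k2 n2)) f"
    and "totally_geodesic M (prod_submfd (space_form k1 n1) (space_form k2 n2)) f"
  shows
    "(into_slice M (space_form k1 n1) (space_form k2 n2) f \<or>
      into_slice M (space_form k2 n2) (space_form k1 n1) (vswap \<circ> f)) \<or>
     (\<exists>m1 m2 \<phi> j1 j2. m1 \<ge> 1 \<and> m2 \<ge> 1 \<and>
        local_isometry M (prod_submfd (space_form k1 m1) (space_form k2 m2)) \<phi> \<and>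
        tg_inclusion (prod_submfd (space_form k1 m1) (space_form k2 m2))
          (prod_submfd (space_form k1 n1) (space_form k2 n2)) (prod_map j1 j2) \<and>
        (\<forall>x\<in>topspace (rtop M). f x = prod_map j1 j2 (\<phi> x))) \<or>
     (k1 * k2 > 0 \<and>
      (\<exists>k a b g \<phi> j1 j2. k = k1 * k2 / (k1 + k2) \<and>
        a > 0 \<and> b > 0 \<and> a\<^sup>2 = k2 / (k1 + k2) \<and> b\<^sup>2 = k1 / (k1 + k2) \<and>
        g = (\<lambda>x::nat \<Rightarrow> real. vpair (\<lambda>i. a * x i) (\<lambda>i. b * x i)) \<and>
        tg_inclusion (space_form k m) (prod_submfd (space_form k1 m) (space_form k2 m)) g \<and>
        local_isometry M (space_form k m) \<phi> \<and>
        tg_inclusion (prod_submfd (space_form k1 m) (space_form k2 m))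
          (prod_submfd (space_form k1 n1) (space_form k2 n2)) (prod_map j1 j2) \<and>
        (\<forall>x\<in>topspace (rtop M). f x = prod_map j1 j2 (g (\<phi> x))))) \<or>
     (k2 = 0 \<and> geodesic_times_flat M k1 n1 n2 f) \<or>
     (k1 = 0 \<and> geodesic_times_flat M k2 n2 n1 (vswap \<circ> f))"
proof -
  note M = assms(2) and iso = assms(5) and tg = assms(6)
  let ?\<eta> = "space_form_form k1 n1" and ?\<theta> = "space_form_form k2 n2"
  obtain \<Gamma> where \<Gamma>: "continuous_symbols M \<Gamma>" "differentiable_symbols M \<Gamma>"
    "affine_map_eq M \<Gamma> k1 n1 (vfst \<circ> f)" "affine_map_eq M \<Gamma> k2 n2 (vsnd \<circ> f)"
    using christoffel_symbols_exist[OF M iso tg] by blast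
  have "topspace (rtop M) \<noteq> {}" using M unfolding riemannian_manifold_def by blast
  then obtain x0 where "x0 \<in> topspace (rtop M)" by blast
  then obtain c0 u0 where c0: "c0 \<in> atlas M" "u0 \<in> fst c0" using manifold_point[OF M] by blast
  have gram: "gram M c u a b =
      ip ?\<eta> (vpderiv a ((vfst \<circ> f) \<circ> snd c) u) (vpderiv b ((vfst \<circ> f) \<circ> snd c) u) +
      ip ?\<theta> (vpderiv a ((vsnd \<circ> f) \<circ> snd c) u) (vpderiv b ((vsnd \<circ> f) \<circ> snd c) u)"
    if "c \<in> atlas M" "u \<in> fst c" "a < rdim M" "b < rdim M" for c u a b
    using iso that unfolding isometric_immersion_def vpderiv_vfst vpderiv_vsnd
    by (simp add: ip_vpair[OF finite_space_form_form finite_space_form_form])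
  interpret P: geodesic_pair M \<Gamma> k1 k2 n1 n2 "vfst \<circ> f" "vsnd \<circ> f" c0 u0
    by unfold_locales (use M \<Gamma> gram c0 in auto)
  \<comment> \<open>The same data with the factors interchanged, for slices of the second factor and
    for a flat first factor.\<close>
  interpret Q: geodesic_pair M \<Gamma> k2 k1 n2 n1 "vsnd \<circ> f" "vfst \<circ> f" c0 u0
    by unfold_locales (use M \<Gamma> gram c0 in \<open>auto simp: add.commute\<close>)
  have fP: "(\<lambda>x. vpair ((vfst \<circ> f) x) ((vsnd \<circ> f) x)) = f" by auto
  have fQ: "(\<lambda>x. vpair ((vsnd \<circ> f) x) ((vfst \<circ> f) x)) = vswap \<circ> f" by (auto simp: vswap_def)
  have xx: "P.xx a = vpderiv a (f \<circ> snd c0) u0" for a unfolding vpderiv_vfst vpderiv_vsnd by simp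
  have V: "P.tangent_span = diff_image M f c0 u0" unfolding P.tangent_span_def xx diff_image_def ..
  obtain I where I: "determined_by P.tangent_span I" using P.tangent_span_facts(2) by blast
  have tri: "vpair (curvature_op k1 ?\<eta> (vfst X) (vfst Y) (vfst Z)) (curvature_op k2 ?\<theta> (vsnd X) (vsnd Y) (vsnd Z))
      \<in> P.tangent_span" if "X \<in> P.tangent_span" "Y \<in> P.tangent_span" "Z \<in> P.tangent_span" for X Y Z
    using diff_image_curvature_invariant[OF M \<Gamma>(2,3,4) c0] that unfolding V by blast
  consider (split) "\<forall>X\<in>P.tangent_span. vpair (vfst X) (\<lambda>_. 0) \<in> P.tangent_span"
    | (proportional) "k1 * k2 > 0" "\<forall>X\<in>P.tangent_span. \<forall>Y\<in>P.tangent_span. k1 * ip ?\<eta> (vfst X) (vfst Y) = k2 * ip ?\<theta> (vsnd X) (vsnd Y)"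
    | (line) s where "s \<in> P.tangent_span" "P.gg s s = 1" "vfst s \<noteq> (\<lambda>_. 0)" "vsnd s \<noteq> (\<lambda>_. 0)"
      "\<forall>Y\<in>P.tangent_span. vpair (vfst (\<lambda>i. Y i - P.gg Y s * s i)) (\<lambda>_. 0) \<in> P.tangent_span"
      "\<forall>Z\<in>P.tangent_span. vpair (vfst Z) (\<lambda>_. 0) \<in> P.tangent_span \<longrightarrow>
          P.gg Z s = 0 \<and> k1 * ip ?\<eta> (vfst Z) (vfst Z) = k2 * ip ?\<theta> (vsnd Z) (vsnd Z)"
    using curvature_invariant_cases[OF P.tangent_span_subsp I finite_space_form_form finite_space_form_form
        P.positive(1) P.positive(2) tri assms(1)] by blast
  then show ?thesis
  proof cases
    case split
    then have "(\<forall>a<rdim M. vpderiv a (vfst \<circ> f \<circ> snd c0) u0 = (\<lambda>_. 0)) \<or>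
      (\<forall>a<rdim M. vpderiv a (vsnd \<circ> f \<circ> snd c0) u0 = (\<lambda>_. 0)) \<or>
      (\<exists>m1 m2 \<phi> j1 j2. m1 \<ge> 1 \<and> m2 \<ge> 1 \<and> local_isometry M (prod_submfd (space_form k1 m1) (space_form k2 m2)) \<phi> \<and>
        tg_inclusion (prod_submfd (space_form k1 m1) (space_form k2 m2)) (prod_submfd (space_form k1 n1) (space_form k2 n2)) (prod_map j1 j2) \<and>
        (\<forall>x\<in>topspace (rtop M). f x = prod_map j1 j2 (\<phi> x)))"
      using P.split_case by simp
    then show ?thesis using P.into_slice_case[unfolded fP] Q.into_slice_case[unfolded fQ] by blast
  next
    case proportional
    then show ?thesis using P.proportional_case[unfolded assms(3)] by simp
  next
    case (line s)
    \<comment> \<open>The relation of the case is applied to \<open>Z\<close> and also to its first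
      component alone, whose second component is 0. This makes both sides of the relation
      vanish.\<close>
    have N: "k1 * ip ?\<eta> (vfst Z) (vfst Z) = 0 \<and> k2 * ip ?\<theta> (vsnd Z) (vsnd Z) = 0"
      if Z: "Z \<in> P.tangent_span" "vpair (vfst Z) (\<lambda>_. 0) \<in> P.tangent_span" for Z
      using line(6)[rule_format, OF Z] line(6)[rule_format, OF Z(2)] Z(2) by (simp add: ip_zero_left)
    \<comment> \<open>The part of \<open>Y\<close> orthogonal to \<open>s\<close>. By
      \<open>N\<close>, its component in each factor of nonzero curvature has length 0, so
      positivity removes it.\<close>
    define R where "R Y = (\<lambda>i. Y i - P.gg Y s * s i)" for Y
    have R: "R Y \<in> P.tangent_span" "vpair (vfst (R Y)) (\<lambda>_. 0) \<in> P.tangent_span" if "Y \<in> P.tangent_span" for Y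
      using line(5) that unfolding R_def
      by (auto intro!: subsp_diff[OF P.tangent_span_subsp] subsp_scale[OF P.tangent_span_subsp] line(1))
    have R1: "vfst Y = (\<lambda>i. P.gg Y s * vfst s i)" if "Y \<in> P.tangent_span" "k1 \<noteq> 0" for Y
    proof -
      have "ip ?\<eta> (vfst (R Y)) (vfst (R Y)) = 0" using N[OF R[OF that(1)]] that(2) by simp
      then have "vfst (R Y) = (\<lambda>_. 0)" using P.positive(1)[OF R(1)[OF that(1)]] by fastforce
      then show ?thesis by (simp add: R_def fun_eq_iff)
    qed
    have R2: "vsnd Y = (\<lambda>i. P.gg Y s * vsnd s i)" if "Y \<in> P.tangent_span" "k2 \<noteq> 0" for Y
    proof -
      have "ip ?\<theta> (vsnd (R Y)) (vsnd (R Y)) = 0" using N[OF R[OF that(1)]] that(2) by simp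
      then have "vsnd (R Y) = (\<lambda>_. 0)" using P.positive(2)[OF R(1)[OF that(1)]] by fastforce
      then show ?thesis by (simp add: R_def fun_eq_iff)
    qed
    consider "k1 \<noteq> 0" "k2 \<noteq> 0" | "k1 \<noteq> 0" "k2 = 0" | "k1 = 0" "k2 \<noteq> 0" using assms(1) by auto
    then show ?thesis
    proof cases
      case 1
      \<comment> \<open>With both curvatures nonzero, both components of the remainder vanish and
        the tangent space is the line of \<open>s\<close>. This is the dimension that the hypothesis
        on \<open>m = 1\<close> rules out.\<close>
      have "1 = rdim M"
      proof (rule P.basis_card[of 1 "\<lambda>_. s"])
        show "orthonormal (vpair ?\<eta> ?\<theta>) 1 (\<lambda>_. s)" using line(2) by (simp add: orthonormal_def)
        show "\<exists>w. P.xx a = (\<lambda>i. \<Sum>b<1::nat. w b * s i)" if "a < rdim M" for a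
        proof -
          have "P.xx a = (\<lambda>i. P.gg (P.xx a) s * s i)"
            unfolding vpair_eq_iff[of "P.xx a"] using R1[OF P.xx_mem[OF that] 1(1)] R2[OF P.xx_mem[OF that] 1(2)] by simp
          then show ?thesis by (intro exI[of _ "\<lambda>_. P.gg (P.xx a) s"]) simp
        qed
      qed (use line(1) in simp)
      with 1 assms(3,4) show ?thesis by simp
    next
      case 2
      have "geodesic_times_flat M k1 n1 n2 (\<lambda>x. vpair ((vfst \<circ> f) x) ((vsnd \<circ> f) x))"
        by (rule P.flat_splitting_case[OF 2(2,1) line(1-4) R1[OF _ 2(1)]])
      then show ?thesis unfolding fP using 2 by blast
    next
      case 3
      \<comment> \<open>The interchange of components carries one tangent space to the other, so the
        vector \<open>s\<close> and the rank-one relation can be used in the interchanged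
        setting.\<close>
      have sw: "vswap X \<in> Q.tangent_span" if "X \<in> P.tangent_span" for X
      proof -
        obtain w where X: "X = (\<lambda>i. \<Sum>a<rdim M. w a * P.xx a i)" using \<open>X \<in> P.tangent_span\<close> by (auto simp: P.tangent_span_def)
        have "vswap X = (\<lambda>i. \<Sum>a<rdim M. w a * Q.xx a i)"
          unfolding X vswap_def vfst_sum vsnd_sum vpair_sum by simp
        then show ?thesis unfolding Q.tangent_span_def by blast
      qed
      have ws: "vswap X \<in> P.tangent_span" if "X \<in> Q.tangent_span" for X
      proof -
        obtain w where X: "X = (\<lambda>i. \<Sum>a<rdim M. w a * Q.xx a i)" using \<open>X \<in> Q.tangent_span\<close> by (auto simp: Q.tangent_span_def)
        have "vswap X = (\<lambda>i. \<Sum>a<rdim M. w a * P.xx a i)"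
          unfolding X vswap_def vfst_sum vsnd_sum vpair_sum by simp
        then show ?thesis unfolding P.tangent_span_def by blast
      qed
      have gsw: "Q.gg X (vswap s) = P.gg (vswap X) s" for X unfolding P.gg Q.gg by (simp add: vswap_def)
      have "geodesic_times_flat M k2 n2 n1 (\<lambda>x. vpair ((vsnd \<circ> f) x) ((vfst \<circ> f) x))"
      proof (rule Q.flat_splitting_case[OF 3 sw[OF line(1)]])
        show "Q.gg (vswap s) (vswap s) = 1" using line(2) unfolding gsw by (simp add: vswap_def)
        show "vfst (vswap s) \<noteq> (\<lambda>_. 0)" "vsnd (vswap s) \<noteq> (\<lambda>_. 0)" using line(3,4) by (auto simp: vswap_def)
        show "vfst X = (\<lambda>i. Q.gg X (vswap s) * vfst (vswap s) i)" if "X \<in> Q.tangent_span" for X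
          using R2[OF ws[OF that] 3(2)] unfolding gsw by (simp add: vswap_def)
      qed
      then show ?thesis unfolding fQ using 3 by blast
    qed
  qed
qed

end
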